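(* Let $\kappa$ be a $C^\infty$ function germ at $0\in\mathbb{R}$, let $\theta(t)=\int_0^t\kappa(u)\,du$ with Taylor expansion $\sum_{i\ge1}\theta_i t^i/i!$, let $\boldsymbol t=(\cos\theta,\sin\theta)$, $\boldsymbol n=(-\sin\theta,\cos\theta)$, and let $\phi_2(t)=\int_0^t u\,\boldsymbol t(u)\,du$. For a nonzero constant $\delta$ let $\phi_2^\delta(t)=\phi_2(t)+\delta\,\boldsymbol n(t)$ be its parallel curve. (i) If $\phi_2$ has an $A_2$ singularity at $0$ (i.e., $\theta_1\ne0$), then $\phi_2^\delta$, $\delta\ne0$, is nonsingular at $0$. (ii) If $\phi_2$ has an $A_4$ singularity at $0$ (i.e., $\theta_1=0$, $\theta_3\ne0$), then $\phi_2^\delta$ has an $A_4$ singularity at $0$ if $\delta\ne\theta_2^{-1}$, and an $E_8$ singularity at $0$ if $\delta=\theta_2^{-1}$. (iii) Assume that $\phi_2$ has an $A_{2k}$ singularity at $0$ with $k\ge3$. (iii-a) If $\delta\ne\theta_2^{-1}$, then $\phi_2^\delta$ has an $A_{2k}$ singularity at $0$. (iii-b) If $\delta=\theta_2^{-1}$ and $\theta_4\ne0$, then $\phi_2^\delta$ has a $W^\#_{1,2k-5}$ singularity at $0$. (iii-c) If $\delta=\theta_2^{-1}$ and $\theta_4=0$, then $\phi_2^\delta$ has a singularity of multiplicity $\ge5$ at $0$. In particular, $\phi_2^\delta$ is not $\mathcal A$-simple at $0$.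
   Context: Two $C^\infty$ map germs $f,g:(\mathbb{R},0)\to(\mathbb{R}^2,0)$ are $\mathcal A$-equivalent if there are diffeomorphism germs $h$ of $(\mathbb{R},0)$ and $\psi$ of $(\mathbb{R}^2,0)$ with $f\circ h=\psi\circ g$. Parallel curves are regarded as germs at $0$ after translating $\phi_2^\delta(0)$ to the origin. The condition $\delta=\theta_2^{-1}$ means $\delta\theta_2=1$ (so if $\theta_2=0$, then $\delta\ne\theta_2^{-1}$ for every $\delta$). A germ has multiplicity $m$ at $0$ if it equals $\frac{t^m}{m!}\hat\phi(t)$ with $\hat\phi$ a $C^\infty$ map to $\mathbb{R}^2$, $\hat\phi(0)\ne0$ (a germ whose Taylor series vanishes identically is regarded as having infinite multiplicity). A germ has at $0$ a singularity of type: $A_{2k}$ ($k\ge1$) if it is $\mathcal A$-equivalent to $(t^2,t^{2k+1})$; $E_8$ if it is $\mathcal A$-equivalent to $(t^3,t^5)$; $W^\#_{1,2q-1}$ ($q\ge1$) if it is $\mathcal A$-equivalent to $(t^4,t^6+t^{2q+5})$. A germ $\phi:(\mathbb{R},0)\to(\mathbb{R}^2,0)$ is $\mathcal A$-simple if it is an irreducible parametrization and for any finite-parameter deformation $\{\phi^u\}_{u\in(\mathbb{R}^k,0)}$, $\phi^0=\phi$, the point $0\in\mathbb{R}^k$ is not in the closure of a set of parameters $u$ for which the $\phi^u$ are all $\mathcal A$-distinct (moduli). By the classification of Bruce and Gaffney, the singular $\mathcal A$-simple germs are, up to $\mathcal A$-equivalence: $(t^2,t^{2k+1})$; $(t^3,t^{3k+1}+\varepsilon_pt^{3(k+p)+2})$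 with $0\le p\le k-2$, $(t^3,t^{3k+1})$; $(t^3,t^{3k+2}+\varepsilon_{p+1}t^{3(k+p)+4})$ with $0\le p\le k-2$, $(t^3,t^{3k+2})$; $(t^4,t^5\pm t^7)$, $(t^4,t^5)$; $(t^4,t^6+t^{2q+5})$, $q\ge1$; $(t^4,t^7\pm t^9)$, $(t^4,t^7\pm t^{13})$, $(t^4,t^7)$ (with $\varepsilon_p=1$ for $p$ even and $\varepsilon_p=\pm1$ for $p$ odd). *)

theory Defs
  imports "HOL-Analysis.Analysis" "HOL-Library.Extended_Nat"
begin

text \<open>
  Germs at the origin are represented by total functions; every notion below depends only on the
  values of its argument near the origin. The plane is \<^typ>\<open>real \<times> real\<close>.
\<close>

subsection \<open>Smooth germs and \<open>\<A>\<close>-equivalence\<close>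

primrec Ck_on :: "nat \<Rightarrow> ('a::euclidean_space \<Rightarrow> 'b::real_normed_vector) \<Rightarrow> 'a set \<Rightarrow> bool" where
  "Ck_on 0 f S \<longleftrightarrow> continuous_on S f"
| "Ck_on (Suc n) f S \<longleftrightarrow>
     (\<forall>x\<in>S. f differentiable (at x)) \<and> (\<forall>v. Ck_on n (\<lambda>x. frechet_derivative f (at x) v) S)"

definition smooth_germ :: "('a::euclidean_space \<Rightarrow> 'b::real_normed_vector) \<Rightarrow> bool" where
  "smooth_germ f \<longleftrightarrow> (\<exists>S. open S \<and> 0 \<in> S \<and> (\<forall>n. Ck_on n f S))"

definition diffeo_germ :: "('a::euclidean_space \<Rightarrow> 'a) \<Rightarrow> bool" where
  "diffeo_germ h \<longleftrightarrow> smooth_germ h \<and> h 0 = 0 \<and>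
     (\<exists>g. smooth_germ g \<and> g 0 = 0 \<and>
          (\<forall>\<^sub>F x in nhds 0. g (h x) = x) \<and> (\<forall>\<^sub>F x in nhds 0. h (g x) = x))"

definition A_equiv :: "(real \<Rightarrow> real \<times> real) \<Rightarrow> (real \<Rightarrow> real \<times> real) \<Rightarrow> bool" where
  "A_equiv f g \<longleftrightarrow> (\<exists>(h :: real \<Rightarrow> real) (\<psi> :: real \<times> real \<Rightarrow> real \<times> real).
     diffeo_germ h \<and> diffeo_germ \<psi> \<and> (\<forall>\<^sub>F t in nhds 0. f (h t) = \<psi> (g t)))"

subsection \<open>Singularity types\<close>

definition nonsingular :: "(real \<Rightarrow> real \<times> real) \<Rightarrow> bool" where
  "nonsingular f \<longleftrightarrow> (\<exists>v. v \<noteq> 0 \<and> (f has_vector_derivative v) (at 0))"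

definition A_sing :: "nat \<Rightarrow> (real \<Rightarrow> real \<times> real) \<Rightarrow> bool" where
  "A_sing n f \<longleftrightarrow> (\<exists>k\<ge>1. n = 2 * k \<and> A_equiv f (\<lambda>t. (t ^ 2, t ^ (2 * k + 1))))"

definition E8_sing :: "(real \<Rightarrow> real \<times> real) \<Rightarrow> bool" where
  "E8_sing f \<longleftrightarrow> A_equiv f (\<lambda>t. (t ^ 3, t ^ 5))"

text \<open>\<open>W1_sharp_sing n\<close> is the type \<open>W\<^sup>#\<close> with lower index \<open>(1, n)\<close>; \<open>n\<close> has to be odd.\<close>

definition W1_sharp_sing :: "nat \<Rightarrow> (real \<Rightarrow> real \<times> real) \<Rightarrow> bool" where
  "W1_sharp_sing n f \<longleftrightarrow>
     (\<exists>q\<ge>1. n = 2 * q - 1 \<and> A_equiv f (\<lambda>t. (t ^ 4, t ^ 6 + t ^ (2 * q + 5))))"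

definition has_multiplicity :: "(real \<Rightarrow> real \<times> real) \<Rightarrow> enat \<Rightarrow> bool" where
  "has_multiplicity f M \<longleftrightarrow> (case M of
     enat m \<Rightarrow> (\<exists>g. smooth_germ g \<and> g 0 \<noteq> 0 \<and> (\<forall>\<^sub>F t in nhds 0. f t = (t ^ m / fact m) *\<^sub>R g t))
   | \<infinity> \<Rightarrow> smooth_germ f \<and> (\<forall>n. ((\<lambda>g t. vector_derivative g (at t)) ^^ n) f 0 = 0))"

subsection \<open>Simple germs\<close>

text \<open>
  The number of parameters of a deformation is arbitrary, so parameter spaces cannot be types.
  The space \<open>\<real>\<^sup>n\<close> is the set of sequences vanishing from index \<open>n\<close> on, with the
  topology induced by the product topology, which is the Euclidean one. Differentiability
  of class \<open>C\<^sup>m\<close> is existence and continuity of the iterated partial derivatives.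
\<close>

definition Rn :: "nat \<Rightarrow> (nat \<Rightarrow> real) set" where
  "Rn n = {x. \<forall>i\<ge>n. x i = 0}"

primrec Ck_Rn :: "nat \<Rightarrow> nat \<Rightarrow> ((nat \<Rightarrow> real) \<Rightarrow> 'b::real_normed_vector) \<Rightarrow> (nat \<Rightarrow> real) set \<Rightarrow> bool"
where
  "Ck_Rn n 0 f S \<longleftrightarrow> continuous_on S f"
| "Ck_Rn n (Suc m) f S \<longleftrightarrow> (\<forall>i<n.
     (\<forall>x\<in>S. (\<lambda>s. f (x(i := s))) differentiable (at (x i))) \<and>
     Ck_Rn n m (\<lambda>x. vector_derivative (\<lambda>s. f (x(i := s))) (at (x i))) S)"

definition smooth_germ_Rn :: "nat \<Rightarrow> ((nat \<Rightarrow> real) \<Rightarrow> 'b::real_normed_vector) \<Rightarrow> bool" where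
  "smooth_germ_Rn n f \<longleftrightarrow> (\<exists>S. open S \<and> (\<lambda>_. 0) \<in> S \<and> (\<forall>m. Ck_Rn n m f (S \<inter> Rn n)))"

text \<open>
  A deformation \<open>\<Phi> u t\<close> with \<open>k\<close> parameters is jointly smooth in \<open>(t, u)\<close>, which is encoded as the
  sequence \<open>t, u 0, \<dots>, u (k - 1), 0, \<dots>\<close>. All its members are germs
  from \<open>(\<real>, 0)\<close> to \<open>(\<real>\<^sup>2, 0)\<close>.
\<close>

definition deformation ::
  "nat \<Rightarrow> ((nat \<Rightarrow> real) \<Rightarrow> real \<Rightarrow> real \<times> real) \<Rightarrow> (real \<Rightarrow> real \<times> real) \<Rightarrow> bool" where
  "deformation k \<Phi> \<phi> \<longleftrightarrow>
     smooth_germ_Rn (Suc k) (\<lambda>x. \<Phi> (\<lambda>i. x (Suc i)) (x 0)) \<and>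
     (\<forall>\<^sub>F t in nhds 0. \<Phi> (\<lambda>_. 0) t = \<phi> t) \<and>
     (\<exists>W. open W \<and> (\<lambda>_. 0) \<in> W \<and> (\<forall>u\<in>W \<inter> Rn k. \<Phi> u 0 = 0))"

text \<open>A parametrization is irreducible if it is not a reparametrization of another smooth germ
  by a smooth \<open>h\<close> that is not a diffeomorphism germ.\<close>

definition irreducible_param :: "(real \<Rightarrow> real \<times> real) \<Rightarrow> bool" where
  "irreducible_param \<phi> \<longleftrightarrow> \<not> (\<exists>(\<rho> :: real \<Rightarrow> real \<times> real) (h :: real \<Rightarrow> real).
     smooth_germ \<rho> \<and> smooth_germ h \<and> h 0 = 0 \<and> deriv h 0 = 0 \<and> (\<forall>\<^sub>F t in nhds 0. \<phi> t = \<rho> (h t)))"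

text \<open>
  Moduli at the parameter \<open>0\<close>: a set \<open>U\<close> of parameters with pairwise non-equivalent germs that
  accumulates at \<open>0\<close>. Since a single parameter is vacuously such a set, and since a discrete
  series of classes does not amount to moduli, \<open>U\<close> has to be uncountable in each neighbourhood of \<open>0\<close>.
\<close>

definition has_moduli :: "nat \<Rightarrow> ((nat \<Rightarrow> real) \<Rightarrow> real \<Rightarrow> real \<times> real) \<Rightarrow> bool" where
  "has_moduli k \<Phi> \<longleftrightarrow> (\<exists>U\<subseteq>Rn k.
     pairwise (\<lambda>u v. \<not> A_equiv (\<Phi> u) (\<Phi> v)) U \<and>
     (\<forall>W. open W \<and> (\<lambda>_. 0) \<in> W \<longrightarrow> uncountable (U \<inter> W)))"

definition A_simple :: "(real \<Rightarrow> real \<times> real) \<Rightarrow> bool" where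
  "A_simple \<phi> \<longleftrightarrow> smooth_germ \<phi> \<and> \<phi> 0 = 0 \<and> irreducible_param \<phi> \<and>
     (\<forall>k \<Phi>. deformation k \<Phi> \<phi> \<longrightarrow> \<not> has_moduli k \<Phi>)"

subsection \<open>The curve and its parallels\<close>

definition angle :: "(real \<Rightarrow> real) \<Rightarrow> real \<Rightarrow> real" where
  "angle \<kappa> t = (LBINT u=0..t. \<kappa> u)"

text \<open>\<open>angle_coeff \<kappa> i\<close> is \<open>\<theta>\<^sub>i\<close>, for \<open>\<theta> = \<Sum> \<theta>\<^sub>i t\<^sup>i / i!\<close>.\<close>

definition angle_coeff :: "(real \<Rightarrow> real) \<Rightarrow> nat \<Rightarrow> real" where
  "angle_coeff \<kappa> i = (deriv ^^ i) (angle \<kappa>) 0"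

definition tangent_vec :: "(real \<Rightarrow> real) \<Rightarrow> real \<Rightarrow> real \<times> real" where
  "tangent_vec \<kappa> t = (cos (angle \<kappa> t), sin (angle \<kappa> t))"

definition normal_vec :: "(real \<Rightarrow> real) \<Rightarrow> real \<Rightarrow> real \<times> real" where
  "normal_vec \<kappa> t = (- sin (angle \<kappa> t), cos (angle \<kappa> t))"

definition phi2 :: "(real \<Rightarrow> real) \<Rightarrow> real \<Rightarrow> real \<times> real" where
  "phi2 \<kappa> t = (LBINT u=0..t. u *\<^sub>R tangent_vec \<kappa> u)"

definition phi2_parallel :: "(real \<Rightarrow> real) \<Rightarrow> real \<Rightarrow> real \<Rightarrow> real \<times> real" where
  "phi2_parallel \<kappa> \<delta> t = phi2 \<kappa> t + \<delta> *\<^sub>R normal_vec \<kappa> t"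

definition phi2_parallel_germ :: "(real \<Rightarrow> real) \<Rightarrow> real \<Rightarrow> real \<Rightarrow> real \<times> real" where
  "phi2_parallel_germ \<kappa> \<delta> t = phi2_parallel \<kappa> \<delta> t - phi2_parallel \<kappa> \<delta> 0"

end

theory Submission
  imports Defs "HOL-Computational_Algebra.Polynomial"
begin

text \<open>
  Near \<open>0\<close> one has \<open>(\<phi>\<^sub>2\<^sup>\<delta>)' = (t - \<delta> \<theta>') (cos \<theta>, sin \<theta>)\<close>, so the order of \<open>g = t - \<delta> \<theta>'\<close> is the
  multiplicity minus one. Taking a root of the first component \<open>x\<close> as parameter makes the first
  component a monomial \<open>s\<^sup>m\<close>; the odd part of \<open>\<theta>\<close> then determines the first Taylor coefficient of
  the second component that cannot be removed by subtracting a function of \<open>s\<^sup>m\<close>. Higher order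
  terms are removed exactly and not only formally, since by Borel's lemma every smooth function is
  \<open>\<Sum>i<m. s\<^sup>i a\<^sub>i (s\<^sup>m)\<close> with smooth \<open>a\<^sub>i\<close>.
  The converse of the \<open>A\<^sub>2\<^sub>k\<close> criterion uses the highest order of agreement of the curve with itself
  under an orientation reversing fold \<open>\<sigma>(t) = -t + \<dots>\<close>.

  A germ of multiplicity at least five is not simple because its 9-jets carry a modulus: below degree 10
  a change of target coordinates acts linearly, hence the \<open>2 \<times> 2\<close> minors of the coefficients in degrees
  5 to 9 scale by a common factor, and two polynomials \<open>A\<close>, \<open>B\<close> in these minors are relative invariants
  under reparametrization. The ratio \<open>B\<^sup>2 / A\<^sup>3\<close> is a nonconstant rational function on a suitable
  one-parameter family through the given germ.
\<close>

text \<open>Since dy/dx = tan \<theta>, in the parameter s with x = s^m the second component has the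
  derivative m s^(m-1) tan (\<theta> (H s)), where H inverts the root. For even m an even \<theta>
  would make H odd and this slope even. So the first odd coefficient, of degree b, enters twice:
  through tan \<theta>, in degree b of the slope, and through the failure of H to be odd, in degree
  b + 2 - m. For m = 2 the two add up, for m = 4 the second one decides.

  Maps (X, Y) \<mapsto> (X, F (X, Y)) cannot reach every degree of the second component, and the
  exceptions shape the normal forms: degree 7 for E8 is removed by a shear, degree 2q+7 for W# by a
  projective change along the cusp, and the degrees 2q+11 and 6q+9 are tied by one polynomial
  relation, for which a free constant in a weighted dilation prepares.

  The family used for non-simplicity must work for every germ of multiplicity at least five, even
  one with vanishing 9-jet; therefore degrees in the parameter, not values at 0, show that the ratio
  is not constant.\<close>

declare Ck_on.simps(2) [simp del]

section \<open>Maps of class C^n on open sets\<close>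

lemma Ck_on_Suc_differentiable: "Ck_on (Suc n) f S \<Longrightarrow> x \<in> S \<Longrightarrow> f differentiable (at x)"
  unfolding Ck_on.simps by blast

lemma Ck_on_Suc_frechet: "Ck_on (Suc n) f S \<Longrightarrow> Ck_on n (\<lambda>x. frechet_derivative f (at x) v) S"
  unfolding Ck_on.simps by blast

text \<open>The recursion refers to the selected \<open>frechet_derivative\<close>; uniqueness of
  derivatives lets any explicit formula for the derivative take its place.\<close>

lemma Ck_on_SucI:
  assumes "\<And>x. x \<in> S \<Longrightarrow> (f has_derivative f' x) (at x)" and "\<And>v. Ck_on n (\<lambda>x. f' x v) S"
    and "open S"
  shows "Ck_on (Suc n) f S"
proof -
  have eq: "frechet_derivative f (at x) = f' x" if "x \<in> S" for x
    using frechet_derivative_at[OF assms(1)[OF that]] by simp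
  \<comment> \<open>The explicit and the selected derivative agree only on S, so invariance of the
    class under equality on an open set is needed already here, by an induction of its own.\<close>
  have cong: "Ck_on n h S \<Longrightarrow> (\<And>x. x \<in> S \<Longrightarrow> g x = h x) \<Longrightarrow> Ck_on n g S"
    for g h :: "'a \<Rightarrow> 'b"
  proof (induction n arbitrary: g h)
    case 0
    then show ?case using continuous_on_cong[of S S g h] by simp
  next
    case (Suc n)
    have gh: "frechet_derivative g (at x) = frechet_derivative h (at x)" "g differentiable (at x)"
      if "x \<in> S" for x
    proof -
      have h: "h differentiable (at x)" using Ck_on_Suc_differentiable[OF Suc.prems(1) that] .
      show "frechet_derivative g (at x) = frechet_derivative h (at x)"
        by (rule frechet_derivative_transform_within_open[symmetric, OF h assms(3) that])
           (rule Suc.prems(2)[symmetric])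
      show "g differentiable (at x)"
        using has_derivative_transform_within_open[OF h[unfolded frechet_derivative_works] assms(3) that
            Suc.prems(2)[symmetric]] by (auto simp: differentiable_def)
    qed
    have "Ck_on n (\<lambda>x. frechet_derivative g (at x) v) S" for v
      by (rule Suc.IH[of "\<lambda>x. frechet_derivative h (at x) v"]) (simp_all add: Ck_on_Suc_frechet[OF Suc.prems(1)] gh(1))
    then show ?case using gh(2) unfolding Ck_on.simps by blast
  qed
  show ?thesis
    unfolding Ck_on.simps
  proof (intro conjI ballI allI)
    show "f differentiable (at x)" if "x \<in> S" for x
      using assms(1)[OF that] by (auto simp: differentiable_def)
    show "Ck_on n (\<lambda>x. frechet_derivative f (at x) v) S" for v
      by (rule cong[OF assms(2)[of v]]) (simp add: eq)
  qed
qed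

lemma Ck_on_cong:
  assumes "Ck_on n f S" "open S" "\<And>x. x \<in> S \<Longrightarrow> g x = f x"
  shows "Ck_on n g S"
proof (cases n)
  case 0
  then show ?thesis using assms(1) continuous_on_cong[of S S g f] assms(3) by simp
next
  case (Suc m)
  show ?thesis unfolding Suc
  proof (rule Ck_on_SucI[where f' = "\<lambda>x. frechet_derivative f (at x)"])
    fix x assume x: "x \<in> S"
    have "(f has_derivative frechet_derivative f (at x)) (at x)"
      using Ck_on_Suc_differentiable[of m f S x] assms(1) x unfolding Suc frechet_derivative_works by blast
    then show "(g has_derivative frechet_derivative f (at x)) (at x)"
      by (rule has_derivative_transform_within_open[OF _ assms(2) x]) (simp add: assms(3))
  next
    show "Ck_on m (\<lambda>x. frechet_derivative f (at x) v) S" for v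
      using assms(1) unfolding Suc by (rule Ck_on_Suc_frechet)
  qed (rule assms(2))
qed

lemma Ck_on_subset: "Ck_on n f S \<Longrightarrow> T \<subseteq> S \<Longrightarrow> Ck_on n f T"
proof (induction n arbitrary: f)
  case 0
  then show ?case by (auto intro: continuous_on_subset)
next
  case (Suc n)
  then show ?case unfolding Ck_on.simps by blast
qed

lemma Ck_on_SucD: "Ck_on (Suc n) f S \<Longrightarrow> Ck_on n f S"
proof (induction n arbitrary: f)
  case 0
  then show ?case
    by (auto dest: Ck_on_Suc_differentiable simp: differentiable_imp_continuous_within
        intro!: continuous_at_imp_continuous_on)
next
  case (Suc n)
  then show ?case unfolding Ck_on.simps(2)[of "Suc n"] Ck_on.simps(2)[of n] by blast
qed

lemma Ck_on_const: "open S \<Longrightarrow> Ck_on n (\<lambda>x. c) S"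
proof (induction n arbitrary: c)
  case (Suc n)
  show ?case by (rule Ck_on_SucI[where f' = "\<lambda>x v. 0", OF _ Suc.IH Suc.prems]) (auto simp: Suc.prems)
qed simp

lemma Ck_on_bounded_linear: 
  assumes "open S" "bounded_linear L" shows "Ck_on n L S"
proof (cases n)
  case 0
  then show ?thesis using linear_continuous_on[OF assms(2)] by simp
next
  case (Suc m)
  show ?thesis unfolding Suc
    by (rule Ck_on_SucI[where f' = "\<lambda>x. L"])
       (intro bounded_linear_imp_has_derivative Ck_on_const assms)+
qed

lemma Ck_on_Suc_has_derivative:
  "Ck_on (Suc n) f S \<Longrightarrow> x \<in> S \<Longrightarrow> (f has_derivative frechet_derivative f (at x)) (at x)"
  using Ck_on_Suc_differentiable frechet_derivative_works by blast

lemma Ck_on_add: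
  assumes "open S" "Ck_on n f S" "Ck_on n g S" shows "Ck_on n (\<lambda>x. f x + g x) S"
  using assms(2,3)
proof (induction n arbitrary: f g)
  case 0
  then show ?case by (auto intro: continuous_intros)
next
  case (Suc n)
  show ?case
  proof (rule Ck_on_SucI[OF _ _ assms(1)])
    show "((\<lambda>x. f x + g x) has_derivative
        (\<lambda>v. frechet_derivative f (at x) v + frechet_derivative g (at x) v)) (at x)" if "x \<in> S" for x
      by (intro has_derivative_add Ck_on_Suc_has_derivative[OF Suc.prems(1) that]
          Ck_on_Suc_has_derivative[OF Suc.prems(2) that])
    show "Ck_on n (\<lambda>x. frechet_derivative f (at x) v + frechet_derivative g (at x) v) S" for v
      by (intro Suc.IH Ck_on_Suc_frechet Suc.prems)
  qed
qed

lemma Ck_on_linear_compose: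
  assumes "open S" "Ck_on n f S" "bounded_linear L" shows "Ck_on n (\<lambda>x. L (f x)) S"
  using assms(2)
proof (induction n arbitrary: f)
  case 0
  then show ?case using assms(3) by (auto intro: bounded_linear.continuous_on)
next
  case (Suc n)
  show ?case
  proof (rule Ck_on_SucI[OF _ _ assms(1)])
    show "((\<lambda>x. L (f x)) has_derivative (\<lambda>v. L (frechet_derivative f (at x) v))) (at x)" if "x \<in> S" for x
      by (intro bounded_linear.has_derivative[OF assms(3)] Ck_on_Suc_has_derivative[OF Suc.prems that])
    show "Ck_on n (\<lambda>x. L (frechet_derivative f (at x) v)) S" for v
      by (intro Suc.IH Ck_on_Suc_frechet Suc.prems)
  qed
qed

lemma Ck_on_bilinear:
  assumes "open S" "bounded_bilinear B" "Ck_on n f S" "Ck_on n g S"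
  shows "Ck_on n (\<lambda>x. B (f x) (g x)) S"
  using assms(3,4)
proof (induction n arbitrary: f g)
  case 0
  then show ?case using assms(2) by (auto intro: bounded_bilinear.continuous_on)
next
  case (Suc n)
  show ?case
  proof (rule Ck_on_SucI[OF _ _ assms(1)])
    show "((\<lambda>x. B (f x) (g x)) has_derivative
        (\<lambda>v. B (f x) (frechet_derivative g (at x) v) + B (frechet_derivative f (at x) v) (g x))) (at x)"
      if "x \<in> S" for x
      by (intro bounded_bilinear.FDERIV[OF assms(2)] Ck_on_Suc_has_derivative[OF Suc.prems(1) that]
          Ck_on_Suc_has_derivative[OF Suc.prems(2) that])
    show "Ck_on n (\<lambda>x. B (f x) (frechet_derivative g (at x) v) + B (frechet_derivative f (at x) v) (g x)) S"
      for v
      by (intro Ck_on_add Suc.IH assms(1) Ck_on_SucD[OF Suc.prems(1)] Ck_on_SucD[OF Suc.prems(2)]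
          Ck_on_Suc_frechet Suc.prems)
  qed
qed

lemmas Ck_on_mult = Ck_on_bilinear[OF _ bounded_bilinear_mult]
lemmas Ck_on_scaleR = Ck_on_bilinear[OF _ bounded_bilinear_scaleR]

lemma Ck_on_sum:
  assumes "open S" "\<And>i. i \<in> I \<Longrightarrow> Ck_on n (f i) S" shows "Ck_on n (\<lambda>x. \<Sum>i\<in>I. f i x) S"
  using assms(2)
  by (induction I rule: infinite_finite_induct) (auto intro: Ck_on_add Ck_on_const assms(1))

lemma Ck_on_compose:
  assumes "open S" "Ck_on n f S" "Ck_on n g T" "f ` S \<subseteq> T"
  shows "Ck_on n (\<lambda>x. g (f x)) S"
  using assms(2,3)
proof (induction n arbitrary: g)
  case 0
  then show ?case using assms(4) by (auto intro: continuous_on_compose2)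
next
  case (Suc n)
  define Df where "Df x v = frechet_derivative f (at x) v" for x v
  show ?case
  proof (rule Ck_on_SucI[OF _ _ assms(1)])
    fix x assume x: "x \<in> S"
    have f: "(f has_derivative Df x) (at x)"
      unfolding Df_def by (rule Ck_on_Suc_has_derivative[OF Suc.prems(1) x])
    have g: "(g has_derivative frechet_derivative g (at (f x))) (at (f x))"
      by (rule Ck_on_Suc_has_derivative[OF Suc.prems(2)]) (use x assms(4) in blast)
    have l: "linear (frechet_derivative g (at (f x)))"
      using g has_derivative_linear by blast
    \<comment> \<open>\<open>Ck_on\<close> controls the derivative of g only in fixed directions,
      while the chain rule applies it to the moving vector \<open>Df x v\<close>. Expanding this
      vector in the basis yields a finite sum of products to which the induction hypothesis
      applies.\<close>
    have "frechet_derivative g (at (f x)) (\<Sum>b\<in>Basis. (Df x v \<bullet> b) *\<^sub>R b) =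
        (\<Sum>b\<in>Basis. (Df x v \<bullet> b) *\<^sub>R frechet_derivative g (at (f x)) b)" for v
      by (simp only: linear_sum[OF l] linear_scale[OF l])
    then have "frechet_derivative g (at (f x)) (Df x v) =
        (\<Sum>b\<in>Basis. (Df x v \<bullet> b) *\<^sub>R frechet_derivative g (at (f x)) b)" for v
      by (simp only: euclidean_representation)
    then have "frechet_derivative g (at (f x)) \<circ> Df x =
        (\<lambda>v. \<Sum>b\<in>Basis. (Df x v \<bullet> b) *\<^sub>R frechet_derivative g (at (f x)) b)" by (simp only: o_def)
    with diff_chain_at[OF f g]
    show "((\<lambda>x. g (f x)) has_derivative
        (\<lambda>v. \<Sum>b\<in>Basis. (Df x v \<bullet> b) *\<^sub>R frechet_derivative g (at (f x)) b)) (at x)"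
      by (simp only: o_def)
  next
    fix v
    have "Ck_on n (\<lambda>x. frechet_derivative g (at (f x)) b) S" for b
      by (rule Suc.IH[OF Ck_on_SucD[OF Suc.prems(1)] Ck_on_Suc_frechet[OF Suc.prems(2)]])
    moreover have "Ck_on n (\<lambda>x. Df x v) S"
      unfolding Df_def by (rule Ck_on_Suc_frechet[OF Suc.prems(1)])
    ultimately show "Ck_on n (\<lambda>x. \<Sum>b\<in>Basis. (Df x v \<bullet> b) *\<^sub>R frechet_derivative g (at (f x)) b) S"
      by (intro Ck_on_sum[OF assms(1)] Ck_on_scaleR[OF assms(1)]
          Ck_on_linear_compose[OF assms(1) _ bounded_linear_inner_left])
  qed
qed

section \<open>Smooth maps and smooth germs\<close>

definition smooth_on :: "('a::euclidean_space \<Rightarrow> 'b::real_normed_vector) \<Rightarrow> 'a set \<Rightarrow> bool" where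
  "smooth_on f S \<longleftrightarrow> open S \<and> (\<forall>n. Ck_on n f S)"

lemma smooth_germ_iff: "smooth_germ f \<longleftrightarrow> (\<exists>S. 0 \<in> S \<and> smooth_on f S)"
  by (auto simp: smooth_germ_def smooth_on_def)

lemma smooth_germI: "0 \<in> S \<Longrightarrow> smooth_on f S \<Longrightarrow> smooth_germ f"
  by (auto simp: smooth_germ_iff)

lemma smooth_germE:
  assumes "smooth_germ f" obtains S where "0 \<in> S" "smooth_on f S"
  using assms by (auto simp: smooth_germ_iff)

lemma smooth_onD: "smooth_on f S \<Longrightarrow> open S" "smooth_on f S \<Longrightarrow> Ck_on n f S"
  by (auto simp: smooth_on_def)

lemma smooth_on_subset: "smooth_on f S \<Longrightarrow> open T \<Longrightarrow> T \<subseteq> S \<Longrightarrow> smooth_on f T"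
  by (auto simp: smooth_on_def intro: Ck_on_subset)

lemma smooth_on_cong: "smooth_on f S \<Longrightarrow> (\<And>x. x \<in> S \<Longrightarrow> g x = f x) \<Longrightarrow> smooth_on g S"
  by (auto simp: smooth_on_def intro: Ck_on_cong)

lemma smooth_on_linear: "open S \<Longrightarrow> bounded_linear L \<Longrightarrow> smooth_on L S"
  by (auto simp: smooth_on_def intro: Ck_on_bounded_linear)

lemma smooth_on_const: "open S \<Longrightarrow> smooth_on (\<lambda>x. c) S"
  by (auto simp: smooth_on_def intro: Ck_on_const)

lemma smooth_on_add: "smooth_on f S \<Longrightarrow> smooth_on g S \<Longrightarrow> smooth_on (\<lambda>x. f x + g x) S"
  by (auto simp: smooth_on_def intro: Ck_on_add)

lemma smooth_on_bilinear:
  "bounded_bilinear B \<Longrightarrow> smooth_on f S \<Longrightarrow> smooth_on g S \<Longrightarrow> smooth_on (\<lambda>x. B (f x) (g x)) S"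
  by (auto simp: smooth_on_def intro: Ck_on_bilinear)

lemma smooth_on_compose:
  "smooth_on f S \<Longrightarrow> smooth_on g T \<Longrightarrow> f ` S \<subseteq> T \<Longrightarrow> smooth_on (\<lambda>x. g (f x)) S"
  by (auto simp: smooth_on_def intro: Ck_on_compose)

lemma smooth_on_continuous: "smooth_on f S \<Longrightarrow> continuous_on S f"
  unfolding smooth_on_def by (metis Ck_on.simps(1))

lemma smooth_germ_compose_on:
  assumes "smooth_germ f" "smooth_on g T" "f 0 \<in> T"
  shows "smooth_germ (\<lambda>x. g (f x))"
proof -
  obtain S where S: "0 \<in> S" "smooth_on f S" using smooth_germE[OF assms(1)] .
  have "open (S \<inter> f -` T)"
    by (rule continuous_open_preimage[OF smooth_on_continuous[OF S(2)] smooth_onD(1)[OF S(2)]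
          smooth_onD(1)[OF assms(2)]])
  then have "smooth_on f (S \<inter> f -` T)" by (rule smooth_on_subset[OF S(2)]) simp
  then have "smooth_on (\<lambda>x. g (f x)) (S \<inter> f -` T)"
    using assms(2) by (rule smooth_on_compose) blast
  then show ?thesis by (rule smooth_germI[rotated]) (simp add: S(1) assms(3))
qed

lemma smooth_germ_compose:
  assumes "smooth_germ f" "smooth_germ g" "f 0 = 0" shows "smooth_germ (\<lambda>x. g (f x))"
proof -
  obtain T where "0 \<in> T" "smooth_on g T" using smooth_germE[OF assms(2)] .
  then show ?thesis using smooth_germ_compose_on[OF assms(1), of g T] assms(3) by simp
qed

lemma smooth_germ_linear: "bounded_linear L \<Longrightarrow> smooth_germ L"
  by (rule smooth_germI[of UNIV]) (simp_all add: smooth_on_linear)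

lemma smooth_germ_const: "smooth_germ (\<lambda>x. c)"
  by (rule smooth_germI[of UNIV]) (simp_all add: smooth_on_const)

lemma smooth_germ_ident: "smooth_germ (\<lambda>x. x)"
  using smooth_germ_linear[OF bounded_linear_ident] .

lemma smooth_germ_on2:
  assumes "smooth_germ f" "smooth_germ g"
  obtains S where "0 \<in> S" "smooth_on f S" "smooth_on g S"
proof -
  obtain S where S: "0 \<in> S" "smooth_on f S" using smooth_germE[OF assms(1)] .
  obtain T where T: "0 \<in> T" "smooth_on g T" using smooth_germE[OF assms(2)] .
  have "open (S \<inter> T)" by (intro open_Int smooth_onD(1)[OF S(2)] smooth_onD(1)[OF T(2)])
  from that[OF _ smooth_on_subset[OF S(2) this] smooth_on_subset[OF T(2) this]] S(1) T(1)
  show thesis by simp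
qed

lemma smooth_germ_add:
  assumes "smooth_germ f" "smooth_germ g" shows "smooth_germ (\<lambda>x. f x + g x)"
  by (rule smooth_germ_on2[OF assms]) (rule smooth_germI[OF _ smooth_on_add])

lemma smooth_germ_bilinear:
  assumes "bounded_bilinear B" "smooth_germ f" "smooth_germ g"
  shows "smooth_germ (\<lambda>x. B (f x) (g x))"
  by (rule smooth_germ_on2[OF assms(2,3)]) (rule smooth_germI[OF _ smooth_on_bilinear[OF assms(1)]])

lemmas smooth_germ_scaleR = smooth_germ_bilinear[OF bounded_bilinear_scaleR]

lemma smooth_germ_mult:
  fixes f g :: "'a::euclidean_space \<Rightarrow> real"
  shows "smooth_germ f \<Longrightarrow> smooth_germ g \<Longrightarrow> smooth_germ (\<lambda>x. f x * g x)"
  by (rule smooth_germ_bilinear[OF bounded_bilinear_mult])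

lemma smooth_germ_linear_compose:
  assumes "bounded_linear L" "smooth_germ f" shows "smooth_germ (\<lambda>x. L (f x))"
proof -
  obtain S where S: "open S" "0 \<in> S" "\<And>n. Ck_on n f S" using assms(2) unfolding smooth_germ_def by blast
  show ?thesis unfolding smooth_germ_def
    using S(1,2) Ck_on_linear_compose[OF S(1) S(3) assms(1)] by blast
qed

lemma smooth_germ_minus: "smooth_germ f \<Longrightarrow> smooth_germ (\<lambda>x. - f x)"
  by (rule smooth_germ_linear_compose[OF bounded_linear_minus[OF bounded_linear_ident]])

lemma smooth_germ_diff: "smooth_germ f \<Longrightarrow> smooth_germ g \<Longrightarrow> smooth_germ (\<lambda>x. f x - g x)"
  using smooth_germ_add[OF _ smooth_germ_minus] by simp

lemma smooth_germ_power:
  fixes f :: "'a::euclidean_space \<Rightarrow> real"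
  shows "smooth_germ f \<Longrightarrow> smooth_germ (\<lambda>x. f x ^ n)"
  by (induction n) (auto intro: smooth_germ_const smooth_germ_mult)

lemma smooth_germ_sum:
  "(\<And>i. i \<in> I \<Longrightarrow> smooth_germ (f i)) \<Longrightarrow> smooth_germ (\<lambda>x. \<Sum>i\<in>I. f i x)"
  by (induction I rule: infinite_finite_induct) (auto intro: smooth_germ_add smooth_germ_const)

lemma smooth_germ_fst: "smooth_germ f \<Longrightarrow> smooth_germ (\<lambda>x. fst (f x))"
  by (rule smooth_germ_linear_compose[OF bounded_linear_fst])

lemma smooth_germ_snd: "smooth_germ f \<Longrightarrow> smooth_germ (\<lambda>x. snd (f x))"
  by (rule smooth_germ_linear_compose[OF bounded_linear_snd])

lemma smooth_germ_Pair:
  assumes "smooth_germ f" "smooth_germ g" shows "smooth_germ (\<lambda>x. (f x, g x))"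
proof -
  have "smooth_germ (\<lambda>x. (f x, 0) + (0, g x))"
    by (rule smooth_germ_add[OF
        smooth_germ_linear_compose[OF bounded_linear_Pair[OF bounded_linear_ident bounded_linear_zero] assms(1)]
        smooth_germ_linear_compose[OF bounded_linear_Pair[OF bounded_linear_zero bounded_linear_ident] assms(2)]])
  then show ?thesis by simp
qed

lemma smooth_germ_cong:
  assumes "smooth_germ f" "\<forall>\<^sub>F x in nhds 0. g x = f x" shows "smooth_germ g"
proof -
  obtain S where S: "0 \<in> S" "smooth_on f S" using smooth_germE[OF assms(1)] .
  obtain T where T: "open T" "0 \<in> T" "\<And>x. x \<in> T \<Longrightarrow> g x = f x"
    using assms(2) unfolding eventually_nhds by blast
  have "smooth_on f (S \<inter> T)"
    by (rule smooth_on_subset[OF S(2) open_Int[OF smooth_onD(1)[OF S(2)] T(1)]]) simp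
  then have "smooth_on g (S \<inter> T)" by (rule smooth_on_cong) (simp add: T(3))
  then show ?thesis by (rule smooth_germI[rotated]) (simp add: S(1) T(2))
qed

lemma smooth_germ_isCont:
  assumes "smooth_germ f" shows "isCont f 0"
proof -
  obtain S where S: "0 \<in> S" "smooth_on f S" using smooth_germE[OF assms] .
  show ?thesis
    using smooth_on_continuous[OF S(2)] continuous_on_eq_continuous_at[OF smooth_onD(1)[OF S(2)]] S(1)
    by blast
qed

lemma smooth_germ_tendsto: "smooth_germ f \<Longrightarrow> (f \<longlongrightarrow> f 0) (nhds 0)"
  using smooth_germ_isCont[of f] tendsto_at_iff_tendsto_nhds[of f 0] by (simp add: isCont_def)

lemma smooth_germ_filterlim:
  "smooth_germ f \<Longrightarrow> f 0 = 0 \<Longrightarrow> filterlim f (nhds 0) (nhds 0)"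
  using smooth_germ_tendsto[of f] by simp

text \<open>Identities between germs hold only near 0. This is the rule for substituting into them:
  a continuous f with f 0 = 0 keeps small arguments small.\<close>

lemma eventually_compose_germ:
  "\<forall>\<^sub>F x in nhds 0. P x \<Longrightarrow> smooth_germ f \<Longrightarrow> f 0 = 0 \<Longrightarrow> \<forall>\<^sub>F x in nhds 0. P (f x)"
  using eventually_compose_filterlim[OF _ smooth_germ_filterlim, of P f] by blast

lemma smooth_germ_eventually_ne:
  "smooth_germ f \<Longrightarrow> f 0 \<noteq> c \<Longrightarrow> \<forall>\<^sub>F x in nhds 0. f x \<noteq> c"
  by (rule tendsto_imp_eventually_ne[OF smooth_germ_tendsto])

subsection \<open>Real functions of one variable\<close>

lemma Ck_on_real_SucI:
  fixes f :: "real \<Rightarrow> real"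
  assumes "open S" "\<And>x. x \<in> S \<Longrightarrow> (f has_real_derivative f' x) (at x)" "Ck_on n f' S"
  shows "Ck_on (Suc n) f S"
proof (rule Ck_on_SucI[where f' = "\<lambda>x v. f' x * v"])
  show "(f has_derivative (*) (f' x)) (at x)" if "x \<in> S" for x
    using assms(2)[OF that] by (simp add: has_field_derivative_def)
  show "Ck_on n (\<lambda>x. f' x * v) S" for v by (rule Ck_on_mult[OF assms(1,3) Ck_on_const[OF assms(1)]])
qed (rule assms(1))

text \<open>An explicit chain of successive derivatives replaces the computation of iterated
  \<open>deriv\<close>; each member is continuous because it is differentiable.\<close>

lemma smooth_on_real_family:
  fixes D :: "nat \<Rightarrow> real \<Rightarrow> real"
  assumes "open S" "\<And>n x. x \<in> S \<Longrightarrow> (D n has_real_derivative D (Suc n) x) (at x)"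
  shows "smooth_on (D n) S"
proof -
  have "Ck_on k (D n) S" for k n
  proof (induction k arbitrary: n)
    case 0
    then show ?case
      using DERIV_isCont[OF assms(2)] by (auto intro!: continuous_at_imp_continuous_on)
  next
    case (Suc k)
    show ?case by (rule Ck_on_real_SucI[OF assms(1) assms(2) Suc])
  qed
  then show ?thesis using assms(1) by (simp add: smooth_on_def)
qed

lemma smooth_on_real_deriv:
  fixes f :: "real \<Rightarrow> real"
  assumes "smooth_on f S"
  shows "smooth_on (deriv f) S" "x \<in> S \<Longrightarrow> (f has_real_derivative deriv f x) (at x)"
proof -
  have d: "(f has_real_derivative deriv f x) (at x) \<and> frechet_derivative f (at x) 1 = deriv f x"
    if "x \<in> S" for x
  proof -
    have "(f has_derivative frechet_derivative f (at x)) (at x)"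
      by (rule Ck_on_Suc_has_derivative[OF smooth_onD(2)[OF assms] that])
    moreover from this obtain c where "frechet_derivative f (at x) = (\<lambda>v. v * c)"
      using has_derivative_bounded_linear[of f] unfolding real_bounded_linear by blast
    ultimately have "(f has_real_derivative frechet_derivative f (at x) 1) (at x)"
      by (simp add: has_field_derivative_def mult_commute_abs)
    then show ?thesis using DERIV_imp_deriv[of f] by simp
  qed
  have "Ck_on n (deriv f) S" for n
  proof (rule Ck_on_cong)
    show "Ck_on n (\<lambda>x. frechet_derivative f (at x) 1) S"
      by (rule Ck_on_Suc_frechet[OF smooth_onD(2)[OF assms]])
  qed (use d smooth_onD(1)[OF assms] in auto)
  then show "smooth_on (deriv f) S" using assms unfolding smooth_on_def by blast
  show "x \<in> S \<Longrightarrow> (f has_real_derivative deriv f x) (at x)" using d by blast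
qed

lemma smooth_on_real_derivI:
  fixes f :: "real \<Rightarrow> real"
  assumes "open S" "\<And>x. x \<in> S \<Longrightarrow> (f has_real_derivative f' x) (at x)" "smooth_on f' S"
  shows "smooth_on f S"
proof -
  have "Ck_on (Suc n) f S" for n
    by (rule Ck_on_real_SucI[OF assms(1,2) smooth_onD(2)[OF assms(3)]])
  then show ?thesis using assms(1) Ck_on_SucD unfolding smooth_on_def by blast
qed

lemma smooth_on_inverse: "smooth_on (inverse :: real \<Rightarrow> real) (- {0})"
proof -
  have "Ck_on n (inverse :: real \<Rightarrow> real) (- {0})" for n
  proof (induction n)
    case 0
    then show ?case by (auto intro!: continuous_intros)
  next
    case (Suc n)
    show ?case
    proof (rule Ck_on_real_SucI[where f'="\<lambda>x. (-1) * (inverse x * inverse x)"])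
      show "(inverse has_real_derivative (-1) * (inverse x * inverse x)) (at x)" if "x \<in> - {0}" for x :: real
        using that by (auto intro!: derivative_eq_intros)
      show "Ck_on n (\<lambda>x::real. - 1 * (inverse x * inverse x)) (- {0})"
        by (intro Ck_on_mult Suc.IH Ck_on_const open_Compl) simp_all
    qed (simp add: open_Compl)
  qed
  then show ?thesis by (simp add: smooth_on_def open_Compl)
qed

lemma smooth_on_ln: "smooth_on (ln :: real \<Rightarrow> real) {0<..}"
proof (rule smooth_on_real_derivI[where f'=inverse])
  show "smooth_on (inverse :: real \<Rightarrow> real) {0<..}" by (rule smooth_on_subset[OF smooth_on_inverse]) auto
qed (auto intro!: derivative_eq_intros simp: field_simps)

lemma smooth_on_exp: "smooth_on (exp :: real \<Rightarrow> real) UNIV"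
  using smooth_on_real_family[of UNIV "\<lambda>n. exp"] by auto

lemma smooth_on_powr: "smooth_on (\<lambda>x::real. x powr a) {0<..}"
proof -
  have "smooth_on (\<lambda>x::real. exp (a * ln x)) {0<..}"
    by (rule smooth_on_compose[OF smooth_on_bilinear[OF bounded_bilinear_mult smooth_on_const smooth_on_ln]
          smooth_on_exp]) auto
  then show ?thesis by (rule smooth_on_cong) (auto simp: powr_def)
qed

lemma smooth_on_sin: "smooth_on (sin :: real \<Rightarrow> real) UNIV"
  and smooth_on_cos: "smooth_on (cos :: real \<Rightarrow> real) UNIV"
proof -
  \<comment> \<open>Differentiating sine is a shift by pi / 2, so the derivatives of sine and cosine
    form one chain.\<close>
  define D where "D n x = sin (x + real n * (pi / 2))" for n and x :: real
  have "sin (x + real (Suc n) * (pi / 2)) = cos (x + real n * (pi / 2))" for n x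
    using sin_add[of "x + real n * (pi / 2)" "pi / 2"] by (simp add: algebra_simps add_divide_distrib)
  then have "(D n has_real_derivative D (Suc n) x) (at x)" for n x
    unfolding D_def by (auto intro!: derivative_eq_intros)
  then have "smooth_on (D n) UNIV" for n using smooth_on_real_family[of UNIV D] by simp
  moreover have "D 0 = sin" "D 1 = cos" by (simp_all add: D_def sin_add fun_eq_iff)
  ultimately show "smooth_on (sin :: real \<Rightarrow> real) UNIV" "smooth_on (cos :: real \<Rightarrow> real) UNIV"
    by metis+
qed

lemma smooth_germ_inverse:
  fixes f :: "'a::euclidean_space \<Rightarrow> real"
  shows "smooth_germ f \<Longrightarrow> f 0 \<noteq> 0 \<Longrightarrow> smooth_germ (\<lambda>x. inverse (f x))"
  by (rule smooth_germ_compose_on[OF _ smooth_on_inverse]) auto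

lemma smooth_germ_divide:
  fixes f g :: "'a::euclidean_space \<Rightarrow> real"
  shows "smooth_germ f \<Longrightarrow> smooth_germ g \<Longrightarrow> g 0 \<noteq> 0 \<Longrightarrow> smooth_germ (\<lambda>x. f x / g x)"
  unfolding divide_inverse by (intro smooth_germ_mult smooth_germ_inverse)

lemma smooth_germ_powr:
  fixes f :: "'a::euclidean_space \<Rightarrow> real"
  shows "smooth_germ f \<Longrightarrow> f 0 > 0 \<Longrightarrow> smooth_germ (\<lambda>x. f x powr a)"
  by (rule smooth_germ_compose_on[OF _ smooth_on_powr]) auto

lemma smooth_germ_sin:
  fixes f :: "'a::euclidean_space \<Rightarrow> real"
  shows "smooth_germ f \<Longrightarrow> smooth_germ (\<lambda>x. sin (f x))"
  by (rule smooth_germ_compose_on[OF _ smooth_on_sin]) auto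

lemma smooth_germ_cos:
  fixes f :: "'a::euclidean_space \<Rightarrow> real"
  shows "smooth_germ f \<Longrightarrow> smooth_germ (\<lambda>x. cos (f x))"
  by (rule smooth_germ_compose_on[OF _ smooth_on_cos]) auto

lemmas smooth_germ_intros = smooth_germ_ident smooth_germ_const smooth_germ_add smooth_germ_diff
  smooth_germ_minus smooth_germ_mult smooth_germ_power smooth_germ_sum smooth_germ_fst smooth_germ_snd
  smooth_germ_Pair smooth_germ_scaleR smooth_germ_divide smooth_germ_sin smooth_germ_cos

lemma smooth_germ_deriv:
  fixes f :: "real \<Rightarrow> real"
  assumes "smooth_germ f"
  shows "smooth_germ (deriv f)" "\<forall>\<^sub>F x in nhds 0. (f has_real_derivative deriv f x) (at x)"
    "(f has_real_derivative deriv f 0) (at 0)"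
proof -
  obtain S where S: "0 \<in> S" "smooth_on f S" using smooth_germE[OF assms] .
  note d = smooth_on_real_deriv[OF S(2)]
  show "smooth_germ (deriv f)" using S(1) d(1) by (rule smooth_germI)
  show "\<forall>\<^sub>F x in nhds 0. (f has_real_derivative deriv f x) (at x)"
    unfolding eventually_nhds using S(1) d(2) smooth_onD(1)[OF S(2)] by blast
  show "(f has_real_derivative deriv f 0) (at 0)" using d(2)[OF S(1)] .
qed

lemma smooth_germ_derivI:
  fixes f f' :: "real \<Rightarrow> real"
  assumes "smooth_germ f'" "\<forall>\<^sub>F x in nhds 0. (f has_real_derivative f' x) (at x)"
  shows "smooth_germ f"
proof -
  obtain S where S: "0 \<in> S" "smooth_on f' S" using smooth_germE[OF assms(1)] .
  obtain T where T: "open T" "0 \<in> T" "\<And>x. x \<in> T \<Longrightarrow> (f has_real_derivative f' x) (at x)"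
    using assms(2) unfolding eventually_nhds by blast
  have o: "open (S \<inter> T)" by (rule open_Int[OF smooth_onD(1)[OF S(2)] T(1)])
  have "smooth_on f (S \<inter> T)"
    by (rule smooth_on_real_derivI[OF o T(3) smooth_on_subset[OF S(2) o]]) auto
  then show ?thesis by (rule smooth_germI[rotated]) (simp add: S(1) T(2))
qed

text \<open>To be differentiated, an equality must hold in a neighbourhood of each point near 0;
  \<open>eventually_eventually\<close> provides this.\<close>

lemma deriv_cong_germ:
  assumes "\<forall>\<^sub>F x in nhds 0. f x = g x"
  shows "\<forall>\<^sub>F x in nhds (0::real). deriv f x = deriv g (x::real)"
proof -
  have "\<forall>\<^sub>F x in nhds 0. \<forall>\<^sub>F y in nhds x. f y = g y"
    using assms by (simp add: eventually_eventually)
  then show ?thesis by eventually_elim (rule deriv_cong_ev, auto)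
qed

subsection \<open>Division by powers and Taylor coefficients\<close>

lemma smooth_on_deriv_power:
  fixes f :: "real \<Rightarrow> real"
  assumes "smooth_on f S"
  shows "smooth_on ((deriv ^^ n) f) S"
  by (induction n) (auto intro: assms smooth_on_real_deriv(1))

lemma smooth_germ_deriv_power:
  fixes f :: "real \<Rightarrow> real"
  shows "smooth_germ f \<Longrightarrow> smooth_germ ((deriv ^^ n) f)"
  by (induction n) (auto intro: smooth_germ_deriv(1))

text \<open>The quotient is the integral of f' (u x) over u in [0, 1]. Differentiating n times under
  the integral gives \<open>G n\<close>, so these integrals form a chain of derivatives and the
  quotient is smooth also at 0.\<close>

lemma hadamard:
  fixes f :: "real \<Rightarrow> real"
  assumes "smooth_germ f"
  obtains g where "smooth_germ g" "\<forall>\<^sub>F t in nhds 0. f t = f 0 + t * g t"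
proof -
  obtain S where S: "0 \<in> S" "smooth_on f S" using smooth_germE[OF assms] .
  obtain \<epsilon> where \<epsilon>: "\<epsilon> > 0" "ball 0 \<epsilon> \<subseteq> S"
    using S(1) smooth_onD(1)[OF S(2)] open_contains_ball by blast
  define B where "B = ball (0::real) \<epsilon>"
  define D where "D n = (deriv ^^ n) f" for n
  have D: "smooth_on (D n) B" for n
    unfolding D_def B_def
    by (rule smooth_on_subset[OF smooth_on_deriv_power[OF S(2)] open_ball \<epsilon>(2)])
  have derD: "(D n has_real_derivative D (Suc n) x) (at x)" if "x \<in> B" for n x
    using smooth_on_real_deriv(2)[OF D[of n] that] by (simp add: D_def)
  have seg: "u * x \<in> B" if "x \<in> B" "u \<in> cbox 0 1" for u x
  proof -
    have "\<bar>u * x\<bar> \<le> \<bar>x\<bar>" using that(2) by (simp add: abs_mult mult_left_le_one_le)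
    then show ?thesis using that(1) by (simp add: B_def)
  qed
  have cont: "continuous_on (B \<times> cbox 0 1) (\<lambda>(x, u). u ^ k * D n (u * x))" for k n
  proof -
    have "continuous_on (B \<times> cbox 0 1) (\<lambda>p. D n (snd p * fst p))"
      by (rule continuous_on_compose2[OF smooth_on_continuous[OF D[of n]]])
         (auto intro!: continuous_intros simp: seg)
    then show ?thesis by (auto simp: split_beta intro!: continuous_intros)
  qed
  define G where "G n x = integral (cbox 0 1) (\<lambda>u. u ^ n * D (Suc n) (u * x))" for n and x :: real
  have int: "(\<lambda>u. u ^ k * D n (u * x)) integrable_on cbox 0 1" if "x \<in> B" for k n x
  proof (rule integrable_continuous)
    show "continuous_on (cbox 0 1) (\<lambda>u. u ^ k * D n (u * x))"
    proof -
      have "continuous_on (cbox 0 1) ((\<lambda>(x, u). u ^ k * D n (u * x)) \<circ> Pair x)"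
        by (intro continuous_on_compose continuous_intros)
           (rule continuous_on_subset[OF cont], use that in auto)
      then show ?thesis by (simp add: o_def)
    qed
  qed
  have "(G n has_real_derivative G (Suc n) x) (at x)" if "x \<in> B" for n x
  proof -
    have "((\<lambda>x. integral (cbox 0 1) (\<lambda>u. u ^ n * D (Suc n) (u * x))) has_real_derivative
        integral (cbox 0 1) (\<lambda>u. u ^ Suc n * D (Suc (Suc n)) (u * x))) (at x within B)"
    proof (rule leibniz_rule_field_derivative)
      show "((\<lambda>x. u ^ n * D (Suc n) (u * x)) has_real_derivative u ^ Suc n * D (Suc (Suc n)) (u * x))
          (at x within B)" if "x \<in> B" "u \<in> cbox 0 1" for x u
      proof -
        from derD[OF seg[OF that]]
        have "((\<lambda>x. D (Suc n) (u * x)) has_real_derivative D (Suc (Suc n)) (u * x) * u) (at x)"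
          by (rule DERIV_chain2) (auto intro!: derivative_eq_intros)
        from has_field_derivative_at_within[OF DERIV_cmult[OF this, of "u ^ n"]]
        show ?thesis by (simp add: mult_ac)
      qed
      show "continuous_on (B \<times> cbox 0 1) (\<lambda>(x, u). u ^ Suc n * D (Suc (Suc n)) (u * x))" by (rule cont)
      show "(\<lambda>u. u ^ n * D (Suc n) (u * x)) integrable_on cbox 0 1" if "x \<in> B" for x
        using that by (rule int)
    qed (use that in \<open>simp_all add: B_def\<close>)
    moreover have "at x within B = at x"
      by (rule at_within_open[OF that]) (simp add: B_def)
    ultimately show ?thesis by (simp add: G_def[abs_def])
  qed
  then have "smooth_on (G 0) B" by (intro smooth_on_real_family) (simp_all add: B_def)
  then have "smooth_germ (G 0)" by (rule smooth_germI[rotated]) (simp add: B_def \<epsilon>)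
  moreover have "f x = f 0 + x * G 0 x" if "x \<in> B" for x
  proof -
    have "((\<lambda>u. x * D 1 (u * x)) has_integral f (1 * x) - f (0 * x)) {0..1}"
    proof (rule fundamental_theorem_of_calculus)
      show "((\<lambda>u. f (u * x)) has_vector_derivative x * D 1 (u * x)) (at u within {0..1})"
        if u: "u \<in> {0..1}" for u
      proof -
        have "u * x \<in> B" using seg[OF \<open>x \<in> B\<close>, of u] u by simp
        from derD[OF this, of 0] have "(f has_real_derivative D 1 (u * x)) (at (u * x))"
          by (simp add: D_def)
        then have "((\<lambda>u. f (u * x)) has_real_derivative D 1 (u * x) * x) (at u within {0..1})"
          by (intro has_field_derivative_at_within[OF DERIV_chain2]) (auto intro!: derivative_eq_intros)
        then show ?thesis by (simp add: has_real_derivative_iff_has_vector_derivative mult.commute)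
      qed
    qed simp
    then have "integral {0..1} (\<lambda>u. x * D 1 (u * x)) = f (1 * x) - f (0 * x)" by (rule integral_unique)
    then show ?thesis by (simp add: G_def)
  qed
  note eq = this
  have "open B" "0 \<in> B" by (simp_all add: B_def \<epsilon>)
  from eventually_mono[OF eventually_nhds_in_open[OF this] eq]
  have "\<forall>\<^sub>F t in nhds 0. f t = f 0 + t * G 0 t" .
  ultimately show thesis by (rule that)
qed

text \<open>For n \<ge> 1 this is membership in the n-th power of the ideal of smooth germs
  vanishing at 0. Unlike a bound of the form O(t^n) it survives differentiation, at the cost of one
  order.\<close>

definition van :: "nat \<Rightarrow> (real \<Rightarrow> real) \<Rightarrow> bool" where
  "van n f \<longleftrightarrow> (\<exists>g. smooth_germ g \<and> (\<forall>\<^sub>F t in nhds 0. f t = t ^ n * g t))"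

lemma vanI: "smooth_germ g \<Longrightarrow> \<forall>\<^sub>F t in nhds 0. f t = t ^ n * g t \<Longrightarrow> van n f"
  unfolding van_def by (intro exI conjI)

lemma vanE:
  assumes "van n f" obtains g where "smooth_germ g" "\<forall>\<^sub>F t in nhds 0. f t = t ^ n * g t"
  using assms unfolding van_def by (elim exE conjE)

lemma van_smooth:
  assumes "van n f" shows "smooth_germ f"
proof -
  obtain g where g: "smooth_germ g" "\<forall>\<^sub>F t in nhds 0. f t = t ^ n * g t" using vanE[OF assms] .
  show ?thesis by (rule smooth_germ_cong[OF _ g(2)]) (intro smooth_germ_intros g(1))
qed

lemma van_cong:
  assumes "van n f" "\<forall>\<^sub>F t in nhds 0. g t = f t" shows "van n g"
proof -
  obtain k where k: "smooth_germ k" "\<forall>\<^sub>F t in nhds 0. f t = t ^ n * k t" using vanE[OF assms(1)] .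
  show ?thesis by (rule vanI[OF k(1)]) (use assms(2) k(2) in eventually_elim, simp)
qed

lemma van_eq: "van n f \<Longrightarrow> (\<And>t. g t = f t) \<Longrightarrow> van n g"
  by (erule van_cong) simp

lemma van_zero: "van n (\<lambda>t. 0)"
  by (rule vanI[of "\<lambda>t. 0"]) (simp_all add: smooth_germ_const)

lemma van_0: "smooth_germ f \<Longrightarrow> van 0 f"
  by (rule vanI[of f]) simp_all

lemma van_add:
  assumes "van n f" "van n g" shows "van n (\<lambda>t. f t + g t)"
proof -
  obtain k where k: "smooth_germ k" "\<forall>\<^sub>F t in nhds 0. f t = t ^ n * k t" using vanE[OF assms(1)] .
  obtain l where l: "smooth_germ l" "\<forall>\<^sub>F t in nhds 0. g t = t ^ n * l t" using vanE[OF assms(2)] .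
  show ?thesis
    by (rule vanI[OF smooth_germ_add[OF k(1) l(1)]])
       (use k(2) l(2) in eventually_elim, simp add: algebra_simps)
qed

lemma van_mult:
  assumes "van m f" "van n g" shows "van (m + n) (\<lambda>t. f t * g t)"
proof -
  obtain k where k: "smooth_germ k" "\<forall>\<^sub>F t in nhds 0. f t = t ^ m * k t" using vanE[OF assms(1)] .
  obtain l where l: "smooth_germ l" "\<forall>\<^sub>F t in nhds 0. g t = t ^ n * l t" using vanE[OF assms(2)] .
  show ?thesis
    by (rule vanI[OF smooth_germ_mult[OF k(1) l(1)]])
       (use k(2) l(2) in eventually_elim, simp add: power_add)
qed

lemma van_mult_left: "smooth_germ f \<Longrightarrow> van n g \<Longrightarrow> van n (\<lambda>t. f t * g t)"
  using van_mult[OF van_0] by fastforce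

lemma van_mult_right: "van n g \<Longrightarrow> smooth_germ f \<Longrightarrow> van n (\<lambda>t. g t * f t)"
  using van_mult[OF _ van_0] by fastforce

lemma van_cmult: "van n g \<Longrightarrow> van n (\<lambda>t. c * g t)"
  by (rule van_mult_left[OF smooth_germ_const])

lemma van_minus: "van n f \<Longrightarrow> van n (\<lambda>t. - f t)"
  using van_cmult[of n f "-1"] by simp

lemma van_diff: "van n f \<Longrightarrow> van n g \<Longrightarrow> van n (\<lambda>t. f t - g t)"
  using van_add[OF _ van_minus] by simp

lemma van_power_id: "n \<le> k \<Longrightarrow> van n (\<lambda>t. t ^ k)"
  by (rule vanI[of "\<lambda>t. t ^ (k - n)"]) (auto intro: smooth_germ_intros simp flip: power_add)

lemma van_monom: "n \<le> k \<Longrightarrow> van n (\<lambda>t. c * t ^ k)"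
  by (rule van_cmult[OF van_power_id])

lemma van_mono:
  assumes "van n f" "m \<le> n" shows "van m f"
proof -
  obtain k where k: "smooth_germ k" "\<forall>\<^sub>F t in nhds 0. f t = t ^ n * k t" using vanE[OF assms(1)] .
  have "van m (\<lambda>t. t ^ n * k t)" by (rule van_mult_right[OF van_power_id[OF assms(2)] k(1)])
  then show ?thesis using k(2) by (rule van_cong)
qed

lemma van_power: "van 1 f \<Longrightarrow> van k (\<lambda>t. f t ^ k)"
proof (induction k)
  case 0
  then show ?case using van_0[OF smooth_germ_const] by simp
next
  case (Suc k)
  show ?case using van_mult[OF Suc.prems Suc.IH[OF Suc.prems]] by simp
qed

lemma van_1I:
  assumes "smooth_germ f" "f 0 = 0" shows "van 1 f"
proof -
  obtain g where "smooth_germ g" "\<forall>\<^sub>F t in nhds 0. f t = f 0 + t * g t" using hadamard[OF assms(1)] .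
  then show ?thesis using vanI[of g f 1] assms(2) by simp
qed

lemma van_1D: "van (Suc n) f \<Longrightarrow> f 0 = 0"
  by (erule vanE) (drule eventually_nhds_x_imp_x, simp)

lemma van_compose:
  assumes "van n f" "smooth_germ h" "h 0 = 0" shows "van n (\<lambda>t. f (h t))"
proof -
  obtain k where k: "smooth_germ k" "\<forall>\<^sub>F t in nhds 0. f t = t ^ n * k t" using vanE[OF assms(1)] .
  have "van n (\<lambda>t. h t ^ n * k (h t))"
    by (rule van_mult_right[OF van_power[OF van_1I[OF assms(2,3)]] smooth_germ_compose[OF assms(2) k(1) assms(3)]])
  then show ?thesis by (rule van_cong) (rule eventually_compose_germ[OF k(2) assms(2,3)])
qed

lemma van_unit:
  assumes "van n (\<lambda>t. f t * u t)" "smooth_germ u" "u 0 \<noteq> 0" shows "van n f"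
proof -
  have "van n (\<lambda>t. f t * u t * inverse (u t))"
    by (rule van_mult_right[OF assms(1) smooth_germ_inverse[OF assms(2,3)]])
  then show ?thesis
    by (rule van_cong) (use smooth_germ_eventually_ne[OF assms(2,3)] in eventually_elim, simp)
qed

text \<open>The Taylor coefficient, meaningful for smooth germs. The iterate of \<open>deriv\<close>
  is the one in \<open>angle_coeff\<close>, so for the angle the two differ just by the
  factorial.\<close>

definition tc :: "(real \<Rightarrow> real) \<Rightarrow> nat \<Rightarrow> real" where
  "tc f n = (deriv ^^ n) f 0 / fact n"

lemma deriv_power_cong_germ:
  fixes f g :: "real \<Rightarrow> real"
  assumes "\<forall>\<^sub>F t in nhds 0. f t = g t"
  shows "\<forall>\<^sub>F t in nhds 0. (deriv ^^ n) f t = (deriv ^^ n) g t"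
  by (induction n) (use assms deriv_cong_germ in auto)

lemma tc_cong: "\<forall>\<^sub>F t in nhds 0. f t = g t \<Longrightarrow> tc f n = tc g n"
  unfolding tc_def using eventually_nhds_x_imp_x[OF deriv_power_cong_germ] by simp

lemma tc_0: "tc f 0 = f 0"
  by (simp add: tc_def)

lemma tc_deriv: "tc (deriv f) n = real (Suc n) * tc f (Suc n)"
  by (simp add: tc_def funpow_swap1 field_simps del: of_nat_Suc)

lemma tc_lincomb:
  assumes "smooth_germ f" "smooth_germ g"
  shows "tc (\<lambda>t. a * f t + b * g t) n = a * tc f n + b * tc g n"
proof -
  have "\<forall>\<^sub>F t in nhds 0. (deriv ^^ n) (\<lambda>t. a * f t + b * g t) t = a * (deriv ^^ n) f t + b * (deriv ^^ n) g t"
  proof (induction n)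
    case (Suc n)
    from smooth_germ_deriv(2)[OF smooth_germ_deriv_power[OF assms(1), of n]]
      smooth_germ_deriv(2)[OF smooth_germ_deriv_power[OF assms(2), of n]] deriv_cong_germ[OF Suc]
    show ?case
    proof eventually_elim
      case (elim t)
      have "((\<lambda>t. a * (deriv ^^ n) f t + b * (deriv ^^ n) g t) has_real_derivative
          a * deriv ((deriv ^^ n) f) t + b * deriv ((deriv ^^ n) g) t) (at t)"
        by (intro DERIV_add DERIV_cmult elim(1,2))
      from DERIV_imp_deriv[OF this] elim(3) show ?case by simp
    qed
  qed simp
  from eventually_nhds_x_imp_x[OF this] show ?thesis by (simp add: tc_def add_divide_distrib)
qed

lemma tc_add: "smooth_germ f \<Longrightarrow> smooth_germ g \<Longrightarrow> tc (\<lambda>t. f t + g t) n = tc f n + tc g n"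
  using tc_lincomb[of f g 1 1] by simp

lemma tc_diff: "smooth_germ f \<Longrightarrow> smooth_germ g \<Longrightarrow> tc (\<lambda>t. f t - g t) n = tc f n - tc g n"
  using tc_lincomb[of f g 1 "-1"] by simp

lemma tc_cmult: "smooth_germ f \<Longrightarrow> tc (\<lambda>t. c * f t) n = c * tc f n"
  using tc_lincomb[of f f c 0] by simp

lemma tc_zero: "tc (\<lambda>t. 0) n = 0"
  using tc_cmult[OF smooth_germ_const, of 0 0] by simp

lemma tc_sum: "(\<And>i. i \<in> I \<Longrightarrow> smooth_germ (f i)) \<Longrightarrow> tc (\<lambda>t. \<Sum>i\<in>I. f i t) n = (\<Sum>i\<in>I. tc (f i) n)"
  by (induction I rule: infinite_finite_induct) (auto simp: tc_zero tc_add smooth_germ_sum)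

lemma tc_Suc:
  assumes "smooth_germ g" "\<forall>\<^sub>F t in nhds 0. f t = c + t * g t"
  shows "tc f (Suc n) = tc g n"
proof -
  \<comment> \<open>With a single factor t the Leibniz rule has two terms. At 0 the first one
    vanishes, and the factor n + 1 of the second turns (n + 1)! into n!.\<close>
  let ?g = "\<lambda>n. (deriv ^^ n) g"
  have "\<forall>\<^sub>F t in nhds 0. (deriv ^^ Suc n) f t = t * ?g (Suc n) t + real (Suc n) * ?g n t"
  proof (induction n)
    case 0
    from smooth_germ_deriv(2)[OF assms(1)] deriv_cong_germ[OF assms(2)] show ?case
    proof eventually_elim
      case (elim t)
      have "((\<lambda>t. c + t * g t) has_real_derivative t * deriv g t + g t) (at t)"
        by (rule derivative_eq_intros elim(1) refl | simp)+
      from DERIV_imp_deriv[OF this] elim(2) show ?case by simp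
    qed
  next
    case (Suc n)
    from smooth_germ_deriv(2)[OF smooth_germ_deriv_power[OF assms(1), of "Suc n"]]
      smooth_germ_deriv(2)[OF smooth_germ_deriv_power[OF assms(1), of n]] deriv_cong_germ[OF Suc]
    show ?case
    proof eventually_elim
      case (elim t)
      have "((\<lambda>t. t * ?g (Suc n) t + real (Suc n) * ?g n t) has_real_derivative
          t * deriv (?g (Suc n)) t + ?g (Suc n) t + real (Suc n) * deriv (?g n) t) (at t)"
        by (rule derivative_eq_intros elim(1,2) refl | simp)+
      from DERIV_imp_deriv[OF this] elim(3) show ?case by (simp add: algebra_simps)
    qed
  qed
  from eventually_nhds_x_imp_x[OF this] show ?thesis
    by (simp add: tc_def field_simps del: of_nat_Suc funpow.simps)
qed

lemma tc_const: "tc (\<lambda>t. c) n = (if n = 0 then c else 0)"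
proof (cases n)
  case (Suc m)
  have "tc (\<lambda>t. c) (Suc m) = tc (\<lambda>t. 0) m" by (rule tc_Suc[OF smooth_germ_const, of _ c]) simp
  then show ?thesis by (simp add: Suc tc_zero)
qed (simp add: tc_0)

lemma tc_shift:
  assumes "smooth_germ g"
  shows "tc (\<lambda>t. t ^ k * g t) n = (if n < k then 0 else tc g (n - k))"
proof (induction k arbitrary: n)
  case (Suc k)
  show ?case
  proof (cases n)
    case (Suc m)
    have "smooth_germ (\<lambda>t. t ^ k * g t)" by (intro smooth_germ_intros assms)
    then have "tc (\<lambda>t. t ^ Suc k * g t) (Suc m) = tc (\<lambda>t. t ^ k * g t) m"
      by (rule tc_Suc[of _ _ 0]) (simp add: mult.assoc)
    then show ?thesis using Suc.IH Suc by simp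
  qed (simp add: tc_0)
qed simp

lemma tc_monom: "tc (\<lambda>t. c * t ^ k) n = (if n = k then c else 0)"
  using tc_shift[OF smooth_germ_const, of k c n] by (auto simp: tc_const mult.commute)

lemma taylor:
  assumes "smooth_germ f"
  shows "van n (\<lambda>t. f t - (\<Sum>i<n. tc f i * t ^ i))"
  using assms
proof (induction n arbitrary: f)
  case 0
  then show ?case using van_0 by simp
next
  case (Suc n)
  obtain g where g: "smooth_germ g" "\<forall>\<^sub>F t in nhds 0. f t = f 0 + t * g t" using hadamard[OF Suc.prems] .
  have "van (Suc n) (\<lambda>t. t ^ 1 * (g t - (\<Sum>i<n. tc g i * t ^ i)))"
    using van_mult[OF van_power_id[OF order_refl, of 1] Suc.IH[OF g(1)]] by simp
  then show ?case
  proof (rule van_cong)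
    show "\<forall>\<^sub>F t in nhds 0. f t - (\<Sum>i<Suc n. tc f i * t ^ i) = t ^ 1 * (g t - (\<Sum>i<n. tc g i * t ^ i))"
      using g(2)
    proof eventually_elim
      case (elim t)
      have "(\<Sum>i<Suc n. tc f i * t ^ i) = f 0 + (\<Sum>i<n. tc f (Suc i) * t ^ Suc i)"
        by (simp add: sum.lessThan_Suc_shift tc_0 del: sum.lessThan_Suc)
      also have "(\<Sum>i<n. tc f (Suc i) * t ^ Suc i) = t * (\<Sum>i<n. tc g i * t ^ i)"
        by (simp add: tc_Suc[OF g] sum_distrib_left algebra_simps)
      finally show ?case using elim by (simp add: algebra_simps)
    qed
  qed
qed

lemma van_tc: "van n f \<Longrightarrow> i < n \<Longrightarrow> tc f i = 0"
proof -
  assume a: "van n f" "i < n"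
  obtain k where k: "smooth_germ k" "\<forall>\<^sub>F t in nhds 0. f t = t ^ n * k t" using vanE[OF a(1)] .
  show ?thesis using tc_cong[OF k(2)] tc_shift[OF k(1)] a(2) by simp
qed

lemma van_iff_tc: "van n f \<longleftrightarrow> smooth_germ f \<and> (\<forall>i<n. tc f i = 0)"
proof safe
  assume a: "smooth_germ f" "\<forall>i<n. tc f i = 0"
  show "van n f" by (rule van_eq[OF taylor[OF a(1)]]) (simp add: a(2))
qed (auto intro: van_smooth van_tc)

lemma tc_eq:
  assumes "van n (\<lambda>t. f t - g t)" "smooth_germ f" "smooth_germ g" "i < n"
  shows "tc f i = tc g i"
  using van_tc[OF assms(1,4)] tc_diff[OF assms(2,3)] by simp

lemma van_SucI: "van n f \<Longrightarrow> tc f n = 0 \<Longrightarrow> van (Suc n) f"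
  unfolding van_iff_tc by (auto simp: less_Suc_eq)

lemma van_leading: 
  assumes "van n f" shows "van (Suc n) (\<lambda>t. f t - tc f n * t ^ n)"
proof (rule van_SucI)
  show "van n (\<lambda>t. f t - tc f n * t ^ n)" by (rule van_diff[OF assms van_monom]) simp
  show "tc (\<lambda>t. f t - tc f n * t ^ n) n = 0"
    by (simp add: tc_diff van_smooth[OF assms] smooth_germ_intros tc_monom)
qed

lemma van_deriv: 
  assumes "van (Suc n) f" shows "van n (deriv f)"
  unfolding van_iff_tc
  using smooth_germ_deriv(1)[OF van_smooth[OF assms]] van_tc[OF assms] by (auto simp: tc_deriv)

lemma van_deriv_imp:
  assumes "smooth_germ f" "f 0 = 0" "van n (deriv f)" shows "van (Suc n) f"
  unfolding van_iff_tc
proof (intro conjI allI impI assms(1))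
  fix i assume "i < Suc n"
  then show "tc f i = 0"
    using van_tc[OF assms(3), of "i - 1"] assms(2) by (cases i) (auto simp: tc_0 tc_deriv)
qed

text \<open>A first order expansion of H at a moving base point that needs no remainder in two
  variables: the Taylor polynomial of H is treated exactly by factoring differences of powers, and
  its remainder has order N at both points. N \<ge> 2 keeps the linear coefficient of H in the
  polynomial, which gives the value of v at 0.\<close>

lemma compose_increment:
  assumes "smooth_germ H" "smooth_germ u" "smooth_germ w" "u 0 = 0" "w 0 = 0" "N \<ge> 2"
  obtains v where "smooth_germ v" "v 0 = tc H 1" "van N (\<lambda>s. H (u s + w s) - H (u s) - w s * v s)"
proof
  let ?q = "\<lambda>i s. \<Sum>j<i. u s ^ (i - Suc j) * (u s + w s) ^ j"
  let ?v = "\<lambda>s. \<Sum>i<N. tc H i * ?q i s"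
  let ?R = "\<lambda>t. H t - (\<Sum>i<N. tc H i * t ^ i)"
  show "smooth_germ ?v" by (intro smooth_germ_intros assms)
  have "tc H i * ?q i 0 = (if i = 1 then tc H 1 else 0)" for i
    using assms(4,5) by (cases "i = 0 \<or> i = 1") (auto simp: power_0_left intro!: sum.neutral)
  then show "?v 0 = tc H 1" using assms(6) by simp
  have uw: "smooth_germ (\<lambda>s. u s + w s)" by (intro smooth_germ_intros assms)
  have "van N (\<lambda>s. ?R (u s + w s) - ?R (u s))"
    by (rule van_diff[OF van_compose[OF taylor[OF assms(1)] uw] van_compose[OF taylor[OF assms(1)] assms(2)]])
       (simp_all add: assms)
  moreover have "(\<Sum>i<N. tc H i * (u s + w s) ^ i) - (\<Sum>i<N. tc H i * u s ^ i) = w s * ?v s" for s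
  proof -
    have "(u s + w s) ^ i - u s ^ i = w s * ?q i s" for i
      using power_diff_sumr2[of "u s + w s" i "u s"] by simp
    then have "tc H i * (u s + w s) ^ i - tc H i * u s ^ i = w s * (tc H i * ?q i s)" for i
      by (metis mult.left_commute right_diff_distrib)
    then show ?thesis by (simp add: sum_subtractf[symmetric] sum_distrib_left)
  qed
  ultimately show "van N (\<lambda>s. H (u s + w s) - H (u s) - w s * ?v s)"
    by (elim van_eq) (simp add: algebra_simps)
qed

subsection \<open>Borel's lemma and decomposition modulo powers\<close>

lemma smooth_on_mult:
  fixes f g :: "'a::euclidean_space \<Rightarrow> real"
  shows "smooth_on f S \<Longrightarrow> smooth_on g S \<Longrightarrow> smooth_on (\<lambda>x. f x * g x) S"
  by (rule smooth_on_bilinear[OF bounded_bilinear_mult])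

lemma smooth_on_power:
  fixes f :: "'a::euclidean_space \<Rightarrow> real"
  assumes "smooth_on f S" shows "smooth_on (\<lambda>x. f x ^ n) S"
proof (induction n)
  case 0
  then show ?case using smooth_on_const[OF smooth_onD(1)[OF assms]] by simp
next
  case (Suc n)
  then show ?case using smooth_on_mult[OF assms] by simp
qed

lemma deriv_power_family:
  fixes D :: "nat \<Rightarrow> real \<Rightarrow> real"
  assumes "open S" "\<And>n x. x \<in> S \<Longrightarrow> (D n has_real_derivative D (Suc n) x) (at x)" "x \<in> S"
  shows "(deriv ^^ n) (D 0) x = D n x"
  using assms(3)
proof (induction n arbitrary: x)
  case (Suc n)
  have "\<forall>\<^sub>F y in nhds x. (deriv ^^ n) (D 0) y = D n y"
    unfolding eventually_nhds using assms(1) Suc by (intro exI[of _ S]) auto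
  then have "deriv ((deriv ^^ n) (D 0)) x = deriv (D n) x" by (rule deriv_cong_ev) simp
  then show ?case using DERIV_imp_deriv[OF assms(2)[OF Suc.prems]] by simp
qed simp

definition bounded_derivs :: "(real \<Rightarrow> real) \<Rightarrow> bool" where
  "bounded_derivs f \<longleftrightarrow> smooth_on f UNIV \<and> (\<forall>n. \<exists>M. \<forall>x. \<bar>(deriv ^^ n) f x\<bar> \<le> M)"

lemma deriv_power_add:
  fixes f g :: "real \<Rightarrow> real"
  assumes "smooth_on f UNIV" "smooth_on g UNIV"
  shows "(deriv ^^ n) (\<lambda>t. f t + g t) = (\<lambda>t. (deriv ^^ n) f t + (deriv ^^ n) g t)"
proof -
  have "(deriv ^^ n) ((\<lambda>n t. (deriv ^^ n) f t + (deriv ^^ n) g t) 0) x = (deriv ^^ n) f x + (deriv ^^ n) g x" for x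
  proof (rule deriv_power_family[of UNIV])
    show "((\<lambda>t. (deriv ^^ n) f t + (deriv ^^ n) g t) has_real_derivative
        (deriv ^^ Suc n) f x + (deriv ^^ Suc n) g x) (at x)" for n x
      using DERIV_add[OF smooth_on_real_deriv(2)[OF smooth_on_deriv_power[OF assms(1), of n], of x]
          smooth_on_real_deriv(2)[OF smooth_on_deriv_power[OF assms(2), of n], of x]] by simp
  qed simp_all
  then show ?thesis by (auto simp: fun_eq_iff)
qed

lemma bounded_derivs_deriv:
  assumes "bounded_derivs f" shows "bounded_derivs (deriv f)"
  unfolding bounded_derivs_def
proof (intro conjI allI)
  show "smooth_on (deriv f) UNIV" using assms smooth_on_real_deriv(1) unfolding bounded_derivs_def by fast
  show "\<exists>M. \<forall>x. \<bar>(deriv ^^ n) (deriv f) x\<bar> \<le> M" for n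
    using assms unfolding bounded_derivs_def by (metis funpow_Suc_right o_apply)
qed

lemma bounded_derivs_mult:
  assumes "bounded_derivs f" "bounded_derivs g"
  shows "bounded_derivs (\<lambda>t. f t * g t)"
proof -
  have sm: "smooth_on f UNIV" if "bounded_derivs f" for f
    using that unfolding bounded_derivs_def by simp
  have "\<exists>M. \<forall>x. \<bar>(deriv ^^ n) (\<lambda>t. f t * g t) x\<bar> \<le> M" for n
    using assms
  proof (induction n arbitrary: f g)
    case 0
    obtain A where A: "\<And>x. \<bar>f x\<bar> \<le> A"
      using 0(1) unfolding bounded_derivs_def by (metis funpow_0)
    obtain B where B: "\<And>x. \<bar>g x\<bar> \<le> B"
      using 0(2) unfolding bounded_derivs_def by (metis funpow_0)
    have "\<bar>f x * g x\<bar> \<le> A * B" for x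
      unfolding abs_mult by (intro mult_mono A B) (use order_trans[OF abs_ge_zero A] in auto)
    then show ?case by auto
  next
    case (Suc n)
    note f' = bounded_derivs_deriv[OF Suc.prems(1)] and g' = bounded_derivs_deriv[OF Suc.prems(2)]
    obtain A where A: "\<And>x. \<bar>(deriv ^^ n) (\<lambda>t. deriv f t * g t) x\<bar> \<le> A"
      using Suc.IH[OF f' Suc.prems(2)] by blast
    obtain B where B: "\<And>x. \<bar>(deriv ^^ n) (\<lambda>t. f t * deriv g t) x\<bar> \<le> B"
      using Suc.IH[OF Suc.prems(1) g'] by blast
    have "deriv (\<lambda>t. f t * g t) = (\<lambda>x. deriv f x * g x + f x * deriv g x)"
      by (rule ext) (use DERIV_imp_deriv[OF DERIV_mult[OF smooth_on_real_deriv(2)[OF sm[OF Suc.prems(1)]]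
            smooth_on_real_deriv(2)[OF sm[OF Suc.prems(2)]]]] in simp)
    then have "(deriv ^^ Suc n) (\<lambda>t. f t * g t) = (deriv ^^ n) (\<lambda>t. deriv f t * g t + f t * deriv g t)"
      by (simp only: funpow_Suc_right o_apply)
    also have "\<dots> = (\<lambda>x. (deriv ^^ n) (\<lambda>t. deriv f t * g t) x + (deriv ^^ n) (\<lambda>t. f t * deriv g t) x)"
      by (rule deriv_power_add) (intro smooth_on_mult sm Suc.prems f' g')+
    finally have "\<bar>(deriv ^^ Suc n) (\<lambda>t. f t * g t) x\<bar> \<le> A + B" for x
      using A[of x] B[of x] by simp
    then show ?case by blast
  qed
  then show ?thesis unfolding bounded_derivs_def using smooth_on_mult[OF sm sm] assms by blast
qed

lemma bounded_derivs_sin_power: "bounded_derivs (\<lambda>t. sin t ^ n)"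
proof (induction n)
  case 0
  have "(deriv ^^ k) (\<lambda>t. 1) = (if k = 0 then (\<lambda>t. 1) else (\<lambda>t::real. 0::real))" for k
    by (induction k) auto
  then have "\<bar>(deriv ^^ k) (\<lambda>t. 1) x\<bar> \<le> (1::real)" for k and x :: real by simp
  then show ?case by (auto simp: bounded_derivs_def smooth_on_const)
next
  case (Suc n)
  define D where "D n x = sin (x + real n * (pi / 2))" for n and x :: real
  have "sin (x + real (Suc n) * (pi / 2)) = cos (x + real n * (pi / 2))" for n x
    using sin_add[of "x + real n * (pi / 2)" "pi / 2"] by (simp add: algebra_simps add_divide_distrib)
  then have "(D n has_real_derivative D (Suc n) x) (at x)" for n x
    unfolding D_def by (auto intro!: derivative_eq_intros)
  then have "(deriv ^^ n) (D 0) x = D n x" for n x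
    by (intro deriv_power_family[of UNIV]) auto
  moreover have "D 0 = sin" by (simp add: D_def fun_eq_iff)
  ultimately have "\<bar>(deriv ^^ n) sin x\<bar> \<le> 1" for n and x :: real by (simp add: D_def)
  then have "bounded_derivs sin" unfolding bounded_derivs_def using smooth_on_sin by blast
  then show ?case using bounded_derivs_mult[OF _ Suc] by simp
qed

text \<open>The summand is c / l^n * sin (l t)^n. Powers of sine replace cut-off functions: they
  start with t^n and all their derivatives are bounded on the line. A derivative of order j < n
  carries the factor l^j / l^n \<le> 1 / l, so a large l makes it small.\<close>

lemma borel_step:
  obtains F where "smooth_on F UNIV" "van n F" "tc F n = c"
    "\<And>j x. j < n \<Longrightarrow> \<bar>(deriv ^^ j) F x\<bar> \<le> (1 / 2) ^ n"
proof -
  define G where "G = (\<lambda>t::real. sin t ^ n)"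
  have G: "smooth_on G UNIV" "\<And>k. \<exists>M. \<forall>x. \<bar>(deriv ^^ k) G x\<bar> \<le> M"
    using bounded_derivs_sin_power[of n] unfolding bounded_derivs_def G_def by auto
  obtain M where M: "\<And>k x. \<bar>(deriv ^^ k) G x\<bar> \<le> M k" using G(2) by metis
  define L where "L = (\<Sum>k<n. M k)"
  have M0: "M k \<ge> 0" for k using order_trans[OF abs_ge_zero M] .
  have L: "\<bar>(deriv ^^ k) G x\<bar> \<le> L" if "k < n" for k x
    using M[of k x] member_le_sum[of k "{..<n}" M] that M0 unfolding L_def by force
  have L0: "L \<ge> 0" unfolding L_def by (intro sum_nonneg M0)
  define l where "l = 1 + \<bar>c\<bar> * L * 2 ^ n"
  have l: "l \<ge> 1" using L0 by (simp add: l_def)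
  define F where "F j t = c / l ^ n * (l ^ j * (deriv ^^ j) G (l * t))" for j t
  have derF: "(F j has_real_derivative F (Suc j) t) (at t)" for j t
  proof -
    have "((deriv ^^ j) G has_real_derivative (deriv ^^ Suc j) G (l * t)) (at (l * t))"
      using smooth_on_real_deriv(2)[OF smooth_on_deriv_power[OF G(1), of j], of "l * t"] by simp
    then have "((\<lambda>t. (deriv ^^ j) G (l * t)) has_real_derivative (deriv ^^ Suc j) G (l * t) * l) (at t)"
      by (rule DERIV_chain2) (auto intro!: derivative_eq_intros)
    from DERIV_cmult[OF DERIV_cmult[OF this, of "l ^ j"], of "c / l ^ n"] show ?thesis
      unfolding F_def by (simp add: mult_ac)
  qed
  have F: "(deriv ^^ j) (F 0) x = F j x" for j x
    by (rule deriv_power_family[of UNIV]) (simp_all add: derF)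
  have smF: "smooth_on (F 0) UNIV" by (rule smooth_on_real_family) (simp_all add: derF)
  have tcF: "tc (F 0) j = c / l ^ n * l ^ j * tc G j" for j
    by (simp add: tc_def F F_def)
  obtain s :: "real \<Rightarrow> real" where s: "smooth_germ s" "\<forall>\<^sub>F t in nhds 0. sin t = sin 0 + t * s t"
    using hadamard[OF smooth_germI[OF UNIV_I smooth_on_sin]] .
  have "s 0 = 1"
  proof -
    have "tc sin 1 = tc s 0" using tc_Suc[OF s] by simp
    moreover have "deriv sin 0 = (1::real)" using DERIV_imp_deriv[OF DERIV_sin[of "0::real"]] by simp
    ultimately show ?thesis by (simp add: tc_def)
  qed
  have ev: "\<forall>\<^sub>F t in nhds 0. G t = t ^ n * s t ^ n"
    using s(2) by eventually_elim (simp add: G_def power_mult_distrib)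
  have tcG: "tc G j = (if j < n then 0 else tc (\<lambda>t. s t ^ n) (j - n))" for j
    using tc_cong[OF ev] tc_shift[OF smooth_germ_power[OF s(1)]] by simp
  show thesis
  proof
    show "smooth_on (F 0) UNIV" by (rule smF)
    have "smooth_germ (F 0)" by (rule smooth_germI[OF _ smF]) simp
    then show "van n (F 0)" unfolding van_iff_tc by (simp add: tcF tcG)
    show "tc (F 0) n = c" using l \<open>s 0 = 1\<close> by (simp add: tcF tcG tc_0)
    show "\<bar>(deriv ^^ j) (F 0) x\<bar> \<le> (1 / 2) ^ n" if "j < n" for j x
    proof -
      have "l ^ j * l \<le> l ^ n" using power_increasing[of "Suc j" n l] that l by (simp add: mult.commute)
      then have "l ^ j / l ^ n \<le> 1 / l" using l by (simp add: field_simps)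
      then have "\<bar>c\<bar> * \<bar>(deriv ^^ j) G (l * x)\<bar> * (l ^ j / l ^ n) \<le> \<bar>c\<bar> * L * (1 / l)"
        using L[OF that] l L0 by (intro mult_mono mult_left_mono) auto
      also have "\<dots> \<le> (1 / 2) ^ n"
      proof -
        have "\<bar>c\<bar> * L * 2 ^ n \<le> l" unfolding l_def by simp
        then have "\<bar>c\<bar> * L \<le> l * (1 / 2) ^ n" by (simp add: power_one_over field_simps)
        then show ?thesis using l by (simp add: field_simps)
      qed
      finally show ?thesis unfolding F F_def using l by (simp add: abs_mult mult_ac)
    qed
  qed
qed

lemma borel:
  fixes a :: "nat \<Rightarrow> real"
  obtains f where "smooth_germ f" "\<And>n. tc f n = a n"
proof -
  define good where "good F n c \<longleftrightarrow> smooth_on F UNIV \<and> van n F \<and> tc F n = c \<and>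
    (\<forall>j<n. \<forall>x. \<bar>(deriv ^^ j) F x\<bar> \<le> (1 / 2) ^ n)" for F n and c :: real
  have "\<exists>F. good F n c" for n c
    by (rule borel_step[of n c]) (auto simp: good_def)
  then obtain Fc where Fc: "\<And>n c. good (Fc n c) n c" by metis
  \<comment> \<open>The powers of sine have higher Taylor terms as well, so the n-th summand
    supplies only what the previous partial sum lacks in degree n.\<close>
  define S where "S = rec_nat (\<lambda>t. 0) (\<lambda>n s t. s t + Fc n (a n - tc s n) t)"
  define F where "F n = Fc n (a n - tc (S n) n)" for n
  have S_0: "S 0 = (\<lambda>t. 0)" and S_Suc: "S (Suc n) = (\<lambda>t. S n t + F n t)" for n
    by (simp_all add: S_def F_def)
  have smF: "smooth_on (F n) UNIV" and vF: "van n (F n)" and tF: "tc (F n) n = a n - tc (S n) n"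
    and bF: "j < n \<Longrightarrow> \<bar>(deriv ^^ j) (F n) x\<bar> \<le> (1 / 2) ^ n" for n j x
    using Fc[of n "a n - tc (S n) n"] unfolding good_def F_def by auto
  have smS: "smooth_germ (S n)" for n
    by (induction n) (simp_all add: S_0 S_Suc smooth_germ_const smooth_germ_add van_smooth[OF vF])
  have S_sum: "tc (S n) k = (\<Sum>i<n. tc (F i) k)" for n k
    by (induction n) (simp_all add: S_0 S_Suc tc_zero tc_add smS van_smooth[OF vF])
  define f where "f j x = (\<Sum>n. (deriv ^^ j) (F n) x)" for j x
  \<comment> \<open>For a fixed order j the geometric bound holds for the summands with n > j, which
    is enough for comparison.\<close>
  have sumb: "summable (\<lambda>n. (deriv ^^ j) (F n) x)" for j x
  proof (rule summable_comparison_test_ev)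
    show "\<forall>\<^sub>F n in sequentially. norm ((deriv ^^ j) (F n) x) \<le> (1 / 2) ^ n"
      using eventually_gt_at_top[of j] by eventually_elim (simp add: bF)
  qed (simp add: summable_geometric)
  have derf: "(f j has_real_derivative f (Suc j) x) (at x)" for j x
    unfolding f_def
  proof (rule has_field_derivative_series'(2)[where S=UNIV and ?x0.0=0])
    show "((deriv ^^ j) (F n) has_real_derivative (deriv ^^ Suc j) (F n) x) (at x within UNIV)" for n x
      using smooth_on_real_deriv(2)[OF smooth_on_deriv_power[OF smF, of j]] by simp
    show "uniformly_convergent_on UNIV (\<lambda>n x. \<Sum>i<n. (deriv ^^ Suc j) (F i) x)"
    proof (rule Weierstrass_m_test'_ev)
      show "\<forall>\<^sub>F n in sequentially. \<forall>x\<in>UNIV. norm ((deriv ^^ Suc j) (F n) x) \<le> (1 / 2) ^ n"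
        using eventually_gt_at_top[of "Suc j"] by eventually_elim (metis bF real_norm_def)
    qed (simp add: summable_geometric)
  qed (use sumb in auto)
  have sm: "smooth_on (f 0) UNIV" by (rule smooth_on_real_family) (simp_all add: derf)
  have "tc (f 0) k = a k" for k
  proof -
    have "(deriv ^^ k) (f 0) 0 = f k 0" by (rule deriv_power_family[of UNIV]) (simp_all add: derf)
    also have "\<dots> = (\<Sum>n<Suc k. (deriv ^^ k) (F n) 0)"
      unfolding f_def
    proof (rule suminf_finite)
      show "(deriv ^^ k) (F n) 0 = 0" if "n \<notin> {..<Suc k}" for n
        using van_tc[OF vF, of k n] that by (simp add: tc_def)
    qed simp
    finally have "tc (f 0) k = (\<Sum>n<Suc k. tc (F n) k)" by (simp add: tc_def sum_divide_distrib add_divide_distrib)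
    also have "\<dots> = tc (S k) k + tc (F k) k" by (simp add: S_sum)
    finally show ?thesis by (simp add: tF)
  qed
  then show thesis by (rule that[OF smooth_germI[OF UNIV_I sm]])
qed

section \<open>Flat germs as functions of a power\<close>

definition flat :: "(real \<Rightarrow> real) \<Rightarrow> bool" where
  "flat f \<longleftrightarrow> (\<forall>n. van n f)"

lemma flat_smooth: "flat f \<Longrightarrow> smooth_germ f"
  unfolding flat_def using van_smooth by blast

lemma flat_tc: "flat f \<longleftrightarrow> smooth_germ f \<and> (\<forall>n. tc f n = 0)"
  unfolding flat_def van_iff_tc by auto

lemma flat_divide:
  assumes "flat f" obtains g where "flat g" "\<forall>\<^sub>F t in nhds 0. f t = t ^ k * g t"
proof -
  obtain g where g: "smooth_germ g" "\<forall>\<^sub>F t in nhds 0. f t = t ^ k * g t"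
    using vanE[of k f] assms unfolding flat_def by blast
  have "tc g n = tc f (k + n)" for n using tc_cong[OF g(2)] tc_shift[OF g(1)] by simp
  then have "flat g" using g(1) assms unfolding flat_tc by simp
  then show thesis using g(2) that by blast
qed

text \<open>Composition with the m-th root remains smooth at 0 because each derivative divides by m
  t^(m-1), and flatness pays for every such division. The extension by 0 to r \<le> 0 fits for the
  same reason.\<close>

lemma flat_root:
  assumes "flat f" "m \<ge> 1"
  obtains Q where "flat Q" "\<forall>\<^sub>F t in nhds 0. Q (t ^ m) = (if t ^ m > 0 then f \<bar>t\<bar> else 0)"
proof -
  obtain S where S: "0 \<in> S" "smooth_on f S" using smooth_germE[OF flat_smooth[OF assms(1)]] .
  obtain \<epsilon> where \<epsilon>: "\<epsilon> > 0" "ball 0 \<epsilon> \<subseteq> S"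
    using S(1) smooth_onD(1)[OF S(2)] open_contains_ball by blast
  define I where "I = {0<..<\<epsilon>}"
  have "I \<subseteq> S" using \<epsilon>(2) by (auto simp: I_def ball_def)
  then have f: "smooth_on f I" by (intro smooth_on_subset[OF S(2)]) (simp_all add: I_def)
  \<comment> \<open>The operator h \<mapsto> h' / (m t^(m-1)) is d/dr for r = t^m, written in the
    variable t; so \<open>F n\<close> is the n-th derivative with respect to r.\<close>
  define F where "F n = ((\<lambda>h t. deriv h t * inverse (real m * t ^ (m - 1))) ^^ n) f" for n
  have F_Suc: "F (Suc n) t = deriv (F n) t * inverse (real m * t ^ (m - 1))" for n t
    by (simp add: F_def)
  have unit: "smooth_on (\<lambda>t. inverse (real m * t ^ (m - 1))) I"
  proof (rule smooth_on_compose[OF _ smooth_on_inverse])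
    show "smooth_on (\<lambda>t. real m * t ^ (m - 1)) I"
      by (intro smooth_on_mult smooth_on_power smooth_on_const smooth_on_linear bounded_linear_ident)
         (simp_all add: I_def)
  qed (use assms(2) in \<open>auto simp: I_def\<close>)
  have smF: "smooth_on (F n) I" for n
  proof (induction n)
    case (Suc n)
    have "smooth_on (\<lambda>t. deriv (F n) t * inverse (real m * t ^ (m - 1))) I"
      by (intro smooth_on_mult unit smooth_on_real_deriv(1)[OF Suc])
    then show ?case by (simp add: F_Suc[abs_def])
  qed (simp add: F_def f)
  have flF: "\<exists>g \<eta>. flat g \<and> \<eta> > 0 \<and> \<eta> \<le> \<epsilon> \<and> (\<forall>t\<in>{0<..<\<eta>}. F n t = g t)" for n
  proof (induction n)
    case 0
    show ?case using assms(1) \<epsilon>(1) by (intro exI[of _ f] exI[of _ \<epsilon>]) (simp add: F_def)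
  next
    case (Suc n)
    then obtain g \<eta> where g: "flat g" "\<eta> > 0" "\<eta> \<le> \<epsilon>" "\<And>t. t \<in> {0<..<\<eta>} \<Longrightarrow> F n t = g t" by blast
    have "flat (deriv g)" unfolding flat_def using g(1) van_deriv unfolding flat_def by blast
    from flat_divide[OF this]
    obtain k where k: "flat k" "\<forall>\<^sub>F t in nhds 0. deriv g t = t ^ (m - 1) * k t" .
    obtain \<eta>' where \<eta>': "\<eta>' > 0" "\<And>t. \<bar>t\<bar> < \<eta>' \<Longrightarrow> deriv g t = t ^ (m - 1) * k t"
      using k(2) unfolding eventually_nhds_metric by (auto simp: dist_real_def)
    have "F (Suc n) t = inverse (real m) * k t" if "t \<in> {0<..<min \<eta> \<eta>'}" for t
    proof -
      have "\<forall>\<^sub>F y in nhds t. F n y = g y"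
        unfolding eventually_nhds using g(4) that by (intro exI[of _ "{0<..<\<eta>}"]) auto
      then have "deriv (F n) t = deriv g t" by (rule deriv_cong_ev) simp
      then show ?thesis using that \<eta>'(2)[of t] by (simp add: F_Suc)
    qed
    moreover have "flat (\<lambda>t. inverse (real m) * k t)"
      using k(1) unfolding flat_def by (auto intro: van_cmult)
    ultimately show ?case
      using g(2,3) \<eta>'(1) by (intro exI[of _ "\<lambda>t. inverse (real m) * k t"] exI[of _ "min \<eta> \<eta>'"]) auto
  qed
  define Q where "Q n r = (if r > 0 then F n (root m r) else 0)" for n r
  define V where "V = {..<\<epsilon> ^ m}"
  have m: "m > 0" using assms(2) by simp
  have root_I: "root m r \<in> I" if "0 < r" "r < \<epsilon> ^ m" for r
  proof -
    have "root m r < root m (\<epsilon> ^ m)" using that(2) m by simp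
    then show ?thesis using that m \<epsilon>(1) by (simp add: I_def real_root_power_cancel)
  qed
  have "(Q n has_real_derivative Q (Suc n) r) (at r)" if "r \<in> V" for n r
  proof -
    consider "r > 0" | "r < 0" | "r = 0" by linarith
    then show ?thesis
    proof cases
      case 1
      have "(F n has_real_derivative deriv (F n) (root m r)) (at (root m r))"
        using smooth_on_real_deriv(2)[OF smF root_I] 1 that by (simp add: V_def)
      from DERIV_chain2[OF this DERIV_real_root[OF m 1]]
      have "((\<lambda>r. F n (root m r)) has_real_derivative Q (Suc n) r) (at r)"
        using 1 by (simp add: Q_def F_Suc)
      moreover have "\<forall>\<^sub>F y in nhds r. F n (root m y) = Q n y"
        unfolding eventually_nhds using 1 by (intro exI[of _ "{0<..}"]) (auto simp: Q_def)
      ultimately show ?thesis using DERIV_cong_ev[of r r "\<lambda>r. F n (root m r)" "Q n"] by simp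
    next
      case 2
      have "((\<lambda>r. 0) has_real_derivative Q (Suc n) r) (at r)" using 2 by (simp add: Q_def)
      moreover have "\<forall>\<^sub>F y in nhds r. 0 = Q n y"
        unfolding eventually_nhds using 2 by (intro exI[of _ "{..<0}"]) (auto simp: Q_def)
      ultimately show ?thesis using DERIV_cong_ev[of r r "\<lambda>r. 0" "Q n"] by simp
    next
      case 3
      obtain g \<eta> where g: "flat g" "\<eta> > 0" "\<And>t. t \<in> {0<..<\<eta>} \<Longrightarrow> F n t = g t" using flF[of n] by blast
      \<comment> \<open>Splitting off t^(2m) bounds \<open>Q n\<close> by a multiple of r^2, so that
        its difference quotient at 0 tends to 0.\<close>
      obtain k where k: "flat k" "\<forall>\<^sub>F t in nhds 0. g t = t ^ (2 * m) * k t"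
        using flat_divide[OF g(1)] .
      have "\<forall>\<^sub>F t in nhds 0. dist (k t) (k 0) < 1"
        using smooth_germ_tendsto[OF flat_smooth[OF k(1)]] zero_less_one unfolding tendsto_iff by blast
      then have "\<forall>\<^sub>F t in nhds 0. \<bar>g t\<bar> \<le> (\<bar>k 0\<bar> + 1) * t ^ (2 * m)"
        using k(2)
      proof eventually_elim
        case (elim t)
        have "\<bar>k t\<bar> \<le> \<bar>k 0\<bar> + 1" using elim(1) by (simp add: dist_real_def)
        then have "\<bar>k t\<bar> * t ^ (2 * m) \<le> (\<bar>k 0\<bar> + 1) * t ^ (2 * m)" by (rule mult_right_mono) simp
        moreover have "\<bar>g t\<bar> = \<bar>k t\<bar> * t ^ (2 * m)"
          unfolding elim(2) abs_mult by (subst abs_of_nonneg) simp_all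
        ultimately show ?case by simp
      qed
      then obtain \<eta>' where \<eta>': "\<eta>' > 0" "\<And>t. \<bar>t\<bar> < \<eta>' \<Longrightarrow> \<bar>g t\<bar> \<le> (\<bar>k 0\<bar> + 1) * t ^ (2 * m)"
        unfolding eventually_nhds_metric by (auto simp: dist_real_def)
      define \<zeta> where "\<zeta> = min \<eta> \<eta>'"
      have \<zeta>: "\<zeta> > 0" using g(2) \<eta>'(1) by (simp add: \<zeta>_def)
      have bound: "\<bar>Q n r\<bar> \<le> (\<bar>k 0\<bar> + 1) * r ^ 2" if "r < \<zeta> ^ m" for r
      proof (cases "r > 0")
        case True
        have "root m r < root m (\<zeta> ^ m)" using that m by simp
        then have "0 < root m r" "root m r < \<zeta>" using True m \<zeta> by (simp_all add: real_root_power_cancel)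
        then have "\<bar>F n (root m r)\<bar> \<le> (\<bar>k 0\<bar> + 1) * root m r ^ (2 * m)"
          using g(3)[of "root m r"] \<eta>'(2)[of "root m r"] by (simp add: \<zeta>_def)
        also have "root m r ^ (2 * m) = r ^ 2"
          using True m by (simp add: power_mult power_mult[of _ m 2, symmetric] mult.commute[of 2] power_mult)
        finally show ?thesis using True by (simp add: Q_def)
      qed (simp add: Q_def)
      have "((\<lambda>h. Q n h / h) \<longlongrightarrow> 0) (at 0)"
      proof (rule Lim_null_comparison)
        have "\<forall>\<^sub>F h in at 0. h < \<zeta> ^ m"
          using \<zeta> by (intro order_tendstoD(2)[OF tendsto_ident_at]) simp
        then show "\<forall>\<^sub>F h in at 0. norm (Q n h / h) \<le> (\<bar>k 0\<bar> + 1) * \<bar>h\<bar>"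
          using eventually_neq_at_within[of 0 0 UNIV]
        proof eventually_elim
          case (elim h)
          have "\<bar>Q n h\<bar> / \<bar>h\<bar> \<le> (\<bar>k 0\<bar> + 1) * h ^ 2 / \<bar>h\<bar>"
            by (intro divide_right_mono bound elim) simp
          also have "\<dots> = (\<bar>k 0\<bar> + 1) * \<bar>h\<bar>" using elim(2) by (simp add: power2_eq_square abs_if)
          finally show ?case by simp
        qed
        show "((\<lambda>h. (\<bar>k 0\<bar> + 1) * \<bar>h\<bar>) \<longlongrightarrow> 0) (at 0)"
          by (auto intro!: tendsto_eq_intros)
      qed
      then show ?thesis using 3 by (simp add: DERIV_def Q_def)
    qed
  qed
  note derQ = this
  have V: "open V" "0 \<in> V" using \<epsilon> by (simp_all add: V_def)
  have smQ: "smooth_germ (Q 0)"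
    by (rule smooth_germI[OF V(2)]) (rule smooth_on_real_family[of V Q 0, OF V(1) derQ])
  have "tc (Q 0) n = 0" for n
    using deriv_power_family[of V Q 0 n, OF V(1) derQ V(2)] by (simp add: tc_def Q_def)
  then have "flat (Q 0)" using smQ by (simp add: flat_tc)
  moreover have "Q 0 (t ^ m) = (if t ^ m > 0 then f \<bar>t\<bar> else 0)" for t
  proof (cases "t ^ m > 0")
    case True
    then have "root m (t ^ m) = \<bar>t\<bar>"
      using m real_root_power_cancel[OF m, of "\<bar>t\<bar>"] by (simp flip: power_abs)
    then show ?thesis using True by (simp add: Q_def F_def)
  qed (simp add: Q_def)
  ultimately show thesis using that by simp
qed

lemma flat_add: "flat f \<Longrightarrow> flat g \<Longrightarrow> flat (\<lambda>t. f t + g t)"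
  by (auto simp: flat_def intro: van_add)

lemma flat_cmult: "flat f \<Longrightarrow> flat (\<lambda>t. c * f t)"
  by (auto simp: flat_def intro: van_cmult)

lemma flat_reflect:
  assumes "flat f" shows "flat (\<lambda>t. f (- t))"
  unfolding flat_def
proof
  fix n
  have "van n f" using assms by (simp add: flat_def)
  from van_compose[OF this smooth_germ_minus[OF smooth_germ_ident]] show "van n (\<lambda>t. f (- t))" by simp
qed

text \<open>For even m the power t^m forgets the sign of t, so the even and the odd part of f need
  one coefficient each. For odd m the sign is kept; treating the two half-lines separately already
  exhibits f as a function of t^m.\<close>

lemma flat_decomposition:
  assumes "flat f" "m \<ge> 1"
  obtains P Q where "flat P" "flat Q" "\<forall>\<^sub>F t in nhds 0. f t = P (t ^ m) + t * Q (t ^ m)"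
proof (cases "even m")
  case True
  define fe where "fe t = (1 / 2) * (f t + f (- t))" for t
  define fo where "fo t = (1 / 2) * (f t + (- 1) * f (- t))" for t
  have fe: "flat fe" unfolding fe_def[abs_def] by (intro flat_cmult flat_add flat_reflect assms)
  have fo: "flat fo" unfolding fo_def[abs_def] by (intro flat_cmult flat_add flat_reflect assms)
  obtain g where g: "flat g" "\<forall>\<^sub>F t in nhds 0. fo t = t ^ 1 * g t" using flat_divide[OF fo] .
  obtain P where P: "flat P" "\<forall>\<^sub>F t in nhds 0. P (t ^ m) = (if t ^ m > 0 then fe \<bar>t\<bar> else 0)"
    using flat_root[OF fe assms(2)] .
  obtain Q where Q: "flat Q" "\<forall>\<^sub>F t in nhds 0. Q (t ^ m) = (if t ^ m > 0 then g \<bar>t\<bar> else 0)"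
    using flat_root[OF g(1) assms(2)] .
  have g': "\<forall>\<^sub>F t in nhds 0. fo (- t) = - t * g (- t)"
    using eventually_compose_germ[OF g(2) smooth_germ_minus[OF smooth_germ_ident]] by simp
  have f0: "f 0 = 0" using assms(1) van_1D[of 0 f] by (auto simp: flat_def)
  show thesis
  proof (rule that[OF P(1) Q(1)])
    show "\<forall>\<^sub>F t in nhds 0. f t = P (t ^ m) + t * Q (t ^ m)"
      using P(2) Q(2) g(2) g'
    proof eventually_elim
      case (elim t)
      show ?case
      proof (cases "t = 0")
        case False
        then have pos: "t ^ m > 0" using True by (simp add: zero_less_power_eq)
        have "fe \<bar>t\<bar> = fe t" by (simp add: fe_def abs_if)
        moreover have "t * g \<bar>t\<bar> = fo t"
        proof (cases "t > 0")
          case False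
          then have "g (- t) * (- t) = fo (- t)" using elim(4) by simp
          moreover have "fo (- t) = - fo t" by (simp add: fo_def field_simps)
          ultimately show ?thesis using False by (simp add: mult.commute)
        qed (use elim(3) in simp)
        moreover have "f t = fe t + fo t" by (simp add: fe_def fo_def field_simps)
        ultimately show ?thesis using elim(1,2) pos by simp
      qed (use elim(1) f0 assms(2) in \<open>simp add: zero_power\<close>)
    qed
  qed
next
  case False
  obtain P where P: "flat P" "\<forall>\<^sub>F t in nhds 0. P (t ^ m) = (if t ^ m > 0 then f \<bar>t\<bar> else 0)"
    using flat_root[OF assms] .
  obtain Q where Q: "flat Q" "\<forall>\<^sub>F t in nhds 0. Q (t ^ m) = (if t ^ m > 0 then f (- \<bar>t\<bar>) else 0)"
    using flat_root[OF flat_reflect[OF assms(1)] assms(2)] .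
  have Q': "\<forall>\<^sub>F t in nhds 0. Q ((- t) ^ m) = (if (- t) ^ m > 0 then f (- \<bar>- t\<bar>) else 0)"
    using eventually_compose_germ[OF Q(2) smooth_germ_minus[OF smooth_germ_ident]] by simp
  have f0: "f 0 = 0" using assms(1) van_1D[of 0 f] by (auto simp: flat_def)
  show thesis
  proof (rule that[OF flat_add[OF P(1) flat_reflect[OF Q(1)]]])
    show "flat (\<lambda>t. 0)" by (simp add: flat_def van_zero)
    show "\<forall>\<^sub>F t in nhds 0. f t = P (t ^ m) + Q (- (t ^ m)) + t * 0"
      using P(2) Q'
    proof eventually_elim
      case (elim t)
      have "(- t) ^ m = - (t ^ m)" using False by simp
      moreover have "t ^ m > 0 \<longleftrightarrow> t > 0" using False by (auto simp: zero_less_power_eq)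
      moreover have "t ^ m < 0 \<longleftrightarrow> t < 0" using False by (auto simp: power_less_zero_eq)
      ultimately show ?case using elim f0 assms(2)
        by (cases t "0::real" rule: linorder_cases) (auto simp: power_0_left)
    qed
  qed
qed

lemma tc_compose_power:
  assumes "smooth_germ a" "m \<ge> 1"
  shows "tc (\<lambda>t. a (t ^ m)) n = (if m dvd n then tc a (n div m) else 0)"
proof -
  let ?N = "Suc n"
  have "van ?N (\<lambda>t. a (t ^ m) - (\<Sum>i<?N. tc a i * (t ^ m) ^ i))"
    by (rule van_compose[OF taylor[OF assms(1)], of "\<lambda>t. t ^ m"])
       (use assms(2) in \<open>auto intro: smooth_germ_intros simp: power_0_left\<close>)
  then have "tc (\<lambda>t. a (t ^ m)) n = tc (\<lambda>t. \<Sum>i<?N. tc a i * (t ^ m) ^ i) n"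
    by (rule tc_eq)
       (use assms in \<open>auto intro!: smooth_germ_intros smooth_germ_compose[where f="\<lambda>t. t ^ m"] simp: power_0_left\<close>)
  also have "\<dots> = (\<Sum>i<?N. if n = m * i then tc a i else 0)"
    by (simp only: tc_sum smooth_germ_intros power_mult[symmetric] tc_monom)
  also have "\<dots> = (if m dvd n then tc a (n div m) else 0)"
  proof (cases "m dvd n")
    case True
    then obtain k where k: "n = m * k" by blast
    then have kN: "k < ?N" using assms(2) by (cases m) auto
    have "(n = m * i) = (i = k)" for i using k assms(2) by auto
    then have "(\<Sum>i<?N. if n = m * i then tc a i else 0) = (\<Sum>i<?N. if i = k then tc a i else 0)"
      by (simp only:)
    also have "\<dots> = tc a k" using kN by simp
    finally show ?thesis using True k assms(2) by simp
  next
    case False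
    then have "n \<noteq> m * i" for i by auto
    then show ?thesis using False by simp
  qed
  finally show ?thesis .
qed

text \<open>Borel's lemma realizes the Taylor series belonging to each residue class of degrees
  modulo m. The remainder is flat and goes into the coefficients with index 0 and 1, whence m \<ge>
  2.\<close>

lemma decomposition:
  assumes "smooth_germ f" "m \<ge> 2"
  obtains a where "\<forall>i. smooth_germ (a i)" "\<forall>i j. tc (a i) j = tc f (i + m * j)"
    "\<forall>\<^sub>F t in nhds 0. f t = (\<Sum>i<m. t ^ i * a i (t ^ m))"
proof -
  have "\<exists>b. smooth_germ b \<and> (\<forall>j. tc b j = tc f (i + m * j))" for i
    by (rule borel[of "\<lambda>j. tc f (i + m * j)"]) blast
  then obtain b where b: "\<And>i. smooth_germ (b i)" "\<And>i j. tc (b i) j = tc f (i + m * j)" by metis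
  have m: "m \<ge> 1" using assms(2) by simp
  have sm: "smooth_germ (\<lambda>t. b i (t ^ m))" for i
    by (rule smooth_germ_compose[OF _ b(1)]) (use m in \<open>auto intro: smooth_germ_intros\<close>)
  let ?s = "\<lambda>t. \<Sum>i<m. t ^ i * b i (t ^ m)"
  have sms: "smooth_germ ?s" by (intro smooth_germ_intros sm)
  have "tc (\<lambda>t. f t - ?s t) n = 0" for n
  proof -
    have "tc ?s n = (\<Sum>i<m. if n < i then 0 else tc (\<lambda>t. b i (t ^ m)) (n - i))"
      by (subst tc_sum) (auto intro!: smooth_germ_intros sm simp: tc_shift[OF sm])
    also have "\<dots> = (\<Sum>i<m. if i = n mod m then tc f n else 0)"
    proof (rule sum.cong[OF refl])
      fix i assume i: "i \<in> {..<m}"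
      have "(\<not> n < i \<and> m dvd n - i) \<longleftrightarrow> i = n mod m"
      proof
        assume "\<not> n < i \<and> m dvd n - i"
        then show "i = n mod m" using i by (metis lessThan_iff linorder_not_less mod_less mod_eq_dvd_iff_nat)
      next
        assume "i = n mod m"
        then show "\<not> n < i \<and> m dvd n - i" using m by (simp add: dvd_minus_mod linorder_not_less)
      qed
      moreover have "i + m * ((n - i) div m) = n" if "i = n mod m"
        using that by (simp add: minus_mod_eq_mult_div)
      ultimately show "(if n < i then 0 else tc (\<lambda>t. b i (t ^ m)) (n - i)) = (if i = n mod m then tc f n else 0)"
        by (auto simp: tc_compose_power[OF b(1) m] b(2))
    qed
    also have "\<dots> = tc f n" using assms(2) by simp
    finally show ?thesis by (simp add: tc_diff[OF assms(1) sms])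
  qed
  then have fl: "flat (\<lambda>t. f t - ?s t)" using assms(1) sms by (simp add: flat_tc smooth_germ_diff)
  obtain P Q where PQ: "flat P" "flat Q"
    "\<forall>\<^sub>F t in nhds 0. f t - ?s t = P (t ^ m) + t * Q (t ^ m)" using flat_decomposition[OF fl m] .
  define a where "a i r = b i r + ((if i = 0 then 1 else 0) * P r + (if i = 1 then 1 else 0) * Q r)" for i r
  have fl: "flat (\<lambda>r. (if i = 0 then 1 else 0) * P r + (if i = 1 then 1 else 0) * Q r)" for i :: nat
    by (intro flat_add flat_cmult PQ)
  show thesis
  proof
    show "\<forall>i. smooth_germ (a i)"
      unfolding a_def[abs_def] by (intro allI smooth_germ_add b flat_smooth[OF fl])
    show "\<forall>i j. tc (a i) j = tc f (i + m * j)"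
    proof (intro allI)
      show "tc (a i) j = tc f (i + m * j)" for i j
        using fl[of i] unfolding a_def[abs_def] by (simp add: tc_add b flat_tc)
    qed
    show "\<forall>\<^sub>F t in nhds 0. f t = (\<Sum>i<m. t ^ i * a i (t ^ m))"
      using PQ(3)
    proof eventually_elim
      case (elim t)
      have "(\<Sum>i<m. t ^ i * a i (t ^ m)) = ?s t + (\<Sum>i<m. (if i = 0 then P (t ^ m) else 0) + (if i = 1 then t * Q (t ^ m) else 0))"
        by (subst sum.distrib[symmetric], rule sum.cong) (auto simp: a_def algebra_simps)
      also have "\<dots> = ?s t + (P (t ^ m) + t * Q (t ^ m))"
        using assms(2) by (simp add: sum.distrib)
      finally show ?case using elim by simp
    qed
  qed
qed

subsection \<open>Diffeomorphism germs\<close>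

lemma frechet_plane:
  fixes F :: "real \<times> real \<Rightarrow> real"
  assumes "(F has_derivative F') (at x)"
  shows "F' v = F' (1, 0) * fst v + F' (0, 1) * snd v"
proof -
  have l: "linear F'" using assms has_derivative_linear by blast
  have "v = fst v *\<^sub>R (1, 0) + snd v *\<^sub>R (0, 1)" by (simp add: prod_eq_iff)
  then have "F' v = F' (fst v *\<^sub>R (1, 0) + snd v *\<^sub>R (0, 1))" by simp
  also have "\<dots> = fst v * F' (1, 0) + snd v * F' (0, 1)"
    by (simp only: linear_add[OF l] linear_scale[OF l] real_scaleR_def)
  finally show ?thesis by (simp add: mult.commute)
qed

text \<open>The inverse function theorem yields a differentiable inverse g only. Its derivative at y
  is the inverse matrix at g y, which Cramer's rule expresses by the partial derivatives and 1 / J.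
  So if g is of class C^n, its derivative is too, and g is of class C^(n+1).\<close>

lemma diffeo_germ_plane:
  fixes F G :: "real \<times> real \<Rightarrow> real"
  assumes "smooth_germ F" "smooth_germ G" "F 0 = 0" "G 0 = 0"
    and "(F has_derivative F') (at 0)" "(G has_derivative G') (at 0)"
    and "F' (1, 0) * G' (0, 1) - F' (0, 1) * G' (1, 0) \<noteq> 0"
  shows "diffeo_germ (\<lambda>p. (F p, G p))"
proof -
  obtain S where S: "0 \<in> S" "smooth_on F S" "smooth_on G S" using smooth_germ_on2[OF assms(1,2)] .
  have oS: "open S" by (rule smooth_onD(1)[OF S(2)])
  define a where "a x = frechet_derivative F (at x) (1, 0)" for x
  define b where "b x = frechet_derivative F (at x) (0, 1)" for x
  define c where "c x = frechet_derivative G (at x) (1, 0)" for x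
  define d where "d x = frechet_derivative G (at x) (0, 1)" for x
  have DF: "(F has_derivative (\<lambda>v. a x * fst v + b x * snd v)) (at x)" if "x \<in> S" for x
  proof -
    note d = Ck_on_Suc_has_derivative[OF smooth_onD(2)[OF S(2)] that]
    have "frechet_derivative F (at x) = (\<lambda>v. a x * fst v + b x * snd v)"
      unfolding a_def b_def by (rule ext) (rule frechet_plane[OF d])
    then show ?thesis using d by simp
  qed
  have DG: "(G has_derivative (\<lambda>v. c x * fst v + d x * snd v)) (at x)" if "x \<in> S" for x
  proof -
    note d = Ck_on_Suc_has_derivative[OF smooth_onD(2)[OF S(3)] that]
    have "frechet_derivative G (at x) = (\<lambda>v. c x * fst v + d x * snd v)"
      unfolding c_def d_def by (rule ext) (rule frechet_plane[OF d])
    then show ?thesis using d by simp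
  qed
  have Ck: "Ck_on n a S" "Ck_on n b S" "Ck_on n c S" "Ck_on n d S" for n
    unfolding a_def[abs_def] b_def[abs_def] c_def[abs_def] d_def[abs_def]
    by (rule Ck_on_Suc_frechet[OF smooth_onD(2)[OF S(2)]] Ck_on_Suc_frechet[OF smooth_onD(2)[OF S(3)]])+
  define J where "J x = a x * d x - b x * c x" for x
  have J0: "J 0 \<noteq> 0"
  proof -
    have "F' = (\<lambda>v. a 0 * fst v + b 0 * snd v)" "G' = (\<lambda>v. c 0 * fst v + d 0 * snd v)"
      by (rule has_derivative_unique[OF assms(5) DF[OF S(1)]] has_derivative_unique[OF assms(6) DG[OF S(1)]])+
    then show ?thesis using assms(7) by (simp add: J_def)
  qed
  define \<psi> where "\<psi> p = (F p, G p)" for p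
  define L where "L a b c d = Blinfun (\<lambda>v::real \<times> real. (a * fst v + b * snd v, c * fst v + d * snd v))"
    for a b c d :: real
  have L: "blinfun_apply (L a b c d) = (\<lambda>v. (a * fst v + b * snd v, c * fst v + d * snd v))" for a b c d
    unfolding L_def
    by (intro bounded_linear_Blinfun_apply bounded_linear_Pair bounded_linear_add bounded_linear_const_mult
        bounded_linear_fst bounded_linear_snd)
  have L_eq: "L a b c d = a *\<^sub>R L 1 0 0 0 + b *\<^sub>R L 0 1 0 0 + c *\<^sub>R L 0 0 1 0 + d *\<^sub>R L 0 0 0 1" for a b c d
    by (rule blinfun_eqI) (simp add: L blinfun.add_left blinfun.scaleR_left)
  define D where "D x = L (a x) (b x) (c x) (d x)" for x
  have der: "(\<psi> has_derivative blinfun_apply (D x)) (at x)" if "x \<in> S" for x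
    unfolding D_def L \<psi>_def by (intro has_derivative_Pair DF DG that)
  have cont: "continuous_on S D"
    unfolding D_def using Ck[of 0] by (subst L_eq, intro continuous_intros) simp_all
  define K where "K x = L (d x / J x) (- b x / J x) (- c x / J x) (a x / J x)" for x
  have KD: "blinfun_apply (K x) (blinfun_apply (D x) v) = v" "blinfun_apply (D x) (blinfun_apply (K x) v) = v"
    if "J x \<noteq> 0" for x v
  proof -
    have "a x * d x = J x + b x * c x" by (simp add: J_def)
    then have *: "(d x * (a x * u + b x * w) - b x * (c x * u + d x * w)) = J x * u"
      "(a x * (c x * u + d x * w) - c x * (a x * u + b x * w)) = J x * w"
      "a x * (d x * u - b x * w) + b x * (a x * w - c x * u) = J x * u"
      "c x * (d x * u - b x * w) + d x * (a x * w - c x * u) = J x * w" for u w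
      by (simp_all add: J_def algebra_simps)
    have e1: "p / J x * u + - q / J x * w = (p * u - q * w) / J x" for p q u w
      by (simp add: diff_divide_distrib)
    have e2: "- q / J x * w + p / J x * u = (p * u - q * w) / J x" for p q u w
      by (simp add: diff_divide_distrib)
    have e3: "p * (u / J x) + q * (w / J x) = (p * u + q * w) / J x" for p q u w
      by (simp add: add_divide_distrib)
    show "blinfun_apply (K x) (blinfun_apply (D x) v) = v"
      using that by (simp only: K_def D_def L fst_conv snd_conv e1 e2 * prod_eq_iff) simp
    show "blinfun_apply (D x) (blinfun_apply (K x) v) = v"
      using that by (simp only: K_def D_def L fst_conv snd_conv e1 e2 e3 * prod_eq_iff) simp
  qed
  have inv: "K 0 o\<^sub>L D 0 = id_blinfun"
    by (rule blinfun_eqI) (simp add: KD J0)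
  obtain U V g g' where g: "open U" "U \<subseteq> S" "0 \<in> U" "open V" "\<psi> 0 \<in> V" "homeomorphism U V \<psi> g"
    "\<And>y. y \<in> V \<Longrightarrow> (g has_derivative (g' y)) (at y)"
    "\<And>y. y \<in> V \<Longrightarrow> g' y = inv (blinfun_apply (D (g y)))"
    "\<And>y. y \<in> V \<Longrightarrow> bij (blinfun_apply (D (g y)))"
    apply (rule inverse_function_theorem[OF oS der cont S(1) inv], assumption)
    subgoal premises p by (rule p(1)[OF p(2-7)]; erule p(8) p(9) p(10))
    done
  have gU: "g y \<in> U" "\<psi> (g y) = y" if "y \<in> V" for y
    using g(6) that unfolding homeomorphism_def by auto
  have hg: "g (\<psi> x) = x" if "x \<in> U" for x
    using g(6) that unfolding homeomorphism_def by auto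
  \<comment> \<open>The theorem returns only bijectivity of the derivative. If J were 0, the columns
    of the adjugate matrix, up to sign, would lie in the kernel; injectivity would then make all
    four entries vanish, and the derivative with them.\<close>
  have ne: "J (g y) \<noteq> 0" if "y \<in> V" for y
  proof
    assume 0: "J (g y) = 0"
    have inj: "inj (blinfun_apply (D (g y)))" using g(9)[OF that] by (simp add: bij_def)
    have z: "v = 0" if "blinfun_apply (D (g y)) v = 0" for v
      using injD[OF inj, of v 0] that by simp
    have "(d (g y), - c (g y)) = 0" "(b (g y), - a (g y)) = 0"
      by (rule z, use 0 in \<open>simp add: D_def L J_def zero_prod_def mult.commute\<close>)+
    then have "blinfun_apply (D (g y)) (1, 0) = 0" by (simp add: D_def L zero_prod_def)
    then have "(1::real, 0::real) = 0" by (rule z)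
    then show False by (simp add: zero_prod_def)
  qed
  have derg: "(g has_derivative blinfun_apply (K (g y))) (at y)" if y: "y \<in> V" for y
  proof -
    have "g' y = blinfun_apply (K (g y))"
    proof
      fix w
      have "inv (blinfun_apply (D (g y))) w = blinfun_apply (K (g y)) w"
        using bij_inv_eq_iff[OF g(9)[OF y]] KD(2)[OF ne[OF y]] by metis
      then show "g' y w = blinfun_apply (K (g y)) w" using g(8)[OF y] by simp
    qed
    then show ?thesis using g(7)[OF y] by simp
  qed
  have gV: "g ` V \<subseteq> S" using gU(1) g(2) by blast
  have "Ck_on n g V" for n
  proof (induction n)
    case 0
    show ?case using g(6) by (simp add: homeomorphism_def)
  next
    case (Suc n)
    note ck = Ck_on_compose[OF g(4) Suc Ck(1) gV] Ck_on_compose[OF g(4) Suc Ck(2) gV]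
      Ck_on_compose[OF g(4) Suc Ck(3) gV] Ck_on_compose[OF g(4) Suc Ck(4) gV]
    have "Ck_on n (\<lambda>y. a (g y) * d (g y) + (-1) * (b (g y) * c (g y))) V"
      by (intro Ck_on_add[OF g(4)] Ck_on_mult[OF g(4)] Ck_on_const[OF g(4)] ck)
    then have "Ck_on n (\<lambda>y. J (g y)) V" by (simp add: J_def)
    then have yi: "Ck_on n (\<lambda>y. inverse (J (g y))) V"
      by (rule Ck_on_compose[OF g(4) _ smooth_onD(2)[OF smooth_on_inverse]]) (use ne in auto)
    show ?case
    proof (rule Ck_on_SucI[OF derg _ g(4)])
      fix w :: "real \<times> real"
      have 1: "Ck_on n (\<lambda>y. inverse (J (g y)) * (fst w * d (g y) + (- snd w) * b (g y))) V"
        and 2: "Ck_on n (\<lambda>y. inverse (J (g y)) * ((- fst w) * c (g y) + snd w * a (g y))) V"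
        by (intro Ck_on_add[OF g(4)] Ck_on_mult[OF g(4)] Ck_on_const[OF g(4)] ck yi)+
      have "Ck_on n (\<lambda>y. (inverse (J (g y)) * (fst w * d (g y) + (- snd w) * b (g y)), 0) +
          (0, inverse (J (g y)) * ((- fst w) * c (g y) + snd w * a (g y)))) V"
        by (rule Ck_on_add[OF g(4)
            Ck_on_linear_compose[OF g(4) 1 bounded_linear_Pair[OF bounded_linear_ident bounded_linear_zero]]
            Ck_on_linear_compose[OF g(4) 2 bounded_linear_Pair[OF bounded_linear_zero bounded_linear_ident]]])
      then show "Ck_on n (\<lambda>y. blinfun_apply (K (g y)) w) V"
        by (simp add: K_def L diff_divide_distrib divide_inverse algebra_simps)
    qed
  qed
  then have "smooth_on g V" using g(4) unfolding smooth_on_def by simp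
  moreover have p0: "\<psi> 0 = 0" using assms(3,4) by (simp add: \<psi>_def zero_prod_def)
  then have V0: "0 \<in> V" using g(5) by simp
  ultimately have "smooth_germ g" by (intro smooth_germI)
  moreover have "g 0 = 0" using hg[OF g(3)] p0 by simp
  moreover have "\<forall>\<^sub>F x in nhds 0. g (\<psi> x) = x"
    by (rule eventually_mono[OF eventually_nhds_in_open[OF g(1,3)] hg])
  moreover have "\<forall>\<^sub>F x in nhds 0. \<psi> (g x) = x"
    by (rule eventually_mono[OF eventually_nhds_in_open[OF g(4) V0] gU(2)])
  moreover have "smooth_germ \<psi>" unfolding \<psi>_def[abs_def] by (intro smooth_germ_Pair assms)
  ultimately have "diffeo_germ \<psi>" unfolding diffeo_germ_def using p0 by auto
  then show ?thesis by (simp add: \<psi>_def[abs_def])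
qed

text \<open>These are the coordinate changes that leave the first component alone, hence keep it a
  monomial. Their Jacobian determinant at 0 is the partial derivative of F in the second
  variable.\<close>

lemma diffeo_germ_fibred:
  fixes F :: "real \<times> real \<Rightarrow> real"
  assumes "smooth_germ F" "F 0 = 0" "((\<lambda>s. F (0, s)) has_real_derivative c) (at 0)" "c \<noteq> 0"
  shows "diffeo_germ (\<lambda>p. (fst p, F p))"
proof -
  obtain S where S: "0 \<in> S" "smooth_on F S" using smooth_germE[OF assms(1)] .
  define F' where "F' = frechet_derivative F (at 0)"
  have F': "(F has_derivative F') (at 0)"
    unfolding F'_def by (rule Ck_on_Suc_has_derivative[OF smooth_onD(2)[OF S(2)] S(1)])
  have "((\<lambda>s. (0::real, s)) has_derivative (\<lambda>s. (0, s))) (at 0)"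
    by (auto intro!: derivative_eq_intros)
  moreover have "(F has_derivative F') (at (0, 0))" using F' by (simp add: zero_prod_def)
  ultimately have "((\<lambda>s. F (0, s)) has_derivative (\<lambda>s. F' (0, s))) (at 0)"
    by (rule has_derivative_compose)
  moreover have "((\<lambda>s. F (0, s)) has_derivative (*) c) (at 0)"
    using assms(3) by (simp add: has_field_derivative_def)
  ultimately have "(\<lambda>s. F' (0, s)) = (*) c" by (rule has_derivative_unique)
  from fun_cong[OF this, of 1] have c: "F' (0, 1) = c" by simp
  show ?thesis
    by (rule diffeo_germ_plane[OF smooth_germ_fst[OF smooth_germ_ident] assms(1) _ assms(2)
          has_derivative_fst[OF has_derivative_ident] F']) (simp_all add: assms(4) c)
qed

lemma diffeo_germD: "diffeo_germ h \<Longrightarrow> smooth_germ h" "diffeo_germ h \<Longrightarrow> h 0 = 0"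
  by (auto simp: diffeo_germ_def)

lemma diffeo_germE:
  assumes "diffeo_germ h"
  obtains g where "diffeo_germ g" "\<forall>\<^sub>F x in nhds 0. g (h x) = x" "\<forall>\<^sub>F x in nhds 0. h (g x) = x"
  using assms unfolding diffeo_germ_def by blast

lemma diffeo_germ_id: "diffeo_germ (\<lambda>x. x)"
  unfolding diffeo_germ_def by (auto intro!: exI[of _ "\<lambda>x. x"] smooth_germ_ident)

text \<open>The product of h with the identity reduces the line to the plane, so that the inverse
  function theorem is used only once.\<close>

lemma diffeo_germ_real:
  fixes h :: "real \<Rightarrow> real"
  assumes "smooth_germ h" "h 0 = 0" "deriv h 0 \<noteq> 0"
  shows "diffeo_germ h"
proof -
  have h': "(h has_derivative (\<lambda>v. deriv h 0 * v)) (at (fst (0::real \<times> real)))"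
    using smooth_germ_deriv(3)[OF assms(1)] by (simp add: has_field_derivative_def)
  have dg: "diffeo_germ (\<lambda>p::real \<times> real. (h (fst p), snd p))"
    by (rule diffeo_germ_plane[OF smooth_germ_compose[OF smooth_germ_fst[OF smooth_germ_ident] assms(1)]
          smooth_germ_snd[OF smooth_germ_ident] _ _
          has_derivative_compose[OF has_derivative_fst[OF has_derivative_ident] h']
          has_derivative_snd[OF has_derivative_ident]]) (simp_all add: assms)
  obtain \<psi> where \<psi>: "diffeo_germ \<psi>" "\<forall>\<^sub>F p in nhds (0::real \<times> real). \<psi> (h (fst p), snd p) = p"
    "\<forall>\<^sub>F p in nhds 0. (h (fst (\<psi> p)), snd (\<psi> p)) = p" using diffeo_germE[OF dg] .
  note d = diffeo_germD[OF \<psi>(1)]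
  define g where "g t = fst (\<psi> (t, 0))" for t
  have e: "smooth_germ (\<lambda>t::real. (t, 0::real))" "(\<lambda>t::real. (t, 0::real)) 0 = 0"
    by (intro smooth_germ_intros, simp add: zero_prod_def)
  have "smooth_germ g" unfolding g_def[abs_def] by (intro smooth_germ_fst smooth_germ_compose[OF e(1) d(1)] e(2))
  moreover have "g 0 = 0" using d(2) by (simp add: g_def zero_prod_def)
  moreover have "\<forall>\<^sub>F t in nhds 0. g (h t) = t"
    using eventually_compose_germ[OF \<psi>(2) e] by eventually_elim (simp add: g_def)
  moreover have "\<forall>\<^sub>F t in nhds 0. h (g t) = t"
    using eventually_compose_germ[OF \<psi>(3) e] by eventually_elim (simp add: g_def)
  ultimately show ?thesis unfolding diffeo_germ_def using assms by auto
qed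

lemma diffeo_germ_compose:
  assumes "diffeo_germ f" "diffeo_germ g" shows "diffeo_germ (\<lambda>x. g (f x))"
proof -
  obtain f' where f': "diffeo_germ f'" "\<forall>\<^sub>F x in nhds 0. f' (f x) = x" "\<forall>\<^sub>F x in nhds 0. f (f' x) = x"
    using diffeo_germE[OF assms(1)] .
  obtain g' where g': "diffeo_germ g'" "\<forall>\<^sub>F x in nhds 0. g' (g x) = x" "\<forall>\<^sub>F x in nhds 0. g (g' x) = x"
    using diffeo_germE[OF assms(2)] .
  note d = diffeo_germD[OF assms(1)] diffeo_germD[OF assms(2)] diffeo_germD[OF f'(1)] diffeo_germD[OF g'(1)]
  have "\<forall>\<^sub>F x in nhds 0. g' (g (f x)) = f x" by (rule eventually_compose_germ[OF g'(2) d(1,2)])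
  then have 1: "\<forall>\<^sub>F x in nhds 0. f' (g' (g (f x))) = x" using f'(2) by eventually_elim simp
  have "\<forall>\<^sub>F x in nhds 0. f (f' (g' x)) = g' x" by (rule eventually_compose_germ[OF f'(3) d(7,8)])
  then have 2: "\<forall>\<^sub>F x in nhds 0. g (f (f' (g' x))) = x" using g'(3) by eventually_elim simp
  show ?thesis unfolding diffeo_germ_def
    using smooth_germ_compose[OF d(1,3,2)] smooth_germ_compose[OF d(7,5,8)] 1 2 d
    by (intro conjI exI[of _ "\<lambda>x. f' (g' x)"]) simp_all
qed

lemma diffeo_germ_deriv_ne_0:
  fixes h :: "real \<Rightarrow> real"
  assumes "diffeo_germ h" shows "deriv h 0 \<noteq> 0"
proof
  assume 0: "deriv h 0 = 0"
  obtain g where g: "diffeo_germ g" "\<forall>\<^sub>F x in nhds 0. g (h x) = x" using diffeo_germE[OF assms] .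
  note d = diffeo_germD[OF assms] diffeo_germD[OF g(1)]
  have "(g has_real_derivative deriv g 0) (at (h 0))" using smooth_germ_deriv(3)[OF d(3)] d(2) by simp
  from DERIV_chain2[OF this smooth_germ_deriv(3)[OF d(1)]]
  have "((\<lambda>x. g (h x)) has_real_derivative 0) (at 0)" using 0 by simp
  then have "((\<lambda>x. x) has_real_derivative 0) (at 0)"
    using DERIV_cong_ev[OF refl g(2) refl] by blast
  then show False using DERIV_unique[OF DERIV_ident] by fastforce
qed

section \<open>The equivalence relation on plane germs\<close>

lemma A_equiv_sym:
  assumes "A_equiv f g" "smooth_germ g" "g 0 = 0" shows "A_equiv g f"
proof -
  obtain h \<psi> where h: "diffeo_germ h" "diffeo_germ \<psi>" "\<forall>\<^sub>F t in nhds 0. f (h t) = \<psi> (g t)"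
    using assms(1) unfolding A_equiv_def by blast
  obtain h' where h': "diffeo_germ h'" "\<forall>\<^sub>F x in nhds 0. h' (h x) = x" "\<forall>\<^sub>F x in nhds 0. h (h' x) = x"
    using diffeo_germE[OF h(1)] .
  \<comment> \<open>\<open>\<psi>'\<close> inverts \<open>\<psi>\<close> only near the origin;
    smoothness of g and g 0 = 0 keep the points g t there.\<close>
  obtain \<psi>' where p': "diffeo_germ \<psi>'" "\<forall>\<^sub>F x in nhds 0. \<psi>' (\<psi> x) = x" "\<forall>\<^sub>F x in nhds 0. \<psi> (\<psi>' x) = x"
    using diffeo_germE[OF h(2)] .
  have "\<forall>\<^sub>F t in nhds 0. \<psi>' (\<psi> (g t)) = g t" by (rule eventually_compose_germ[OF p'(2) assms(2,3)])
  then have "\<forall>\<^sub>F t in nhds 0. \<psi>' (f (h t)) = g t" using h(3) by eventually_elim simp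
  then have "\<forall>\<^sub>F t in nhds 0. \<psi>' (f (h (h' t))) = g (h' t)"
    by (rule eventually_compose_germ[OF _ diffeo_germD[OF h'(1)]])
  then have "\<forall>\<^sub>F t in nhds 0. g (h' t) = \<psi>' (f t)" using h'(3) by eventually_elim simp
  then show ?thesis unfolding A_equiv_def using h'(1) p'(1) by blast
qed

lemma A_equiv_trans:
  assumes "A_equiv f g" "A_equiv g k" shows "A_equiv f k"
proof -
  obtain h \<psi> where h: "diffeo_germ h" "diffeo_germ \<psi>" "\<forall>\<^sub>F t in nhds 0. f (h t) = \<psi> (g t)"
    using assms(1) unfolding A_equiv_def by blast
  obtain h' \<psi>' where h': "diffeo_germ h'" "diffeo_germ \<psi>'" "\<forall>\<^sub>F t in nhds 0. g (h' t) = \<psi>' (k t)"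
    using assms(2) unfolding A_equiv_def by blast
  have "\<forall>\<^sub>F t in nhds 0. f (h (h' t)) = \<psi> (g (h' t))"
    by (rule eventually_compose_germ[OF h(3) diffeo_germD[OF h'(1)]])
  then have "\<forall>\<^sub>F t in nhds 0. f (h (h' t)) = \<psi> (\<psi>' (k t))" using h'(3) by eventually_elim simp
  then show ?thesis
    unfolding A_equiv_def using diffeo_germ_compose[OF h'(1) h(1)] diffeo_germ_compose[OF h'(2) h(2)]
    by (intro exI[of _ "\<lambda>t. h (h' t)"] exI[of _ "\<lambda>p. \<psi> (\<psi>' p)"]) simp
qed

lemma A_equivI:
  "diffeo_germ h \<Longrightarrow> diffeo_germ \<psi> \<Longrightarrow> \<forall>\<^sub>F t in nhds 0. f (h t) = \<psi> (g t) \<Longrightarrow> A_equiv f g"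
  unfolding A_equiv_def by (intro exI conjI)

lemma A_equiv_reparam:
  assumes "diffeo_germ h" "\<forall>\<^sub>F t in nhds 0. f (h t) = g t" shows "A_equiv f g"
  by (rule A_equivI[OF assms(1) diffeo_germ_id assms(2)])

lemma A_equiv_left:
  assumes "diffeo_germ \<psi>" "\<forall>\<^sub>F t in nhds 0. f t = \<psi> (g t)" shows "A_equiv f g"
  by (rule A_equivI[OF diffeo_germ_id assms])

lemma A_equiv_push:
  assumes "diffeo_germ \<psi>" "smooth_germ f" "f 0 = 0" shows "A_equiv f (\<lambda>t. \<psi> (f t))"
  by (rule A_equiv_sym[OF A_equiv_left[OF assms(1)] assms(2,3)]) simp

lemma A_equiv_cong: "\<forall>\<^sub>F t in nhds 0. f t = g t \<Longrightarrow> A_equiv f g"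
  by (rule A_equiv_left[OF diffeo_germ_id])

subsection \<open>Reparametrisation\<close>

lemma van_cancel:
  assumes "van (k + n) (\<lambda>s. s ^ k * f s)" "smooth_germ f" shows "van n f"
  unfolding van_iff_tc
proof (intro conjI allI impI assms(2))
  fix i assume "i < n"
  then show "tc f i = 0" using van_tc[OF assms(1), of "k + i"] tc_shift[OF assms(2), of k "k + i"] by simp
qed

lemma van_factor:
  assumes "van n f"
  obtains g where "smooth_germ g" "\<forall>\<^sub>F t in nhds 0. f t = t ^ n * g t" "\<forall>i. tc g i = tc f (n + i)"
proof -
  obtain g where g: "smooth_germ g" "\<forall>\<^sub>F t in nhds 0. f t = t ^ n * g t" using vanE[OF assms] .
  show thesis by (rule that[OF g]) (use tc_cong[OF g(2)] tc_shift[OF g(1)] in simp)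
qed

lemma tc_compose_1:
  assumes "smooth_germ f" "smooth_germ h" "h 0 = 0"
  shows "tc (\<lambda>t. f (h t)) 1 = tc f 1 * tc h 1"
proof -
  have "(f has_real_derivative deriv f 0) (at (h 0))" using smooth_germ_deriv(3)[OF assms(1)] assms(3) by simp
  from DERIV_chain2[OF this smooth_germ_deriv(3)[OF assms(2)]] show ?thesis
    using DERIV_imp_deriv by (simp add: tc_def)
qed

lemma tc_compose_leading:
  assumes "van n f" "smooth_germ h" "h 0 = 0"
  shows "tc (\<lambda>t. f (h t)) n = tc f n * tc h 1 ^ n"
proof -
  obtain g where g: "smooth_germ g" "\<forall>\<^sub>F t in nhds 0. f t = t ^ n * g t" "\<forall>i. tc g i = tc f (n + i)"
    using van_factor[OF assms(1)] .
  obtain k where k: "smooth_germ k" "\<forall>\<^sub>F t in nhds 0. h t = t ^ 1 * k t" "\<forall>i. tc k i = tc h (1 + i)"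
    using van_factor[OF van_1I[OF assms(2,3)]] .
  have "\<forall>\<^sub>F t in nhds 0. f (h t) = h t ^ n * g (h t)" by (rule eventually_compose_germ[OF g(2) assms(2,3)])
  then have "\<forall>\<^sub>F t in nhds 0. f (h t) = t ^ n * (k t ^ n * g (h t))"
    using k(2) by eventually_elim (simp add: power_mult_distrib)
  from tc_cong[OF this, of n] have "tc (\<lambda>t. f (h t)) n = k 0 ^ n * g 0"
    by (subst (asm) tc_shift) (intro smooth_germ_intros k(1) smooth_germ_compose[OF assms(2) g(1) assms(3)],
        simp add: tc_0 assms(3))
  then show ?thesis using spec[OF g(3), of 0] spec[OF k(3), of 0] by (simp add: tc_0)
qed

text \<open>Write f = t^n z and H s = s (1 + w) with w = c s^j + .... The change comes from (1 +
  w)^n = 1 + n c s^j + ..., while z (H s) - z s has order j + 1 because H s - s has. This tracks how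
  a reparametrization moves one prescribed coefficient.\<close>

lemma compose_perturb:
  assumes "van n f" "smooth_germ H" "van (j + 2) (\<lambda>s. H s - s - c * s ^ (j + 1))" "j \<ge> 1"
  shows "van (n + j + 1) (\<lambda>s. f (H s) - f s - real n * c * tc f n * s ^ (n + j))"
proof -
  have H0: "H 0 = 0" using van_1D[of "j + 1" "\<lambda>s. H s - s - c * s ^ (j + 1)"] assms(3) by simp
  obtain z where z: "smooth_germ z" "\<forall>\<^sub>F t in nhds 0. f t = t ^ n * z t" "\<forall>i. tc z i = tc f (n + i)"
    using van_factor[OF assms(1)] .
  obtain r where r: "smooth_germ r" "\<forall>\<^sub>F s in nhds 0. H s - s - c * s ^ (j + 1) = s ^ (j + 2) * r s"
    using vanE[OF assms(3)] .
  define \<mu> where "\<mu> s = c + s * r s" for s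
  have \<mu>: "smooth_germ \<mu>" unfolding \<mu>_def[abs_def] by (intro smooth_germ_intros r(1))
  have H: "\<forall>\<^sub>F s in nhds 0. H s = s * (1 + s ^ j * \<mu> s)"
    using r(2) by eventually_elim (simp add: \<mu>_def algebra_simps)
  define w where "w s = s ^ j * \<mu> s" for s
  have w: "smooth_germ w" unfolding w_def[abs_def] by (intro smooth_germ_intros \<mu>)
  have w0: "w 0 = 0" using assms(4) by (simp add: w_def)
  have vw: "van j w" unfolding w_def[abs_def] by (rule van_mult_right[OF van_power_id[OF order_refl] \<mu>])
  have vw1: "van (j + 1) (\<lambda>s. w s - c * s ^ j)"
    by (rule van_eq[OF van_mult_right[OF van_power_id[OF order_refl] r(1)]]) (simp add: w_def \<mu>_def algebra_simps)
  have N2: "2 \<le> j + 2" by simp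
  have sm1: "smooth_germ (\<lambda>x::real. (1 + x) ^ n)" by (intro smooth_germ_intros)
  obtain v where v: "smooth_germ v" "v 0 = tc (\<lambda>x. (1 + x) ^ n) 1"
    "van (j + 2) (\<lambda>s. (1 + (0 + w s)) ^ n - (1 + 0) ^ n - w s * v s)"
    using compose_increment[OF sm1 smooth_germ_const w refl w0 N2] .
  have "((\<lambda>x. (1 + x) ^ n) has_real_derivative real n) (at 0)"
    by (auto intro!: derivative_eq_intros)
  then have v0: "v 0 = real n" using v(2) DERIV_imp_deriv by (simp add: tc_def)
  have "van (j + 1) (\<lambda>s. w s * (v s - real n))"
    using van_mult[OF vw van_1I[of "\<lambda>s. v s - real n"]] v0 by (simp add: smooth_germ_intros v(1))
  from van_add[OF van_add[OF van_mono[OF v(3)] this] van_cmult[OF vw1, of "real n"]]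
  have P: "van (j + 1) (\<lambda>s. (1 + w s) ^ n - 1 - real n * c * s ^ j)"
    by (rule van_eq) (simp_all add: algebra_simps)
  have zH: "smooth_germ (\<lambda>s. z (H s))" by (rule smooth_germ_compose[OF assms(2) z(1) H0])
  have vwm: "van (j + 1) (\<lambda>s. H s - s)"
    using van_add[OF van_mono[OF assms(3), of "j + 1"] van_monom[of "j + 1" "j + 1" c]] by simp
  obtain v' where v': "smooth_germ v'" "v' 0 = tc z 1"
    "van (j + 2) (\<lambda>s. z (s + (H s - s)) - z s - (H s - s) * v' s)"
    using compose_increment[OF z(1) smooth_germ_ident smooth_germ_diff[OF assms(2) smooth_germ_ident] refl _ N2]
      H0 by auto
  from van_add[OF van_mono[OF v'(3), of "j + 1"] van_mult_right[OF vwm v'(1)]]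
  have Z: "van (j + 1) (\<lambda>s. z (H s) - z s)" by simp
  have z0: "van (j + 1) (\<lambda>s. real n * c * s ^ j * (z s - z 0))"
    by (rule van_mult[OF van_monom van_1I]) (auto intro: smooth_germ_intros z(1))
  have "van (j + 1) (\<lambda>s. ((1 + w s) ^ n - 1 - real n * c * s ^ j) * z (H s) + (z (H s) - z s)
      + real n * c * s ^ j * (z (H s) - z s) + real n * c * s ^ j * (z s - z 0))"
    by (intro van_add van_mult_right[OF P zH] Z z0 van_mult_left[OF _ Z] smooth_germ_intros)
  then have "van (j + 1) (\<lambda>s. (1 + w s) ^ n * z (H s) - z s - real n * c * z 0 * s ^ j)"
    by (rule van_eq) (simp add: algebra_simps)
  from van_mult[OF van_power_id[OF order_refl, of n] this]
  have "van (n + j + 1) (\<lambda>s. s ^ n * ((1 + w s) ^ n * z (H s) - z s - real n * c * z 0 * s ^ j))"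
    by (simp add: add.assoc)
  moreover have "\<forall>\<^sub>F s in nhds 0. f (H s) = H s ^ n * z (H s)"
    by (rule eventually_compose_germ[OF z(2) assms(2) H0])
  then have "\<forall>\<^sub>F s in nhds 0. f (H s) - f s - real n * c * tc f n * s ^ (n + j) =
      s ^ n * ((1 + w s) ^ n * z (H s) - z s - real n * c * z 0 * s ^ j)"
    using H z(2)
  proof eventually_elim
    case (elim s)
    have "f (H s) = s ^ n * ((1 + w s) ^ n * z (H s))"
      using elim(1) unfolding elim(2) by (simp add: power_mult_distrib w_def)
    then show ?case using elim(3) spec[OF z(3), of 0] by (simp add: tc_0 algebra_simps power_add)
  qed
  ultimately show ?thesis by (rule van_cong)
qed

text \<open>Only the unit u in x = t^m u, with u 0 = 1, is raised to the power 1 / m. So the root t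
  u^(1/m) is smooth and invertible for either parity of m.\<close>

lemma root_reparam:
  assumes "van m x" "tc x m = 1" "m \<ge> 1"
  obtains S H where "diffeo_germ S" "diffeo_germ H" "tc S 1 = 1" "tc H 1 = 1"
    "\<forall>\<^sub>F t in nhds 0. S t ^ m = x t" "\<forall>\<^sub>F s in nhds 0. x (H s) = s ^ m"
    "\<forall>\<^sub>F t in nhds 0. H (S t) = t" "\<forall>\<^sub>F s in nhds 0. S (H s) = s"
proof -
  obtain u where u: "smooth_germ u" "\<forall>\<^sub>F t in nhds 0. x t = t ^ m * u t" "\<forall>i. tc u i = tc x (m + i)"
    using van_factor[OF assms(1)] .
  have u0: "u 0 = 1" using spec[OF u(3), of 0] assms(2) by (simp add: tc_0)
  define k where "k t = u t powr (1 / real m)" for t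
  define S where "S t = t * k t" for t
  have k: "smooth_germ k" unfolding k_def[abs_def] by (rule smooth_germ_powr[OF u(1)]) (simp add: u0)
  have S: "smooth_germ S" "S 0 = 0" unfolding S_def[abs_def] by (auto intro!: smooth_germ_intros k)
  have S1: "tc S 1 = 1" using tc_shift[OF k, of 1 1] by (simp add: S_def[abs_def] tc_0 k_def u0)
  have dS: "diffeo_germ S" by (rule diffeo_germ_real[OF S]) (use S1 in \<open>simp add: tc_def\<close>)
  obtain H where H: "diffeo_germ H" "\<forall>\<^sub>F t in nhds 0. H (S t) = t" "\<forall>\<^sub>F s in nhds 0. S (H s) = s"
    using diffeo_germE[OF dS] .
  have Sx: "\<forall>\<^sub>F t in nhds 0. S t ^ m = x t"
  proof -
    have "\<forall>\<^sub>F t in nhds 0. u t > 0"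
      using order_tendstoD(1)[OF smooth_germ_tendsto[OF u(1)], of 0] u0 by simp
    then show ?thesis using u(2)
    proof eventually_elim
      case (elim t)
      have "k t ^ m = k t powr real m" using elim(1) by (simp add: powr_realpow k_def)
      also have "\<dots> = u t" using elim(1) assms(3) by (simp add: k_def powr_powr)
      finally show ?case using elim(2) by (simp add: S_def power_mult_distrib)
    qed
  qed
  have "\<forall>\<^sub>F s in nhds 0. S (H s) ^ m = x (H s)" by (rule eventually_compose_germ[OF Sx diffeo_germD[OF H(1)]])
  then have xH: "\<forall>\<^sub>F s in nhds 0. x (H s) = s ^ m" using H(3) by eventually_elim simp
  have "tc (\<lambda>s. S (H s)) 1 = tc S 1 * tc H 1" by (rule tc_compose_1[OF S(1) diffeo_germD[OF H(1)]])
  moreover have "tc (\<lambda>s. S (H s)) 1 = tc (\<lambda>s. 1 * s ^ 1) 1" by (rule tc_cong) (use H(3) in simp)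
  ultimately have "tc H 1 = 1" using S1 tc_monom[of 1 1 1] by simp
  then show thesis using that[OF dS H(1) S1 _ Sx xH H(2,3)] by simp
qed

text \<open>With H s = s k, comparing x (H s) = s^m with the expansion of x gives k^m - 1 + c s^j =
  0 up to order j + 1. Here k^m - 1 = (k - 1) w with a geometric sum w whose value at 0 is m, hence
  the quotient - c / m.\<close>

lemma root_perturb:
  assumes "van (m + j + 1) (\<lambda>s. x s - s ^ m - c * s ^ (m + j))" "m \<ge> 1" "j \<ge> 1"
    and "smooth_germ H" "H 0 = 0" "tc H 1 = 1" "\<forall>\<^sub>F s in nhds 0. x (H s) = s ^ m"
  shows "van (j + 2) (\<lambda>s. H s - s - (- c / real m) * s ^ (j + 1))"
proof -
  obtain k where k: "smooth_germ k" "\<forall>\<^sub>F s in nhds 0. H s = s ^ 1 * k s" "\<forall>i. tc k i = tc H (1 + i)"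
    using van_factor[OF van_1I[OF assms(4,5)]] .
  have k0: "k 0 = 1" using spec[OF k(3), of 0] assms(6) by (simp add: tc_0)
  define w where "w s = (\<Sum>i<m. k s ^ i)" for s
  have w: "smooth_germ w" unfolding w_def[abs_def] by (intro smooth_germ_intros k(1))
  have w0: "w 0 = real m" by (simp add: w_def k0)
  have "van (m + j + 1) (\<lambda>s. x (H s) - H s ^ m - c * H s ^ (m + j))" by (rule van_compose[OF assms(1,4,5)])
  moreover have "van (m + j + 1) (\<lambda>s. c * (H s ^ (m + j) - s ^ (m + j)))"
  proof -
    have v: "van (m + j) (\<lambda>s. H s ^ (m + j) - s ^ (m + j))"
      by (rule van_diff[OF van_power[OF van_1I[OF assms(4,5)]] van_power_id[OF order_refl]])
    have vv: "van (m + j) (\<lambda>s. H s ^ (m + j))" by (rule van_power[OF van_1I[OF assms(4,5)]])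
    have "tc (\<lambda>s. H s ^ (m + j)) (m + j) = 1"
      using tc_compose_leading[OF van_power_id[OF order_refl] assms(4,5), of "m + j"]
        tc_monom[of 1 "m + j" "m + j"] assms(6) by simp
    moreover have "tc (\<lambda>s::real. s ^ (m + j)) (m + j) = 1" using tc_monom[of 1 "m + j" "m + j"] by simp
    ultimately have "tc (\<lambda>s. H s ^ (m + j) - s ^ (m + j)) (m + j) = 0"
      by (simp add: tc_diff smooth_germ_intros assms(4))
    from van_cmult[OF van_SucI[OF v this]] show ?thesis by simp
  qed
  ultimately have "van (m + j + 1) (\<lambda>s. x (H s) - H s ^ m - c * s ^ (m + j))"
    by (rule van_eq[OF van_add]) (simp add: algebra_simps)
  moreover have "\<forall>\<^sub>F s in nhds 0. s ^ m * ((k s - 1) * w s + c * s ^ j) = - (x (H s) - H s ^ m - c * s ^ (m + j))"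
    using k(2) assms(7)
  proof eventually_elim
    case (elim s)
    have "(k s - 1) * w s = k s ^ m - 1" unfolding w_def by (rule power_diff_1_eq[symmetric])
    then have "s ^ m * ((k s - 1) * w s + c * s ^ j) = s ^ m * (k s ^ m - 1 + c * s ^ j)" by simp
    also have "\<dots> = H s ^ m - s ^ m + c * s ^ (m + j)"
      using elim(1) by (simp add: power_mult_distrib algebra_simps power_add)
    finally show ?case using elim(2) by simp
  qed
  ultimately have "van (m + j + 1) (\<lambda>s. s ^ m * ((k s - 1) * w s + c * s ^ j))"
    by (rule van_cong[OF van_minus])
  then have "van (m + (j + 1)) (\<lambda>s. s ^ m * ((k s - 1) * w s + c * s ^ j))"
    by (simp only: add.assoc)
  then have "van (j + 1) (\<lambda>s. (k s - 1) * w s + c * s ^ j)"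
    by (rule van_cancel) (intro smooth_germ_intros k(1) w)
  moreover have "van (j + 1) (\<lambda>s. (c / real m * s ^ j) * (w s - real m))"
    by (rule van_mult[OF van_monom van_1I]) (auto intro: smooth_germ_intros w simp: w0)
  ultimately have "van (j + 1) (\<lambda>s. (k s - 1 + c / real m * s ^ j) * w s)"
    by (rule van_eq[OF van_add]) (use assms(2) in \<open>simp add: field_simps\<close>)
  then have "van (j + 1) (\<lambda>s. k s - 1 + c / real m * s ^ j)"
    by (rule van_unit[OF _ w]) (use w0 assms(2) in simp)
  from van_mult[OF van_power_id[OF order_refl, of 1] this]
  have "van (j + 2) (\<lambda>s. s ^ 1 * (k s - 1 + c / real m * s ^ j))" by simp
  then show ?thesis
    by (rule van_cong) (use k(2) in eventually_elim, simp add: algebra_simps)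
qed

subsection \<open>Normal forms\<close>

lemma smooth_germ_fst_compose:
  fixes a :: "real \<Rightarrow> real"
  assumes "smooth_germ a" shows "smooth_germ (\<lambda>p::real \<times> real. a (fst p))"
  by (rule smooth_germ_compose[OF smooth_germ_fst[OF smooth_germ_ident] assms]) simp

text \<open>Split y = a_0 (s^2) + s a_1 (s^2). The hypotheses say that a_1 = r^k u with u 0 \<noteq>
  0, so y = a_0 (X) + Y u (X) on the curve (X, Y) = (t^2, t^(2k+1)).\<close>

lemma A2k_normal_form:
  assumes "smooth_germ y" "y 0 = 0" "\<And>i. i < k \<Longrightarrow> tc y (2 * i + 1) = 0" "tc y (2 * k + 1) \<noteq> 0"
  shows "A_equiv (\<lambda>s. (s ^ 2, y s)) (\<lambda>t. (t ^ 2, t ^ (2 * k + 1)))"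
proof -
  obtain a where a: "\<forall>i. smooth_germ (a i)" "\<forall>i j. tc (a i) j = tc y (i + 2 * j)"
    "\<forall>\<^sub>F t in nhds 0. y t = (\<Sum>i<2. t ^ i * a i (t ^ 2))"
    using decomposition[OF assms(1) order_refl] .
  have va: "van k (a 1)" unfolding van_iff_tc using spec[OF a(1), of 1] spec[OF a(2), of 1] assms(3) by simp
  obtain u where u: "smooth_germ u" "\<forall>\<^sub>F t in nhds 0. a 1 t = t ^ k * u t" "\<forall>i. tc u i = tc (a 1) (k + i)"
    using van_factor[OF va] .
  have a0: "a 0 0 = 0" using spec[OF spec[OF a(2), of 0], of 0] assms(2) by (simp add: tc_0)
  have u0: "u 0 \<noteq> 0" using spec[OF u(3), of 0] spec[OF spec[OF a(2), of 1], of k] assms(4) by (simp add: tc_0)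
  define F where "F p = a 0 (fst p) + snd p * u (fst p)" for p
  have "diffeo_germ (\<lambda>p. (fst p, F p))"
  proof (rule diffeo_germ_fibred)
    show "smooth_germ F" unfolding F_def[abs_def]
      by (intro smooth_germ_intros smooth_germ_fst_compose u(1) spec[OF a(1)])
    show "((\<lambda>s. F (0, s)) has_real_derivative u 0) (at 0)"
      unfolding F_def by (auto intro!: derivative_eq_intros)
  qed (use u0 a0 in \<open>simp_all add: F_def\<close>)
  then show ?thesis
  proof (rule A_equiv_left)
    have "\<forall>\<^sub>F t in nhds 0. a 1 (t ^ 2) = (t ^ 2) ^ k * u (t ^ 2)"
      by (rule eventually_compose_germ[OF u(2)]) (auto intro: smooth_germ_intros)
    then show "\<forall>\<^sub>F t in nhds 0. (t ^ 2, y t) =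
        (fst (t ^ 2, t ^ (2 * k + 1)), F (t ^ 2, t ^ (2 * k + 1)))"
      using a(3) by eventually_elim
        (simp add: F_def numeral_2_eq_2 power_mult power_add power_mult[of _ 2 k, symmetric] algebra_simps)
  qed
qed

section \<open>The type E8\<close>

lemma diffeo_germ_shear: "diffeo_germ (\<lambda>p::real \<times> real. (fst p + e * snd p, snd p))"
  by (rule diffeo_germ_plane[where F' = "\<lambda>v. fst v + e * snd v" and G' = snd])
     (auto intro!: smooth_germ_intros derivative_eq_intros)

text \<open>The gaps of the semigroup generated by 3 and 5 are 1, 2, 4 and 7. With the coefficient
  in degree 7 gone, the terms of degree 1 modulo 3 begin with s^10 = (s^5)^2 and become Y^2 b (X);
  those of degree 2 modulo 3 become Y u (X).\<close>

lemma E8_normal_form_aux: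
  assumes "van 5 y" "tc y 5 \<noteq> 0" "tc y 7 = 0"
  shows "A_equiv (\<lambda>s. (s ^ 3, y s)) (\<lambda>t. (t ^ 3, t ^ 5))"
proof -
  have m3: "(2::nat) \<le> 3" by simp
  obtain a where a: "\<forall>i. smooth_germ (a i)" "\<forall>i j. tc (a i) j = tc y (i + 3 * j)"
    "\<forall>\<^sub>F t in nhds 0. y t = (\<Sum>i<3. t ^ i * a i (t ^ 3))"
    using decomposition[OF van_smooth[OF assms(1)] m3] .
  have y: "tc y i = 0" if "i < 5" for i using van_tc[OF assms(1) that] .
  \<comment> \<open>The three coefficients are those of y in the degrees 1, 4 and 7.\<close>
  have "tc (a 1) j = 0" if "j < 3" for j
  proof -
    have "j = 0 \<or> j = 1 \<or> j = 2" using that by auto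
    then show ?thesis using spec[OF spec[OF a(2), of 1], of j] y assms(3) by auto
  qed
  then have va: "van 3 (a 1)" unfolding van_iff_tc using spec[OF a(1), of 1] by simp
  obtain b where b: "smooth_germ b" "\<forall>\<^sub>F t in nhds 0. a 1 t = t ^ 3 * b t" using vanE[OF va] .
  have va2: "van 1 (a 2)" unfolding van_iff_tc using spec[OF a(1), of 2] spec[OF spec[OF a(2), of 2], of 0] y by simp
  obtain u where u: "smooth_germ u" "\<forall>\<^sub>F t in nhds 0. a 2 t = t ^ 1 * u t" "\<forall>i. tc u i = tc (a 2) (1 + i)"
    using van_factor[OF va2] .
  have a0: "a 0 0 = 0" using spec[OF spec[OF a(2), of 0], of 0] y[of 0] by (simp add: tc_0)
  have u0: "u 0 \<noteq> 0" using spec[OF u(3), of 0] spec[OF spec[OF a(2), of 2], of 1] assms(2) by (simp add: tc_0)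
  define F where "F p = a 0 (fst p) + snd p * u (fst p) + snd p ^ 2 * b (fst p)" for p
  have "diffeo_germ (\<lambda>p. (fst p, F p))"
  proof (rule diffeo_germ_fibred)
    show "smooth_germ F" unfolding F_def[abs_def]
      by (intro smooth_germ_intros smooth_germ_fst_compose u(1) b(1) spec[OF a(1)])
    show "((\<lambda>s. F (0, s)) has_real_derivative u 0) (at 0)"
      unfolding F_def by (auto intro!: derivative_eq_intros)
  qed (use u0 a0 in \<open>simp_all add: F_def\<close>)
  then show ?thesis
  proof (rule A_equiv_left)
    have cube: "smooth_germ (\<lambda>t::real. t ^ 3)" by (intro smooth_germ_intros)
    have "\<forall>\<^sub>F t in nhds 0. a 1 (t ^ 3) = (t ^ 3) ^ 3 * b (t ^ 3)"
      by (rule eventually_compose_germ[OF b(2) cube]) simp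
    moreover have "\<forall>\<^sub>F t in nhds 0. a 2 (t ^ 3) = (t ^ 3) ^ 1 * u (t ^ 3)"
      by (rule eventually_compose_germ[OF u(2) cube]) simp
    ultimately show "\<forall>\<^sub>F t in nhds 0. (t ^ 3, y t) = (fst (t ^ 3, t ^ 5), F (t ^ 3, t ^ 5))"
      using a(3)
    proof eventually_elim
      case (elim t)
      have "(\<Sum>i<3. t ^ i * a i (t ^ 3)) = a 0 (t ^ 3) + t * a 1 (t ^ 3) + t ^ 2 * a 2 (t ^ 3)"
        by (simp add: eval_nat_numeral)
      then show ?case using elim by (simp add: F_def algebra_simps flip: power_mult power_add power_Suc power_Suc2)
    qed
  qed
qed

text \<open>Degree 7 is out of reach of fibred changes. The shear adds \<epsilon> y to the first
  component; extracting the cube root anew moves the parameter by - (\<epsilon> y_5 / 3) s^3, and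
  this changes y in degree 7 by - (5 / 3) \<epsilon> y_5^2. The choice of \<epsilon> makes it cancel
  y_7.\<close>

lemma E8_normal_form:
  assumes "van 5 y" "tc y 5 \<noteq> 0"
  shows "A_equiv (\<lambda>s. (s ^ 3, y s)) (\<lambda>t. (t ^ 3, t ^ 5))"
proof -
  define \<epsilon> where "\<epsilon> = 3 * tc y 7 / (5 * tc y 5 ^ 2)"
  have y: "smooth_germ y" using van_smooth[OF assms(1)] .
  have y0: "y 0 = 0" using assms(1) van_1D[of 4 y] by simp
  define x where "x s = s ^ 3 + \<epsilon> * y s" for s
  have vx: "van 3 x" unfolding x_def[abs_def]
    by (intro van_add van_power_id order_refl van_cmult van_mono[OF assms(1)]) simp
  have tx: "tc x 3 = 1"
    unfolding x_def[abs_def] using tc_monom[of 1 3 3] van_tc[OF assms(1), of 3]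
    by (simp add: tc_add tc_cmult smooth_germ_intros y)
  obtain S H where H: "diffeo_germ S" "diffeo_germ H" "tc S 1 = 1" "tc H 1 = 1"
    "\<forall>\<^sub>F t in nhds 0. S t ^ 3 = x t" "\<forall>\<^sub>F s in nhds 0. x (H s) = s ^ 3"
    "\<forall>\<^sub>F t in nhds 0. H (S t) = t" "\<forall>\<^sub>F s in nhds 0. S (H s) = s"
    using root_reparam[OF vx tx one_le_numeral] .
  note h = diffeo_germD[OF H(2)]
  have "van (3 + 2 + 1) (\<lambda>s. x s - s ^ 3 - (\<epsilon> * tc y 5) * s ^ (3 + 2))"
  proof (rule van_eq)
    show "van (3 + 2 + 1) (\<lambda>s. \<epsilon> * (y s - tc y 5 * s ^ 5))"
      using van_cmult[OF van_leading[OF assms(1)], of \<epsilon>] by simp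
  qed (simp add: x_def algebra_simps)
  from root_perturb[OF this _ _ h H(4,6)]
  have "van (2 + 2) (\<lambda>s. H s - s - (- (\<epsilon> * tc y 5) / real 3) * s ^ (2 + 1))" by simp
  from compose_perturb[OF assms(1) h(1) this]
  have v: "van 8 (\<lambda>s. y (H s) - y s - real 5 * (- (\<epsilon> * tc y 5) / real 3) * tc y 5 * s ^ 7)" by simp
  have yH: "smooth_germ (\<lambda>s. y (H s))" by (rule smooth_germ_compose[OF h(1) y h(2)])
  have "tc (\<lambda>s. y (H s) - y s - real 5 * (- (\<epsilon> * tc y 5) / real 3) * tc y 5 * s ^ 7) 7 =
      tc (\<lambda>s. y (H s)) 7 - tc y 7 - real 5 * (- (\<epsilon> * tc y 5) / real 3) * tc y 5"
    by (simp only: tc_diff tc_monom smooth_germ_intros yH y) simp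
  with van_tc[OF v, of 7] have "tc (\<lambda>s. y (H s)) 7 = 0"
    using assms(2) by (simp add: \<epsilon>_def field_simps power2_eq_square)
  moreover have "tc (\<lambda>s. y (H s)) 5 \<noteq> 0"
    using tc_compose_leading[OF assms(1) h] H(4) assms(2) by simp
  ultimately have E: "A_equiv (\<lambda>s. (s ^ 3, y (H s))) (\<lambda>t. (t ^ 3, t ^ 5))"
    using van_compose[OF assms(1) h] by (intro E8_normal_form_aux)
  have "A_equiv (\<lambda>s. (s ^ 3, y s)) (\<lambda>t. (x t, y t))"
    using A_equiv_push[OF diffeo_germ_shear[of \<epsilon>], of "\<lambda>s. (s ^ 3, y s)"]
    by (simp add: x_def smooth_germ_intros y y0 zero_prod_def)
  moreover have "A_equiv (\<lambda>t. (x t, y t)) (\<lambda>s. (s ^ 3, y (H s)))"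
    by (rule A_equiv_reparam[OF H(2)]) (use H(6) in simp)
  ultimately show ?thesis by (rule A_equiv_trans[OF A_equiv_trans[OF _ _] E])
qed

section \<open>The types W#\<close>

lemma smooth_germ_power_compose:
  fixes a :: "real \<Rightarrow> real"
  assumes "smooth_germ a" "n \<ge> 1" shows "smooth_germ (\<lambda>t. a (t ^ n))"
  by (rule smooth_germ_compose[OF smooth_germ_power[OF smooth_germ_ident] assms(1)])
     (use assms(2) in \<open>simp add: power_0_left\<close>)

text \<open>Sort the degrees modulo 4. The even part is p_0 (s^4) + s^6 u (s^4), and Y \<mapsto> p_0
  (X) + Y u (X) produces it from s^6. Dividing the odd part by u leaves two series, in the degrees
  congruent to 2q+5 and to 2q+7.\<close>

lemma W_normalise_even:
  assumes "van 6 y" "tc y 6 \<noteq> 0" "\<And>i. i < q + 2 \<Longrightarrow> tc y (2 * i + 1) = 0"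
  obtains B D where "smooth_germ B" "smooth_germ D" "B 0 = tc y (2 * q + 5) / tc y 6"
    "D 0 = tc y (2 * q + 7) / tc y 6"
    "A_equiv (\<lambda>s. (s ^ 4, y s))
       (\<lambda>s. (s ^ 4, s ^ 6 + s ^ (2 * q + 5) * B (s ^ 4) + s ^ (2 * q + 7) * D (s ^ 4)))"
proof -
  note y = van_smooth[OF assms(1)]
  have ty: "tc y i = 0" if "i < 6" for i using van_tc[OF assms(1) that] .
  obtain a where a: "\<forall>i. smooth_germ (a i)" "\<forall>i j. tc (a i) j = tc y (i + 2 * j)"
    "\<forall>\<^sub>F t in nhds 0. y t = (\<Sum>i<2. t ^ i * a i (t ^ 2))"
    using decomposition[OF y order_refl] .
  have "van (q + 2) (a 1)"
    unfolding van_iff_tc using spec[OF a(1), of 1] spec[OF a(2), of 1] assms(3) by simp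
  from van_factor[OF this]
  obtain Q where Q: "smooth_germ Q" "\<forall>\<^sub>F t in nhds 0. a 1 t = t ^ (q + 2) * Q t"
    "\<forall>i. tc Q i = tc (a 1) (q + 2 + i)" .
  obtain p where p: "\<forall>i. smooth_germ (p i)" "\<forall>i j. tc (p i) j = tc (a 0) (i + 2 * j)"
    "\<forall>\<^sub>F t in nhds 0. a 0 t = (\<Sum>i<2. t ^ i * p i (t ^ 2))"
    using decomposition[OF spec[OF a(1), of 0] order_refl] .
  obtain b where b: "\<forall>i. smooth_germ (b i)" "\<forall>i j. tc (b i) j = tc Q (i + 2 * j)"
    "\<forall>\<^sub>F t in nhds 0. Q t = (\<Sum>i<2. t ^ i * b i (t ^ 2))"
    using decomposition[OF Q(1) order_refl] .
  \<comment> \<open>The constant term of \<open>p 1\<close> is the coefficient of y in degree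
    2.\<close>
  have "van 1 (p 1)" 
    unfolding van_iff_tc using spec[OF p(1), of 1] spec[OF spec[OF p(2), of 1], of 0]
      spec[OF spec[OF a(2), of 0], of 1] ty by simp
  from van_factor[OF this]
  obtain u where u: "smooth_germ u" "\<forall>\<^sub>F t in nhds 0. p 1 t = t ^ 1 * u t" "\<forall>i. tc u i = tc (p 1) (1 + i)" .
  have p0: "p 0 0 = 0"
    using spec[OF spec[OF p(2), of 0], of 0] spec[OF spec[OF a(2), of 0], of 0] ty[of 0] by (simp add: tc_0)
  have u0: "u 0 = tc y 6"
    using spec[OF u(3), of 0] spec[OF spec[OF p(2), of 1], of 1] spec[OF spec[OF a(2), of 0], of 3]
    by (simp add: tc_0 eval_nat_numeral)
  have b0: "b 0 0 = tc y (2 * q + 5)"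
    using spec[OF spec[OF b(2), of 0], of 0] spec[OF Q(3), of 0] spec[OF spec[OF a(2), of 1], of "q + 2"]
    by (simp add: tc_0 algebra_simps eval_nat_numeral)
  have b1: "b 1 0 = tc y (2 * q + 7)"
    using spec[OF spec[OF b(2), of 1], of 0] spec[OF Q(3), of 1] spec[OF spec[OF a(2), of 1], of "q + 3"]
    by (simp add: tc_0 algebra_simps eval_nat_numeral)
  define B where "B r = b 0 r / u r" for r
  define D where "D r = b 1 r / u r" for r
  have u0': "u 0 \<noteq> 0" using u0 assms(2) by simp
  have B: "smooth_germ B" and D: "smooth_germ D"
    unfolding B_def[abs_def] D_def[abs_def] by (intro smooth_germ_divide spec[OF b(1)] u(1) u0')+
  define F where "F z = p 0 (fst z) + snd z * u (fst z)" for z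
  have "diffeo_germ (\<lambda>z. (fst z, F z))"
  proof (rule diffeo_germ_fibred)
    show "smooth_germ F" unfolding F_def[abs_def]
      by (intro smooth_germ_intros smooth_germ_fst_compose u(1) spec[OF p(1)])
    show "((\<lambda>s. F (0, s)) has_real_derivative u 0) (at 0)"
      unfolding F_def by (auto intro!: derivative_eq_intros)
  qed (use u0' p0 in \<open>simp_all add: F_def\<close>)
  then have "A_equiv (\<lambda>s. (s ^ 4, y s))
       (\<lambda>s. (s ^ 4, s ^ 6 + s ^ (2 * q + 5) * B (s ^ 4) + s ^ (2 * q + 7) * D (s ^ 4)))"
  proof (rule A_equiv_left)
    have sq: "smooth_germ (\<lambda>t::real. t ^ 2)" "(\<lambda>t::real. t ^ 2) 0 = 0"
      and qu: "smooth_germ (\<lambda>t::real. t ^ 4)" "(\<lambda>t::real. t ^ 4) 0 = 0"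
      by (auto intro: smooth_germ_intros)
    have une: "\<forall>\<^sub>F t in nhds 0. u (t ^ 4) \<noteq> 0"
      by (rule eventually_compose_germ[OF smooth_germ_eventually_ne[OF u(1) u0'] qu])
    show "\<forall>\<^sub>F s in nhds 0. (s ^ 4, y s) =
      (fst (s ^ 4, s ^ 6 + s ^ (2 * q + 5) * B (s ^ 4) + s ^ (2 * q + 7) * D (s ^ 4)),
       F (s ^ 4, s ^ 6 + s ^ (2 * q + 5) * B (s ^ 4) + s ^ (2 * q + 7) * D (s ^ 4)))"
      using a(3) eventually_compose_germ[OF Q(2) sq] eventually_compose_germ[OF p(3) sq]
        eventually_compose_germ[OF b(3) sq] eventually_compose_germ[OF u(2) qu] une
    proof eventually_elim
      case (elim s)
      have e: "(s ^ 2) ^ 2 = s ^ 4" by (simp flip: power_mult)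
      have two: "(\<Sum>i<2. f i) = f 0 + f 1" for f :: "nat \<Rightarrow> real" by (simp add: numeral_2_eq_2)
      have "y s = a 0 (s ^ 2) + s * a 1 (s ^ 2)" using elim(1) unfolding two by simp
      also have "a 0 (s ^ 2) = p 0 (s ^ 4) + s ^ 2 * (s ^ 4 * u (s ^ 4))"
        using elim(3,5) unfolding two e by simp
      also have "a 1 (s ^ 2) = (s ^ 2) ^ (q + 2) * (b 0 (s ^ 4) + s ^ 2 * b 1 (s ^ 4))"
        using elim(2,4) unfolding two e by simp
      finally have "y s = p 0 (s ^ 4) + s ^ 2 * (s ^ 4 * u (s ^ 4)) +
          s * ((s ^ 2) ^ (q + 2) * (b 0 (s ^ 4) + s ^ 2 * b 1 (s ^ 4)))" .
      then have "y s = p 0 (s ^ 4) + (s ^ 2 * s ^ 4) * u (s ^ 4) + (s * (s ^ 2) ^ (q + 2)) * b 0 (s ^ 4) +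
          (s * (s ^ 2) ^ (q + 2) * s ^ 2) * b 1 (s ^ 4)"
        by (simp only: distrib_left mult.assoc add.assoc)
      moreover have "s * (s ^ 2) ^ (q + 2) = s ^ (2 * q + 5)"
      proof -
        have "s * (s ^ 2) ^ (q + 2) = s ^ Suc (2 * (q + 2))" by (simp only: power_mult power_Suc)
        also have "Suc (2 * (q + 2)) = 2 * q + 5" by simp
        finally show ?thesis .
      qed
      moreover have "s ^ (2 * q + 5) * s ^ 2 = s ^ (2 * q + 7)" "s ^ 2 * s ^ 4 = s ^ 6"
        by (simp_all add: power_add[symmetric] add.commute)
      ultimately have "y s = p 0 (s ^ 4) + s ^ 6 * u (s ^ 4) + s ^ (2 * q + 5) * b 0 (s ^ 4) +
          s ^ (2 * q + 7) * b 1 (s ^ 4)" by (simp only:)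
      then show ?case using elim(6) by (simp add: F_def B_def D_def field_simps)
    qed
  qed
  then show thesis by (rule that[OF B D, rotated 2]) (simp_all only: B_def D_def b0 b1 u0)
qed

text \<open>The plane diffeomorphism below restricts on the cusp \<open>(r\<^sup>2, r\<^sup>3)\<close> to the projective
  change of parameter \<open>r \<mapsto> r / (1 + e r)\<close>.\<close>

lemma cusp_diffeo:
  fixes e :: real
  defines "P \<equiv> (\<lambda>p. (fst p - 2 * e * snd p + e\<^sup>2 * fst p ^ 2) / (1 - e\<^sup>2 * fst p) ^ 2)"
    and "Q \<equiv> (\<lambda>p. (snd p - 3 * e * fst p ^ 2 + 3 * e\<^sup>2 * fst p * snd p - e ^ 3 * fst p ^ 3) / (1 - e\<^sup>2 * fst p) ^ 3)"
  shows "diffeo_germ (\<lambda>p. (P p, Q p))"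
proof (rule diffeo_germ_plane)
  show "smooth_germ P" "smooth_germ Q"
    unfolding P_def Q_def by (intro smooth_germ_intros; simp)+
  show "(P has_derivative (\<lambda>v. fst v - 2 * e * snd v)) (at 0)"
    unfolding P_def by (rule derivative_eq_intros refl | simp)+
  show "(Q has_derivative snd) (at 0)"
    unfolding Q_def by (rule derivative_eq_intros refl | simp)+
qed (simp_all add: P_def Q_def)

text \<open>A fibred change cannot reach degree 2q+7. The projective map of the cusp, followed by
  the reparametrization that undoes it there, fixes (t^4, t^6) and acts only on the remainder R. It
  moves the coefficient in question twice: through R (h t), and through the term of degree 2q+5 that
  R brings into the first component.\<close>

lemma W_shift:
  assumes q: "q \<ge> 1" and R: "van (2 * q + 5) R" "tc R (2 * q + 5) = c" "tc R (2 * q + 6) = 0" "c \<noteq> 0"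
  obtains y where "A_equiv (\<lambda>t. (t ^ 4, t ^ 6 + R t)) (\<lambda>s. (s ^ 4, y s))" "van 6 y" "tc y 6 = 1"
    "\<forall>i<q + 2. tc y (2 * i + 1) = 0" "tc y (2 * q + 5) = c" "tc y (2 * q + 7) = 0"
proof -
  define n where "n = 2 * q + 5"
  define c' where "c' = tc R (n + 2)"
  \<comment> \<open>With n = 2q + 5 the new coefficient in degree n + 2 is c' + n e c / 2 + 3 e c;
    this value of e makes it vanish.\<close>
  define e where "e = - (2 * c') / (c * (2 * real q + 11))"
  note smR = van_smooth[OF R(1)]
  \<comment> \<open>In terms of r = h^2 and \<rho> = t^2 the reparametrization is r = \<rho> / (1 -
    e \<rho>), the inverse of r \<mapsto> r / (1 + e r).\<close>
  define w where "w t = (1 - e * t ^ 2) powr (- 1 / 2)" for t :: real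
  define h where "h t = t * w t" for t
  have sw: "smooth_germ w" unfolding w_def[abs_def] by (intro smooth_germ_powr smooth_germ_intros) simp
  have w0: "w 0 = 1" by (simp add: w_def)
  have sh: "smooth_germ h" "h 0 = 0" unfolding h_def[abs_def] by (auto intro!: smooth_germ_intros sw)
  have h1: "tc h 1 = 1" using tc_shift[OF sw, of 1 1] by (simp add: h_def[abs_def] tc_0 w0)
  have dh: "diffeo_germ h" by (rule diffeo_germ_real[OF sh]) (use h1 in \<open>simp add: tc_def\<close>)
  have wsq: "\<forall>\<^sub>F t in nhds 0. w t ^ 2 * (1 - e * t ^ 2) = 1 \<and> 1 - e * t ^ 2 > 0"
  proof -
    have "\<forall>\<^sub>F t in nhds 0. 1 - e * t ^ 2 > (0::real)"
      by (rule order_tendstoD(1)[OF smooth_germ_tendsto]) (auto intro!: smooth_germ_intros)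
    then show ?thesis
    proof eventually_elim
      case (elim t)
      then have "w t ^ 2 = (1 - e * t ^ 2) powr (- 1)"
        by (simp add: w_def powr_powr flip: powr_realpow)
      then show ?case using elim by (simp add: powr_minus)
    qed
  qed
  \<comment> \<open>The expansion of w comes from (w - 1) (w + 1) = w^2 - 1 = e t^2 w^2 by dividing
    by the unit w + 1, whose value at 0 is 2.\<close>
  have hx: "van (2 + 2) (\<lambda>t. h t - t - e / 2 * t ^ (2 + 1))"
  proof -
    have "van (2 + 1) (\<lambda>t. (e * t ^ 2) * (w t ^ 2 - (w t + 1) / 2))"
      by (rule van_mult[OF van_monom[OF order_refl] van_1I]) (auto intro!: smooth_germ_intros sw simp: w0)
    then have "van 3 (\<lambda>t. (e * t ^ 2) * (w t ^ 2 - (w t + 1) / 2))" by (subst (asm) numeral_plus_one) (simp only: semiring_norm)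
    then have "van 3 (\<lambda>t. (w t - 1 - e / 2 * t ^ 2) * (w t + 1))"
    proof (rule van_cong)
      show "\<forall>\<^sub>F t in nhds 0. (w t - 1 - e / 2 * t ^ 2) * (w t + 1) = (e * t ^ 2) * (w t ^ 2 - (w t + 1) / 2)"
        using wsq
      proof eventually_elim
        case (elim t)
        then have "w t ^ 2 - 1 = e * t ^ 2 * w t ^ 2" by (simp add: algebra_simps)
        then show ?case by (simp add: field_simps power2_eq_square)
      qed
    qed
    then have "van 3 (\<lambda>t. w t - 1 - e / 2 * t ^ 2)"
      by (rule van_unit) (auto intro!: smooth_germ_intros sw simp: w0)
    from van_mult[OF van_power_id[OF order_refl, of 1] this]
    have "van (2 + 2) (\<lambda>t. t ^ 1 * (w t - 1 - e / 2 * t ^ 2))" by simp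
    then show ?thesis by (rule van_eq) (simp add: h_def algebra_simps power2_eq_square power3_eq_cube)
  qed
  have hsq: "\<forall>\<^sub>F t in nhds 0. h t ^ 2 * (1 - e * t ^ 2) = t ^ 2 \<and> 1 - e * t ^ 2 > 0"
    using wsq
  proof eventually_elim
    case (elim t)
    have "h t ^ 2 * (1 - e * t ^ 2) = t ^ 2 * (w t ^ 2 * (1 - e * t ^ 2))"
      by (simp only: h_def power_mult_distrib mult.assoc)
    then show ?case using elim by simp
  qed
  define d where "d t = 1 - e\<^sup>2 * h t ^ 4" for t
  have sd: "smooth_germ d" unfolding d_def[abs_def] by (intro smooth_germ_intros sh)
  have d0: "d 0 = 1" by (simp add: d_def sh)
  have dev: "\<forall>\<^sub>F t in nhds 0. d t \<noteq> 0" by (rule smooth_germ_eventually_ne[OF sd]) (simp add: d0)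
  have Rh: "smooth_germ (\<lambda>t. R (h t))" by (rule smooth_germ_compose[OF sh(1) smR sh(2)])
  \<comment> \<open>The contributions to the two components that contain R; those free of R add up
    to exactly t^4 and t^6.\<close>
  define A where "A t = - (2 * e) * R (h t) / d t ^ 2" for t
  define G where "G t = R (h t) * (1 + 3 * e\<^sup>2 * h t ^ 4) / d t ^ 3" for t
  have sA: "smooth_germ A" and sG: "smooth_germ G"
    unfolding A_def[abs_def] G_def[abs_def] by (intro smooth_germ_intros Rh sd sh(1); simp add: d0)+
  have E1: "A_equiv (\<lambda>t. (t ^ 4, t ^ 6 + R t)) (\<lambda>t. (t ^ 4 + A t, t ^ 6 + G t))"
  proof -
    define P where "P \<equiv> (\<lambda>p. (fst p - 2 * e * snd p + e\<^sup>2 * fst p ^ 2) / (1 - e\<^sup>2 * fst p) ^ 2)"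
    define Q where "Q \<equiv> (\<lambda>p. (snd p - 3 * e * fst p ^ 2 + 3 * e\<^sup>2 * fst p * snd p - e ^ 3 * fst p ^ 3) / (1 - e\<^sup>2 * fst p) ^ 3)"
    let ?f = "\<lambda>t. (t ^ 4, t ^ 6 + R t)"
    have f: "smooth_germ ?f" by (intro smooth_germ_intros smR)
    have "van (Suc (2 * q + 4)) R" using R(1) by (simp add: eval_nat_numeral)
    then have f0: "?f 0 = 0" using van_1D[of "2 * q + 4" R] by (simp add: zero_prod_def)
    have "A_equiv ?f (\<lambda>t. (P (?f t), Q (?f t)))"
      using A_equiv_push[OF cusp_diffeo[of e] f f0] by (simp only: P_def Q_def)
    moreover have "A_equiv (\<lambda>t. (P (?f t), Q (?f t))) (\<lambda>t. (t ^ 4 + A t, t ^ 6 + G t))"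
    proof (rule A_equiv_reparam[OF dh])
      show "\<forall>\<^sub>F t in nhds 0. (P (?f (h t)), Q (?f (h t))) = (t ^ 4 + A t, t ^ 6 + G t)"
        using hsq dev
      proof eventually_elim
        case (elim t)
        define r where "r = h t ^ 2"
        define \<rho> where "\<rho> = t ^ 2"
        have r: "r * (1 - e * \<rho>) = \<rho>" "1 - e * \<rho> > 0" using elim(1) by (simp_all add: r_def \<rho>_def)
        have pw: "h t ^ 4 = r ^ 2" "h t ^ 6 = r ^ 3" "t ^ 4 = \<rho> ^ 2" "t ^ 6 = \<rho> ^ 3"
          by (simp_all add: r_def \<rho>_def flip: power_mult)
        have "(1 + e * r) * (1 - e * \<rho>) = (1 - e * \<rho>) + e * (r * (1 - e * \<rho>))"
          by (simp add: algebra_simps)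
        then have "(1 + e * r) * (1 - e * \<rho>) = 1" using r(1) by simp
        then have er: "1 + e * r \<noteq> 0" by auto
        have \<rho>r: "\<rho> * (1 + e * r) = r" using r(1) by (simp add: algebra_simps)
        have dd: "d t = (1 - e * r) * (1 + e * r)" by (simp add: d_def pw power2_eq_square algebra_simps)
        then have er': "1 - e * r \<noteq> 0" using elim(2) d0 by auto
        have "(r ^ 2 - 2 * e * r ^ 3 + e\<^sup>2 * (r ^ 2) ^ 2) = r ^ 2 * (1 - e * r) ^ 2"
          by (simp add: power2_eq_square power3_eq_cube algebra_simps)
        also have "\<dots> = \<rho> ^ 2 * d t ^ 2"
          unfolding dd by (subst \<rho>r[symmetric]) (simp add: power_mult_distrib)
        finally have 1: "(r ^ 2 - 2 * e * r ^ 3 + e\<^sup>2 * (r ^ 2) ^ 2) = \<rho> ^ 2 * d t ^ 2" .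
        have "(r ^ 3 - 3 * e * (r ^ 2) ^ 2 + 3 * e\<^sup>2 * r ^ 2 * r ^ 3 - e ^ 3 * (r ^ 2) ^ 3) = r ^ 3 * (1 - e * r) ^ 3"
          by (simp add: power2_eq_square power3_eq_cube algebra_simps)
        also have "\<dots> = \<rho> ^ 3 * d t ^ 3"
          unfolding dd by (subst \<rho>r[symmetric]) (simp add: power_mult_distrib)
        finally have 2: "(r ^ 3 - 3 * e * (r ^ 2) ^ 2 + 3 * e\<^sup>2 * r ^ 2 * r ^ 3 - e ^ 3 * (r ^ 2) ^ 3) = \<rho> ^ 3 * d t ^ 3" .
        have dne: "d t \<noteq> 0" using er er' dd by simp
        have de: "1 - e\<^sup>2 * r ^ 2 = d t" by (simp add: d_def pw)
        have "P (?f (h t)) = (\<rho> ^ 2 * d t ^ 2 - 2 * e * R (h t)) / d t ^ 2"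
          unfolding P_def by (simp add: pw de 1[symmetric] algebra_simps)
        moreover have "Q (?f (h t)) = (\<rho> ^ 3 * d t ^ 3 + R (h t) * (1 + 3 * e\<^sup>2 * r ^ 2)) / d t ^ 3"
          unfolding Q_def by (simp add: pw de 2[symmetric] algebra_simps)
        ultimately show ?case
          using dne by (simp add: A_def G_def pw add_divide_distrib diff_divide_distrib)
      qed
    qed
    ultimately show ?thesis by (rule A_equiv_trans)
  qed
  have vR: "van n R" using R(1) by (simp add: n_def)
  have vRh: "van n (\<lambda>t. R (h t))" by (rule van_compose[OF vR sh])
  have h4: "van 4 (\<lambda>t. h t ^ 4)" by (rule van_power[OF van_1I[OF sh]])
  have Rh3: "van (n + 3) (\<lambda>t. R (h t) - R t - real n * (e / 2) * c * t ^ (n + 2))"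
  proof -
    have "tc R n = c" using R(2) by (simp add: n_def)
    then show ?thesis
      using compose_perturb[OF vR sh(1) hx] by (simp add: numeral_3_eq_3)
  qed
  have Rx: "van (n + 3) (\<lambda>t. R t - c * t ^ n - c' * t ^ (n + 2))"
    unfolding van_iff_tc
  proof (intro conjI allI impI)
    show s: "smooth_germ (\<lambda>t. R t - c * t ^ n - c' * t ^ (n + 2))" by (intro smooth_germ_intros smR)
    fix i assume "i < n + 3"
    have "tc (\<lambda>t. R t - c * t ^ n - c' * t ^ (n + 2)) i =
        tc R i - (if i = n then c else 0) - (if i = n + 2 then c' else 0)"
      by (simp only: tc_diff tc_monom smooth_germ_intros smR)
    moreover have "tc R i = (if i = n then c else 0) + (if i = n + 2 then c' else 0)"
    proof -
      consider "i < n" | "i = n" | "i = n + 1" | "i = n + 2" using \<open>i < n + 3\<close> by linarith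
      then show ?thesis
        using van_tc[OF vR, of i] R(2,3) by cases (auto simp: n_def c'_def add.commute)
    qed
    ultimately show "tc (\<lambda>t. R t - c * t ^ n - c' * t ^ (n + 2)) i = 0" by simp
  qed
  define c2 where "c2 = c' + real n * (e / 2) * c"
  have Rhx: "van (n + 3) (\<lambda>t. R (h t) - c * t ^ n - c2 * t ^ (n + 2))"
    by (rule van_eq[OF van_add[OF Rh3 Rx]]) (simp add: c2_def algebra_simps)
  have vd: "van 4 (\<lambda>t. d t - 1)"
    by (rule van_eq[OF van_cmult[OF h4, of "- e\<^sup>2"]]) (simp add: d_def)
  have Gx: "van (n + 3) (\<lambda>t. G t - c * t ^ n - c2 * t ^ (n + 2))"
  proof -
    define v where "v t = (1 + 3 * e\<^sup>2 * h t ^ 4) / d t ^ 3" for t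
    have sv: "smooth_germ v" unfolding v_def[abs_def] by (intro smooth_germ_intros sd sh(1)) (simp add: d0)
    have "van 4 (\<lambda>t. 3 * e\<^sup>2 * h t ^ 4 - (d t - 1) * (d t ^ 2 + d t + 1))"
      by (intro van_diff van_cmult h4 van_mult_right[OF vd] smooth_germ_intros sd)
    then have "van 4 (\<lambda>t. (v t - 1) * d t ^ 3)"
      by (rule van_cong) (use dev in \<open>eventually_elim,
        simp add: v_def field_simps power2_eq_square power3_eq_cube\<close>)
    then have "van 4 (\<lambda>t. v t - 1)"
      by (rule van_unit) (auto intro!: smooth_germ_intros sd simp: d0)
    from van_mono[OF van_mult[OF vRh this], of "n + 3"]
    have "van (n + 3) (\<lambda>t. R (h t) * (v t - 1))" by simp
    from van_add[OF this Rhx] show ?thesis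
      by (rule van_eq) (simp add: G_def v_def algebra_simps)
  qed
  have vG: "van n G" unfolding G_def[abs_def] times_divide_eq_right[symmetric]
    by (rule van_mult_right[OF vRh]) (intro smooth_germ_intros sh(1) sd, simp add: d0)
  have vA: "van n A"
    unfolding A_def[abs_def] divide_inverse
    by (rule van_mult_right[OF van_cmult[OF vRh]]) (intro smooth_germ_inverse smooth_germ_intros sd, simp add: d0)
  have tA: "tc A n = - 2 * e * c"
  proof -
    have "van (n + 1) (\<lambda>t. A t * d t ^ 2 - (- 2 * e * c) * t ^ n)"
    proof (rule van_cong)
      show "van (n + 1) (\<lambda>t. - (2 * e) * (R (h t) - c * t ^ n - c2 * t ^ (n + 2)) + - (2 * e * c2) * t ^ (n + 2))"
        by (intro van_add van_cmult van_mono[OF Rhx] van_power_id) simp_all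
      show "\<forall>\<^sub>F t in nhds 0. A t * d t ^ 2 - (- 2 * e * c) * t ^ n =
          - (2 * e) * (R (h t) - c * t ^ n - c2 * t ^ (n + 2)) + - (2 * e * c2) * t ^ (n + 2)"
        using dev
        by eventually_elim (simp add: A_def algebra_simps)
    qed
    moreover have "van (n + 1) (\<lambda>t. A t * (d t ^ 2 - 1))"
      by (rule van_mult[OF vA van_1I]) (auto intro!: smooth_germ_intros sd simp: d0)
    ultimately have "van (n + 1) (\<lambda>t. A t - (- 2 * e * c) * t ^ n)"
      by (rule van_eq[OF van_diff]) (simp add: algebra_simps)
    then have "tc A n = tc (\<lambda>t. (- 2 * e * c) * t ^ n) n"
      by (rule tc_eq[OF _ sA]) (intro smooth_germ_intros, simp)
    then show ?thesis by (simp only: tc_monom if_True refl)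
  qed
  \<comment> \<open>The error A has order n = 4 + j and leading coefficient - 2 e c. So the fourth
    root of t^4 + A moves the parameter by (e c / 2) s^(j+1), which moves s^6 by 3 e c
    s^(n+2).\<close>
  define j where "j = 2 * q + 1"
  have n: "n = 4 + j" by (simp add: n_def j_def)
  define x where "x t = t ^ 4 + A t" for t
  have xx: "van (4 + j + 1) (\<lambda>t. x t - t ^ 4 - (- 2 * e * c) * t ^ (4 + j))"
    using van_leading[OF vA] unfolding tA by (simp add: x_def n)
  have vx: "van 4 x" unfolding x_def[abs_def]
    by (intro van_add van_power_id van_mono[OF vA]) (simp_all add: n)
  have tx: "tc x 4 = 1"
    unfolding x_def[abs_def] using tc_monom[of 1 4 4] van_tc[OF vA, of 4]
    by (simp add: tc_add smooth_germ_intros sA n j_def)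
  obtain S H where H: "diffeo_germ S" "diffeo_germ H" "tc S 1 = 1" "tc H 1 = 1"
    "\<forall>\<^sub>F t in nhds 0. S t ^ 4 = x t" "\<forall>\<^sub>F s in nhds 0. x (H s) = s ^ 4"
    "\<forall>\<^sub>F t in nhds 0. H (S t) = t" "\<forall>\<^sub>F s in nhds 0. S (H s) = s"
    using root_reparam[OF vx tx one_le_numeral] .
  note sH = diffeo_germD[OF H(2)]
  have j1: "1 \<le> j" by (simp add: j_def)
  have Hx: "van (j + 2) (\<lambda>s. H s - s - e * c / 2 * s ^ (j + 1))"
    using root_perturb[OF xx _ j1 sH H(4,6)] by (simp add: mult_ac)
  have H6: "van (n + 3) (\<lambda>s. H s ^ 6 - s ^ 6 - 3 * e * c * s ^ (n + 2))"
  proof -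
    have t6: "tc (\<lambda>s::real. s ^ 6) 6 = 1" using tc_monom[of 1 6 6] by simp
    have idx: "6 + j + 1 = n + 3" "6 + j = n + 2" by (simp_all add: n)
    have "van (n + 3) (\<lambda>s. H s ^ 6 - s ^ 6 - real 6 * (e * c / 2) * 1 * s ^ (n + 2))"
      using compose_perturb[OF van_power_id[OF order_refl, of 6] sH(1) Hx j1] unfolding idx t6
      by (simp only: add.assoc one_plus_numeral numeral_plus_one semiring_norm)
    then show ?thesis by (rule van_eq) (simp add: field_simps)
  qed
  \<comment> \<open>Here q \<ge> 1 enters: the difference has order n + j, and j = 2q + 1 \<ge>
    3.\<close>
  have HG: "van (n + 3) (\<lambda>s. G (H s) - G s)"
  proof -
    have "van (n + j) (\<lambda>s. G (H s) - G s - real n * (e * c / 2) * tc G n * s ^ (n + j) +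
        real n * (e * c / 2) * tc G n * s ^ (n + j))"
      using van_mono[OF compose_perturb[OF vG sH(1) Hx j1], of "n + j"] by (intro van_add van_monom) simp_all
    then have *: "van (n + j) (\<lambda>s. G (H s) - G s)" by simp
    show ?thesis using van_mono[OF *, of "n + 3"] q by (simp add: j_def)
  qed
  define y where "y s = H s ^ 6 + G (H s)" for s
  have c3: "c2 = - (3 * e * c)"
  proof -
    have "c * (2 * real q + 11) \<noteq> 0" using R(4) by (simp add: add_nonneg_eq_0_iff)
    then have "e * (c * (2 * real q + 11)) = - (2 * c')" by (simp add: e_def)
    then show ?thesis by (simp add: c2_def n_def algebra_simps)
  qed
  have yx: "van (n + 3) (\<lambda>s. y s - (1 * s ^ 6 + c * s ^ n))"
    by (rule van_eq[OF van_add[OF van_add[OF H6 HG] Gx]])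
       (simp add: y_def c3 algebra_simps)
  have sy: "smooth_germ y"
    unfolding y_def[abs_def] by (intro smooth_germ_intros sH(1) smooth_germ_compose[OF sH(1) sG sH(2)])
  have ty: "tc y i = (if i = 6 then 1 else 0) + (if i = n then c else 0)" if "i < n + 3" for i
    using tc_eq[OF yx sy _ that] by (simp only: tc_add tc_monom smooth_germ_intros)
  have "A_equiv (\<lambda>t. (t ^ 4 + A t, t ^ 6 + G t)) (\<lambda>s. (s ^ 4, y s))"
    by (rule A_equiv_reparam[OF H(2)]) (use H(6) in eventually_elim, simp add: x_def y_def)
  from A_equiv_trans[OF E1 this] show thesis
  proof (rule that)
    show "van 6 y" unfolding van_iff_tc using sy ty q by (simp add: n_def)
    show "\<forall>i<q + 2. tc y (2 * i + 1) = 0"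
    proof (intro allI impI)
      fix i assume "i < q + 2"
      moreover have "2 * i + 1 \<noteq> 6" by presburger
      ultimately show "tc y (2 * i + 1) = 0" using ty[of "2 * i + 1"] by (simp add: n_def)
    qed
  qed (use ty q in \<open>simp_all add: n_def\<close>)
qed

text \<open>The dilation s \<mapsto> s p (s^4), compensated in the plane with the weights 4 and 6,
  multiplies the coefficient of s^(2q+5) by p^(2q-1) relative to that of s^6. It is normalised not
  to 1 but to 1 plus a term of order q + 1 in s^4: the free constant e of that term is what makes 2
  E 0 + D' 0 vanish, as \<open>W_absorb\<close> demands.\<close>

lemma W_unit_coefficient:
  assumes "q \<ge> 1" "smooth_germ B" "smooth_germ D" "B 0 > 0"
  obtains E D' where "smooth_germ E" "smooth_germ D'" "2 * E 0 + D' 0 = 0"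
    "A_equiv (\<lambda>t. (t ^ 4, t ^ 6 + t ^ (2 * q + 5) * B (t ^ 4) + t ^ (2 * q + 11) * D (t ^ 4)))
       (\<lambda>s. (s ^ 4, s ^ 6 + s ^ (2 * q + 5) * (1 + s ^ (4 * (q + 1)) * E (s ^ 4)) + s ^ (2 * q + 11) * D' (s ^ 4)))"
proof -
  define N where "N = 2 * q - 1"
  have N: "N \<ge> 1" using assms(1) by (simp add: N_def)
  define p0 where "p0 = inverse (B 0 powr (1 / real N))"
  have p0: "p0 > 0" using assms(4) by (simp add: p0_def)
  \<comment> \<open>In the end E 0 = e p0^(4(q+1)) and D' 0 = D 0 p0^(2q+5), which dictates this
    value.\<close>
  define e where "e = - (D 0 * p0 ^ (2 * q + 5)) / (2 * p0 ^ (4 * (q + 1)))"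
  define g where "g r = B r / (1 + e * r ^ (q + 1))" for r
  have g: "smooth_germ g" unfolding g_def[abs_def] by (intro smooth_germ_intros assms) simp
  have g0: "g 0 = B 0" by (simp add: g_def)
  define \<rho> where "\<rho> r = g r powr (1 / real N)" for r
  have \<rho>: "smooth_germ \<rho>" unfolding \<rho>_def[abs_def] by (rule smooth_germ_powr[OF g]) (simp add: g0 assms)
  have \<rho>0: "\<rho> 0 = inverse p0" by (simp add: \<rho>_def g0 p0_def)
  have \<rho>ev: "\<forall>\<^sub>F r in nhds 0. \<rho> r > 0 \<and> \<rho> r ^ N * (1 + e * r ^ (q + 1)) = B r"
  proof -
    have "\<forall>\<^sub>F r in nhds 0. g r > 0"
      by (rule order_tendstoD(1)[OF smooth_germ_tendsto[OF g]]) (simp add: g0 assms)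
    moreover have "\<forall>\<^sub>F r in nhds 0. 1 + e * r ^ (q + 1) \<noteq> 0"
      by (rule smooth_germ_eventually_ne) (auto intro!: smooth_germ_intros)
    ultimately show ?thesis
    proof eventually_elim
      case (elim r)
      have pos: "\<rho> r > 0" using elim(1) by (simp add: \<rho>_def)
      have "\<rho> r ^ N = \<rho> r powr real N" using pos by (simp add: powr_realpow)
      also have "\<dots> = g r" using elim(1) N by (simp add: \<rho>_def powr_powr)
      finally show ?case using pos elim(2) by (simp add: g_def)
    qed
  qed
  \<comment> \<open>The equation p^N B (\<Xi>) = 1 + e \<Xi>^(q+1) involves p also through the
    rescaled point \<Xi> = r p^4. As a function of that point, \<rho> = 1 / p is explicit; inverting
    the map \<open>\<Phi>\<close> returns to the variable r.\<close>
  define \<Phi> where "\<Phi> r = r * \<rho> r ^ 4" for r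
  have s\<Phi>: "smooth_germ \<Phi>" "\<Phi> 0 = 0" unfolding \<Phi>_def[abs_def] by (auto intro!: smooth_germ_intros \<rho>)
  have "tc \<Phi> 1 = \<rho> 0 ^ 4"
    using tc_shift[OF smooth_germ_power[OF \<rho>], of 1 4 1] by (simp add: \<Phi>_def[abs_def] tc_0)
  then have "deriv \<Phi> 0 \<noteq> 0" using p0 \<rho>0 by (simp add: tc_def)
  then have d\<Phi>: "diffeo_germ \<Phi>" by (rule diffeo_germ_real[OF s\<Phi>])
  obtain \<Xi> where \<Xi>: "diffeo_germ \<Xi>" "\<forall>\<^sub>F r in nhds 0. \<Xi> (\<Phi> r) = r" "\<forall>\<^sub>F r in nhds 0. \<Phi> (\<Xi> r) = r"
    using diffeo_germE[OF d\<Phi>] .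
  note s\<Xi> = diffeo_germD[OF \<Xi>(1)]
  define p where "p r = inverse (\<rho> (\<Xi> r))" for r
  have p: "smooth_germ p" unfolding p_def[abs_def]
    by (intro smooth_germ_inverse smooth_germ_compose[OF s\<Xi>(1) \<rho> s\<Xi>(2)]) (use p0 in \<open>simp add: s\<Xi> \<rho>0\<close>)
  have pz: "p 0 = p0" by (simp add: p_def s\<Xi> \<rho>0)
  have pev: "\<forall>\<^sub>F r in nhds 0. \<Xi> r = r * p r ^ 4 \<and> p r ^ N * B (\<Xi> r) = 1 + e * \<Xi> r ^ (q + 1)"
    using eventually_compose_germ[OF \<rho>ev s\<Xi>] \<Xi>(3)
  proof eventually_elim
    case (elim r)
    have "p r ^ N * B (\<Xi> r) = (p r ^ N * \<rho> (\<Xi> r) ^ N) * (1 + e * \<Xi> r ^ (q + 1))"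
      using elim(1) by (simp only: mult.assoc)
    also have "p r ^ N * \<rho> (\<Xi> r) ^ N = 1"
      using elim(1) by (simp add: p_def power_mult_distrib[symmetric])
    finally have 1: "p r ^ N * B (\<Xi> r) = 1 + e * \<Xi> r ^ (q + 1)" by simp
    have "r * p r ^ 4 = \<Xi> r * (\<rho> (\<Xi> r) ^ 4 * p r ^ 4)"
      using elim(2) by (simp only: \<Phi>_def mult.assoc[symmetric])
    also have "\<rho> (\<Xi> r) ^ 4 * p r ^ 4 = 1"
      using elim(1) by (simp add: p_def power_mult_distrib[symmetric])
    finally show ?case using 1 by simp
  qed
  define h where "h s = s * p (s ^ 4)" for s
  have sp: "smooth_germ (\<lambda>s. p (s ^ 4))" by (rule smooth_germ_power_compose[OF p]) simp
  have sh: "smooth_germ h" "h 0 = 0" unfolding h_def[abs_def] by (auto intro!: smooth_germ_intros sp)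
  have "tc h 1 = p0" using tc_shift[OF sp, of 1 1] by (simp add: h_def[abs_def] tc_0 pz)
  then have dh: "diffeo_germ h" using p0 by (intro diffeo_germ_real[OF sh]) (simp add: tc_def)
  have d\<psi>: "diffeo_germ (\<lambda>z::real \<times> real. (fst z * p (fst z) ^ 4, snd z * p (fst z) ^ 6))"
  proof (rule diffeo_germ_plane)
    have "(p has_derivative (*) (deriv p 0)) (at (fst (0::real \<times> real)))"
      using smooth_germ_deriv(3)[OF p] by (simp add: has_field_derivative_def)
    from has_derivative_compose[OF has_derivative_fst[OF has_derivative_ident] this]
    have pd: "((\<lambda>z::real \<times> real. p (fst z)) has_derivative (\<lambda>v. deriv p 0 * fst v)) (at 0)" .
    show "((\<lambda>z::real \<times> real. fst z * p (fst z) ^ 4) has_derivative (\<lambda>v. fst v * p0 ^ 4)) (at 0)"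
      by (rule derivative_eq_intros pd refl | simp add: pz)+
    show "((\<lambda>z::real \<times> real. snd z * p (fst z) ^ 6) has_derivative (\<lambda>v. snd v * p0 ^ 6)) (at 0)"
      by (rule derivative_eq_intros pd refl | simp add: pz)+
  qed (use p0 in \<open>auto intro!: smooth_germ_intros smooth_germ_fst_compose p\<close>)
  define E where "E r = e * p r ^ (4 * (q + 1))" for r
  define D' where "D' r = p r ^ (2 * q + 5) * D (\<Xi> r)" for r
  show thesis
  proof
    show "smooth_germ E" "smooth_germ D'" unfolding E_def[abs_def] D'_def[abs_def]
      by (intro smooth_germ_intros p smooth_germ_compose[OF s\<Xi>(1) assms(3) s\<Xi>(2)])+
    show "2 * E 0 + D' 0 = 0" using p0 by (simp add: E_def D'_def pz s\<Xi> e_def)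
    have qu: "smooth_germ (\<lambda>t::real. t ^ 4)" "(\<lambda>t::real. t ^ 4) 0 = 0" by (auto intro: smooth_germ_intros)
    show "A_equiv (\<lambda>t. (t ^ 4, t ^ 6 + t ^ (2 * q + 5) * B (t ^ 4) + t ^ (2 * q + 11) * D (t ^ 4)))
       (\<lambda>s. (s ^ 4, s ^ 6 + s ^ (2 * q + 5) * (1 + s ^ (4 * (q + 1)) * E (s ^ 4)) + s ^ (2 * q + 11) * D' (s ^ 4)))"
    proof (rule A_equivI[OF dh d\<psi>])
      let ?z = "\<lambda>s. (s ^ 4, s ^ 6 + s ^ (2 * q + 5) * (1 + s ^ (4 * (q + 1)) * E (s ^ 4)) + s ^ (2 * q + 11) * D' (s ^ 4))"
      show "\<forall>\<^sub>F s in nhds 0. (h s ^ 4, h s ^ 6 + h s ^ (2 * q + 5) * B (h s ^ 4) + h s ^ (2 * q + 11) * D (h s ^ 4)) =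
        (fst (?z s) * p (fst (?z s)) ^ 4, snd (?z s) * p (fst (?z s)) ^ 6)"
        using eventually_compose_germ[OF pev qu]
      proof eventually_elim
        case (elim s)
        define r where "r = s ^ 4"
        define P where "P = p r"
        define X where "X = \<Xi> r"
        have X: "X = r * P ^ 4" and PB: "P ^ N * B X = 1 + e * X ^ (q + 1)"
          using conjunct1[OF elim] conjunct2[OF elim] unfolding r_def X_def P_def .
        have h: "h s ^ k = s ^ k * P ^ k" for k by (simp add: h_def r_def P_def power_mult_distrib)
        have h4: "h s ^ 4 = X" using h[of 4] X by (simp add: r_def)
        have i: "2 * q + 5 = 6 + N" "2 * q + 11 = 6 + (2 * q + 5)" using assms(1) by (simp_all add: N_def)
        have "P ^ (2 * q + 5) * B X = P ^ 6 * (P ^ N * B X)" unfolding i(1) by (simp only: power_add mult.assoc)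
        also have "\<dots> = P ^ 6 * (1 + e * X ^ (q + 1))" by (simp only: PB)
        also have "X ^ (q + 1) = r ^ (q + 1) * P ^ (4 * (q + 1))"
          by (simp only: X power_mult_distrib power_mult)
        also have "e * (r ^ (q + 1) * P ^ (4 * (q + 1))) = r ^ (q + 1) * (e * P ^ (4 * (q + 1)))"
          by (simp only: mult_ac)
        finally have b: "P ^ (2 * q + 5) * B X = P ^ 6 * (1 + s ^ (4 * (q + 1)) * E r)"
          by (simp only: E_def P_def r_def power_mult)
        have d: "P ^ (2 * q + 11) * D X = P ^ 6 * D' r"
          unfolding i(2) power_add D'_def P_def X_def by (simp only: mult.assoc)
        have "h s ^ 6 + h s ^ (2 * q + 5) * B (h s ^ 4) + h s ^ (2 * q + 11) * D (h s ^ 4) =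
            s ^ 6 * P ^ 6 + s ^ (2 * q + 5) * (P ^ (2 * q + 5) * B X) + s ^ (2 * q + 11) * (P ^ (2 * q + 11) * D X)"
          unfolding h4 by (simp only: h mult.assoc)
        also have "\<dots> = (s ^ 6 + s ^ (2 * q + 5) * (1 + s ^ (4 * (q + 1)) * E r) + s ^ (2 * q + 11) * D' r) * P ^ 6"
          unfolding b d by (simp only: distrib_right mult.assoc mult.commute[of _ "P ^ 6"] mult.left_commute[of _ "P ^ 6"] distrib_left)
        finally show ?case using h4 X by (simp only: fst_conv snd_conv r_def P_def)
      qed
    qed
  qed
qed

text \<open>On the curve X = x, Y = u + w with x = s^4, u = s^6, w = s^(2q+5), P = x^(q+1), one has
  u^2 = x^3 and w^2 = P u. Therefore K becomes 2 w u - P w, and the leading surplus E 0 P w + D 0 w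
  u is a multiple of it precisely under the last hypothesis. All further terms are combinations of x
  K and x^(q-1) M, where M becomes x^3 w.\<close>

lemma W_absorb:
  assumes "q \<ge> 1" "smooth_germ E" "smooth_germ D" "2 * E 0 + D 0 = 0"
  shows "A_equiv
    (\<lambda>s. (s ^ 4, s ^ 6 + s ^ (2 * q + 5) * (1 + s ^ (4 * (q + 1)) * E (s ^ 4)) + s ^ (2 * q + 11) * D (s ^ 4)))
    (\<lambda>t. (t ^ 4, t ^ 6 + t ^ (2 * q + 5)))"
proof -
  obtain E1 where E1: "smooth_germ E1" "\<forall>\<^sub>F t in nhds 0. E t = E 0 + t * E1 t" using hadamard[OF assms(2)] .
  obtain D1 where D1: "smooth_germ D1" "\<forall>\<^sub>F t in nhds 0. D t = D 0 + t * D1 t" using hadamard[OF assms(3)] .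
  define K where "K z = snd z ^ 2 - fst z ^ 3 - fst z ^ (q + 1) * snd z" for z :: "real \<times> real"
  \<comment> \<open>Composed so that only w survives on the curve: there N equals x^3 w (1 +
    x^(2q-1) / 4), and division by the unit gives M = x^3 w.\<close>
  define N where "N z = snd z * K z / 2 - fst z ^ (q + 4) + fst z ^ (q + 1) * (K z / 2 + fst z ^ (q + 1) * snd z) / 2"
    for z :: "real \<times> real"
  define M where "M z = N z / (1 + fst z ^ (2 * q - 1) / 4)" for z :: "real \<times> real"
  define F where "F z = snd z - E 0 * K z + fst z ^ (q - 1) * M z * (E1 (fst z) + D1 (fst z) / 2) + D1 (fst z) * fst z * K z / 2"
    for z :: "real \<times> real"
  have q0: "(0::real) ^ (2 * q - Suc 0) = 0" using assms(1) by simp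
  have q4: "(0::real) ^ (q + 4) = 0" by (simp add: power_add)
  have sK: "smooth_germ K" unfolding K_def[abs_def] by (intro smooth_germ_intros)
  have sN: "smooth_germ N" unfolding N_def[abs_def] by (intro smooth_germ_intros sK) simp_all
  have sM: "smooth_germ M" unfolding M_def[abs_def] by (intro smooth_germ_intros sN) (simp_all add: q0)
  have sF: "smooth_germ F" unfolding F_def[abs_def]
    by (intro smooth_germ_intros sK sM smooth_germ_fst_compose E1(1) D1(1)) simp_all
  have "diffeo_germ (\<lambda>z. (fst z, F z))"
  proof (rule diffeo_germ_fibred[OF sF])
    define c where "c = 0 ^ (q - 1) * (E1 0 + D1 0 / 2) / 2"
    have N0: "N (0, s) = s ^ 3 / 2" for s
      by (simp add: N_def K_def q4 power2_eq_square power3_eq_cube)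
    have M0: "M (0, s) = s ^ 3 / 2" for s by (simp add: M_def N0 q0)
    have "F (0, s) = s - E 0 * s ^ 2 + c * s ^ 3" for s
      by (simp add: F_def M0 K_def c_def)
    then show "((\<lambda>s. F (0, s)) has_real_derivative 1) (at 0)"
      by (auto intro!: derivative_eq_intros)
    show "F 0 = 0" by (simp add: F_def M_def N_def K_def q4)
  qed simp
  then show ?thesis
  proof (rule A_equiv_left)
    have qu: "smooth_germ (\<lambda>t::real. t ^ 4)" "(\<lambda>t::real. t ^ 4) 0 = 0" by (auto intro: smooth_germ_intros)
    show "\<forall>\<^sub>F s in nhds 0.
      (s ^ 4, s ^ 6 + s ^ (2 * q + 5) * (1 + s ^ (4 * (q + 1)) * E (s ^ 4)) + s ^ (2 * q + 11) * D (s ^ 4)) =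
      (fst (s ^ 4, s ^ 6 + s ^ (2 * q + 5)), F (s ^ 4, s ^ 6 + s ^ (2 * q + 5)))"
      using eventually_compose_germ[OF E1(2) qu] eventually_compose_germ[OF D1(2) qu]
    proof eventually_elim
      case (elim s)
      define x where "x = s ^ 4"
      define u where "u = s ^ 6"
      define w where "w = s ^ (2 * q + 5)"
      define P where "P = x ^ (q + 1)"
      have ux: "u ^ 2 = x ^ 3" by (simp add: u_def x_def flip: power_mult)
      have w2: "w ^ 2 = P * u"
        by (simp add: w_def P_def u_def x_def add.commute flip: power_mult power_add)
      have wu: "s ^ (2 * q + 11) = w * u"
        by (simp add: w_def u_def add.commute flip: power_add)
      have P': "s ^ (4 * (q + 1)) = P" by (simp only: P_def x_def power_mult)
      have i: "q + 4 = (q + 1) + 3" "q - 1 + 3 = (q + 1) + 1" "3 + (2 * q - 1) = (q + 1) * 2"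
        using assms(1) by simp_all
      have xq4: "x ^ (q + 4) = P * x ^ 3" unfolding i(1) by (simp only: P_def power_add)
      have xq: "x ^ (q - 1) * x ^ 3 = P * x" "x ^ 3 * x ^ (2 * q - 1) = P ^ 2"
        unfolding power_add[symmetric] i by (simp_all only: P_def power_add power_mult power_one_right)
      have K: "K (x, u + w) = 2 * w * u - P * w"
        unfolding K_def fst_conv snd_conv P_def[symmetric] ux[symmetric]
        using w2 by (simp add: power2_eq_square algebra_simps)
      have "N (x, u + w) = (u + w) * (2 * w * u - P * w) / 2 - P * u ^ 2 + P * ((2 * w * u - P * w) / 2 + P * (u + w)) / 2"
        unfolding N_def K fst_conv snd_conv P_def[symmetric] xq4 ux by simp
      also have "\<dots> = u ^ 2 * w + w ^ 2 * u - P * w ^ 2 / 2 - P * u ^ 2 + P ^ 2 * w / 4 + P ^ 2 * u / 2"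
        by (simp add: power2_eq_square field_simps)
      also have "\<dots> = w * (x ^ 3 + P ^ 2 / 4)"
        unfolding w2 ux[symmetric] by (simp add: power2_eq_square field_simps)
      also have "\<dots> = x ^ 3 * w * (1 + x ^ (2 * q - 1) / 4)"
        unfolding xq(2)[symmetric] by (simp add: field_simps)
      finally have N: "N (x, u + w) = x ^ 3 * w * (1 + x ^ (2 * q - 1) / 4)" .
      have "x \<ge> 0" by (simp add: x_def)
      then have "1 + x ^ (2 * q - 1) / 4 > 0" by (intro add_pos_nonneg) simp_all
      then have M: "M (x, u + w) = x ^ 3 * w" unfolding M_def N by simp
      have "F (x, u + w) = u + w - E 0 * (2 * w * u - P * w) + (x ^ (q - 1) * x ^ 3) * w * (E1 x + D1 x / 2)
          + D1 x * x * (2 * w * u - P * w) / 2"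
        unfolding F_def M K fst_conv snd_conv by simp
      also have "\<dots> = u + w * (1 + P * (E 0 + x * E1 x)) + w * u * (- 2 * E 0 + x * D1 x)"
        unfolding xq(1) by (simp add: field_simps)
      also have "\<dots> = u + w * (1 + P * E x) + w * u * D x"
        using elim assms(4) by (simp add: x_def)
      finally show ?case unfolding wu P' by (simp add: x_def u_def w_def)
    qed
  qed
qed

text \<open>Once the coefficient in degree 2q+7 is zero, a second sorting modulo 4 yields a series
  D' with D' 0 = 0. Its terms start only in degree 2q+11, where the absorption works.\<close>

lemma W_normal_form:
  assumes q: "q \<ge> 1" and y: "van 6 y" "tc y 6 \<noteq> 0" "\<And>i. i < q + 2 \<Longrightarrow> tc y (2 * i + 1) = 0"
    "tc y (2 * q + 5) \<noteq> 0"
  shows "A_equiv (\<lambda>s. (s ^ 4, y s)) (\<lambda>t. (t ^ 4, t ^ 6 + t ^ (2 * q + 5)))"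
proof -
  obtain B D where B: "smooth_germ B" "smooth_germ D" "B 0 = tc y (2 * q + 5) / tc y 6"
    "D 0 = tc y (2 * q + 7) / tc y 6"
    and E1: "A_equiv (\<lambda>s. (s ^ 4, y s))
       (\<lambda>s. (s ^ 4, s ^ 6 + s ^ (2 * q + 5) * B (s ^ 4) + s ^ (2 * q + 7) * D (s ^ 4)))"
    using W_normalise_even[OF y(1-3)] .
  define T where "T s = B (s ^ 4) + s ^ 2 * D (s ^ 4)" for s
  have T: "smooth_germ T" unfolding T_def[abs_def]
    by (intro smooth_germ_intros smooth_germ_power_compose B) simp_all
  define R where "R s = s ^ (2 * q + 5) * T s" for s
  have vR: "van (2 * q + 5) R" unfolding R_def[abs_def] by (rule van_mult_right[OF van_power_id[OF order_refl] T])
  have tR: "tc R (2 * q + 5 + i) = tc T i" for i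
    using tc_shift[OF T, of "2 * q + 5" "2 * q + 5 + i"] by (simp add: R_def[abs_def])
  have T1: "tc T 1 = 0"
  proof -
    have "tc T 1 = tc (\<lambda>s. B (s ^ 4)) 1 + tc (\<lambda>s. s ^ 2 * D (s ^ 4)) 1"
      unfolding T_def[abs_def] by (rule tc_add) (intro smooth_germ_intros smooth_germ_power_compose B; simp)+
    moreover have "tc (\<lambda>s. s ^ 2 * D (s ^ 4)) 1 = 0"
      using tc_shift[OF smooth_germ_power_compose[OF B(2)], of 4 2 1] by simp
    ultimately show ?thesis using tc_compose_power[OF B(1), of 4 1] by simp
  qed
  have Rn: "tc R (2 * q + 5) = B 0" using tR[of 0] by (simp add: tc_0 T_def)
  have Rn1: "tc R (2 * q + 6) = 0"
  proof -
    have "2 * q + 6 = 2 * q + 5 + 1" by simp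
    then show ?thesis using tR[of 1] T1 by metis
  qed
  have B0: "B 0 \<noteq> 0" using B(3) y(2,4) by simp
  obtain z where E2: "A_equiv (\<lambda>t. (t ^ 4, t ^ 6 + R t)) (\<lambda>s. (s ^ 4, z s))" and z: "van 6 z" "tc z 6 = 1"
    "\<forall>i<q + 2. tc z (2 * i + 1) = 0" "tc z (2 * q + 5) = B 0" "tc z (2 * q + 7) = 0"
    using W_shift[OF q vR Rn Rn1 B0] .
  have "tc z 6 \<noteq> 0" using z(2) by simp
  have z3: "tc z (2 * i + 1) = 0" if "i < q + 2" for i using z(3) that by simp
  obtain B' D' where B': "smooth_germ B'" "smooth_germ D'" "B' 0 = tc z (2 * q + 5) / tc z 6"
    "D' 0 = tc z (2 * q + 7) / tc z 6"
    and E3: "A_equiv (\<lambda>s. (s ^ 4, z s))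
       (\<lambda>s. (s ^ 4, s ^ 6 + s ^ (2 * q + 5) * B' (s ^ 4) + s ^ (2 * q + 7) * D' (s ^ 4)))"
    using W_normalise_even[OF z(1) \<open>tc z 6 \<noteq> 0\<close> z3] .
  have "D' 0 = 0" using B'(4) z(5) by simp
  from vanE[OF van_1I[OF B'(2) this]]
  obtain C where C: "smooth_germ C" "\<forall>\<^sub>F t in nhds 0. D' t = t ^ 1 * C t" .
  have C4: "\<forall>\<^sub>F t in nhds 0. D' (t ^ 4) = (t ^ 4) ^ 1 * C (t ^ 4)"
    by (rule eventually_compose_germ[OF C(2)]) (auto intro: smooth_germ_intros)
  let ?W = "\<lambda>B C s. (s ^ 4, s ^ 6 + s ^ (2 * q + 5) * B (s ^ 4) + s ^ (2 * q + 11) * C (s ^ 4))"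
  have E4: "A_equiv (\<lambda>s. (s ^ 4, s ^ 6 + s ^ (2 * q + 5) * B' (s ^ 4) + s ^ (2 * q + 7) * D' (s ^ 4))) (?W B' C)"
    by (rule A_equiv_cong) (use C4 in eventually_elim, simp flip: power_add add: add.commute)
  have fin: "A_equiv (?W B C) (\<lambda>t. (t ^ 4, t ^ 6 + t ^ (2 * q + 5)))"
    if bc: "smooth_germ B" "smooth_germ C" "B 0 > 0" for B C
  proof -
    obtain E D' where "smooth_germ E" "smooth_germ D'" "2 * E 0 + D' 0 = 0"
      and A: "A_equiv (?W B C)
       (\<lambda>s. (s ^ 4, s ^ 6 + s ^ (2 * q + 5) * (1 + s ^ (4 * (q + 1)) * E (s ^ 4)) + s ^ (2 * q + 11) * D' (s ^ 4)))"
      using W_unit_coefficient[OF q bc] .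
    then show ?thesis by (intro A_equiv_trans[OF A] W_absorb q)
  qed
  have "A_equiv (?W B' C) (\<lambda>t. (t ^ 4, t ^ 6 + t ^ (2 * q + 5)))"
  proof (cases "B' 0 > 0")
    case True
    then show ?thesis by (rule fin[OF B'(1) C(1)])
  next
    case False
    \<comment> \<open>Reversing the parameter changes the sign of the odd degree terms and of
      nothing else, which turns a negative leading coefficient into a positive one.\<close>
    have "diffeo_germ (\<lambda>s::real. - s)"
      by (rule diffeo_germ_real) (auto intro: smooth_germ_intros)
    then have "A_equiv (?W B' C) (?W (\<lambda>r. - B' r) (\<lambda>r. - C r))"
      by (rule A_equiv_reparam) simp
    moreover have "A_equiv (?W (\<lambda>r. - B' r) (\<lambda>r. - C r)) (\<lambda>t. (t ^ 4, t ^ 6 + t ^ (2 * q + 5)))"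
      by (rule fin) (use False B'(3) z(2,4) B0 in \<open>auto intro: smooth_germ_intros B' C\<close>)
    ultimately show ?thesis by (rule A_equiv_trans)
  qed
  note E5 = this
  have E12: "A_equiv (\<lambda>s. (s ^ 4, s ^ 6 + s ^ (2 * q + 5) * B (s ^ 4) + s ^ (2 * q + 7) * D (s ^ 4)))
      (\<lambda>t. (t ^ 4, t ^ 6 + R t))"
    by (rule A_equiv_cong) (simp add: R_def T_def distrib_left add.commute flip: power_add mult.assoc)
  show ?thesis
    by (rule A_equiv_trans[OF E1 A_equiv_trans[OF E12 A_equiv_trans[OF E2 A_equiv_trans[OF E3 A_equiv_trans[OF E4 E5]]]]])
qed

subsection \<open>Leading terms\<close>

lemma tc_mult_leading:
  assumes "van n f" "smooth_germ g" shows "tc (\<lambda>t. f t * g t) n = tc f n * g 0"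
proof -
  obtain k where k: "smooth_germ k" "\<forall>\<^sub>F t in nhds 0. f t = t ^ n * k t" "\<forall>i. tc k i = tc f (n + i)"
    using van_factor[OF assms(1)] .
  have "\<forall>\<^sub>F t in nhds 0. f t * g t = t ^ n * (k t * g t)" using k(2) by eventually_elim simp
  from tc_cong[OF this, of n] show ?thesis
    using tc_shift[OF smooth_germ_mult[OF k(1) assms(2)], of n n] spec[OF k(3), of 0] by (simp add: tc_0)
qed

lemma tc_mult_leading2:
  assumes "van m f" "van n g" shows "tc (\<lambda>t. f t * g t) (m + n) = tc f m * tc g n"
proof -
  obtain k where k: "smooth_germ k" "\<forall>\<^sub>F t in nhds 0. g t = t ^ n * k t" "\<forall>i. tc k i = tc g (n + i)"
    using van_factor[OF assms(2)] .
  have "\<forall>\<^sub>F t in nhds 0. f t * g t = t ^ n * (f t * k t)" using k(2) by eventually_elim simp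
  from tc_cong[OF this, of "m + n"] show ?thesis
    using tc_shift[OF smooth_germ_mult[OF van_smooth[OF assms(1)] k(1)], of n "m + n"]
      tc_mult_leading[OF assms(1) k(1)] spec[OF k(3), of 0] by (simp add: tc_0)
qed

lemma tc_reflect:
  assumes "smooth_germ f" shows "tc (\<lambda>t. f (- t)) n = (- 1) ^ n * tc f n"
proof -
  have r: "smooth_germ (\<lambda>t::real. - t)" by (intro smooth_germ_intros)
  have v: "van (Suc n) (\<lambda>t. f (- t) - (\<Sum>i<Suc n. tc f i * (- t) ^ i))"
    using van_compose[OF taylor[OF assms] r, of "Suc n"] by simp
  have s1: "smooth_germ (\<lambda>t. f (- t))" by (rule smooth_germ_compose[OF r assms]) simp
  have s2: "smooth_germ (\<lambda>t. \<Sum>i<Suc n. tc f i * (- t) ^ i)" by (intro smooth_germ_intros)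
  have "tc (\<lambda>t. f (- t)) n = tc (\<lambda>t. \<Sum>i<Suc n. tc f i * (- t) ^ i) n"
    by (rule tc_eq[OF v s1 s2 lessI])
  also have "(\<lambda>t. \<Sum>i<Suc n. tc f i * (- t) ^ i) = (\<lambda>t. \<Sum>i<Suc n. ((- 1) ^ i * tc f i) * t ^ i)"
    by (rule ext, rule sum.cong[OF refl], subst power_minus) (simp only: mult_ac)
  also have "tc (\<lambda>t. \<Sum>i<Suc n. ((- 1) ^ i * tc f i) * t ^ i) n = (\<Sum>i<Suc n. if n = i then (- 1) ^ i * tc f i else 0)"
    by (simp only: tc_sum smooth_germ_intros tc_monom)
  also have "\<dots> = (- 1) ^ n * tc f n" by (subst sum.delta') simp_all
  finally show ?thesis .
qed

lemma van_derivD: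
  assumes "smooth_germ f" "f 0 = 0" "van n (deriv f)"
  shows "van (Suc n) f" "tc f (Suc n) = tc (deriv f) n / real (Suc n)"
  using van_deriv_imp[OF assms] tc_deriv[of f n] by (simp_all add: field_simps del: of_nat_Suc)

lemma sin_leading:
  assumes "van (Suc n) f"
  shows "van (Suc n) (\<lambda>t. sin (f t))" "tc (\<lambda>t. sin (f t)) (Suc n) = tc f (Suc n)"
proof -
  obtain s :: "real \<Rightarrow> real" where s: "smooth_germ s" "\<forall>\<^sub>F t in nhds 0. sin t = sin 0 + t * s t"
    using hadamard[OF smooth_germI[OF UNIV_I smooth_on_sin]] .
  have s0: "s 0 = 1"
    using tc_Suc[OF s, of 0] DERIV_imp_deriv[OF DERIV_sin[of "0::real"]] by (simp add: tc_def)
  note f = van_smooth[OF assms] van_1D[OF assms]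
  have sf: "smooth_germ (\<lambda>t. s (f t))" by (rule smooth_germ_compose[OF f(1) s(1) f(2)])
  have ev: "\<forall>\<^sub>F t in nhds 0. sin (f t) = f t * s (f t)"
    using eventually_compose_germ[OF s(2) f] by eventually_elim simp
  show "van (Suc n) (\<lambda>t. sin (f t))" by (rule van_cong[OF van_mult_right[OF assms sf] ev])
  show "tc (\<lambda>t. sin (f t)) (Suc n) = tc f (Suc n)"
    using tc_cong[OF ev] tc_mult_leading[OF assms sf] by (simp add: f s0)
qed

lemma eventually_reflect: "\<forall>\<^sub>F t in nhds 0. P t \<Longrightarrow> \<forall>\<^sub>F t in nhds (0::real). P (- t)"
  by (rule eventually_compose_germ[OF _ smooth_germ_minus[OF smooth_germ_ident]]) simp_all

lemma reflect_smooth: "smooth_germ f \<Longrightarrow> smooth_germ (\<lambda>t::real. f (- t))"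
  by (rule smooth_germ_compose[OF smooth_germ_minus[OF smooth_germ_ident]]) simp_all

subsection \<open>The parallel curve\<close>

text \<open>A common setting for both curves of the theorem: \<delta> = 0 gives \<phi>_2 itself.
  Here \<open>\<theta>\<close> is the angle function, so its coefficients
  \<open>tc \<theta> i\<close> are \<theta>_i / i!.\<close>

locale parallel_curve =
  fixes \<theta> x y :: "real \<Rightarrow> real" and \<delta> :: real
  assumes \<theta>: "smooth_germ \<theta>" "\<theta> 0 = 0"
    and x0: "x 0 = 0" and y0: "y 0 = 0"
    and dx: "\<forall>\<^sub>F t in nhds 0. (x has_real_derivative (t - \<delta> * deriv \<theta> t) * cos (\<theta> t)) (at t)"
    and dy: "\<forall>\<^sub>F t in nhds 0. (y has_real_derivative (t - \<delta> * deriv \<theta> t) * sin (\<theta> t)) (at t)"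
begin

definition g :: "real \<Rightarrow> real" where "g t = t - \<delta> * deriv \<theta> t"

text \<open>The slope dy/dx, which as tan \<theta> stays smooth at the singular point.\<close>

definition p :: "real \<Rightarrow> real" where "p t = sin (\<theta> t) / cos (\<theta> t)"

lemma smooth_g: "smooth_germ g"
  unfolding g_def[abs_def] by (intro smooth_germ_intros smooth_germ_deriv \<theta>)

lemma smooth_x: "smooth_germ x" and smooth_y: "smooth_germ y"
  by (rule smooth_germ_derivI[OF _ dx], intro smooth_germ_intros smooth_germ_deriv \<theta>)
     (rule smooth_germ_derivI[OF _ dy], intro smooth_germ_intros smooth_germ_deriv \<theta>)

lemma smooth_p: "smooth_germ p"
  unfolding p_def[abs_def] by (intro smooth_germ_intros \<theta>) (simp add: \<theta>)

lemma deriv_x: "\<forall>\<^sub>F t in nhds 0. deriv x t = g t * cos (\<theta> t)"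
  using dx by eventually_elim (simp add: DERIV_imp_deriv g_def)

lemma deriv_y: "\<forall>\<^sub>F t in nhds 0. deriv y t = p t * deriv x t"
proof -
  have "\<forall>\<^sub>F t in nhds 0. cos (\<theta> t) \<noteq> 0"
    by (rule smooth_germ_eventually_ne[OF smooth_germ_cos[OF \<theta>(1)]]) (simp add: \<theta>)
  then show ?thesis using dy deriv_x
    by eventually_elim (simp add: DERIV_imp_deriv g_def p_def)
qed

lemma tc_g: "tc g i = (if i = 1 then 1 else 0) - \<delta> * (real (Suc i) * tc \<theta> (Suc i))"
proof -
  have "tc g i = tc (\<lambda>t. t) i - \<delta> * tc (deriv \<theta>) i"
    unfolding g_def[abs_def] by (simp add: tc_diff tc_cmult smooth_germ_intros smooth_germ_deriv \<theta>)
  then show ?thesis using tc_monom[of 1 1 i] by (simp add: tc_deriv del: of_nat_Suc)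
qed

lemma x_leading:
  assumes "van n g" shows "van (Suc n) x" "tc x (Suc n) = tc g n / real (Suc n)"
proof -
  have c: "smooth_germ (\<lambda>t. cos (\<theta> t))" by (intro smooth_germ_intros \<theta>)
  have v: "van n (deriv x)" by (rule van_cong[OF van_mult_right[OF assms c] deriv_x])
  show "van (Suc n) x" "tc x (Suc n) = tc g n / real (Suc n)"
    using van_derivD[OF smooth_x x0 v] tc_cong[OF deriv_x, of n] tc_mult_leading[OF assms c]
    by (simp_all add: \<theta>)
qed

lemma \<theta>_odd_part:
  assumes "odd b" "\<And>i. odd i \<Longrightarrow> i < b \<Longrightarrow> tc \<theta> i = 0"
  shows "van b (\<lambda>t. \<theta> t - \<theta> (- t))" "tc (\<lambda>t. \<theta> t - \<theta> (- t)) b = 2 * tc \<theta> b"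
proof -
  have r: "smooth_germ (\<lambda>t. \<theta> (- t))"
    by (rule smooth_germ_compose[OF smooth_germ_minus[OF smooth_germ_ident] \<theta>(1)]) simp
  have t: "tc (\<lambda>t. \<theta> t - \<theta> (- t)) i = tc \<theta> i - (- 1) ^ i * tc \<theta> i" for i
    by (simp add: tc_diff \<theta> r tc_reflect)
  show "van b (\<lambda>t. \<theta> t - \<theta> (- t))"
    unfolding van_iff_tc
  proof (intro conjI allI impI)
    show "tc (\<lambda>t. \<theta> t - \<theta> (- t)) i = 0" if "i < b" for i
      using assms(2)[of i] that by (cases "odd i") (simp_all add: t)
  qed (intro smooth_germ_intros \<theta> r)
  show "tc (\<lambda>t. \<theta> t - \<theta> (- t)) b = 2 * tc \<theta> b" using assms(1) by (simp add: t)
qed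

text \<open>By tan a - tan b = sin (a - b) / (cos a cos b) the slope inherits the leading odd term
  of \<theta>.\<close>

lemma p_odd_part:
  assumes "odd b" "\<And>i. odd i \<Longrightarrow> i < b \<Longrightarrow> tc \<theta> i = 0"
  shows "van b (\<lambda>t. p t - p (- t))" "tc (\<lambda>t. p t - p (- t)) b = 2 * tc \<theta> b"
proof -
  let ?T = "\<lambda>t. \<theta> t - \<theta> (- t)"
  define c where "c t = inverse (cos (\<theta> t) * cos (\<theta> (- t)))" for t
  have c: "smooth_germ c" unfolding c_def[abs_def]
    by (intro smooth_germ_inverse smooth_germ_intros \<theta> reflect_smooth) (simp add: \<theta>)
  obtain n where b: "b = Suc n" using assms(1) by (cases b) auto
  note T = \<theta>_odd_part[OF assms]
  note s = sin_leading[OF T(1)[unfolded b]]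
  have c1: "\<forall>\<^sub>F t in nhds 0. cos (\<theta> t) \<noteq> 0"
    by (rule smooth_germ_eventually_ne[OF smooth_germ_cos[OF \<theta>(1)]]) (simp add: \<theta>)
  have c2: "\<forall>\<^sub>F t in nhds 0. cos (\<theta> (- t)) \<noteq> 0"
    by (rule smooth_germ_eventually_ne[OF smooth_germ_cos[OF reflect_smooth[OF \<theta>(1)]]]) (simp add: \<theta>)
  have ev: "\<forall>\<^sub>F t in nhds 0. p t - p (- t) = sin (?T t) * c t"
    using c1 c2 by eventually_elim (simp add: p_def c_def sin_diff field_simps)
  show "van b (\<lambda>t. p t - p (- t))"
    unfolding b by (rule van_cong[OF van_mult_right[OF s(1) c] ev])
  show "tc (\<lambda>t. p t - p (- t)) b = 2 * tc \<theta> b"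
    using tc_cong[OF ev, of b] tc_mult_leading[OF s(1) c] s(2) T(2) by (simp add: b c_def \<theta>)
qed

lemma p_leading:
  assumes "van (Suc n) \<theta>" shows "van (Suc n) p" "tc p (Suc n) = tc \<theta> (Suc n)"
proof -
  define c where "c t = inverse (cos (\<theta> t))" for t
  have c: "smooth_germ c" unfolding c_def[abs_def]
    by (intro smooth_germ_inverse smooth_germ_intros \<theta>) (simp add: \<theta>)
  have e: "p = (\<lambda>t. sin (\<theta> t) * c t)" by (simp add: p_def c_def divide_inverse fun_eq_iff)
  show "van (Suc n) p" "tc p (Suc n) = tc \<theta> (Suc n)"
    unfolding e using van_mult_right[OF sin_leading(1)[OF assms] c]
      tc_mult_leading[OF sin_leading(1)[OF assms] c] sin_leading(2)[OF assms] by (simp_all add: c_def \<theta>)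
qed

text \<open>Let T t = \<theta> t - \<theta> (- t). Since g t + g (- t) = - \<delta> T', the
  derivative of x (- t) - x t is \<delta> T' cos \<theta> minus g (- t) times a difference of
  cosines of order b. As g vanishes at 0, the second part has order b + 1; for \<delta> = 0 it alone
  is left, and two orders are gained.\<close>

lemma x_odd_part:
  assumes "odd b" "\<And>i. odd i \<Longrightarrow> i < b \<Longrightarrow> tc \<theta> i = 0" "b > 1 \<or> \<delta> = 0"
  shows "van b (\<lambda>t. x (- t) - x t)" "tc (\<lambda>t. x (- t) - x t) b = 2 * \<delta> * tc \<theta> b"
    "\<delta> = 0 \<Longrightarrow> van (Suc (Suc b)) (\<lambda>t. x (- t) - x t)"
proof -
  let ?T = "\<lambda>t. \<theta> t - \<theta> (- t)"
  let ?f = "\<lambda>t. x (- t) - x t"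
  obtain n where b: "b = Suc n" using assms(1) by (cases b) auto
  note T = \<theta>_odd_part[OF assms(1,2)]
  have sT: "smooth_germ ?T" by (rule van_smooth[OF T(1)])
  have sf: "smooth_germ ?f" by (intro smooth_germ_intros reflect_smooth smooth_x)
  \<comment> \<open>Both alternatives of the last hypothesis give g 0 = 0: if b > 1, the linear
    coefficient of \<theta> is among the vanishing ones.\<close>
  have "b > 1 \<Longrightarrow> tc \<theta> 1 = 0" using assms(2)[of 1] by simp
  then have "\<delta> * deriv \<theta> 0 = 0" using assms(3) by (auto simp: tc_def)
  then have g0: "g 0 = 0" by (simp add: g_def)
  have vT': "van n (deriv ?T)" using van_deriv T(1) b by simp
  define C where "C t = cos (\<theta> (- t)) - cos (\<theta> t)" for t
  have vC: "van b C"
  proof -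
    have h: "van (Suc n) (\<lambda>t. ?T t / 2)" using van_cmult[OF T(1), of "1/2"] by (simp add: b)
    have "van b (\<lambda>t. 2 * sin ((\<theta> t + \<theta> (- t)) / 2) * sin (?T t / 2))"
      unfolding b by (rule van_mult_left[OF _ sin_leading(1)[OF h]]) (intro smooth_germ_intros \<theta> reflect_smooth; simp)
    then show ?thesis
      by (rule van_eq) (simp add: C_def cos_diff_cos add.commute mult.assoc)
  qed
  have vgC: "van (Suc b) (\<lambda>t. g (- t) * C t)"
    using van_mult[OF van_1I[OF reflect_smooth[OF smooth_g]] vC] g0 by simp
  have df: "\<forall>\<^sub>F t in nhds 0. deriv ?f t = \<delta> * (deriv ?T t * cos (\<theta> t)) - g (- t) * C t"
    using dx eventually_reflect[OF dx] smooth_germ_deriv(2)[OF \<theta>(1)]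
      eventually_reflect[OF smooth_germ_deriv(2)[OF \<theta>(1)]]
  proof eventually_elim
    case (elim t)
    have "(?f has_real_derivative - ((- t - \<delta> * deriv \<theta> (- t)) * cos (\<theta> (- t)))
        - (t - \<delta> * deriv \<theta> t) * cos (\<theta> t)) (at t)"
      by (intro DERIV_diff DERIV_mirror[THEN iffD1] elim(2) elim(1))
    then have "deriv ?f t = - g (- t) * cos (\<theta> (- t)) - g t * cos (\<theta> t)"
      by (simp add: DERIV_imp_deriv g_def algebra_simps)
    moreover have "(?T has_real_derivative deriv \<theta> t - - deriv \<theta> (- t)) (at t)"
      by (intro DERIV_diff DERIV_mirror[THEN iffD1] elim(4) elim(3))
    then have "deriv ?T t = deriv \<theta> t + deriv \<theta> (- t)" by (simp add: DERIV_imp_deriv)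
    ultimately show ?case by (simp add: g_def C_def algebra_simps)
  qed
  have c: "smooth_germ (\<lambda>t. cos (\<theta> t))" by (intro smooth_germ_intros \<theta>)
  have v1: "van n (\<lambda>t. \<delta> * (deriv ?T t * cos (\<theta> t)))" by (intro van_cmult van_mult_right[OF vT' c])
  have v2: "van n (\<lambda>t. g (- t) * C t)" by (rule van_mono[OF vgC]) (simp add: b)
  have vdf: "van n (deriv ?f)" by (rule van_cong[OF van_diff[OF v1 v2] df])
  have f0: "?f 0 = 0" by simp
  note V = van_derivD[OF sf f0 vdf]
  show "van b ?f" using V(1) by (simp add: b)
  have "tc (deriv ?f) n = \<delta> * tc (deriv ?T) n"
    using tc_cong[OF df, of n] tc_mult_leading[OF vT' c] van_tc[OF vgC, of n]
    by (simp add: tc_diff tc_cmult van_smooth[OF v1] van_smooth[OF v2] van_smooth[OF van_mult_right[OF vT' c]] \<theta> b)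
  also have "tc (deriv ?T) n = real b * (2 * tc \<theta> b)" using tc_deriv[of ?T n] T(2) by (simp add: b)
  finally show "tc ?f b = 2 * \<delta> * tc \<theta> b" using V(2) by (simp add: b)
  assume "\<delta> = 0"
  then have "van (Suc b) (deriv ?f)" by (intro van_cong[OF van_minus[OF vgC]]) (use df in eventually_elim, simp)
  from van_derivD(1)[OF sf f0 this] show "van (Suc (Suc b)) ?f" .
qed

lemma y_odd_part:
  assumes "odd b" "\<And>i. odd i \<Longrightarrow> i < b \<Longrightarrow> tc \<theta> i = 0" "\<delta> = 0"
  shows "van (Suc (Suc b)) (\<lambda>t. y (- t) - y t)"
proof -
  let ?T = "\<lambda>t. \<theta> t - \<theta> (- t)"
  let ?f = "\<lambda>t. y (- t) - y t"
  obtain n where b: "b = Suc n" using assms(1) by (cases b) auto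
  note T = \<theta>_odd_part[OF assms(1,2)]
  have sf: "smooth_germ ?f" by (intro smooth_germ_intros reflect_smooth smooth_y)
  define C where "C t = sin (\<theta> (- t)) - sin (\<theta> t)" for t
  have vC: "van b C"
  proof -
    have h: "van (Suc n) (\<lambda>t. ?T t / 2)" using van_cmult[OF T(1), of "1/2"] by (simp add: b)
    have "van b (\<lambda>t. (- 2 * cos ((\<theta> t + \<theta> (- t)) / 2)) * sin (?T t / 2))"
      unfolding b by (rule van_mult_left[OF _ sin_leading(1)[OF h]]) (intro smooth_germ_intros \<theta> reflect_smooth; simp)
    moreover have "C t = (- 2 * cos ((\<theta> t + \<theta> (- t)) / 2)) * sin (?T t / 2)" for t
    proof -
      have "(\<theta> (- t) - \<theta> t) / 2 = - (?T t / 2)" by (simp add: field_simps)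
      then have "sin ((\<theta> (- t) - \<theta> t) / 2) = - sin (?T t / 2)" by (simp only: sin_minus)
      then show ?thesis unfolding C_def sin_diff_sin by (simp add: add.commute)
    qed
    ultimately show ?thesis by (rule van_eq)
  qed
  have "van (Suc b) (\<lambda>t. t ^ 1 * C t)"
    using van_mult[OF van_power_id[OF order_refl, of 1] vC] by simp
  moreover have "\<forall>\<^sub>F t in nhds 0. deriv ?f t = t ^ 1 * C t"
    using dy eventually_reflect[OF dy]
  proof eventually_elim
    case (elim t)
    have "(?f has_real_derivative - ((- t - \<delta> * deriv \<theta> (- t)) * sin (\<theta> (- t)))
        - (t - \<delta> * deriv \<theta> t) * sin (\<theta> t)) (at t)"
      by (intro DERIV_diff DERIV_mirror[THEN iffD1] elim(2) elim(1))
    then show ?case using assms(3) by (simp add: DERIV_imp_deriv C_def algebra_simps)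
  qed
  ultimately have "van (Suc b) (deriv ?f)" by (rule van_cong)
  from van_derivD(1)[OF sf _ this] show ?thesis by simp
qed

end

lemma diffeo_germ_scale:
  assumes "c \<noteq> 0" "d \<noteq> 0" shows "diffeo_germ (\<lambda>p::real \<times> real. (c * fst p, d * snd p))"
  by (rule diffeo_germ_plane[where F' = "\<lambda>v. c * fst v" and G' = "\<lambda>v. d * snd v"])
     (auto intro!: smooth_germ_intros derivative_eq_intros simp: assms)

context parallel_curve
begin

text \<open>Dividing both components by the leading coefficient of x leaves the slope unchanged.
  From dy = p dx and c x (H s) = s^m follows Y' = m s^(m-1) p (H s), so the coefficients of Y are
  those of the slope, shifted by m.\<close>

lemma reparam:
  assumes "van m x" "tc x m \<noteq> 0" "m \<ge> 1"
  obtains S H Y where "diffeo_germ S" "diffeo_germ H" "tc S 1 = 1" "tc H 1 = 1"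
    "\<forall>\<^sub>F t in nhds 0. S t ^ m = 1 / tc x m * x t"
    "\<forall>\<^sub>F t in nhds 0. H (S t) = t" "\<forall>\<^sub>F s in nhds 0. S (H s) = s"
    "smooth_germ Y" "Y 0 = 0" "A_equiv (\<lambda>t. (x t, y t)) (\<lambda>s. (s ^ m, Y s))"
    "\<forall>n. tc Y n = (if n < m then 0 else real m * tc (\<lambda>s. p (H s)) (n - m) / real n)"
proof -
  define c where "c = 1 / tc x m"
  have c: "c \<noteq> 0" using assms(2) by (simp add: c_def)
  have v: "van m (\<lambda>t. c * x t)" by (rule van_cmult[OF assms(1)])
  have t: "tc (\<lambda>t. c * x t) m = 1"
    using tc_cmult[OF smooth_x, of c m] assms(2) by (simp add: c_def)
  obtain S H where H: "diffeo_germ S" "diffeo_germ H" "tc S 1 = 1" "tc H 1 = 1"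
    "\<forall>\<^sub>F t in nhds 0. S t ^ m = c * x t" "\<forall>\<^sub>F s in nhds 0. c * x (H s) = s ^ m"
    "\<forall>\<^sub>F t in nhds 0. H (S t) = t" "\<forall>\<^sub>F s in nhds 0. S (H s) = s"
    using root_reparam[OF v t assms(3)] .
  note h = diffeo_germD[OF H(2)]
  define Y where "Y s = c * y (H s)" for s
  have Y: "smooth_germ Y" unfolding Y_def[abs_def]
    by (intro smooth_germ_intros smooth_germ_compose[OF h(1) smooth_y h(2)])
  have Y0: "Y 0 = 0" by (simp add: Y_def h y0)
  have P: "smooth_germ (\<lambda>s. p (H s))" by (rule smooth_germ_compose[OF h(1) smooth_p h(2)])
  have "smooth_germ (\<lambda>t. (x t, y t))" "(\<lambda>t. (x t, y t)) 0 = 0"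
    by (simp_all add: smooth_germ_Pair smooth_x smooth_y x0 y0 zero_prod_def)
  then have "A_equiv (\<lambda>t. (x t, y t)) (\<lambda>t. (c * x t, c * y t))"
    using A_equiv_push[OF diffeo_germ_scale[OF c c]] by force
  moreover have "A_equiv (\<lambda>t. (c * x t, c * y t)) (\<lambda>s. (s ^ m, Y s))"
    by (rule A_equiv_reparam[OF H(2)]) (use H(6) in eventually_elim, simp add: Y_def)
  ultimately have A: "A_equiv (\<lambda>t. (x t, y t)) (\<lambda>s. (s ^ m, Y s))" by (rule A_equiv_trans)
  have dY: "\<forall>\<^sub>F s in nhds 0. deriv Y s = s ^ (m - 1) * (real m * p (H s))"
    using eventually_compose_germ[OF smooth_germ_deriv(2)[OF smooth_x] h]
      eventually_compose_germ[OF smooth_germ_deriv(2)[OF smooth_y] h]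
      eventually_compose_germ[OF deriv_y h] smooth_germ_deriv(2)[OF h(1)] deriv_cong_germ[OF H(6)]
  proof eventually_elim
    case (elim s)
    have 1: "deriv (\<lambda>s. c * x (H s)) s = c * (deriv x (H s) * deriv H s)"
      using DERIV_imp_deriv[OF DERIV_cmult[OF DERIV_chain2[of x "deriv x (H s)" H s "deriv H s" UNIV, OF elim(1,4)]]] .
    have 2: "deriv Y s = c * (deriv y (H s) * deriv H s)"
      unfolding Y_def[abs_def]
      using DERIV_imp_deriv[OF DERIV_cmult[OF DERIV_chain2[of y "deriv y (H s)" H s "deriv H s" UNIV, OF elim(2,4)]]] .
    have 3: "deriv (\<lambda>s::real. s ^ m) s = real m * s ^ (m - 1)"
      using DERIV_imp_deriv[OF DERIV_pow[of m s]] by simp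
    have "deriv Y s = p (H s) * (c * (deriv x (H s) * deriv H s))" unfolding 2 elim(3) by (simp only: mult_ac)
    also have "\<dots> = p (H s) * (real m * s ^ (m - 1))" using 1 3 elim(5) by simp
    finally show ?case by (simp only: mult_ac)
  qed
  have "tc Y n = (if n < m then 0 else real m * tc (\<lambda>s. p (H s)) (n - m) / real n)" for n
  proof (cases n)
    case 0
    then show ?thesis using assms(3) Y0 by (simp add: tc_0)
  next
    case (Suc i)
    have "real (Suc i) * tc Y (Suc i) = tc (\<lambda>s. s ^ (m - 1) * (real m * p (H s))) i"
      using tc_cong[OF dY] tc_deriv[of Y i] by simp
    also have "\<dots> = (if i < m - 1 then 0 else real m * tc (\<lambda>s. p (H s)) (i - (m - 1)))"
      by (subst tc_shift) (intro smooth_germ_intros P, simp add: tc_cmult P)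
    finally have *: "real (Suc i) * tc Y (Suc i) = (if i < m - 1 then 0 else real m * tc (\<lambda>s. p (H s)) (i - (m - 1)))" .
    have "i - (m - 1) = n - m" "(i < m - 1) = (n < m)" using assms(3) Suc by auto
    then show ?thesis using * Suc by (simp add: field_simps del: of_nat_Suc split: if_splits)
  qed
  then have tY: "\<forall>n. tc Y n = (if n < m then 0 else real m * tc (\<lambda>s. p (H s)) (n - m) / real n)" by blast
  show thesis by (rule that[OF H(1-4) H(5)[unfolded c_def] H(7,8) Y Y0 A tY])
qed

text \<open>For even m a factor t^m splits off from S (- t)^m - S (t)^m, which is a multiple of x (-
  t) - x t and has order b. So the unit factor of S fails to be even in order b - m, and S fails to
  be odd in order b + 1 - m. The defect passes to the inverse H with the opposite sign.\<close>

lemma root_odd_part: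
  assumes "odd b" "\<And>i. odd i \<Longrightarrow> i < b \<Longrightarrow> tc \<theta> i = 0" and m: "even m" "2 \<le> m" "m < b" "tc x m \<noteq> 0"
    and S: "diffeo_germ S" and H: "diffeo_germ H" and "tc S 1 = 1" "tc H 1 = 1"
    and Sx: "\<forall>\<^sub>F t in nhds 0. S t ^ m = 1 / tc x m * x t"
    and HS: "\<forall>\<^sub>F t in nhds 0. H (S t) = t" and SH: "\<forall>\<^sub>F s in nhds 0. S (H s) = s"
  shows "van (b + 1 - m) (\<lambda>s. H (- s) + H s)"
    "tc (\<lambda>s. H (- s) + H s) (b + 1 - m) = 2 * \<delta> * tc \<theta> b / (real m * tc x m)"
proof -
  note s = diffeo_germD[OF S] and h = diffeo_germD[OF H]
  define c where "c = 1 / tc x m"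
  have b1: "b > 1 \<or> \<delta> = 0" using m by simp
  note X = x_odd_part[OF assms(1,2) b1]
  obtain k where k: "smooth_germ k" "\<forall>\<^sub>F t in nhds 0. S t = t ^ 1 * k t" "\<forall>i. tc k i = tc S (1 + i)"
    using van_factor[OF van_1I[OF s]] .
  have k0: "k 0 = 1" using spec[OF k(3), of 0] assms(9) by (simp add: tc_0)
  define D where "D t = k (- t) - k t" for t
  define W where "W t = (\<Sum>i<m. k t ^ (m - Suc i) * k (- t) ^ i)" for t
  have sD: "smooth_germ D" and sW: "smooth_germ W"
    unfolding D_def[abs_def] W_def[abs_def] by (intro smooth_germ_intros reflect_smooth k(1))+
  have W0: "W 0 = real m" by (simp add: W_def k0)
  have ev: "\<forall>\<^sub>F t in nhds 0. t ^ m * (D t * W t) = c * (x (- t) - x t)"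
    using Sx eventually_reflect[OF Sx] k(2) eventually_reflect[OF k(2)]
  proof eventually_elim
    case (elim t)
    have "D t * W t = k (- t) ^ m - k t ^ m"
      unfolding D_def W_def by (rule power_diff_sumr2[symmetric])
    then have "t ^ m * (D t * W t) = (- t) ^ m * k (- t) ^ m - t ^ m * k t ^ m"
      using m(1) by (simp add: right_diff_distrib)
    also have "\<dots> = S (- t) ^ m - S t ^ m" using elim(3,4) by (simp only: power_one_right power_mult_distrib)
    finally show ?case unfolding elim(1,2) by (simp add: c_def right_diff_distrib)
  qed
  have bm: "b = m + (b - m)" using m(3) by simp
  have sDW: "smooth_germ (\<lambda>t. D t * W t)" by (intro smooth_germ_intros sD sW)
  have "van b (\<lambda>t. t ^ m * (D t * W t))" by (rule van_cong[OF van_cmult[OF X(1)] ev])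
  then have vDW: "van (b - m) (\<lambda>t. D t * W t)" using van_cancel[of m "b - m", OF _ sDW] bm by simp
  then have vD: "van (b - m) D" by (rule van_unit[OF _ sW]) (use W0 m(2) in simp)
  have "tc (\<lambda>t. D t * W t) (b - m) = c * (2 * \<delta> * tc \<theta> b)"
  proof -
    have "tc (\<lambda>t. t ^ m * (D t * W t)) b = c * (2 * \<delta> * tc \<theta> b)"
      using tc_cong[OF ev, of b] X(2) by (simp add: tc_cmult van_smooth[OF X(1)])
    then show ?thesis using tc_shift[OF sDW, of m b] m(3) by simp
  qed
  then have tD: "tc D (b - m) = 2 * \<delta> * tc \<theta> b / (real m * tc x m)"
    using tc_mult_leading[OF vD sW] W0 m(2,4) by (simp add: c_def field_simps)
  define \<omega> where "\<omega> t = S (- t) + S t" for t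
  have s\<omega>: "smooth_germ \<omega>" "\<omega> 0 = 0" unfolding \<omega>_def[abs_def]
    by (intro smooth_germ_intros reflect_smooth s) (simp add: s)
  have ev\<omega>: "\<forall>\<^sub>F t in nhds 0. \<omega> t = - 1 * (t ^ 1 * D t)"
    using k(2) eventually_reflect[OF k(2)] by eventually_elim (simp add: \<omega>_def D_def algebra_simps)
  define r where "r = b + 1 - m"
  have r: "r = 1 + (b - m)" "r \<ge> 2" using m(3) by (simp_all add: r_def)
  have v\<omega>: "van r \<omega>"
    unfolding r(1) by (rule van_cong[OF van_cmult[OF van_mult[OF van_power_id[OF order_refl] vD]] ev\<omega>])
  have t\<omega>: "tc \<omega> r = - tc D (b - m)"
  proof -
    have s1: "smooth_germ (\<lambda>t. t ^ 1 * D t)" by (intro smooth_germ_intros sD)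
    have "tc \<omega> r = - 1 * tc (\<lambda>t. t ^ 1 * D t) r"
      using tc_cong[OF ev\<omega>, of r] tc_cmult[OF s1, of "- 1" r] by (rule trans)
    then show ?thesis using tc_shift[OF sD, of 1 r] r by simp
  qed
  define w where "w s = \<omega> (H s)" for s
  have sw: "smooth_germ w" "w 0 = 0" unfolding w_def[abs_def]
    by (rule smooth_germ_compose[OF h(1) s\<omega>(1) h(2)]) (simp add: h s\<omega>)
  have vw: "van r w" unfolding w_def[abs_def] by (rule van_compose[OF v\<omega> h])
  have tw: "tc w r = tc \<omega> r"
    unfolding w_def[abs_def] using tc_compose_leading[OF v\<omega> h] assms(10) by simp
  have r2: "2 \<le> r + 1" using r by simp
  obtain v where v: "smooth_germ v" "v 0 = tc H 1" "van (r + 1) (\<lambda>s. H (- s + w s) - H (- s) - w s * v s)"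
    using compose_increment[OF h(1) smooth_germ_minus[OF smooth_germ_ident] sw(1) minus_zero sw(2) r2] .
  \<comment> \<open>By definition of \<omega> one has S (- H s) = - s + w s; apply H. Expanding
    around - s then compares H (- s) with - H s.\<close>
  have evH: "\<forall>\<^sub>F s in nhds 0. H (- s + w s) = - H s"
    using eventually_compose_germ[OF eventually_reflect[OF HS] h] SH
    by eventually_elim (simp add: w_def \<omega>_def)
  let ?\<rho> = "\<lambda>s. H (- s) + H s"
  have s\<rho>: "smooth_germ ?\<rho>" by (intro smooth_germ_intros reflect_smooth h)
  have v1: "van (r + 1) (\<lambda>s. ?\<rho> s + w s * v s)"
    by (rule van_cong[OF van_minus[OF v(3)]]) (use evH in eventually_elim, simp)
  have v2: "van r (\<lambda>s. w s * v s)" by (rule van_mult_right[OF vw v(1)])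
  have "van r ?\<rho>" by (rule van_eq[OF van_diff[OF van_mono[OF v1] v2]]) simp_all
  then show "van (b + 1 - m) ?\<rho>" by (simp add: r_def)
  have "tc ?\<rho> r + tc (\<lambda>s. w s * v s) r = 0"
    using van_tc[OF v1, of r] by (simp add: tc_add s\<rho> van_smooth[OF v2])
  then have "tc ?\<rho> r = tc D (b - m)"
    using tc_mult_leading[OF vw v(1)] tw t\<omega> v(2) assms(10) by simp
  then show "tc ?\<rho> (b + 1 - m) = 2 * \<delta> * tc \<theta> b / (real m * tc x m)" by (simp add: tD r_def)
qed

text \<open>The odd part of p (H s) has two sources. One is the difference of p at H s and - H s, of
  order b. The other is the defect H (- s) + H s, of order b + 1 - m, multiplied by the derivative
  of p, which starts with \<open>2 * tc \<theta> 2\<close> times t. They meet in degree b if m = 2;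
  for larger m the second one comes first.\<close>

lemma slope_odd_part:
  assumes b': "odd b" "\<forall>i. odd i \<longrightarrow> i < b \<longrightarrow> tc \<theta> i = 0" and m: "even m" "2 \<le> m" "m < b" "tc x m \<noteq> 0"
    and S: "diffeo_germ S" and H: "diffeo_germ H" and t: "tc S 1 = 1" "tc H 1 = 1"
    and Sx: "\<forall>\<^sub>F t in nhds 0. S t ^ m = 1 / tc x m * x t"
    and HS: "\<forall>\<^sub>F t in nhds 0. H (S t) = t" and SH: "\<forall>\<^sub>F s in nhds 0. S (H s) = s"
    and n: "odd n" "n \<le> b + 2 - m"
  shows "tc (\<lambda>s. p (H s)) n = (if n < b + 2 - m then 0 else
    (if m = 2 then tc \<theta> b else 0) + 2 * \<delta> * tc \<theta> 2 * tc \<theta> b / (real m * tc x m))"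
proof -
  have b: "odd b" "\<And>i. odd i \<Longrightarrow> i < b \<Longrightarrow> tc \<theta> i = 0" using b' by auto
  note h = diffeo_germD[OF H]
  note \<rho> = root_odd_part[OF b m S H t Sx HS SH]
  define \<rho> where "\<rho> s = H (- s) + H s" for s
  define r where "r = b + 1 - m"
  have r: "r \<ge> 2" "b + 2 - m = r + 1" using m(3) by (simp_all add: r_def)
  have v\<rho>: "van r \<rho>" and t\<rho>: "tc \<rho> r = 2 * \<delta> * tc \<theta> b / (real m * tc x m)"
    unfolding \<rho>_def[abs_def] r_def by (rule \<rho>; assumption)+
  have s\<rho>: "smooth_germ \<rho>" "\<rho> 0 = 0" using van_smooth[OF v\<rho>] by (simp_all add: \<rho>_def h)
  have "tc \<theta> 1 = 0" using b(2)[of 1] m by simp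
  then have "van (Suc 1) \<theta>" unfolding van_iff_tc using \<theta> by (auto simp: less_Suc_eq tc_0)
  note pl = p_leading[OF this]
  have vp: "van 2 p" and tp: "tc p 2 = tc \<theta> 2" using pl by (simp_all add: numeral_2_eq_2)
  obtain \<pi> where \<pi>: "smooth_germ \<pi>" "\<forall>\<^sub>F t in nhds 0. p t = t ^ 1 * \<pi> t" "\<forall>i. tc \<pi> i = tc p (1 + i)"
    using van_factor[OF van_mono[OF vp one_le_numeral]] .
  have \<pi>0: "\<pi> 0 = 0" using spec[OF \<pi>(3), of 0] van_tc[OF vp, of 1] by (simp add: tc_0)
  have \<pi>1: "tc \<pi> 1 = tc \<theta> 2" using spec[OF \<pi>(3), of 1] tp by (simp add: numeral_2_eq_2)
  have r2: "2 \<le> r + 1" using r by simp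
  have mH: "smooth_germ (\<lambda>s. - H s)" "- H 0 = 0" by (simp_all add: smooth_germ_minus h)
  have Hm: "smooth_germ (\<lambda>s. H (- s))" "H (- 0) = 0" "tc (\<lambda>s. H (- s)) 1 = - 1"
    using tc_reflect[OF h(1), of 1] t(2) by (simp_all add: reflect_smooth h)
  obtain v where v: "smooth_germ v" "v 0 = tc \<pi> 1" "van (r + 1) (\<lambda>s. \<pi> (- H s + \<rho> s) - \<pi> (- H s) - \<rho> s * v s)"
    using compose_increment[OF \<pi>(1) mH(1) s\<rho>(1) mH(2) s\<rho>(2) r2] .
  define e where "e s = \<pi> (H (- s)) - \<pi> (- H s) - \<rho> s * v s" for s
  have ve: "van (r + 1) e" by (rule van_eq[OF v(3)]) (simp add: e_def \<rho>_def)
  define f where "f s = \<pi> (H (- s)) - H s * v s" for s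
  have s\<pi>: "smooth_germ (\<lambda>s. \<pi> (H (- s)))" by (rule smooth_germ_compose[OF Hm(1) \<pi>(1) Hm(2)])
  have sHv: "smooth_germ (\<lambda>s. H s * v s)" by (intro smooth_germ_intros h v(1))
  have sf: "smooth_germ f" unfolding f_def[abs_def] by (intro smooth_germ_intros s\<pi> h v(1))
  have vf: "van 1 f" by (rule van_1I[OF sf]) (simp add: f_def h \<pi>0)
  have tf: "tc f 1 = - 2 * tc \<theta> 2"
  proof -
    have "tc (\<lambda>s. \<pi> (H (- s))) 1 = - tc \<theta> 2" using tc_compose_1[OF \<pi>(1) Hm(1,2)] Hm(3) \<pi>1 by simp
    moreover have "tc (\<lambda>s. H s * v s) 1 = tc \<theta> 2"
      using tc_mult_leading[OF van_1I[OF h] v(1)] t(2) v(2) \<pi>1 by simp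
    ultimately show ?thesis unfolding f_def[abs_def] by (simp add: tc_diff s\<pi> sHv)
  qed
  define Q2 where "Q2 s = p (H (- s)) - p (- H s)" for s
  have evQ2: "\<forall>\<^sub>F s in nhds 0. Q2 s = \<rho> s * f s - H s * e s"
    using eventually_compose_germ[OF \<pi>(2) Hm(1,2)] eventually_compose_germ[OF \<pi>(2) mH]
  proof eventually_elim
    case (elim s)
    have "Q2 s = H (- s) * \<pi> (H (- s)) + H s * \<pi> (- H s)" using elim by (simp add: Q2_def)
    also have "\<dots> = \<rho> s * f s - H s * e s" by (simp add: \<rho>_def f_def e_def algebra_simps)
    finally show ?case .
  qed
  have v1: "van (r + 1) (\<lambda>s. \<rho> s * f s)" by (rule van_mult[OF v\<rho> vf])
  have v2: "van (r + 2) (\<lambda>s. H s * e s)" using van_mult[OF van_1I[OF h] ve] by simp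
  have vQ2: "van (r + 1) Q2" by (rule van_cong[OF van_diff[OF v1 van_mono[OF v2]] evQ2]) simp
  have tQ2: "tc Q2 (r + 1) = - 2 * tc \<theta> 2 * tc \<rho> r"
    using tc_cong[OF evQ2, of "r + 1"] van_tc[OF v2, of "r + 1"] tc_mult_leading2[OF v\<rho> vf] tf
    by (simp add: tc_diff van_smooth[OF v1] van_smooth[OF v2])
  define Q1 where "Q1 s = p (H s) - p (- H s)" for s
  have po: "van b (\<lambda>t. p t - p (- t))" "tc (\<lambda>t. p t - p (- t)) b = 2 * tc \<theta> b"
    by (rule p_odd_part[OF b]; assumption)+
  have vQ1: "van b Q1" unfolding Q1_def[abs_def] using van_compose[OF po(1) h] .
  have tQ1: "tc Q1 b = 2 * tc \<theta> b"
    unfolding Q1_def[abs_def] using tc_compose_leading[OF po(1) h] po(2) t(2) by simp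
  have P: "smooth_germ (\<lambda>s. p (H s))" by (rule smooth_germ_compose[OF h(1) smooth_p h(2)])
  have Pm: "smooth_germ (\<lambda>s. p (H (- s)))" by (rule reflect_smooth[OF P])
  have "tc (\<lambda>s. p (H s) - p (H (- s))) n = 2 * tc (\<lambda>s. p (H s)) n"
    using n(1) tc_reflect[OF P, of n] by (simp add: tc_diff P Pm)
  moreover have "tc (\<lambda>s. p (H s) - p (H (- s))) n = tc Q1 n - tc Q2 n"
  proof -
    have "(\<lambda>s. p (H s) - p (H (- s))) = (\<lambda>s. Q1 s - Q2 s)" by (simp add: Q1_def Q2_def)
    then show ?thesis by (simp add: tc_diff van_smooth[OF vQ1] van_smooth[OF vQ2])
  qed
  ultimately have 2: "2 * tc (\<lambda>s. p (H s)) n = tc Q1 n - tc Q2 n" by simp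
  show ?thesis
  proof (cases "n < r + 1")
    case True
    then have "n < b" using m r by simp
    then show ?thesis using 2 True van_tc[OF vQ1, of n] van_tc[OF vQ2, of n] r(2) by simp
  next
    case False
    then have nr: "n = r + 1" using n(2) r(2) by simp
    have "tc Q1 n = (if m = 2 then 2 * tc \<theta> b else 0)"
    proof (cases "m = 2")
      case True
      then have "n = b" using nr m(3) by (simp add: r_def)
      then show ?thesis using True tQ1 by simp
    next
      case False
      then have "n < b" using m nr by (simp add: r_def)
      then show ?thesis using False van_tc[OF vQ1] by simp
    qed
    moreover define z where "z = 2 * \<delta> * tc \<theta> 2 * tc \<theta> b / (real m * tc x m)"
    have "tc Q2 n = - 2 * z" using tQ2 nr by (simp add: z_def t\<rho>)
    ultimately have "tc (\<lambda>s. p (H s)) n = (if m = 2 then tc \<theta> b else 0) + z" using 2 by (auto split: if_splits)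
    then show ?thesis using False r(2) by (simp add: z_def)
  qed
qed

section \<open>Recognition of the types from the coefficients of the angle\<close>

lemma A_2_equiv:
  assumes "tc \<theta> 1 \<noteq> 0" "\<delta> = 0"
  shows "A_equiv (\<lambda>t. (x t, y t)) (\<lambda>t. (t ^ 2, t ^ (2 * 1 + 1)))"
proof -
  have "van 1 g" by (rule van_1I[OF smooth_g], unfold g_def, simp add: assms)
  note X = x_leading[OF this]
  have vx: "van 2 x" and tx: "tc x 2 \<noteq> 0" using X tc_g[of 1] assms(2) by (simp_all add: numeral_2_eq_2)
  obtain S H Y where "diffeo_germ S" and H: "diffeo_germ H" and "tc S 1 = 1" and H1: "tc H 1 = 1"
    and "\<forall>\<^sub>F t in nhds 0. S t ^ 2 = 1 / tc x 2 * x t"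
    "\<forall>\<^sub>F t in nhds 0. H (S t) = t" "\<forall>\<^sub>F s in nhds 0. S (H s) = s"
    and Y: "smooth_germ Y" "Y 0 = 0" and A: "A_equiv (\<lambda>t. (x t, y t)) (\<lambda>s. (s ^ 2, Y s))"
    and tY: "\<forall>n. tc Y n = (if n < 2 then 0 else real 2 * tc (\<lambda>s. p (H s)) (n - 2) / real n)"
    using reparam[OF vx tx one_le_numeral] .
  note h = diffeo_germD[OF H]
  have "van (Suc 0) \<theta>" using van_1I[OF \<theta>] by simp
  from p_leading(2)[OF this] have "tc (\<lambda>s. p (H s)) 1 = tc \<theta> 1"
    using tc_compose_1[OF smooth_p h] H1 by simp
  then have "tc Y (2 * 1 + 1) \<noteq> 0" using tY assms(1) by simp
  moreover have "tc Y (2 * i + 1) = 0" if "i < 1" for i using that tY by simp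
  ultimately have "A_equiv (\<lambda>s. (s ^ 2, Y s)) (\<lambda>t. (t ^ 2, t ^ (2 * 1 + 1)))"
    by (intro A2k_normal_form Y)
  with A show ?thesis by (rule A_equiv_trans)
qed

text \<open>Because \<open>tc x 2\<close> is (1 - 2 \<delta> \<open>tc \<theta> 2\<close>) / 2, the
  two contributions to the first odd coefficient of the slope add up to
  \<open>tc \<theta> (2 * k - 1)\<close> divided by 1 - 2 \<delta> \<open>tc \<theta> 2\<close>,
  which is nonzero.\<close>

lemma A_2k_equiv:
  assumes "k \<ge> 2" "\<And>i. odd i \<Longrightarrow> i < 2 * k - 1 \<Longrightarrow> tc \<theta> i = 0" "tc \<theta> (2 * k - 1) \<noteq> 0"
    "2 * \<delta> * tc \<theta> 2 \<noteq> 1"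
  shows "A_equiv (\<lambda>t. (x t, y t)) (\<lambda>t. (t ^ 2, t ^ (2 * k + 1)))"
proof -
  let ?b = "2 * k - 1"
  have b: "odd ?b" "2 < ?b" using assms(1) by auto
  have a1: "tc \<theta> 1 = 0" using assms(2)[of 1] b by simp
  have "tc g 0 = 0" using tc_g[of 0] a1 by simp
  then have "van 1 g" by (intro van_1I[OF smooth_g]) (simp add: tc_0)
  note X = x_leading[OF this]
  have vx: "van 2 x" and tx: "tc x 2 = (1 - 2 * \<delta> * tc \<theta> 2) / 2"
    using X tc_g[of 1] by (simp_all add: numeral_2_eq_2)
  have tx0: "tc x 2 \<noteq> 0" using tx assms(4) by simp
  obtain S H Y where H: "diffeo_germ S" "diffeo_germ H" "tc S 1 = 1" "tc H 1 = 1"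
    "\<forall>\<^sub>F t in nhds 0. S t ^ 2 = 1 / tc x 2 * x t"
    "\<forall>\<^sub>F t in nhds 0. H (S t) = t" "\<forall>\<^sub>F s in nhds 0. S (H s) = s"
    and Y: "smooth_germ Y" "Y 0 = 0" and A: "A_equiv (\<lambda>t. (x t, y t)) (\<lambda>s. (s ^ 2, Y s))"
    and tY: "\<forall>n. tc Y n = (if n < 2 then 0 else real 2 * tc (\<lambda>s. p (H s)) (n - 2) / real n)"
    using reparam[OF vx tx0 one_le_numeral] .
  have e2: "even (2::nat)" by simp
  have odd0: "\<forall>i. odd i \<longrightarrow> i < ?b \<longrightarrow> tc \<theta> i = 0" using assms(2) by blast
  note P = slope_odd_part[OF b(1) odd0 e2 order_refl b(2) tx0 H]
  have "tc Y (2 * i + 1) = 0" if "i < k" for i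
  proof (cases i)
    case (Suc j)
    have "tc (\<lambda>s. p (H s)) (2 * j + 1) = 0" using P[of "2 * j + 1"] that Suc by simp
    then show ?thesis using spec[OF tY, of "2 * i + 1"] Suc by simp
  qed (use tY in simp)
  moreover have "tc Y (2 * k + 1) \<noteq> 0"
  proof -
    have "tc (\<lambda>s. p (H s)) ?b = tc \<theta> ?b + 2 * \<delta> * tc \<theta> 2 * tc \<theta> ?b / (real 2 * tc x 2)"
      using P[OF b(1)] b(2) by simp
    also have "\<dots> = tc \<theta> ?b / (1 - 2 * \<delta> * tc \<theta> 2)"
    proof -
      have "1 - 2 * \<delta> * tc \<theta> 2 \<noteq> 0" using assms(4) by simp
      then show ?thesis unfolding tx by (simp add: field_simps)
    qed
    finally have "tc (\<lambda>s. p (H s)) ?b \<noteq> 0" using assms(3,4) by simp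
    moreover have "2 * k + 1 - 2 = ?b" using assms(1) by simp
    ultimately show ?thesis using spec[OF tY, of "2 * k + 1"] assms(1) by simp
  qed
  ultimately have "A_equiv (\<lambda>s. (s ^ 2, Y s)) (\<lambda>t. (t ^ 2, t ^ (2 * k + 1)))"
    by (intro A2k_normal_form Y)
  with A show ?thesis by (rule A_equiv_trans)
qed

text \<open>The linear term of g cancels and its quadratic one comes from the third coefficient of
  \<theta>, so x has order 3. The slope starts in degree 2, which puts the first term of Y in degree
  3 + 2.\<close>

lemma E8_equiv:
  assumes "tc \<theta> 1 = 0" "tc \<theta> 3 \<noteq> 0" "2 * \<delta> * tc \<theta> 2 = 1"
  shows "A_equiv (\<lambda>t. (x t, y t)) (\<lambda>t. (t ^ 3, t ^ 5))"
proof -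
  have "van 2 g" unfolding van_iff_tc
  proof (intro conjI allI impI smooth_g)
    fix i :: nat assume "i < 2"
    then consider "i = 0" | "i = 1" by linarith
    then show "tc g i = 0" using tc_g[of i] assms by cases (simp_all add: numeral_2_eq_2)
  qed
  note X = x_leading[OF this]
  have vx: "van 3 x" and tx: "tc x 3 \<noteq> 0"
    using X tc_g[of 2] assms by (auto simp: numeral_3_eq_3)
  obtain S H Y where "diffeo_germ S" and H: "diffeo_germ H" and "tc S 1 = 1" and H1: "tc H 1 = 1"
    and "\<forall>\<^sub>F t in nhds 0. S t ^ 3 = 1 / tc x 3 * x t"
    "\<forall>\<^sub>F t in nhds 0. H (S t) = t" "\<forall>\<^sub>F s in nhds 0. S (H s) = s"
    and Y: "smooth_germ Y" "Y 0 = 0" and A: "A_equiv (\<lambda>t. (x t, y t)) (\<lambda>s. (s ^ 3, Y s))"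
    and tY: "\<forall>n. tc Y n = (if n < 3 then 0 else real 3 * tc (\<lambda>s. p (H s)) (n - 3) / real n)"
    using reparam[OF vx tx one_le_numeral] .
  note h = diffeo_germD[OF H]
  have "van (Suc 1) \<theta>" unfolding van_iff_tc using \<theta> assms(1) by (auto simp: less_Suc_eq tc_0)
  note pl = p_leading[OF this]
  have vp: "van 2 p" and tp: "tc p 2 = tc \<theta> 2" using pl by (simp_all add: numeral_2_eq_2)
  have vP: "van 2 (\<lambda>s. p (H s))" by (rule van_compose[OF vp h])
  have tP: "tc (\<lambda>s. p (H s)) 2 = tc \<theta> 2" using tc_compose_leading[OF vp h] tp H1 by simp
  have "van 5 Y" unfolding van_iff_tc
  proof (intro conjI allI impI Y(1))
    fix i :: nat assume "i < 5"
    then have "\<not> i < 3 \<Longrightarrow> i - 3 < 2" by simp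
    then show "tc Y i = 0" using spec[OF tY, of i] van_tc[OF vP, of "i - 3"] by auto
  qed
  moreover have "tc Y 5 \<noteq> 0" using spec[OF tY, of 5] tP assms(3) by auto
  ultimately have "A_equiv (\<lambda>s. (s ^ 3, Y s)) (\<lambda>t. (t ^ 3, t ^ 5))" by (rule E8_normal_form)
  with A show ?thesis by (rule A_equiv_trans)
qed

text \<open>Now x has order 4, by the coefficient of \<theta> in degree 4, and the slope of order 2
  gives Y the leading degree 6. With b = 2q + 3, the first odd term of the slope stems from the root
  failing to be odd; it has degree b - 2 = 2q + 1 and lands in degree 2q + 5 of Y.\<close>

lemma W_equiv:
  assumes "k \<ge> 3" "\<And>i. odd i \<Longrightarrow> i < 2 * k - 1 \<Longrightarrow> tc \<theta> i = 0" "tc \<theta> (2 * k - 1) \<noteq> 0"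
    "2 * \<delta> * tc \<theta> 2 = 1" "tc \<theta> 4 \<noteq> 0"
  shows "A_equiv (\<lambda>t. (x t, y t)) (\<lambda>t. (t ^ 4, t ^ 6 + t ^ (2 * (k - 2) + 5)))"
proof -
  let ?b = "2 * k - 1"
  define q where "q = k - 2"
  have q: "q \<ge> 1" "k = q + 2" using assms(1) by (simp_all add: q_def)
  have b: "odd ?b" "4 < ?b" using assms(1) by auto
  have a: "tc \<theta> 1 = 0" "tc \<theta> 3 = 0" using assms(2)[of 1] assms(2)[of 3] b by simp_all
  have "van 3 g" unfolding van_iff_tc
  proof (intro conjI allI impI smooth_g)
    fix i :: nat assume "i < 3"
    then consider "i = 0" | "i = 1" | "i = 2" by linarith
    then show "tc g i = 0" using tc_g[of i] a assms(4) by cases (simp_all add: numeral_2_eq_2 numeral_3_eq_3)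
  qed
  note X = x_leading[OF this]
  have "\<delta> \<noteq> 0" using assms(4) by auto
  then have vx: "van 4 x" and tx0: "tc x 4 \<noteq> 0"
    using X tc_g[of 3] assms(5) \<open>\<delta> \<noteq> 0\<close> by simp_all
  obtain S H Y where H: "diffeo_germ S" "diffeo_germ H" "tc S 1 = 1" "tc H 1 = 1"
    "\<forall>\<^sub>F t in nhds 0. S t ^ 4 = 1 / tc x 4 * x t"
    "\<forall>\<^sub>F t in nhds 0. H (S t) = t" "\<forall>\<^sub>F s in nhds 0. S (H s) = s"
    and Y: "smooth_germ Y" "Y 0 = 0" and A: "A_equiv (\<lambda>t. (x t, y t)) (\<lambda>s. (s ^ 4, Y s))"
    and tY: "\<forall>n. tc Y n = (if n < 4 then 0 else real 4 * tc (\<lambda>s. p (H s)) (n - 4) / real n)"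
    using reparam[OF vx tx0 one_le_numeral] .
  note h = diffeo_germD[OF H(2)]
  have "van (Suc 1) \<theta>" unfolding van_iff_tc using \<theta> a(1) by (auto simp: less_Suc_eq tc_0)
  note pl = p_leading[OF this]
  have vp: "van 2 p" and tp: "tc p 2 = tc \<theta> 2" using pl by (simp_all add: numeral_2_eq_2)
  have vP: "van 2 (\<lambda>s. p (H s))" by (rule van_compose[OF vp h])
  have tP: "tc (\<lambda>s. p (H s)) 2 = tc \<theta> 2" using tc_compose_leading[OF vp h] tp H(4) by simp
  have vY: "van 6 Y" unfolding van_iff_tc
  proof (intro conjI allI impI Y(1))
    fix i :: nat assume "i < 6"
    then have "\<not> i < 4 \<Longrightarrow> i - 4 < 2" by simp
    then show "tc Y i = 0" using spec[OF tY, of i] van_tc[OF vP, of "i - 4"] by auto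
  qed
  have tY6: "tc Y 6 \<noteq> 0" using spec[OF tY, of 6] tP assms(4) by auto
  have odd0: "\<forall>i. odd i \<longrightarrow> i < ?b \<longrightarrow> tc \<theta> i = 0" using assms(2) by blast
  have e4: "even (4::nat)" "2 \<le> (4::nat)" by simp_all
  note P = slope_odd_part[OF b(1) odd0 e4 b(2) tx0 H]
  have bq: "?b + 2 - 4 = 2 * q + 1" using q by simp
  have odd: "tc Y (2 * i + 1) = 0" if "i < q + 2" for i
  proof (cases "i < 2")
    case True
    then show ?thesis using spec[OF tY, of "2 * i + 1"] by simp
  next
    case False
    then have i: "2 * i + 1 - 4 = 2 * (i - 2) + 1" by simp
    have "tc (\<lambda>s. p (H s)) (2 * (i - 2) + 1) = 0"
      using P[of "2 * (i - 2) + 1"] that False unfolding bq by simp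
    then show ?thesis using spec[OF tY, of "2 * i + 1"] i by simp
  qed
  have "tc Y (2 * q + 5) \<noteq> 0"
  proof -
    have "tc (\<lambda>s. p (H s)) (2 * q + 1) = 2 * \<delta> * tc \<theta> 2 * tc \<theta> ?b / (real 4 * tc x 4)"
      using P[of "2 * q + 1"] unfolding bq by simp
    then have "tc (\<lambda>s. p (H s)) (2 * q + 1) \<noteq> 0" using assms(3,4) tx0 by simp
    moreover have "2 * q + 5 - 4 = 2 * q + 1" by simp
    ultimately show ?thesis using spec[OF tY, of "2 * q + 5"] by simp
  qed
  then have "A_equiv (\<lambda>s. (s ^ 4, Y s)) (\<lambda>t. (t ^ 4, t ^ 6 + t ^ (2 * q + 5)))"
    using vY tY6 odd q(1) by (intro W_normal_form)
  with A show ?thesis unfolding q_def by (rule A_equiv_trans)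
qed

end

subsection \<open>The order of folding\<close>

lemma eventually_nhds_at: "\<forall>\<^sub>F t in nhds a. P t \<Longrightarrow> \<forall>\<^sub>F t in at a. P t"
  by (simp add: eventually_nhds_conv_at)

text \<open>The fold \<sigma> is merely asymptotic to - t. This is enough for the upper bound on
  cusps and is preserved by conjugation with diffeomorphism germs.\<close>

definition fold_order :: "nat \<Rightarrow> (real \<Rightarrow> real \<times> real) \<Rightarrow> bool" where
  "fold_order N f \<longleftrightarrow> (\<exists>\<sigma>::real \<Rightarrow> real. ((\<lambda>t. \<sigma> t / t) \<longlongrightarrow> - 1) (at 0) \<and>
     (\<exists>C. \<forall>\<^sub>F t in at 0. norm (f (\<sigma> t) - f t) \<le> C * \<bar>t\<bar> ^ N))"

text \<open>\<open>Ck_on\<close> speaks of directional derivatives; the sum of their norms over the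
  basis is continuous and bounds the operator norm, so the mean value inequality applies on a small
  ball.\<close>

lemma smooth_germ_lipschitz:
  fixes f :: "'a::euclidean_space \<Rightarrow> 'b::real_normed_vector"
  assumes "smooth_germ f"
  obtains C U where "open U" "0 \<in> U" "\<forall>x\<in>U. \<forall>y\<in>U. norm (f x - f y) \<le> C * norm (x - y)"
proof -
  obtain S where S: "0 \<in> S" "smooth_on f S" using smooth_germE[OF assms] .
  note oS = smooth_onD(1)[OF S(2)]
  define D where "D x = frechet_derivative f (at x)" for x
  have D: "(f has_derivative D x) (at x)" if "x \<in> S" for x
    unfolding D_def by (rule Ck_on_Suc_has_derivative[OF smooth_onD(2)[OF S(2)] that])
  define nD where "nD x = (\<Sum>b\<in>Basis. norm (D x b))" for x
  have cont: "isCont nD 0"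
  proof -
    have "continuous_on S (\<lambda>x. D x b)" for b
      using Ck_on_Suc_frechet[OF smooth_onD(2)[OF S(2), of "Suc 0"], of b] by (simp add: D_def)
    then have "continuous_on S nD" unfolding nD_def[abs_def] by (intro continuous_intros)
    then show ?thesis using continuous_on_eq_continuous_at[OF oS] S(1) by fast
  qed
  define M where "M = nD 0 + 1"
  have "(nD \<longlongrightarrow> nD 0) (nhds 0)" using cont by (simp add: isCont_def tendsto_at_iff_tendsto_nhds)
  then have "\<forall>\<^sub>F x in nhds 0. nD x < M" by (rule order_tendstoD(2)) (simp add: M_def)
  then obtain T where T: "open T" "0 \<in> T" "\<And>x. x \<in> T \<Longrightarrow> nD x < M"
    unfolding eventually_nhds by blast
  have "open (S \<inter> T)" "0 \<in> S \<inter> T" using oS T S by auto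
  then obtain \<epsilon> where \<epsilon>: "\<epsilon> > 0" "ball 0 \<epsilon> \<subseteq> S \<inter> T" using open_contains_ball by blast
  show thesis
  proof (rule that[of "ball 0 \<epsilon>" M])
    show "\<forall>x\<in>ball 0 \<epsilon>. \<forall>y\<in>ball 0 \<epsilon>. norm (f x - f y) \<le> M * norm (x - y)"
    proof (intro ballI)
      fix x y :: 'a assume xy: "x \<in> ball 0 \<epsilon>" "y \<in> ball 0 \<epsilon>"
      show "norm (f x - f y) \<le> M * norm (x - y)"
      proof (rule differentiable_bound[OF convex_ball _ _ xy])
        fix z :: 'a assume z: "z \<in> ball 0 \<epsilon>"
        then have zS: "z \<in> S" "z \<in> T" using \<epsilon>(2) by auto
        show "(f has_derivative D z) (at z within ball 0 \<epsilon>)"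
          by (rule has_derivative_at_withinI[OF D[OF zS(1)]])
        have l: "linear (D z)" using D[OF zS(1)] has_derivative_linear by blast
        show "onorm (D z) \<le> M"
        proof (rule onorm_le)
          fix v
          have "D z v = D z (\<Sum>b\<in>Basis. (v \<bullet> b) *\<^sub>R b)" by (simp only: euclidean_representation)
          also have "\<dots> = (\<Sum>b\<in>Basis. (v \<bullet> b) *\<^sub>R D z b)" by (simp only: linear_sum[OF l] linear_scale[OF l])
          finally have "norm (D z v) \<le> (\<Sum>b\<in>Basis. norm ((v \<bullet> b) *\<^sub>R D z b))" by (simp only: norm_sum)
          also have "\<dots> \<le> (\<Sum>b\<in>Basis. norm v * norm (D z b))"
            unfolding norm_scaleR by (intro sum_mono mult_right_mono Basis_le_norm) simp_all
          also have "\<dots> \<le> M * norm v"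
            unfolding sum_distrib_left[symmetric] nD_def[symmetric]
            using mult_right_mono[OF less_imp_le[OF T(3)[OF zS(2)]], of "norm v"] by (simp add: mult.commute)
          finally show "norm (D z v) \<le> M * norm v" .
        qed
      qed
    qed
  qed (use \<epsilon> in simp_all)
qed

lemma smooth_germ_quotient_tendsto:
  fixes h :: "real \<Rightarrow> real"
  assumes "smooth_germ h" "h 0 = 0" shows "((\<lambda>t. h t / t) \<longlongrightarrow> deriv h 0) (at 0)"
  using smooth_germ_deriv(3)[OF assms(1)] assms(2) by (simp add: DERIV_def)

text \<open>The fold is conjugated by the reparametrization, and the target diffeomorphism is undone
  by its inverse, whose Lipschitz constant only enlarges C.\<close>

lemma fold_order_A_equiv:
  assumes "A_equiv f g" "smooth_germ g" "g 0 = 0" "fold_order N f"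
  shows "fold_order N g"
proof -
  obtain h \<psi> where h: "diffeo_germ h" "diffeo_germ \<psi>" "\<forall>\<^sub>F t in nhds 0. f (h t) = \<psi> (g t)"
    using assms(1) unfolding A_equiv_def by blast
  obtain k where k: "diffeo_germ k" "\<forall>\<^sub>F x in nhds 0. k (h x) = x" "\<forall>\<^sub>F x in nhds 0. h (k x) = x"
    using diffeo_germE[OF h(1)] .
  obtain \<omega> where \<omega>: "diffeo_germ \<omega>" "\<forall>\<^sub>F x in nhds 0. \<omega> (\<psi> x) = x" "\<forall>\<^sub>F x in nhds 0. \<psi> (\<omega> x) = x"
    using diffeo_germE[OF h(2)] .
  note dh = diffeo_germD[OF h(1)] and dk = diffeo_germD[OF k(1)] and d\<psi> = diffeo_germD[OF h(2)]
    and d\<omega> = diffeo_germD[OF \<omega>(1)]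
  obtain \<sigma> C where \<sigma>: "((\<lambda>t. \<sigma> t / t) \<longlongrightarrow> - 1) (at 0)" "\<forall>\<^sub>F t in at 0. norm (f (\<sigma> t) - f t) \<le> C * \<bar>t\<bar> ^ N"
    using assms(4) unfolding fold_order_def by blast
  \<comment> \<open>Limits of quotients live on punctured neighbourhoods, so h and \<sigma> must be
    seen to avoid the value 0 there.\<close>
  have hl: "filterlim h (at 0) (at 0)"
    unfolding filterlim_at
  proof
    show "(h \<longlongrightarrow> 0) (at 0)" using smooth_germ_isCont[OF dh(1)] dh(2) by (simp add: isCont_def)
    have "\<forall>\<^sub>F t in at 0. k (h t) = t" using k(2) by (rule eventually_nhds_at) 
    then show "\<forall>\<^sub>F t in at 0. h t \<in> UNIV \<and> h t \<noteq> 0"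
      using eventually_neq_at_within[of 0 0 UNIV] by eventually_elim (auto simp: dk)
  qed
  have \<sigma>l: "filterlim \<sigma> (at 0) (at 0)"
    unfolding filterlim_at
  proof
    have "((\<lambda>t. \<sigma> t / t * t) \<longlongrightarrow> - 1 * 0) (at 0)" by (intro tendsto_intros \<sigma>(1))
    moreover have "\<forall>\<^sub>F t in at 0. \<sigma> t / t * t = \<sigma> t"
      using eventually_neq_at_within[of 0 0 UNIV] by eventually_elim simp
    ultimately show "(\<sigma> \<longlongrightarrow> 0) (at 0)" using tendsto_cong by force
    have "\<forall>\<^sub>F t in at 0. \<sigma> t / t < 0" by (rule order_tendstoD(2)[OF \<sigma>(1)]) simp
    then show "\<forall>\<^sub>F t in at 0. \<sigma> t \<in> UNIV \<and> \<sigma> t \<noteq> 0" by eventually_elim auto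
  qed
  define \<tau> where "\<tau> t = k (\<sigma> (h t))" for t
  have hq: "((\<lambda>t. h t / t) \<longlongrightarrow> deriv h 0) (at 0)" by (rule smooth_germ_quotient_tendsto[OF dh])
  have kq: "((\<lambda>t. k t / t) \<longlongrightarrow> deriv k 0) (at 0)" by (rule smooth_germ_quotient_tendsto[OF dk])
  have kh: "deriv k 0 * deriv h 0 = 1"
  proof -
    have "((\<lambda>x. k (h x)) has_real_derivative deriv k 0 * deriv h 0) (at 0)"
      using smooth_germ_deriv(3)[OF dk(1)] dh(2)
      by (intro DERIV_chain2[of k _ h] smooth_germ_deriv(3)[OF dh(1)]) simp
    moreover have "((\<lambda>x. x) has_real_derivative 1) (at (0::real))" by simp
    then have "((\<lambda>x. k (h x)) has_real_derivative 1) (at 0)"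
      using DERIV_cong_ev[OF refl k(2) refl, of 1] by simp
    ultimately show ?thesis by (rule DERIV_unique)
  qed
  have sh: "filterlim (\<lambda>t. \<sigma> (h t)) (at 0) (at 0)" by (rule filterlim_compose[OF \<sigma>l hl])
  have lim: "((\<lambda>t. (k (\<sigma> (h t)) / \<sigma> (h t)) * (\<sigma> (h t) / h t) * (h t / t)) \<longlongrightarrow> deriv k 0 * (- 1) * deriv h 0) (at 0)"
    by (intro tendsto_mult filterlim_compose[OF kq sh] filterlim_compose[OF \<sigma>(1) hl] hq)
  have ev: "\<forall>\<^sub>F t in at 0. (k (\<sigma> (h t)) / \<sigma> (h t)) * (\<sigma> (h t) / h t) * (h t / t) = \<tau> t / t"
  proof -
    have "\<forall>\<^sub>F t in at 0. h t \<noteq> 0" using hl unfolding filterlim_at by (auto elim: eventually_mono)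
    moreover have "\<forall>\<^sub>F t in at 0. \<sigma> (h t) \<noteq> 0" using sh unfolding filterlim_at by (auto elim: eventually_mono)
    ultimately show ?thesis by eventually_elim (simp add: \<tau>_def)
  qed
  have "deriv k 0 * (- 1) * deriv h 0 = - 1" using kh by simp
  with iffD1[OF tendsto_cong[OF ev] lim] have t1: "((\<lambda>t. \<tau> t / t) \<longlongrightarrow> - 1) (at 0)" by (simp only:)
  have shn: "filterlim (\<lambda>t. \<sigma> (h t)) (nhds 0) (at 0)" using sh by (simp add: filterlim_at)
  have \<tau>n: "filterlim \<tau> (nhds 0) (at 0)"
    unfolding \<tau>_def[abs_def] by (rule filterlim_compose[OF smooth_germ_filterlim[OF dk] shn])
  have id: "filterlim (\<lambda>t::real. t) (nhds 0) (at 0)" by (rule tendsto_ident_at)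
  have E: "\<forall>\<^sub>F t in nhds 0. \<omega> (f (h t)) = g t"
    using eventually_compose_germ[OF \<omega>(2) assms(2,3)] h(3) by eventually_elim simp
  have E1: "\<forall>\<^sub>F t in at 0. \<omega> (f (h t)) = g t" using E by (rule eventually_nhds_at)
  have E2: "\<forall>\<^sub>F t in at 0. \<omega> (f (\<sigma> (h t))) = g (\<tau> t)"
    using eventually_compose_filterlim[OF E \<tau>n] eventually_compose_filterlim[OF k(3) shn]
    by eventually_elim (simp add: \<tau>_def)
  have F1: "filterlim (\<lambda>t. f (h t)) (nhds 0) (at 0)"
  proof -
    have "filterlim (\<lambda>t. \<psi> (g t)) (nhds 0) (at 0)"
      by (rule filterlim_compose[OF smooth_germ_filterlim[OF d\<psi>] filterlim_compose[OF smooth_germ_filterlim[OF assms(2,3)] id]])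
    moreover have "\<forall>\<^sub>F t in at 0. \<psi> (g t) = f (h t)"
      using eventually_nhds_at[OF h(3)] by eventually_elim simp
    ultimately show ?thesis using filterlim_cong[OF refl refl] by fast
  qed
  have F2: "filterlim (\<lambda>t. f (\<sigma> (h t))) (nhds 0) (at 0)"
  proof -
    have "filterlim (\<lambda>t. \<psi> (g (\<tau> t))) (nhds 0) (at 0)"
      by (rule filterlim_compose[OF smooth_germ_filterlim[OF d\<psi>] filterlim_compose[OF smooth_germ_filterlim[OF assms(2,3)] \<tau>n]])
    moreover have "\<forall>\<^sub>F t in at 0. \<psi> (g (\<tau> t)) = f (\<sigma> (h t))"
      using eventually_compose_filterlim[OF h(3) \<tau>n] eventually_compose_filterlim[OF k(3) shn]
      by eventually_elim (simp add: \<tau>_def)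
    ultimately show ?thesis using filterlim_cong[OF refl refl] by fast
  qed
  obtain M U where U: "open U" "0 \<in> U" "\<forall>x\<in>U. \<forall>y\<in>U. norm (\<omega> x - \<omega> y) \<le> M * norm (x - y)"
    using smooth_germ_lipschitz[OF d\<omega>(1)] .
  have U0: "\<forall>\<^sub>F x in nhds 0. x \<in> U" by (rule eventually_nhds_in_open[OF U(1,2)])
  have B: "\<forall>\<^sub>F t in at 0. norm (f (\<sigma> (h t)) - f (h t)) \<le> C * \<bar>h t\<bar> ^ N"
    by (rule eventually_compose_filterlim[OF \<sigma>(2) hl])
  have H: "\<forall>\<^sub>F t in at 0. \<bar>h t\<bar> \<le> (\<bar>deriv h 0\<bar> + 1) * \<bar>t\<bar>"
  proof -
    have "\<forall>\<^sub>F t in at 0. \<bar>h t / t\<bar> < \<bar>deriv h 0\<bar> + 1"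
      by (rule order_tendstoD(2)[OF tendsto_rabs[OF hq]]) simp
    then show ?thesis using eventually_neq_at_within[of 0 0 UNIV]
      by eventually_elim (simp add: abs_divide field_simps)
  qed
  have "\<forall>\<^sub>F t in at 0. norm (g (\<tau> t) - g t) \<le> (\<bar>M\<bar> * \<bar>C\<bar> * (\<bar>deriv h 0\<bar> + 1) ^ N) * \<bar>t\<bar> ^ N"
    using E1 E2 eventually_compose_filterlim[OF U0 F1] eventually_compose_filterlim[OF U0 F2] B H
  proof eventually_elim
    case (elim t)
    have "norm (g (\<tau> t) - g t) \<le> M * norm (f (\<sigma> (h t)) - f (h t))"
      using elim(3,4) U(3) unfolding elim(1)[symmetric] elim(2)[symmetric] by blast
    also have "\<dots> \<le> \<bar>M\<bar> * norm (f (\<sigma> (h t)) - f (h t))" by (intro mult_right_mono) simp_all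
    finally have e1: "norm (g (\<tau> t) - g t) \<le> \<bar>M\<bar> * norm (f (\<sigma> (h t)) - f (h t))" .
    have e2: "norm (f (\<sigma> (h t)) - f (h t)) \<le> \<bar>C\<bar> * \<bar>h t\<bar> ^ N"
      using elim(5) by (rule order_trans) (intro mult_right_mono; simp)
    have e3: "\<bar>h t\<bar> ^ N \<le> (\<bar>deriv h 0\<bar> + 1) ^ N * \<bar>t\<bar> ^ N"
      using power_mono[OF elim(6), of N] by (simp add: power_mult_distrib)
    have "norm (g (\<tau> t) - g t) \<le> \<bar>M\<bar> * (\<bar>C\<bar> * ((\<bar>deriv h 0\<bar> + 1) ^ N * \<bar>t\<bar> ^ N))"
      by (rule order_trans[OF e1 mult_left_mono[OF order_trans[OF e2 mult_left_mono[OF e3]]]]) simp_all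
    then show ?case by (simp only: mult.assoc)
  qed
  with t1 show ?thesis unfolding fold_order_def by (intro exI[of _ \<tau>]) blast
qed

text \<open>For n = 2k + 1 the quotient (\<sigma> t / t)^n tends to (- 1)^n = - 1, whereas a bound
  of order above n on the second component would force the limit 1.\<close>

lemma fold_order_cusp:
  assumes "fold_order N (\<lambda>t. (t ^ 2, t ^ (2 * k + 1)))" shows "N \<le> 2 * k + 1"
proof (rule ccontr)
  assume "\<not> N \<le> 2 * k + 1"
  then have N: "N = (2 * k + 1) + Suc (N - 2 * k - 2)" by simp
  define n where "n = 2 * k + 1"
  define j where "j = N - 2 * k - 2"
  have nj: "N = n + Suc j" using N by (simp add: n_def j_def)
  have on: "odd n" by (simp add: n_def)
  obtain \<sigma> C where \<sigma>: "((\<lambda>t. \<sigma> t / t) \<longlongrightarrow> - 1) (at 0)"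
    "\<forall>\<^sub>F t in at 0. norm ((\<sigma> t ^ 2, \<sigma> t ^ n) - (t ^ 2, t ^ n)) \<le> C * \<bar>t\<bar> ^ N"
    using assms unfolding fold_order_def n_def by blast
  have "((\<lambda>t. (\<sigma> t / t) ^ n - 1) \<longlongrightarrow> (- 1) ^ n - 1) (at 0)" by (intro tendsto_intros \<sigma>(1))
  moreover have "((\<lambda>t. (\<sigma> t / t) ^ n - 1) \<longlongrightarrow> 0) (at 0)"
  proof (rule Lim_null_comparison)
    show "\<forall>\<^sub>F t in at 0. norm ((\<sigma> t / t) ^ n - 1) \<le> C * \<bar>t\<bar> ^ Suc j"
      using \<sigma>(2) eventually_neq_at_within[of 0 0 UNIV]
    proof eventually_elim
      case (elim t)
      have "\<bar>\<sigma> t ^ n - t ^ n\<bar> \<le> C * \<bar>t\<bar> ^ N"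
        using norm_snd_le[of "\<sigma> t ^ n - t ^ n" "\<sigma> t ^ 2 - t ^ 2"] elim(1) by simp
      then have "\<bar>\<sigma> t ^ n - t ^ n\<bar> / \<bar>t\<bar> ^ n \<le> C * \<bar>t\<bar> ^ N / \<bar>t\<bar> ^ n" by (rule divide_right_mono) simp
      also have "\<dots> = C * \<bar>t\<bar> ^ Suc j" using elim(2) by (simp add: nj power_add)
      also have "\<bar>\<sigma> t ^ n - t ^ n\<bar> / \<bar>t\<bar> ^ n = \<bar>(\<sigma> t / t) ^ n - 1\<bar>"
        using elim(2) by (simp add: power_divide abs_divide[symmetric] power_abs[symmetric] diff_divide_distrib del: abs_divide)
      finally show ?case by simp
    qed
    have "((\<lambda>t::real. C * \<bar>t\<bar> ^ Suc j) \<longlongrightarrow> C * \<bar>0\<bar> ^ Suc j) (at 0)" by (intro tendsto_intros)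
    then show "((\<lambda>t::real. C * \<bar>t\<bar> ^ Suc j) \<longlongrightarrow> 0) (at 0)" by simp
  qed
  ultimately have "(- 1) ^ n - 1 = (0::real)" using tendsto_unique[OF trivial_limit_at] by blast
  then show False using on by simp
qed

lemma fold_orderI:
  assumes "van N (\<lambda>t. x (- t) - x t)" "van N (\<lambda>t. y (- t) - y t)"
  shows "fold_order N (\<lambda>t. (x t, y t))"
proof -
  have b: "\<exists>C. \<forall>\<^sub>F t in at 0. \<bar>f t\<bar> \<le> C * \<bar>t\<bar> ^ N" if van: "van N f" for f
  proof -
    obtain k where k: "smooth_germ k" "\<forall>\<^sub>F t in nhds 0. f t = t ^ N * k t" using vanE[OF van] .
    have "\<forall>\<^sub>F t in nhds 0. \<bar>k t\<bar> < \<bar>k 0\<bar> + 1"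
      by (rule order_tendstoD(2)[OF tendsto_rabs[OF smooth_germ_tendsto[OF k(1)]]]) simp
    with k(2) have "\<forall>\<^sub>F t in nhds 0. \<bar>f t\<bar> \<le> (\<bar>k 0\<bar> + 1) * \<bar>t\<bar> ^ N"
    proof eventually_elim
      case (elim t)
      have "\<bar>t\<bar> ^ N * \<bar>k t\<bar> \<le> \<bar>t\<bar> ^ N * (\<bar>k 0\<bar> + 1)" by (rule mult_left_mono) (use elim(2) in auto)
      then show ?case using elim(1) by (simp add: abs_mult power_abs mult.commute)
    qed
    then show ?thesis using eventually_nhds_at by blast
  qed
  obtain A where A: "\<forall>\<^sub>F t in at 0. \<bar>x (- t) - x t\<bar> \<le> A * \<bar>t\<bar> ^ N" using b[OF assms(1)] by blast
  obtain B where B: "\<forall>\<^sub>F t in at 0. \<bar>y (- t) - y t\<bar> \<le> B * \<bar>t\<bar> ^ N" using b[OF assms(2)] by blast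
  have "\<forall>\<^sub>F t in at 0. norm ((x (- t), y (- t)) - (x t, y t)) \<le> (A + B) * \<bar>t\<bar> ^ N"
    using A B
  proof eventually_elim
    case (elim t)
    have "norm ((x (- t), y (- t)) - (x t, y t)) \<le> \<bar>x (- t) - x t\<bar> + \<bar>y (- t) - y t\<bar>"
      using norm_Pair_le[of "x (- t) - x t" "y (- t) - y t"] by simp
    then show ?case using elim by (simp add: distrib_right)
  qed
  moreover have "((\<lambda>t::real. - t / t) \<longlongrightarrow> - 1) (at 0)"
  proof (rule tendsto_eventually)
    show "\<forall>\<^sub>F t in at 0. - t / t = (- 1::real)"
      using eventually_neq_at_within[of 0 0 UNIV] by eventually_elim simp
  qed
  ultimately show ?thesis unfolding fold_order_def by (intro exI[of _ uminus]) blast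
qed

section \<open>Converse of the cusp criterion, and the order of degenerate curves\<close>

context parallel_curve
begin

lemma smooth_curve: "smooth_germ (\<lambda>t. (x t, y t))" "(\<lambda>t. (x t, y t)) 0 = 0"
  by (simp_all add: smooth_germ_Pair smooth_x smooth_y x0 y0 zero_prod_def)

lemma fold_order_curve:
  assumes "odd b" "\<And>i. odd i \<Longrightarrow> i < b \<Longrightarrow> tc \<theta> i = 0" "\<delta> = 0"
  shows "fold_order (Suc (Suc b)) (\<lambda>t. (x t, y t))"
  by (rule fold_orderI) (rule x_odd_part(3)[OF assms(1,2) _ assms(3)] y_odd_part[OF assms], simp_all add: assms(3))+

text \<open>If all odd coefficients below degree 2k + 2 vanished, the curve would fold to order 2k +
  3, more than its cusp allows. So there is a first nonzero one, in degree 2j - 1 with j \<le> k,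
  and the curve is of type A_2j as well. But the model A_2k folds to order 2k + 1 under t \<mapsto>
  - t, and this forces j = k.\<close>

lemma A_2k_equiv_imp:
  assumes "\<delta> = 0" "k \<ge> 1" "A_equiv (\<lambda>t. (x t, y t)) (\<lambda>t. (t ^ 2, t ^ (2 * k + 1)))"
  shows "\<forall>i. odd i \<longrightarrow> i < 2 * k - 1 \<longrightarrow> tc \<theta> i = 0" "tc \<theta> (2 * k - 1) \<noteq> 0"
proof -
  have model: "smooth_germ (\<lambda>t::real. (t ^ 2, t ^ (2 * j + 1)))" "(\<lambda>t::real. (t ^ 2, t ^ (2 * j + 1))) 0 = 0" for j
    by (auto intro!: smooth_germ_intros simp: zero_prod_def)
  have "\<exists>i. odd i \<and> i < 2 * k + 1 \<and> tc \<theta> i \<noteq> 0"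
  proof (rule ccontr)
    assume "\<not> ?thesis"
    then have "fold_order (Suc (Suc (2 * k + 1))) (\<lambda>t. (x t, y t))" by (intro fold_order_curve assms(1)) auto
    from fold_order_cusp[OF fold_order_A_equiv[OF assms(3) model this]] show False by simp
  qed
  then obtain i where i: "odd i" "i < 2 * k + 1" "tc \<theta> i \<noteq> 0" "\<And>l. l < i \<Longrightarrow> \<not> (odd l \<and> l < 2 * k + 1 \<and> tc \<theta> l \<noteq> 0)"
    using exists_least_iff[of "\<lambda>i. odd i \<and> i < 2 * k + 1 \<and> tc \<theta> i \<noteq> 0"] by blast
  have low: "tc \<theta> l = 0" if "odd l" "l < i" for l using i(2) i(4)[of l] that by auto
  define j where "j = (i + 1) div 2"
  have j: "i = 2 * j - 1" "1 \<le> j" "j \<le> k" using i(1,2) by (auto simp: j_def elim!: oddE)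
  have Aj: "A_equiv (\<lambda>t. (x t, y t)) (\<lambda>t. (t ^ 2, t ^ (2 * j + 1)))"
  proof (cases "j = 1")
    case True
    then show ?thesis using A_2_equiv i(3) j(1) assms(1) by simp
  next
    case False
    then show ?thesis using low i(3) j assms(1) by (intro A_2k_equiv) auto
  qed
  have "fold_order (2 * k + 1) (\<lambda>t. (t ^ 2, t ^ (2 * k + 1)))"
  proof (rule fold_orderI)
    show "van (2 * k + 1) (\<lambda>t. (- t) ^ 2 - t ^ 2)" using van_zero by simp
    show "van (2 * k + 1) (\<lambda>t. (- t) ^ (2 * k + 1) - t ^ (2 * k + 1))"
      by (rule van_eq[OF van_monom[OF order_refl, of _ "- 2"]]) simp
  qed
  from fold_order_A_equiv[OF A_equiv_sym[OF assms(3) model] smooth_curve this]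
  have "fold_order (2 * k + 1) (\<lambda>t. (x t, y t))" .
  from fold_order_cusp[OF fold_order_A_equiv[OF Aj model this]] have "j = k" using j(3) by simp
  then show "\<forall>i. odd i \<longrightarrow> i < 2 * k - 1 \<longrightarrow> tc \<theta> i = 0" "tc \<theta> (2 * k - 1) \<noteq> 0" using low i(3) j(1) by auto
qed

text \<open>A nonzero coefficient makes the order i of g finite. Then x has exact order i + 1, and y
  has at least this order because dy = p dx, so the multiplicity is i + 1.\<close>

lemma finite_multiplicity:
  assumes "van 4 g" "tc g n \<noteq> 0"
  shows "van 5 x" "van 5 y" "\<exists>m\<ge>5. has_multiplicity (\<lambda>t. (x t, y t)) m"
proof -
  obtain i where i: "tc g i \<noteq> 0" "\<And>l. l < i \<Longrightarrow> tc g l = 0"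
    using exists_least_iff[of "\<lambda>i. tc g i \<noteq> 0"] assms(2) by blast
  have vg: "van i g" unfolding van_iff_tc using smooth_g i(2) by simp
  have i4: "i \<ge> 4" using van_tc[OF assms(1), of i] i(1) by (meson not_le)
  note X = x_leading[OF vg]
  have vdx: "van i (deriv x)" by (rule van_deriv[OF X(1)])
  have "van i (deriv y)"
    by (rule van_cong[OF van_mult_left[OF smooth_p vdx] deriv_y])
  then have vy: "van (Suc i) y" by (rule van_derivD(1)[OF smooth_y y0])
  show "van 5 x" "van 5 y" using van_mono[OF X(1), of 5] van_mono[OF vy, of 5] i4 by simp_all
  obtain a where a: "smooth_germ a" "\<forall>\<^sub>F t in nhds 0. x t = t ^ Suc i * a t" "\<forall>l. tc a l = tc x (Suc i + l)"
    using van_factor[OF X(1)] .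
  obtain b where b: "smooth_germ b" "\<forall>\<^sub>F t in nhds 0. y t = t ^ Suc i * b t" using vanE[OF vy] .
  have a0: "a 0 \<noteq> 0" using spec[OF a(3), of 0] X(2) i(1) by (simp add: tc_0)
  have "has_multiplicity (\<lambda>t. (x t, y t)) (enat (Suc i))"
    unfolding has_multiplicity_def enat.case
  proof (intro exI[of _ "\<lambda>t. (fact (Suc i) * a t, fact (Suc i) * b t)"] conjI)
    show "smooth_germ (\<lambda>t. (fact (Suc i) * a t, fact (Suc i) * b t))" by (intro smooth_germ_intros a b)
    show "(fact (Suc i) * a 0, fact (Suc i) * b 0) \<noteq> 0" using a0 by (simp add: zero_prod_def del: fact_Suc)
    show "\<forall>\<^sub>F t in nhds 0. (x t, y t) = (t ^ Suc i / fact (Suc i)) *\<^sub>R (fact (Suc i) * a t, fact (Suc i) * b t)"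
      using a(2) b(2) by eventually_elim (simp del: fact_Suc)
  qed
  moreover have "enat (Suc i) \<ge> 5" using i4 by (simp add: numeral_eq_enat)
  ultimately show "\<exists>m\<ge>5. has_multiplicity (\<lambda>t. (x t, y t)) m" by blast
qed

end

subsection \<open>The curves of the theorem\<close>

lemma integral_germ:
  fixes f :: "real \<Rightarrow> 'a::euclidean_space"
  assumes "smooth_germ f"
  shows "\<forall>\<^sub>F t in nhds 0. ((\<lambda>u. LBINT y=0..u. f y) has_vector_derivative f t) (at t)"
proof -
  obtain S where S: "0 \<in> S" "smooth_on f S" using smooth_germE[OF assms] .
  \<comment> \<open>Smoothness holds only near 0, so the fundamental theorem is applied on a compact
    interval inside the domain of smoothness.\<close>
  obtain \<epsilon> where \<epsilon>: "\<epsilon> > 0" "cball 0 \<epsilon> \<subseteq> S"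
    using S(1) smooth_onD(1)[OF S(2)] open_contains_cball by blast
  have "{- \<epsilon>..\<epsilon>} \<subseteq> S" using \<epsilon>(2) by (auto simp: cball_eq_atLeastAtMost)
  then have c: "continuous_on {- \<epsilon>..\<epsilon>} f" using smooth_on_continuous[OF S(2)] continuous_on_subset by blast
  have "((\<lambda>u. LBINT y=0..u. f y) has_vector_derivative f t) (at t)" if "t \<in> {- \<epsilon><..<\<epsilon>}" for t
    using interval_integral_FTC2[OF _ _ c, of 0 t] that at_within_Icc_at[of "- \<epsilon>" t \<epsilon>] \<epsilon>(1)
    by (simp add: zero_ereal_def)
  then show ?thesis
    unfolding eventually_nhds by (intro exI[of _ "{- \<epsilon><..<\<epsilon>}"]) (use \<epsilon>(1) in auto)
qed

lemma angle_germ: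
  assumes "smooth_germ \<kappa>"
  shows "\<forall>\<^sub>F t in nhds 0. (angle \<kappa> has_real_derivative \<kappa> t) (at t)" "smooth_germ (angle \<kappa>)" "angle \<kappa> 0 = 0"
proof -
  show *: "\<forall>\<^sub>F t in nhds 0. (angle \<kappa> has_real_derivative \<kappa> t) (at t)"
    using integral_germ[OF assms] by (simp add: angle_def[abs_def] has_real_derivative_iff_has_vector_derivative)
  show "smooth_germ (angle \<kappa>)" by (rule smooth_germ_derivI[OF assms *])
  show "angle \<kappa> 0 = 0" by (simp add: angle_def flip: zero_ereal_def)
qed

lemma phi2_zero: "phi2 \<kappa> 0 = 0"
  by (simp add: phi2_def flip: zero_ereal_def)

lemma phi2_parallel_curve:
  assumes "smooth_germ \<kappa>"
  shows "parallel_curve (angle \<kappa>) (\<lambda>t. fst (phi2_parallel_germ \<kappa> \<delta> t)) (\<lambda>t. snd (phi2_parallel_germ \<kappa> \<delta> t)) \<delta>"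
proof
  note A = angle_germ[OF assms]
  show "smooth_germ (angle \<kappa>)" "angle \<kappa> 0 = 0" by (fact A)+
  show "fst (phi2_parallel_germ \<kappa> \<delta> 0) = 0" "snd (phi2_parallel_germ \<kappa> \<delta> 0) = 0"
    by (simp_all add: phi2_parallel_germ_def)
  have "smooth_germ (\<lambda>u. u *\<^sub>R tangent_vec \<kappa> u)"
    unfolding tangent_vec_def by (intro smooth_germ_intros A(2))
  from integral_germ[OF this]
  have phi: "\<forall>\<^sub>F t in nhds 0. (phi2 \<kappa> has_vector_derivative t *\<^sub>R tangent_vec \<kappa> t) (at t)"
    by (simp add: phi2_def[abs_def])
  have d: "\<forall>\<^sub>F t in nhds 0. (angle \<kappa> has_real_derivative deriv (angle \<kappa>) t) (at t)"
    by (rule smooth_germ_deriv(2)[OF A(2)])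
  show "\<forall>\<^sub>F t in nhds 0. ((\<lambda>t. fst (phi2_parallel_germ \<kappa> \<delta> t)) has_real_derivative
      (t - \<delta> * deriv (angle \<kappa>) t) * cos (angle \<kappa> t)) (at t)"
    using phi d
  proof eventually_elim
    case (elim t)
    have "((\<lambda>t. fst (phi2 \<kappa> t)) has_real_derivative t * cos (angle \<kappa> t)) (at t)"
      using bounded_linear.has_vector_derivative[OF bounded_linear_fst elim(1)]
      by (simp add: tangent_vec_def has_real_derivative_iff_has_vector_derivative)
    moreover have "((\<lambda>t. \<delta> * - sin (angle \<kappa> t)) has_real_derivative
        \<delta> * - (cos (angle \<kappa> t) * deriv (angle \<kappa>) t)) (at t)"
      by (auto intro!: derivative_eq_intros elim(2))
    ultimately have "((\<lambda>t. fst (phi2 \<kappa> t) + \<delta> * - sin (angle \<kappa> t) - fst (phi2_parallel \<kappa> \<delta> 0)) has_real_derivative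
        t * cos (angle \<kappa> t) + \<delta> * - (cos (angle \<kappa> t) * deriv (angle \<kappa>) t) - 0) (at t)"
      by (intro DERIV_diff DERIV_add DERIV_const)
    then show ?case
      by (simp add: phi2_parallel_germ_def phi2_parallel_def normal_vec_def algebra_simps)
  qed
  show "\<forall>\<^sub>F t in nhds 0. ((\<lambda>t. snd (phi2_parallel_germ \<kappa> \<delta> t)) has_real_derivative
      (t - \<delta> * deriv (angle \<kappa>) t) * sin (angle \<kappa> t)) (at t)"
    using phi d
  proof eventually_elim
    case (elim t)
    have "((\<lambda>t. snd (phi2 \<kappa> t)) has_real_derivative t * sin (angle \<kappa> t)) (at t)"
      using bounded_linear.has_vector_derivative[OF bounded_linear_snd elim(1)]
      by (simp add: tangent_vec_def has_real_derivative_iff_has_vector_derivative)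
    moreover have "((\<lambda>t. \<delta> * cos (angle \<kappa> t)) has_real_derivative
        \<delta> * - (sin (angle \<kappa> t) * deriv (angle \<kappa>) t)) (at t)"
      by (auto intro!: derivative_eq_intros elim(2))
    ultimately have "((\<lambda>t. snd (phi2 \<kappa> t) + \<delta> * cos (angle \<kappa> t) - snd (phi2_parallel \<kappa> \<delta> 0)) has_real_derivative
        t * sin (angle \<kappa> t) + \<delta> * - (sin (angle \<kappa> t) * deriv (angle \<kappa>) t) - 0) (at t)"
      by (intro DERIV_diff DERIV_add DERIV_const)
    then show ?case
      by (simp add: phi2_parallel_germ_def phi2_parallel_def normal_vec_def algebra_simps)
  qed
qed

lemma phi2_curve:
  assumes "smooth_germ \<kappa>"
  shows "parallel_curve (angle \<kappa>) (\<lambda>t. fst (phi2 \<kappa> t)) (\<lambda>t. snd (phi2 \<kappa> t)) 0"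
  using phi2_parallel_curve[OF assms, of 0] by (simp add: phi2_parallel_germ_def phi2_parallel_def phi2_zero)

lemma angle_coeff_tc: "angle_coeff \<kappa> i = fact i * tc (angle \<kappa>) i"
  by (simp add: angle_coeff_def tc_def)

subsection \<open>Invariants of 9-jets of multiplicity at least five\<close>

lemma tc_mult:
  assumes "smooth_germ f" "smooth_germ g"
  shows "tc (\<lambda>t. f t * g t) n = (\<Sum>i\<le>n. tc f i * tc g (n - i))"
  using assms
proof (induction n arbitrary: f)
  case 0
  then show ?case by (simp add: tc_0)
next
  case (Suc n)
  obtain h where h: "smooth_germ h" "\<forall>\<^sub>F t in nhds 0. f t = f 0 + t * h t" using hadamard[OF Suc.prems(1)] .
  have th: "tc h i = tc f (Suc i)" for i using tc_Suc[OF h] by simp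
  have sm: "smooth_germ (\<lambda>t. h t * g t)" by (intro smooth_germ_intros h Suc.prems)
  have s1: "smooth_germ (\<lambda>t. f 0 * g t)" by (intro smooth_germ_intros Suc.prems)
  have s2: "smooth_germ (\<lambda>t. t ^ 1 * (h t * g t))" by (rule smooth_germ_mult[OF smooth_germ_power[OF smooth_germ_ident] sm])
  have "tc (\<lambda>t. f t * g t) (Suc n) = tc (\<lambda>t. f 0 * g t + t ^ 1 * (h t * g t)) (Suc n)"
    by (rule tc_cong) (use h(2) in eventually_elim, simp add: algebra_simps)
  also have "\<dots> = f 0 * tc g (Suc n) + tc (\<lambda>t. t ^ 1 * (h t * g t)) (Suc n)"
    unfolding tc_add[OF s1 s2] tc_cmult[OF Suc.prems(2)] ..
  also have "tc (\<lambda>t. t ^ 1 * (h t * g t)) (Suc n) = (\<Sum>i\<le>n. tc f (Suc i) * tc g (n - i))"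
    using tc_shift[OF sm, of 1 "Suc n"] Suc.IH[OF h(1) Suc.prems(2)] th by simp
  finally show ?case by (simp add: sum.atMost_Suc_shift tc_0 del: sum.atMost_Suc)
qed

text \<open>The Pluecker coordinates of the plane spanned by the two Taylor expansions.\<close>

definition jet_det :: "(real \<Rightarrow> real) \<Rightarrow> (real \<Rightarrow> real) \<Rightarrow> nat \<Rightarrow> nat \<Rightarrow> real" where
  "jet_det x y i j = tc x i * tc y j - tc x j * tc y i"

text \<open>With \<open>p\<^sub>i\<^sub>j\<close> the minors of the coefficient vectors, these polynomials are, up to scaling, the
  coefficients of the form \<open>det (\<phi>', \<phi>'') dt\<^sup>3\<close> in the parameter for which \<open>det (\<phi>, \<phi>') dt\<close> is a
  monomial.\<close>

definition invA :: "real \<Rightarrow> real \<Rightarrow> real \<Rightarrow> real \<Rightarrow> real" where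
  "invA p56 p57 p58 p67 = 65 * p57 ^ 2 - 60 * p56 * p58 - 72 * p56 * p67"

definition invB :: "real \<Rightarrow> real \<Rightarrow> real \<Rightarrow> real \<Rightarrow> real \<Rightarrow> real \<Rightarrow> real" where
  "invB p56 p57 p58 p59 p67 p68 = 135 * p56 ^ 2 * p59 + 162 * p56 ^ 2 * p68 - 315 * p56 * p57 * p58
     - 189 * p56 * p57 * p67 + 175 * p57 ^ 3"

text \<open>The q are the minors after composition with s + a s^2 + b s^3 + c s^4 + ..., where s = l
  t. If p_ij has weight i + j, the two polynomials are homogeneous of weight 24 and 36, which gives
  the powers of l; a, b and c cancel.\<close>

lemma inv_reparam:
  fixes l a b c p56 p57 p58 p59 p67 p68 :: real
  defines "q56 \<equiv> l ^ 11 * p56"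
    and "q57 \<equiv> l ^ 12 * (p57 + 6 * a * p56)"
    and "q58 \<equiv> l ^ 13 * (p58 + 7 * a * p57 + (6 * b + 15 * a ^ 2) * p56)"
    and "q59 \<equiv> l ^ 14 * (p59 + 8 * a * p58 + (7 * b + 21 * a ^ 2) * p57 + (6 * c + 30 * a * b + 20 * a ^ 3) * p56)"
    and "q67 \<equiv> l ^ 13 * (p67 - (5 * b + 10 * a ^ 2) * p56 + 5 * a * (p57 + 6 * a * p56))"
    and "q68 \<equiv> l ^ 14 * (p68 + 7 * a * p67 - (5 * c + 20 * a * b + 10 * a ^ 3) * p56
      + 5 * a * (p58 + 7 * a * p57 + (6 * b + 15 * a ^ 2) * p56))"
  shows "invA q56 q57 q58 q67 = l ^ 24 * invA p56 p57 p58 p67"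
    "invB q56 q57 q58 q59 q67 q68 = l ^ 36 * invB p56 p57 p58 p59 p67 p68"
proof -
  have l: "l ^ 11 = l ^ 10 * l" "l ^ 12 = l ^ 10 * l ^ 2" "l ^ 13 = l ^ 10 * l ^ 3" "l ^ 14 = l ^ 10 * l ^ 4"
    "l ^ 24 = (l ^ 10) ^ 2 * l ^ 4" "l ^ 36 = (l ^ 10) ^ 3 * l ^ 6"
    by (simp_all flip: power_add power_mult power_Suc power_Suc2)
  show "invA q56 q57 q58 q67 = l ^ 24 * invA p56 p57 p58 p67"
    unfolding assms invA_def l by algebra
  show "invB q56 q57 q58 q59 q67 q68 = l ^ 36 * invB p56 p57 p58 p59 p67 p68"
    unfolding assms invB_def l by algebra
qed

lemma inv_scale:
  "invA (d * p56) (d * p57) (d * p58) (d * p67) = d ^ 2 * invA p56 p57 p58 p67"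
  "invB (d * p56) (d * p57) (d * p58) (d * p59) (d * p67) (d * p68) = d ^ 3 * invB p56 p57 p58 p59 p67 p68"
  unfolding invA_def invB_def by algebra+

definition curveA :: "(real \<Rightarrow> real) \<Rightarrow> (real \<Rightarrow> real) \<Rightarrow> real" where
  "curveA x y = invA (jet_det x y 5 6) (jet_det x y 5 7) (jet_det x y 5 8) (jet_det x y 6 7)"

definition curveB :: "(real \<Rightarrow> real) \<Rightarrow> (real \<Rightarrow> real) \<Rightarrow> real" where
  "curveB x y = invB (jet_det x y 5 6) (jet_det x y 5 7) (jet_det x y 5 8) (jet_det x y 5 9)
     (jet_det x y 6 7) (jet_det x y 6 8)"

text \<open>The expansion of l^n (1 + a t + b t^2 + c t^3 + ...)^n, computed by multiplying with one
  more factor at a time.\<close>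

lemma tc_power_jet:
  assumes "smooth_germ k" "tc k 0 = l" "tc k 1 = l * a" "tc k 2 = l * b" "tc k 3 = l * c"
  shows "tc (\<lambda>t. k t ^ n) 0 = l ^ n" "tc (\<lambda>t. k t ^ n) 1 = l ^ n * (real n * a)"
    "tc (\<lambda>t. k t ^ n) 2 = l ^ n * (real n * b + real n * (real n - 1) / 2 * a ^ 2)"
    "tc (\<lambda>t. k t ^ n) 3 = l ^ n * (real n * c + real n * (real n - 1) * a * b
       + real n * (real n - 1) * (real n - 2) / 6 * a ^ 3)"
proof (induction n)
  case 0
  show "tc (\<lambda>t. k t ^ 0) 0 = l ^ 0" "tc (\<lambda>t. k t ^ 0) 1 = l ^ 0 * (real 0 * a)"
    "tc (\<lambda>t. k t ^ 0) 2 = l ^ 0 * (real 0 * b + real 0 * (real 0 - 1) / 2 * a ^ 2)"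
    "tc (\<lambda>t. k t ^ 0) 3 = l ^ 0 * (real 0 * c + real 0 * (real 0 - 1) * a * b
       + real 0 * (real 0 - 1) * (real 0 - 2) / 6 * a ^ 3)"
    by (simp_all add: tc_const)
next
  case (Suc n)
  have s: "smooth_germ (\<lambda>t. k t ^ n)" by (intro smooth_germ_intros assms)
  have m: "tc (\<lambda>t. k t ^ Suc n) j = (\<Sum>i\<le>j. tc k i * tc (\<lambda>t. k t ^ n) (j - i))" for j
    using tc_mult[OF assms(1) s] by simp
  note sums = atMost_Suc numeral_2_eq_2 numeral_3_eq_3
  note IH = Suc[unfolded numeral_2_eq_2 numeral_3_eq_3 One_nat_def]
  note k = assms(2-5)[unfolded numeral_2_eq_2 numeral_3_eq_3 One_nat_def]
  show "tc (\<lambda>t. k t ^ Suc n) 0 = l ^ Suc n" unfolding m by (simp add: IH k)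
  show "tc (\<lambda>t. k t ^ Suc n) 1 = l ^ Suc n * (real (Suc n) * a)"
    unfolding m by (simp add: IH k algebra_simps)
  show "tc (\<lambda>t. k t ^ Suc n) 2 = l ^ Suc n * (real (Suc n) * b + real (Suc n) * (real (Suc n) - 1) / 2 * a ^ 2)"
    unfolding m numeral_2_eq_2 by (simp add: IH k field_simps)
  show "tc (\<lambda>t. k t ^ Suc n) 3 = l ^ Suc n * (real (Suc n) * c + real (Suc n) * (real (Suc n) - 1) * a * b
       + real (Suc n) * (real (Suc n) - 1) * (real (Suc n) - 2) / 6 * a ^ 3)"
    unfolding m numeral_3_eq_3 numeral_2_eq_2 by (simp add: IH k field_simps)
qed

text \<open>In degree 9 the factor of \<open>tc x 5\<close> also involves the degree 5 coefficient
  of h. It stays an unnamed constant e, common to all x, because it will cancel in the minor of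
  degrees 5 and 9.\<close>

lemma tc_compose_jet:
  assumes "van 5 x" "smooth_germ h" "h 0 = 0" "tc h 1 = l" "tc h 2 = l * a" "tc h 3 = l * b" "tc h 4 = l * c"
  shows "tc (\<lambda>t. x (h t)) 5 = l ^ 5 * tc x 5"
    "tc (\<lambda>t. x (h t)) 6 = l ^ 6 * tc x 6 + l ^ 5 * (5 * a) * tc x 5"
    "tc (\<lambda>t. x (h t)) 7 = l ^ 7 * tc x 7 + l ^ 6 * (6 * a) * tc x 6 + l ^ 5 * (5 * b + 10 * a ^ 2) * tc x 5"
    "tc (\<lambda>t. x (h t)) 8 = l ^ 8 * tc x 8 + l ^ 7 * (7 * a) * tc x 7 + l ^ 6 * (6 * b + 15 * a ^ 2) * tc x 6
      + l ^ 5 * (5 * c + 20 * a * b + 10 * a ^ 3) * tc x 5"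
    "\<exists>e. \<forall>x. van 5 x \<longrightarrow> tc (\<lambda>t. x (h t)) 9 = l ^ 9 * tc x 9 + l ^ 8 * (8 * a) * tc x 8
      + l ^ 7 * (7 * b + 21 * a ^ 2) * tc x 7 + l ^ 6 * (6 * c + 30 * a * b + 20 * a ^ 3) * tc x 6 + e * tc x 5"
proof -
  obtain k where k: "smooth_germ k" "\<forall>\<^sub>F t in nhds 0. h t = t ^ 1 * k t" "\<forall>i. tc k i = tc h (1 + i)"
    using van_factor[OF van_1I[OF assms(2,3)]] .
  have kt: "tc k 0 = l" "tc k 1 = l * a" "tc k 2 = l * b" "tc k 3 = l * c"
    using spec[OF k(3), of 0] spec[OF k(3), of 1] spec[OF k(3), of 2] spec[OF k(3), of 3] assms(4-7)
    by (simp_all add: numeral_2_eq_2[symmetric])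
  note P = tc_power_jet[OF k(1) kt]
  have sk: "smooth_germ (\<lambda>t. k t ^ i)" for i by (intro smooth_germ_intros k(1))
  have tp: "tc (\<lambda>t. h t ^ i) n = (if n < i then 0 else tc (\<lambda>t. k t ^ i) (n - i))" for i n
  proof -
    have "\<forall>\<^sub>F t in nhds 0. h t ^ i = t ^ i * k t ^ i" using k(2) by eventually_elim (simp add: power_mult_distrib)
    then show ?thesis using tc_cong tc_shift[OF sk] by metis
  qed
  have main: "tc (\<lambda>t. x (h t)) n = (\<Sum>i\<in>{5,6,7,8,9}. tc x i * (if n < i then 0 else tc (\<lambda>t. k t ^ i) (n - i)))"
    if x: "van 5 x" and n: "n < 10" for x n
  proof -
    have xs: "(\<Sum>i<10. tc x i * t ^ i) = (\<Sum>i\<in>{5,6,7,8,9}. tc x i * t ^ i)" for t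
    proof -
      have "(\<Sum>i\<in>{5,6,7,8,9}. tc x i * t ^ i) = (\<Sum>i<10. tc x i * t ^ i)"
      proof (rule sum.mono_neutral_left)
        show "\<forall>i\<in>{..<10} - {5,6,7,8,9}. tc x i * t ^ i = 0"
        proof
          fix i :: nat assume "i \<in> {..<10} - {5,6,7,8,9}"
          then have "i < 5" by auto
          then show "tc x i * t ^ i = 0" using van_tc[OF x] by simp
        qed
      qed auto
      then show ?thesis by simp
    qed
    have v: "van 10 (\<lambda>t. x (h t) - (\<Sum>i\<in>{5,6,7,8,9}. tc x i * h t ^ i))"
      using van_compose[OF taylor[OF van_smooth[OF x], of 10] assms(2,3)] unfolding xs .
    have s1: "smooth_germ (\<lambda>t. x (h t))" by (rule smooth_germ_compose[OF assms(2) van_smooth[OF x] assms(3)])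
    have s2: "smooth_germ (\<lambda>t. \<Sum>i\<in>{5,6,7,8,9::nat}. tc x i * h t ^ i)" by (intro smooth_germ_intros assms(2))
    have "tc (\<lambda>t. x (h t)) n = tc (\<lambda>t. \<Sum>i\<in>{5,6,7,8,9}. tc x i * h t ^ i) n" by (rule tc_eq[OF v s1 s2 n])
    also have "\<dots> = (\<Sum>i\<in>{5,6,7,8,9}. tc (\<lambda>t. tc x i * h t ^ i) n)"
      by (rule tc_sum) (intro smooth_germ_intros assms(2))
    also have "\<dots> = (\<Sum>i\<in>{5,6,7,8,9}. tc x i * (if n < i then 0 else tc (\<lambda>t. k t ^ i) (n - i)))"
      by (intro sum.cong refl) (simp only: tc_cmult smooth_germ_power assms(2) tp)
    finally show ?thesis .
  qed
  have P1: "tc (\<lambda>t. k t ^ n) (Suc 0) = l ^ n * (real n * a)" for n using P(2) by simp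
  show "tc (\<lambda>t. x (h t)) 5 = l ^ 5 * tc x 5" using main[OF assms(1), of 5] P(1) by simp
  show "tc (\<lambda>t. x (h t)) 6 = l ^ 6 * tc x 6 + l ^ 5 * (5 * a) * tc x 5"
    using main[OF assms(1), of 6] P(1) P1 by simp
  show "tc (\<lambda>t. x (h t)) 7 = l ^ 7 * tc x 7 + l ^ 6 * (6 * a) * tc x 6 + l ^ 5 * (5 * b + 10 * a ^ 2) * tc x 5"
    using main[OF assms(1), of 7] P(1,3) P1 by simp
  show "tc (\<lambda>t. x (h t)) 8 = l ^ 8 * tc x 8 + l ^ 7 * (7 * a) * tc x 7 + l ^ 6 * (6 * b + 15 * a ^ 2) * tc x 6
      + l ^ 5 * (5 * c + 20 * a * b + 10 * a ^ 3) * tc x 5"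
    using main[OF assms(1), of 8] P(1,3,4) P1 by simp
  show "\<exists>e. \<forall>x. van 5 x \<longrightarrow> tc (\<lambda>t. x (h t)) 9 = l ^ 9 * tc x 9 + l ^ 8 * (8 * a) * tc x 8
      + l ^ 7 * (7 * b + 21 * a ^ 2) * tc x 7 + l ^ 6 * (6 * c + 30 * a * b + 20 * a ^ 3) * tc x 6 + e * tc x 5"
  proof (intro exI[of _ "tc (\<lambda>t. k t ^ 5) 4"] allI impI)
    fix x :: "real \<Rightarrow> real" assume x: "van 5 x"
    show "tc (\<lambda>t. x (h t)) 9 = l ^ 9 * tc x 9 + l ^ 8 * (8 * a) * tc x 8
      + l ^ 7 * (7 * b + 21 * a ^ 2) * tc x 7 + l ^ 6 * (6 * c + 30 * a * b + 20 * a ^ 3) * tc x 6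
      + tc (\<lambda>t. k t ^ 5) 4 * tc x 5"
      using main[OF x, of 9] P(1,3,4) P1 by simp
  qed
qed

lemma curve_invariants_reparam:
  assumes "van 5 x" "van 5 y" "diffeo_germ h"
  obtains l where "l \<noteq> 0" "curveA (\<lambda>t. x (h t)) (\<lambda>t. y (h t)) = l ^ 24 * curveA x y"
    "curveB (\<lambda>t. x (h t)) (\<lambda>t. y (h t)) = l ^ 36 * curveB x y"
proof -
  define l where "l = tc h 1"
  have l: "l \<noteq> 0" using diffeo_germ_deriv_ne_0[OF assms(3)] by (simp add: l_def tc_def)
  \<comment> \<open>Normalised so that h is s + a s^2 + b s^3 + c s^4 + ... in s = l t; then the
    minor of degrees i and j carries the factor l^(i+j).\<close>
  define a where "a = tc h 2 / l ^ 2"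
  define b where "b = tc h 3 / l ^ 3"
  define c where "c = tc h 4 / l ^ 4"
  have h: "tc h 1 = l" "tc h 2 = l * (l * a)" "tc h 3 = l * (l ^ 2 * b)" "tc h 4 = l * (l ^ 3 * c)"
    using l by (simp_all add: a_def b_def c_def field_simps eval_nat_numeral) (simp add: l_def)
  note X = tc_compose_jet(1-4)[OF assms(1) diffeo_germD[OF assms(3)] h]
  note Y = tc_compose_jet(1-4)[OF assms(2) diffeo_germD[OF assms(3)] h]
  obtain e where e: "\<forall>x. van 5 x \<longrightarrow> tc (\<lambda>t. x (h t)) 9 = l ^ 9 * tc x 9 + l ^ 8 * (8 * (l * a)) * tc x 8
      + l ^ 7 * (7 * (l ^ 2 * b) + 21 * (l * a) ^ 2) * tc x 7
      + l ^ 6 * (6 * (l ^ 3 * c) + 30 * (l * a) * (l ^ 2 * b) + 20 * (l * a) ^ 3) * tc x 6 + e * tc x 5"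
    using tc_compose_jet(5)[OF assms(1) diffeo_germD[OF assms(3)] h] by blast
  note X9 = e[rule_format, OF assms(1)] and Y9 = e[rule_format, OF assms(2)]
  let ?q = "jet_det (\<lambda>t. x (h t)) (\<lambda>t. y (h t))"
  let ?p = "jet_det x y"
  have l': "l ^ 6 = l ^ 5 * l" "l ^ 7 = l ^ 5 * l ^ 2" "l ^ 8 = l ^ 5 * l ^ 3" "l ^ 9 = l ^ 5 * l ^ 4"
    "l ^ 11 = (l ^ 5) ^ 2 * l" "l ^ 12 = (l ^ 5) ^ 2 * l ^ 2" "l ^ 13 = (l ^ 5) ^ 2 * l ^ 3" "l ^ 14 = (l ^ 5) ^ 2 * l ^ 4"
    by (simp_all flip: power_add power_mult power_Suc power_Suc2)
  have q: "?q 5 6 = l ^ 11 * ?p 5 6"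
    "?q 5 7 = l ^ 12 * (?p 5 7 + 6 * a * ?p 5 6)"
    "?q 5 8 = l ^ 13 * (?p 5 8 + 7 * a * ?p 5 7 + (6 * b + 15 * a ^ 2) * ?p 5 6)"
    "?q 5 9 = l ^ 14 * (?p 5 9 + 8 * a * ?p 5 8 + (7 * b + 21 * a ^ 2) * ?p 5 7 + (6 * c + 30 * a * b + 20 * a ^ 3) * ?p 5 6)"
    "?q 6 7 = l ^ 13 * (?p 6 7 - (5 * b + 10 * a ^ 2) * ?p 5 6 + 5 * a * (?p 5 7 + 6 * a * ?p 5 6))"
    "?q 6 8 = l ^ 14 * (?p 6 8 + 7 * a * ?p 6 7 - (5 * c + 20 * a * b + 10 * a ^ 3) * ?p 5 6
      + 5 * a * (?p 5 8 + 7 * a * ?p 5 7 + (6 * b + 15 * a ^ 2) * ?p 5 6))"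
    unfolding jet_det_def X Y X9 Y9 l' by algebra+
  show thesis
    by (rule that[OF l]) (simp_all only: curveA_def curveB_def q inv_reparam)
qed

subsection \<open>Invariance under changes of the target coordinates\<close>

lemma smooth_germ_frechet:
  assumes "smooth_germ F" shows "smooth_germ (\<lambda>p. frechet_derivative F (at p) v)"
proof -
  obtain S where S: "0 \<in> S" "smooth_on F S" using smooth_germE[OF assms] .
  have "Ck_on n (\<lambda>p. frechet_derivative F (at p) v) S" for n
    by (rule Ck_on_Suc_frechet[OF smooth_onD(2)[OF S(2)]])
  then show ?thesis by (intro smooth_germI[OF S(1)]) (simp add: smooth_on_def smooth_onD(1)[OF S(2)])
qed

lemma chain_rule_plane:
  fixes F :: "real \<times> real \<Rightarrow> real"
  assumes "smooth_germ F" "smooth_germ x" "smooth_germ y" "x 0 = 0" "y 0 = 0"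
  shows "\<forall>\<^sub>F t in nhds 0. ((\<lambda>t. F (x t, y t)) has_real_derivative
    frechet_derivative F (at (x t, y t)) (1, 0) * deriv x t + frechet_derivative F (at (x t, y t)) (0, 1) * deriv y t) (at t)"
proof -
  obtain S where S: "0 \<in> S" "smooth_on F S" using smooth_germE[OF assms(1)] .
  have "\<forall>\<^sub>F t in nhds 0. (x t, y t) \<in> S"
    by (rule eventually_compose_germ[OF eventually_nhds_in_open[OF smooth_onD(1)[OF S(2)] S(1)]
          smooth_germ_Pair[OF assms(2,3)]]) (simp add: assms(4,5) zero_prod_def)
  then show ?thesis using smooth_germ_deriv(2)[OF assms(2)] smooth_germ_deriv(2)[OF assms(3)]
  proof eventually_elim
    case (elim t)
    let ?F' = "frechet_derivative F (at (x t, y t))"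
    have F: "(F has_derivative ?F') (at (x t, y t))"
      using Ck_on_Suc_has_derivative[OF smooth_onD(2)[OF S(2)] elim(1)] .
    have "((\<lambda>t. (x t, y t)) has_derivative (\<lambda>s. (deriv x t * s, deriv y t * s))) (at t)"
      using elim(2,3) by (intro has_derivative_Pair) (simp_all add: has_field_derivative_def)
    from has_derivative_compose[OF this F]
    have "((\<lambda>t. F (x t, y t)) has_derivative (\<lambda>s. ?F' (deriv x t * s, deriv y t * s))) (at t)" .
    moreover have "?F' (deriv x t * s, deriv y t * s) = (?F' (1, 0) * deriv x t + ?F' (0, 1) * deriv y t) * s" for s
      using frechet_plane[OF F, of "(deriv x t * s, deriv y t * s)"] by (simp add: algebra_simps)
    ultimately show ?case unfolding has_field_derivative_def by simp
  qed
qed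

lemma van_compose_plane:
  fixes F :: "real \<times> real \<Rightarrow> real"
  assumes "smooth_germ F" "van (Suc m) x" "van (Suc m) y"
  shows "van (Suc m) (\<lambda>t. F (x t, y t) - F 0)"
proof (rule van_deriv_imp)
  have z: "x 0 = 0" "y 0 = 0" using van_1D assms by auto
  have s: "smooth_germ x" "smooth_germ y" "smooth_germ (\<lambda>t. (x t, y t))" "(\<lambda>t. (x t, y t)) 0 = 0"
    using van_smooth[OF assms(2)] van_smooth[OF assms(3)] smooth_germ_Pair[OF van_smooth[OF assms(2)] van_smooth[OF assms(3)]] z
    by (simp_all add: zero_prod_def)
  show "smooth_germ (\<lambda>t. F (x t, y t) - F 0)"
    by (rule smooth_germ_diff[OF smooth_germ_compose[OF s(3) assms(1) s(4)] smooth_germ_const])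
  show "F (x 0, y 0) - F 0 = 0" using s(4) by simp
  have c: "smooth_germ (\<lambda>t. frechet_derivative F (at (x t, y t)) v)" for v
    using smooth_germ_compose[OF s(3) smooth_germ_frechet[OF assms(1)] s(4)] .
  have "van m (\<lambda>t. frechet_derivative F (at (x t, y t)) (1, 0) * deriv x t
      + frechet_derivative F (at (x t, y t)) (0, 1) * deriv y t)"
    by (intro van_add van_mult_left c van_deriv assms(2,3))
  then show "van m (deriv (\<lambda>t. F (x t, y t) - F 0))"
  proof (rule van_cong)
    show "\<forall>\<^sub>F t in nhds 0. deriv (\<lambda>t. F (x t, y t) - F 0) t = frechet_derivative F (at (x t, y t)) (1, 0) * deriv x t
      + frechet_derivative F (at (x t, y t)) (0, 1) * deriv y t"
      using chain_rule_plane[OF assms(1) s(1,2) z]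
    proof eventually_elim
      case (elim t)
      show ?case by (rule DERIV_imp_deriv[OF DERIV_diff[OF elim DERIV_const, simplified]])
    qed
  qed
qed

text \<open>Along the curve, F minus its linear part has the derivative (F_x - a) x' + (F_y - b) y',
  of order (m + 1) + m; so nonlinear terms start in degree 2m + 2. The constants depend on F alone
  and are chosen before the curve.\<close>

lemma tc_compose_plane:
  fixes F :: "real \<times> real \<Rightarrow> real"
  assumes "smooth_germ F"
  obtains a b where "\<forall>m x y n. van (Suc m) x \<longrightarrow> van (Suc m) y \<longrightarrow> 0 < n \<longrightarrow> n < 2 * m + 2 \<longrightarrow>
    tc (\<lambda>t. F (x t, y t)) n = a * tc x n + b * tc y n"
proof
  let ?D = "\<lambda>v p. frechet_derivative F (at p) v"
  let ?a = "?D (1, 0) 0" and ?b = "?D (0, 1) 0"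
  show "\<forall>m x y n. van (Suc m) x \<longrightarrow> van (Suc m) y \<longrightarrow> 0 < n \<longrightarrow> n < 2 * m + 2 \<longrightarrow>
    tc (\<lambda>t. F (x t, y t)) n = ?a * tc x n + ?b * tc y n"
  proof (intro allI impI)
    fix m n :: nat and x y :: "real \<Rightarrow> real"
    assume v: "van (Suc m) x" "van (Suc m) y" and n: "0 < n" "n < 2 * m + 2"
    have z: "x 0 = 0" "y 0 = 0" using van_1D v by auto
    have s: "smooth_germ x" "smooth_germ y" "smooth_germ (\<lambda>t. (x t, y t))" "(\<lambda>t. (x t, y t)) 0 = 0"
    using van_smooth[OF v(1)] van_smooth[OF v(2)] smooth_germ_Pair[OF van_smooth[OF v(1)] van_smooth[OF v(2)]] z
    by (simp_all add: zero_prod_def)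
    have sF: "smooth_germ (\<lambda>t. F (x t, y t))" by (rule smooth_germ_compose[OF s(3) assms s(4)])
    have sL: "smooth_germ (\<lambda>t. ?a * x t + ?b * y t)" by (intro smooth_germ_intros s)
    let ?H = "\<lambda>t. F (x t, y t) - F 0 - (?a * x t + ?b * y t)"
    have sH: "smooth_germ ?H" by (intro smooth_germ_diff sF sL smooth_germ_const)
    have "van (Suc m + m) (\<lambda>t. (?D (1, 0) (x t, y t) - ?a) * deriv x t + (?D (0, 1) (x t, y t) - ?b) * deriv y t)"
      by (intro van_add van_mult van_compose_plane smooth_germ_frechet assms v van_deriv)
    then have "van (Suc m + m) (deriv ?H)"
    proof (rule van_cong)
      show "\<forall>\<^sub>F t in nhds 0. deriv ?H t = (?D (1, 0) (x t, y t) - ?a) * deriv x t + (?D (0, 1) (x t, y t) - ?b) * deriv y t"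
        using chain_rule_plane[OF assms s(1,2) z] smooth_germ_deriv(2)[OF s(1)] smooth_germ_deriv(2)[OF s(2)]
      proof eventually_elim
        case (elim t)
        have "(?H has_real_derivative (?D (1, 0) (x t, y t) * deriv x t + ?D (0, 1) (x t, y t) * deriv y t) - 0
            - (?a * deriv x t + ?b * deriv y t)) (at t)"
          by (intro DERIV_diff DERIV_add DERIV_cmult elim DERIV_const)
        from DERIV_imp_deriv[OF this] show ?case by (simp add: algebra_simps)
      qed
    qed
    moreover have "?H 0 = 0" using s(4) z by simp
    ultimately have "van (Suc (Suc m + m)) ?H" by (rule van_deriv_imp[OF sH, rotated])
    then have "tc ?H n = 0" using van_tc n by force
    then show "tc (\<lambda>t. F (x t, y t)) n = ?a * tc x n + ?b * tc y n"
      using n(1) by (simp add: tc_diff sF sL smooth_germ_diff smooth_germ_const tc_const tc_lincomb s)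
  qed
qed

lemma curve_invariants_A_equiv:
  assumes "van 5 x" "van 5 y" "van 5 z" "van 5 w" "A_equiv (\<lambda>t. (x t, y t)) (\<lambda>t. (z t, w t))"
  obtains l d where "l \<noteq> 0" "l ^ 24 * curveA x y = d ^ 2 * curveA z w" "l ^ 36 * curveB x y = d ^ 3 * curveB z w"
proof -
  obtain h \<psi> where h: "diffeo_germ h" "diffeo_germ \<psi>" "\<forall>\<^sub>F t in nhds 0. (x (h t), y (h t)) = \<psi> (z t, w t)"
    using assms(5) unfolding A_equiv_def by blast
  obtain l where l: "l \<noteq> 0" "curveA (\<lambda>t. x (h t)) (\<lambda>t. y (h t)) = l ^ 24 * curveA x y"
    "curveB (\<lambda>t. x (h t)) (\<lambda>t. y (h t)) = l ^ 36 * curveB x y"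
    using curve_invariants_reparam[OF assms(1,2) h(1)] .
  obtain a b where ab: "\<forall>m x y n. van (Suc m) x \<longrightarrow> van (Suc m) y \<longrightarrow> 0 < n \<longrightarrow> n < 2 * m + 2 \<longrightarrow>
    tc (\<lambda>t. fst (\<psi> (x t, y t))) n = a * tc x n + b * tc y n"
    using tc_compose_plane[OF smooth_germ_fst[OF diffeo_germD(1)[OF h(2)]]] .
  obtain c e where ce: "\<forall>m x y n. van (Suc m) x \<longrightarrow> van (Suc m) y \<longrightarrow> 0 < n \<longrightarrow> n < 2 * m + 2 \<longrightarrow>
    tc (\<lambda>t. snd (\<psi> (x t, y t))) n = c * tc x n + e * tc y n"
    using tc_compose_plane[OF smooth_germ_snd[OF diffeo_germD(1)[OF h(2)]]] .
  \<comment> \<open>This is m = 4: linearity holds in the degrees 1 to 9, just far enough for the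
    minors in use.\<close>
  have v: "van (Suc 4) z" "van (Suc 4) w" using assms(3,4) by simp_all
  have X: "tc (\<lambda>t. x (h t)) n = a * tc z n + b * tc w n" if "0 < n" "n < 10" for n
  proof -
    have "\<forall>\<^sub>F t in nhds 0. x (h t) = fst (\<psi> (z t, w t))" using h(3) by eventually_elim (metis fst_conv)
    from tc_cong[OF this] show ?thesis using ab[rule_format, OF v] that by simp
  qed
  have Y: "tc (\<lambda>t. y (h t)) n = c * tc z n + e * tc w n" if "0 < n" "n < 10" for n
  proof -
    have "\<forall>\<^sub>F t in nhds 0. y (h t) = snd (\<psi> (z t, w t))" using h(3) by eventually_elim (metis snd_conv)
    from tc_cong[OF this] show ?thesis using ce[rule_format, OF v] that by simp
  qed
  define d where "d = a * e - b * c"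
  have q: "jet_det (\<lambda>t. x (h t)) (\<lambda>t. y (h t)) i j = d * jet_det z w i j" if "0 < i" "i < 10" "0 < j" "j < 10" for i j
    using that by (simp add: jet_det_def X Y d_def algebra_simps)
  show thesis
  proof (rule that[OF l(1)])
    show "l ^ 24 * curveA x y = d ^ 2 * curveA z w"
      unfolding l(2)[symmetric] by (simp add: curveA_def q inv_scale)
    show "l ^ 36 * curveB x y = d ^ 3 * curveB z w"
      unfolding l(3)[symmetric] by (simp add: curveB_def q inv_scale)
  qed
qed

text \<open>Numerator and denominator both have weight 72 in l and degree 6 in d.\<close>

lemma curve_invariant_ratio:
  assumes "van 5 x" "van 5 y" "van 5 z" "van 5 w" "A_equiv (\<lambda>t. (x t, y t)) (\<lambda>t. (z t, w t))"
    and "curveA x y \<noteq> 0" "curveA z w \<noteq> 0"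
  shows "curveB x y ^ 2 / curveA x y ^ 3 = curveB z w ^ 2 / curveA z w ^ 3"
proof -
  obtain l d where l: "l \<noteq> 0" "l ^ 24 * curveA x y = d ^ 2 * curveA z w" "l ^ 36 * curveB x y = d ^ 3 * curveB z w"
    using curve_invariants_A_equiv[OF assms(1-5)] .
  \<comment> \<open>That d is nonzero is read off from the first scaling relation, whose left side
    is nonzero.\<close>
  have d: "d \<noteq> 0" using l(1,2) assms(6) by auto
  have p: "(l ^ 36) ^ 2 = l ^ 72" "(l ^ 24) ^ 3 = l ^ 72" "(d ^ 3) ^ 2 = d ^ 6" "(d ^ 2) ^ 3 = d ^ 6"
    by (simp_all flip: power_mult)
  have "curveB x y ^ 2 / curveA x y ^ 3 = (l ^ 36 * curveB x y) ^ 2 / (l ^ 24 * curveA x y) ^ 3"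
    using l(1) by (simp add: power_mult_distrib p)
  also have "\<dots> = curveB z w ^ 2 / curveA z w ^ 3"
    unfolding l(2,3) using d by (simp add: power_mult_distrib p)
  finally show ?thesis .
qed

subsection \<open>Deformations depending affinely on the parameters\<close>

lemma smooth_on_vector_derivative:
  fixes f :: "real \<Rightarrow> 'b::real_normed_vector"
  assumes "smooth_on f S"
  shows "smooth_on (\<lambda>t. vector_derivative f (at t)) S"
    "t \<in> S \<Longrightarrow> (f has_vector_derivative vector_derivative f (at t)) (at t)"
proof -
  have d: "f differentiable (at t)" if "t \<in> S" for t
    using Ck_on_Suc_differentiable[OF smooth_onD(2)[OF assms] that] .
  then show "t \<in> S \<Longrightarrow> (f has_vector_derivative vector_derivative f (at t)) (at t)"
    using vector_derivative_works by blast
  have "Ck_on n (\<lambda>t. vector_derivative f (at t)) S" for n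
    by (rule Ck_on_cong[OF Ck_on_Suc_frechet[OF smooth_onD(2)[OF assms], of _ 1] smooth_onD(1)[OF assms]])
      (simp add: frechet_derivative_eq_vector_derivative[OF d])
  then show "smooth_on (\<lambda>t. vector_derivative f (at t)) S"
    using smooth_onD(1)[OF assms] by (simp add: smooth_on_def)
qed

lemma continuous_on_coordinate: "continuous_on S (\<lambda>X::nat \<Rightarrow> real. X i)"
  by (rule continuous_on_subset[OF continuous_on_product_coordinates subset_UNIV])

text \<open>Functions affine in the parameters, with coefficients smooth in t, form a class closed
  under all partial derivatives; this is why the induction lets F, a and b vary. Entry 0 of the
  sequence is the variable t.\<close>

lemma Ck_Rn_affine:
  fixes F :: "(nat \<Rightarrow> real) \<Rightarrow> 'b::real_normed_vector"
  assumes "smooth_on a I" "\<And>i. smooth_on (b i) I" "S \<subseteq> {X. X 0 \<in> I}"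
    and "\<And>X. X 0 \<in> I \<Longrightarrow> F X = a (X 0) + (\<Sum>i=1..<n. X i *\<^sub>R b i (X 0))"
  shows "Ck_Rn n m F S"
  using assms
proof (induction m arbitrary: F a b)
  case 0
  have c: "continuous_on S (\<lambda>X. f (X 0))" if "smooth_on f I" for f :: "real \<Rightarrow> 'b"
    by (rule continuous_on_compose2[OF smooth_on_continuous[OF that] continuous_on_coordinate]) (use 0 in auto)
  have "continuous_on S (\<lambda>X. a (X 0) + (\<Sum>i=1..<n. X i *\<^sub>R b i (X 0)))"
    by (intro continuous_on_add continuous_on_sum continuous_on_scaleR continuous_on_coordinate c 0)
  moreover have "continuous_on S (\<lambda>X. a (X 0) + (\<Sum>i=1..<n. X i *\<^sub>R b i (X 0))) \<longleftrightarrow> continuous_on S F"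
    by (rule continuous_on_cong[OF refl]) (use 0 in \<open>auto simp: 0(4)\<close>)
  ultimately show ?case by simp
next
  case (Suc m)
  have oI: "open I" using smooth_onD(1)[OF Suc.prems(1)] .
  let ?a = "\<lambda>t. vector_derivative a (at t)" and ?b = "\<lambda>i t. vector_derivative (b i) (at t)"
  have d0: "((\<lambda>s. F (X(0 := s))) has_vector_derivative ?a (X 0) + (\<Sum>i=1..<n. X i *\<^sub>R ?b i (X 0))) (at (X 0))"
    if X: "X 0 \<in> I" for X
  proof (rule has_vector_derivative_transform_within_open[OF _ oI X])
    show "((\<lambda>s. a s + (\<Sum>i=1..<n. X i *\<^sub>R b i s)) has_vector_derivative ?a (X 0) + (\<Sum>i=1..<n. X i *\<^sub>R ?b i (X 0))) (at (X 0))"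
      by (intro has_vector_derivative_add has_vector_derivative_sum
          bounded_linear.has_vector_derivative[OF bounded_linear_scaleR_right]
          smooth_on_vector_derivative(2)[OF Suc.prems(1) X] smooth_on_vector_derivative(2)[OF Suc.prems(2) X])
    show "a s + (\<Sum>i=1..<n. X i *\<^sub>R b i s) = F (X(0 := s))" if "s \<in> I" for s
      using that by (simp add: Suc.prems(4)) 
  qed
  have dj: "((\<lambda>s. F (X(j := s))) has_vector_derivative b j (X 0)) (at (X j))"
    if X: "X 0 \<in> I" and j: "j \<in> {1..<n}" for X j
  proof -
    have "((\<lambda>s. a (X 0) + (\<Sum>i=1..<n. (if i = j then s else X i) *\<^sub>R b i (X 0))) has_vector_derivative
        0 + (\<Sum>i=1..<n. if i = j then b i (X 0) else 0)) (at (X j))"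
      by (intro has_vector_derivative_add has_vector_derivative_sum has_vector_derivative_const)
        (auto intro!: derivative_eq_intros)
    moreover have "(\<Sum>i=1..<n. if i = j then b i (X 0) else 0) = b j (X 0)"
      using j by (subst sum.delta) auto
    moreover have "F (X(j := s)) = a (X 0) + (\<Sum>i=1..<n. (if i = j then s else X i) *\<^sub>R b i (X 0))" for s
      using j X by (subst Suc.prems(4)) (auto intro!: sum.cong)
    ultimately show ?thesis by simp
  qed
  show ?case unfolding Ck_Rn.simps
  proof (intro allI impI conjI ballI)
    fix j X assume j: "j < n" and X: "X \<in> S"
    show "(\<lambda>s. F (X(j := s))) differentiable (at (X j))"
    proof (cases "j = 0")
      case True
      show ?thesis unfolding True by (rule differentiableI_vector[OF d0]) (use X Suc.prems(3) in auto)
    next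
      case False
      then have "j \<in> {1..<n}" using j by simp
      show ?thesis by (rule differentiableI_vector[OF dj[OF _ \<open>j \<in> {1..<n}\<close>]]) (use X Suc.prems(3) in auto)
    qed
  next
    fix j assume j: "j < n"
    show "Ck_Rn n m (\<lambda>X. vector_derivative (\<lambda>s. F (X(j := s))) (at (X j))) S"
    proof (cases "j = 0")
      case True
      show ?thesis unfolding True
        by (rule Suc.IH[of ?a ?b, OF smooth_on_vector_derivative(1)[OF Suc.prems(1)]
              smooth_on_vector_derivative(1)[OF Suc.prems(2)] Suc.prems(3)])
          (rule vector_derivative_at[OF d0])
    next
      case False
      then have j: "j \<in> {1..<n}" using j by simp
      show ?thesis
      proof (rule Suc.IH[of "b j" "\<lambda>i t. 0", OF Suc.prems(2) smooth_on_const[OF oI] Suc.prems(3)])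
        fix X :: "nat \<Rightarrow> real" assume "X 0 \<in> I"
        then show "vector_derivative (\<lambda>s. F (X(j := s))) (at (X j)) = b j (X 0) + (\<Sum>i = 1..<n. X i *\<^sub>R 0)"
          using vector_derivative_at[OF dj[OF _ j]] by simp
      qed
    qed
  qed
qed

text \<open>With four independent parameters the deformation is affine in them; the square that is
  wanted later is put into the path through the parameter space instead.\<close>

lemma deformation_monomials:
  assumes "smooth_germ x" "smooth_germ y" "x 0 = 0" "y 0 = 0"
  shows "deformation 4 (\<lambda>u t. (x t + u 0 * t ^ 5, y t + u 1 * t ^ 6 + u 2 * t ^ 7 + u 3 * t ^ 9)) (\<lambda>t. (x t, y t))"
proof -
  obtain I where I: "0 \<in> I" "smooth_on (\<lambda>t. (x t, y t)) I"
    using smooth_germE[OF smooth_germ_Pair[OF assms(1,2)]] .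
  have oI: "open I" using smooth_onD(1)[OF I(2)] .
  \<comment> \<open>Entry 0 of the encoded sequence is t, so the parameter with index i is entry i +
    1 and the monomials are numbered from 1.\<close>
  define e where "e = (\<lambda>i::nat. if i = 1 then 5 else if i = 2 then 6 else if i = 3 then 7 else 9 :: nat)"
  define v where "v = (\<lambda>i::nat. if i = 1 then (1, 0) else (0, 1) :: real \<times> real)"
  let ?F = "\<lambda>X::nat \<Rightarrow> real. (x (X 0) + X 1 * X 0 ^ 5, y (X 0) + X 2 * X 0 ^ 6 + X 3 * X 0 ^ 7 + X 4 * X 0 ^ 9)"
  have s: "smooth_on (\<lambda>t. t ^ e i *\<^sub>R v i) I" for i
    by (rule smooth_on_bilinear[OF bounded_bilinear_scaleR smooth_on_power[OF smooth_on_linear[OF oI bounded_linear_ident]] smooth_on_const[OF oI]])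
  have n: "{1..<5::nat} = {1,2,3,4}" by auto
  have F: "?F X = (x (X 0), y (X 0)) + (\<Sum>i=1..<5. X i *\<^sub>R (X 0 ^ e i *\<^sub>R v i))" for X :: "nat \<Rightarrow> real"
    unfolding n by (simp add: e_def v_def del: One_nat_def)
  have "Ck_Rn 5 m ?F ({X. X 0 \<in> I} \<inter> Rn 5)" for m
    by (rule Ck_Rn_affine[OF I(2) s _ F]) auto
  moreover have "open {X::nat \<Rightarrow> real. X 0 \<in> I}"
    using open_vimage[OF oI continuous_on_coordinate[of UNIV 0]] by (simp add: vimage_def)
  ultimately have "smooth_germ_Rn 5 ?F"
    unfolding smooth_germ_Rn_def using I(1) by (intro exI[of _ "{X. X 0 \<in> I}"]) simp
  moreover have "\<exists>W::(nat \<Rightarrow> real) set. open W \<and> (\<lambda>_. 0) \<in> W" by (intro exI[of _ UNIV]) simp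
  ultimately show ?thesis
    by (simp add: deformation_def numeral_eq_Suc assms(3,4) zero_prod_def)
qed

subsection \<open>Transversals accumulating at the origin\<close>

text \<open>U consists of the least element of every fibre. The least element of the fibre through s
  lies in (0, s], so the fibres through U near 0 cover T near 0; were U countable there, T would be
  a countable union of finite sets.\<close>

lemma transversal_uncountable:
  fixes f :: "real \<Rightarrow> 'b"
  assumes fin: "\<And>s. s \<in> T \<Longrightarrow> finite {r \<in> T. f r = f s}"
    and unc: "\<And>\<eta>. \<eta> > 0 \<Longrightarrow> uncountable (T \<inter> {0<..<\<eta>})" and pos: "T \<subseteq> {0<..}"
  obtains U where "U \<subseteq> T" "inj_on f U" "\<And>\<eta>. \<eta> > 0 \<Longrightarrow> uncountable (U \<inter> {0<..<\<eta>})"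
proof
  define U where "U = {s \<in> T. \<forall>r\<in>T. f r = f s \<longrightarrow> s \<le> r}"
  show "U \<subseteq> T" by (auto simp: U_def)
  show "inj_on f U" by (auto simp: inj_on_def U_def intro: antisym)
  fix \<eta> :: real assume \<eta>: "\<eta> > 0"
  have "T \<inter> {0<..<\<eta>} \<subseteq> (\<Union>u\<in>U \<inter> {0<..<\<eta>}. {r \<in> T. f r = f u})"
  proof
    fix s assume s: "s \<in> T \<inter> {0<..<\<eta>}"
    let ?R = "{r \<in> T. f r = f s}"
    have R: "finite ?R" "s \<in> ?R" using fin s by auto
    then have M: "Min ?R \<in> ?R" "Min ?R \<le> s" using Min_in[of ?R] by auto
    have "Min ?R \<le> r" if "r \<in> T" "f r = f s" for r using R(1) that by simp
    then have "Min ?R \<in> U" using M by (simp add: U_def)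
    moreover have "Min ?R \<in> {0<..<\<eta>}" using M s pos by auto
    ultimately show "s \<in> (\<Union>u\<in>U \<inter> {0<..<\<eta>}. {r \<in> T. f r = f u})" using M s by (intro UN_I[of "Min ?R"]) auto
  qed
  moreover have "countable (\<Union>u\<in>U \<inter> {0<..<\<eta>}. {r \<in> T. f r = f u})" if "countable (U \<inter> {0<..<\<eta>})"
    by (rule countable_UN[OF that]) (use fin \<open>U \<subseteq> T\<close> in \<open>auto intro!: countable_finite\<close>)
  ultimately show "uncountable (U \<inter> {0<..<\<eta>})" using unc[OF \<eta>] countable_subset by blast
qed

lemma degree_mult_bound:
  fixes p q :: "'a::comm_semiring_0 poly"
  shows "degree p \<le> m \<Longrightarrow> degree q \<le> n \<Longrightarrow> degree (p * q) \<le> m + n"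
  by (rule order_trans[OF degree_mult_le add_mono])

text \<open>The added terms dominate for large s, whatever the given germ is. The minors 56 and 57
  grow like s^2 and, owing to the term s^2 t^9, the minor 59 grows like s^3. So A has the leading
  term 65 s^4 and B has 135 s^7, and no other product reaches these degrees.\<close>

lemma curve_family_polynomials:
  assumes "smooth_germ x" "smooth_germ y"
  obtains P Q :: "real poly" where "degree P = 4" "degree Q = 7"
    "\<forall>s. curveA (\<lambda>t. x t + s * t ^ 5) (\<lambda>t. y t + s * t ^ 6 + s * t ^ 7 + s ^ 2 * t ^ 9) = poly P s"
    "\<forall>s. curveB (\<lambda>t. x t + s * t ^ 5) (\<lambda>t. y t + s * t ^ 6 + s * t ^ 7 + s ^ 2 * t ^ 9) = poly Q s"
proof
  let ?x = "tc x" and ?y = "tc y"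
  define p56 where "p56 = [:?x 5 * ?y 6 - ?x 6 * ?y 5, ?x 5 + ?y 6, 1:]"
  define p57 where "p57 = [:?x 5 * ?y 7 - ?x 7 * ?y 5, ?x 5 + ?y 7, 1:]"
  define p58 where "p58 = [:?x 5 * ?y 8 - ?x 8 * ?y 5, ?y 8:]"
  define p59 where "p59 = [:?x 5 * ?y 9 - ?x 9 * ?y 5, ?y 9, ?x 5, 1:]"
  define p67 where "p67 = [:?x 6 * ?y 7 - ?x 7 * ?y 6, ?x 6 - ?x 7:]"
  define p68 where "p68 = [:?x 6 * ?y 8 - ?x 8 * ?y 6, - ?x 8:]"
  define P where "P = smult 65 (p57 ^ 2) + (- smult 60 (p56 * p58) - smult 72 (p56 * p67))"
  define Q where "Q = smult 135 (p56 ^ 2 * p59) + (smult 162 (p56 ^ 2 * p68) - smult 315 (p56 * p57 * p58)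
     - smult 189 (p56 * p57 * p67) + smult 175 (p57 ^ 3))"
  have d: "degree p56 = 2" "degree p57 = 2" "degree p59 = 3" by (simp_all add: p56_def p57_def p59_def)
  have n: "p56 \<noteq> 0" "p57 \<noteq> 0" "p59 \<noteq> 0" using d by auto
  have b: "degree p58 \<le> 1" "degree p67 \<le> 1" "degree p68 \<le> 1" by (simp_all add: p58_def p67_def p68_def)
  have "degree (- smult 60 (p56 * p58) - smult 72 (p56 * p67)) \<le> 3"
    using degree_mult_bound[of p56 2 p58 1] degree_mult_bound[of p56 2 p67 1] d b
    by (intro degree_diff_le) (simp_all add: order_trans[OF degree_smult_le])
  moreover have "degree (smult 65 (p57 ^ 2)) = 4" using n d by (simp add: degree_power_eq)
  ultimately show "degree P = 4" unfolding P_def by (subst degree_add_eq_left) auto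
  have e: "degree (p56 ^ 2) \<le> 4" "degree (p56 * p57) \<le> 4" using n d by (simp_all add: degree_power_eq degree_mult_eq)
  have "degree (smult 162 (p56 ^ 2 * p68) - smult 315 (p56 * p57 * p58)
     - smult 189 (p56 * p57 * p67) + smult 175 (p57 ^ 3)) \<le> 6"
  proof (intro degree_add_le degree_diff_le order_trans[OF degree_smult_le])
    have m: "degree (p * q) \<le> 6" if "degree p \<le> 4" "degree q \<le> 1" for p q :: "real poly"
      using degree_mult_bound[OF that] by simp
    show "degree (p56 ^ 2 * p68) \<le> 6" "degree (p56 * p57 * p58) \<le> 6" "degree (p56 * p57 * p67) \<le> 6"
      by (rule m[OF e(1) b(3)], rule m[OF e(2) b(1)], rule m[OF e(2) b(2)])
    show "degree (p57 ^ 3) \<le> 6" using n d by (simp add: degree_power_eq)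
  qed
  moreover have "degree (smult 135 (p56 ^ 2 * p59)) = 7" using n d by (simp add: degree_power_eq degree_mult_eq)
  ultimately show "degree Q = 7" unfolding Q_def by (subst degree_add_eq_left) auto
  have X: "tc (\<lambda>t. x t + s * t ^ 5) i = ?x i + (if i = 5 then s else 0)" for s i
    using tc_add[OF assms(1) smooth_germ_mult[OF smooth_germ_const smooth_germ_power[OF smooth_germ_ident]]]
    by (simp only: tc_monom)
  have Y: "tc (\<lambda>t. y t + s * t ^ 6 + s * t ^ 7 + s ^ 2 * t ^ 9) i
      = ?y i + (if i = 6 then s else 0) + (if i = 7 then s else 0) + (if i = 9 then s ^ 2 else 0)" for s i
  proof -
    have m: "smooth_germ (\<lambda>t. c * t ^ k)" for c :: real and k by (intro smooth_germ_intros)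
    show ?thesis by (simp only: tc_add smooth_germ_add assms(2) m tc_monom)
  qed
  let ?j = "\<lambda>s. jet_det (\<lambda>t. x t + s * t ^ 5) (\<lambda>t. y t + s * t ^ 6 + s * t ^ 7 + s ^ 2 * t ^ 9)"
  have j: "?j s 5 6 = poly p56 s" "?j s 5 7 = poly p57 s" "?j s 5 8 = poly p58 s" "?j s 5 9 = poly p59 s"
    "?j s 6 7 = poly p67 s" "?j s 6 8 = poly p68 s" for s
    unfolding jet_det_def X Y p56_def p57_def p58_def p59_def p67_def p68_def
    by (simp_all add: algebra_simps power2_eq_square)
  show "\<forall>s. curveA (\<lambda>t. x t + s * t ^ 5) (\<lambda>t. y t + s * t ^ 6 + s * t ^ 7 + s ^ 2 * t ^ 9) = poly P s"
    by (simp add: curveA_def invA_def j P_def)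
  show "\<forall>s. curveB (\<lambda>t. x t + s * t ^ 5) (\<lambda>t. y t + s * t ^ 6 + s * t ^ 7 + s ^ 2 * t ^ 9) = poly Q s"
    by (simp add: curveB_def invB_def j Q_def)
qed

text \<open>Along the path (s, s, s, s^2) in the parameter space each value of the invariant ratio
  is taken only finitely often. One parameter from every fibre gives pairwise inequivalent germs,
  still uncountably many near 0.\<close>

lemma not_A_simple:
  assumes "van 5 x" "van 5 y" shows "\<not> A_simple (\<lambda>t. (x t, y t))"
proof -
  let ?X = "\<lambda>s t. x t + s * t ^ 5" and ?Y = "\<lambda>s t. y t + s * t ^ 6 + s * t ^ 7 + s ^ 2 * t ^ 9"
  define \<Phi> :: "(nat \<Rightarrow> real) \<Rightarrow> real \<Rightarrow> real \<times> real"
    where "\<Phi> = (\<lambda>u t. (x t + u 0 * t ^ 5, y t + u 1 * t ^ 6 + u 2 * t ^ 7 + u 3 * t ^ 9))"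
  define u :: "real \<Rightarrow> nat \<Rightarrow> real" where "u = (\<lambda>s i. if i < 3 then s else if i = 3 then s ^ 2 else 0)"
  have \<Phi>u: "\<Phi> (u s) = (\<lambda>t. (?X s t, ?Y s t))" for s by (simp add: \<Phi>_def u_def)
  obtain P Q :: "real poly" where PQ: "degree P = 4" "degree Q = 7"
    "\<forall>s. curveA (?X s) (?Y s) = poly P s" "\<forall>s. curveB (?X s) (?Y s) = poly Q s"
    using curve_family_polynomials[OF van_smooth[OF assms(1)] van_smooth[OF assms(2)]] .
  have PQ0: "P \<noteq> 0" "Q \<noteq> 0" using PQ(1,2) by auto
  define T where "T = {s. 0 < s \<and> poly P s \<noteq> 0}"
  define f where "f = (\<lambda>s. poly Q s ^ 2 / poly P s ^ 3)"
  have fin: "finite {r \<in> T. f r = f s}" if "s \<in> T" for s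
  proof -
    \<comment> \<open>Parameters in T with the same ratio as s are zeros of this polynomial. It is
      not the zero polynomial, because the square of Q has degree 14 and the cube of P has degree
      12.\<close>
    let ?R = "smult (poly P s ^ 3) (Q ^ 2) - smult (poly Q s ^ 2) (P ^ 3)"
    have s: "poly P s \<noteq> 0" using that by (simp add: T_def)
    have "?R \<noteq> 0"
    proof
      assume "?R = 0"
      then have "degree (smult (poly P s ^ 3) (Q ^ 2)) = degree (smult (poly Q s ^ 2) (P ^ 3))" by simp
      moreover have "degree (smult (poly P s ^ 3) (Q ^ 2)) = 14" using s PQ0 PQ by (simp add: degree_power_eq)
      moreover have "degree (smult (poly Q s ^ 2) (P ^ 3)) \<le> 12"
        by (rule order_trans[OF degree_smult_le]) (simp add: degree_power_eq PQ0 PQ)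
      ultimately show False by simp
    qed
    moreover have "{r \<in> T. f r = f s} \<subseteq> {r. poly ?R r = 0}"
      using s by (auto simp: T_def f_def field_simps)
    ultimately show ?thesis using finite_subset[OF _ poly_roots_finite] by blast
  qed
  have unc: "uncountable (T \<inter> {0<..<\<eta>})" if "\<eta> > 0" for \<eta> :: real
  proof -
    have "uncountable ({0<..<\<eta>} - {s. poly P s = 0})"
      using that by (intro uncountable_minus_countable countable_finite poly_roots_finite PQ0)
        (simp add: uncountable_open_interval)
    moreover have "{0<..<\<eta>} - {s. poly P s = 0} = T \<inter> {0<..<\<eta>}" by (auto simp: T_def)
    ultimately show ?thesis by simp
  qed
  obtain U where U: "U \<subseteq> T" "inj_on f U" and Uu: "\<And>\<eta>. \<eta> > 0 \<Longrightarrow> uncountable (U \<inter> {0<..<\<eta>})"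
    using transversal_uncountable[of T f, OF fin unc] by (auto simp: T_def)
  have vX: "van 5 (?X s)" and vY: "van 5 (?Y s)" for s
    by (intro van_add assms van_monom, simp_all)+
  have ne: "\<not> A_equiv (\<Phi> (u s)) (\<Phi> (u r))" if "s \<in> U" "r \<in> U" "s \<noteq> r" for s r
  proof
    assume "A_equiv (\<Phi> (u s)) (\<Phi> (u r))"
    then have "A_equiv (\<lambda>t. (?X s t, ?Y s t)) (\<lambda>t. (?X r t, ?Y r t))" unfolding \<Phi>u .
    from curve_invariant_ratio[OF vX vY vX vY this] have "f s = f r"
      using that U(1) unfolding PQ(3,4)[rule_format] f_def T_def by blast
    then show False using that U(2) by (auto dest: inj_onD)
  qed
  have inj: "inj u"
  proof (rule injI)
    fix s r assume "u s = u r"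
    from fun_cong[OF this, of 0] show "s = r" by (simp add: u_def)
  qed
  have "uncountable (u ` U \<inter> W)" if W: "open W" "(\<lambda>_. 0) \<in> W" for W
  proof -
    have "continuous_on UNIV (\<lambda>s. u s i)" for i
      by (cases "i < 3"; cases "i = 3") (simp_all add: u_def continuous_intros)
    then have "continuous_on UNIV u" by (rule continuous_on_coordinatewise_then_product)
    then have "open (u -` W)" using W(1) by (intro open_vimage)
    moreover have "u 0 = (\<lambda>_. 0)" by (auto simp: u_def)
    then have "0 \<in> u -` W" using W(2) by simp
    ultimately obtain \<eta> where \<eta>: "\<eta> > 0" "ball 0 \<eta> \<subseteq> u -` W" using open_contains_ball by blast
    have "{0<..<\<eta>} \<subseteq> ball 0 \<eta>" by (auto simp: dist_real_def)
    then have "u ` (U \<inter> {0<..<\<eta>}) \<subseteq> u ` U \<inter> W" using \<eta>(2) by blast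
    moreover have "uncountable (u ` (U \<inter> {0<..<\<eta>}))"
      using Uu[OF \<eta>(1)] countable_image_inj_on[OF _ inj_on_subset[OF inj subset_UNIV]] by blast
    ultimately show ?thesis using countable_subset by blast
  qed
  moreover have "u ` U \<subseteq> Rn 4" by (auto simp: u_def Rn_def)
  moreover have "pairwise (\<lambda>u v. \<not> A_equiv (\<Phi> u) (\<Phi> v)) (u ` U)"
    using ne by (force simp: pairwise_def)
  ultimately have "has_moduli 4 \<Phi>" unfolding has_moduli_def by (intro exI[of _ "u ` U"]) simp
  moreover have "deformation 4 \<Phi> (\<lambda>t. (x t, y t))"
    unfolding \<Phi>_def
    using deformation_monomials[OF van_smooth[OF assms(1)] van_smooth[OF assms(2)]] van_1D[of 4 x] van_1D[of 4 y] assms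
    by simp
  ultimately show ?thesis unfolding A_simple_def by blast
qed

section \<open>The cases of the theorem\<close>

lemma (in parallel_curve) nonsingular_curve:
  assumes "\<delta> \<noteq> 0" "tc \<theta> 1 \<noteq> 0" shows "nonsingular (\<lambda>t. (x t, y t))"
proof -
  have "tc x (Suc 0) = tc g 0 / real (Suc 0)" by (rule x_leading(2)[OF van_0[OF smooth_g]])
  then have "deriv x 0 = - \<delta> * tc \<theta> 1" by (simp add: tc_def[of x] tc_g)
  moreover have "((\<lambda>t. (x t, y t)) has_vector_derivative (deriv x 0, deriv y 0)) (at 0)"
    using smooth_germ_deriv(3)[OF smooth_x] smooth_germ_deriv(3)[OF smooth_y]
    by (intro has_vector_derivative_Pair) (simp_all add: has_real_derivative_iff_has_vector_derivative)
  ultimately show ?thesis using assms unfolding nonsingular_def by (intro exI[of _ "(deriv x 0, deriv y 0)"]) (simp add: zero_prod_def)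
qed

lemma A_sing_iff: "A_sing (2 * k) f \<longleftrightarrow> k \<ge> 1 \<and> A_equiv f (\<lambda>t. (t ^ 2, t ^ (2 * k + 1)))"
  by (auto simp: A_sing_def)

lemma (in parallel_curve) A_sing_curve_iff:
  assumes "\<delta> = 0" "k \<ge> 1"
  shows "A_sing (2 * k) (\<lambda>t. (x t, y t)) \<longleftrightarrow>
    (\<forall>i. odd i \<longrightarrow> i < 2 * k - 1 \<longrightarrow> tc \<theta> i = 0) \<and> tc \<theta> (2 * k - 1) \<noteq> 0" (is "_ \<longleftrightarrow> ?R")
proof
  assume "A_sing (2 * k) (\<lambda>t. (x t, y t))"
  then show ?R using A_2k_equiv_imp[OF assms] unfolding A_sing_iff by blast
next
  assume R: ?R
  show "A_sing (2 * k) (\<lambda>t. (x t, y t))"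
  proof (cases "k = 1")
    case True
    then show ?thesis using A_2_equiv R assms(1) unfolding A_sing_iff by simp
  next
    case False
    then have "k \<ge> 2" using assms(2) by simp
    then show ?thesis using A_2k_equiv[of k] R assms unfolding A_sing_iff by simp
  qed
qed

text \<open>All coefficients of g below degree 4 cancel, but the nonzero odd coefficient of \<theta>
  in degree 2k - 1 reappears in g in degree 2k - 2, so the order of g is finite.\<close>

lemma (in parallel_curve) degenerate_curve:
  assumes "k \<ge> 3" "\<delta> \<noteq> 0" "\<And>i. odd i \<Longrightarrow> i < 2 * k - 1 \<Longrightarrow> tc \<theta> i = 0" "tc \<theta> (2 * k - 1) \<noteq> 0"
    and "2 * \<delta> * tc \<theta> 2 = 1" "tc \<theta> 4 = 0"
  shows "\<exists>m\<ge>5. has_multiplicity (\<lambda>t. (x t, y t)) m" "\<not> A_simple (\<lambda>t. (x t, y t))"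
proof -
  have \<theta>13: "tc \<theta> 1 = 0" "tc \<theta> 3 = 0" using assms(1,3) by simp_all
  have "tc g i = 0" if i: "i < 4" for i
  proof -
    consider "i = 0" | "i = 1" | "i = 2" | "i = 3" using i by linarith
    then show ?thesis using \<theta>13 assms(5,6) by cases (simp_all add: tc_g eval_nat_numeral)
  qed
  then have v: "van 4 g" unfolding van_iff_tc using smooth_g by simp
  \<comment> \<open>The index 2k - 2 is not 1, so the summand t of g does not interfere.\<close>
  have "Suc (2 * k - 2) = 2 * k - 1" "2 * k - 2 \<noteq> 1" using assms(1) by simp_all
  then have n: "tc g (2 * k - 2) \<noteq> 0" using assms(2,4) by (simp add: tc_g del: of_nat_Suc)
  show "\<exists>m\<ge>5. has_multiplicity (\<lambda>t. (x t, y t)) m" by (rule finite_multiplicity(3)[OF v n])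
  show "\<not> A_simple (\<lambda>t. (x t, y t))" by (rule not_A_simple[OF finite_multiplicity(1,2)[OF v n]])
qed

theorem theorem5p6:
  fixes \<kappa> :: "real \<Rightarrow> real" and \<delta> :: real and \<theta> :: "nat \<Rightarrow> real"
    and \<phi> \<phi>\<delta> :: "real \<Rightarrow> real \<times> real"
  assumes "smooth_germ \<kappa>"
    and "\<delta> \<noteq> 0"
  defines "\<theta> \<equiv> angle_coeff \<kappa>"
    and "\<phi> \<equiv> phi2 \<kappa>"
    and "\<phi>\<delta> \<equiv> phi2_parallel_germ \<kappa> \<delta>"
  shows
    "(A_sing 2 \<phi> \<longleftrightarrow> \<theta> 1 \<noteq> 0) \<and>
     (A_sing 2 \<phi> \<longrightarrow> nonsingular \<phi>\<delta>) \<and>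
     (A_sing 4 \<phi> \<longleftrightarrow> \<theta> 1 = 0 \<and> \<theta> 3 \<noteq> 0) \<and>
     (A_sing 4 \<phi> \<longrightarrow>
        (\<delta> * \<theta> 2 \<noteq> 1 \<longrightarrow> A_sing 4 \<phi>\<delta>) \<and>
        (\<delta> * \<theta> 2 = 1 \<longrightarrow> E8_sing \<phi>\<delta>)) \<and>
     (\<forall>k\<ge>3. A_sing (2 * k) \<phi> \<longrightarrow>
        (\<delta> * \<theta> 2 \<noteq> 1 \<longrightarrow> A_sing (2 * k) \<phi>\<delta>) \<and>
        (\<delta> * \<theta> 2 = 1 \<and> \<theta> 4 \<noteq> 0 \<longrightarrow> W1_sharp_sing (2 * k - 5) \<phi>\<delta>) \<and>
        (\<delta> * \<theta> 2 = 1 \<and> \<theta> 4 = 0 \<longrightarrow>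
           (\<exists>m\<ge>5. has_multiplicity \<phi>\<delta> m) \<and> \<not> A_simple \<phi>\<delta>))"
proof -
  note \<kappa> = assms(1) and \<delta> = assms(2)
  \<comment> \<open>Two instances: \<phi>_2 as its own parallel at distance 0, for the criteria on
    the angle, and the parallel at distance \<delta>, for the conclusions.\<close>
  interpret \<phi>: parallel_curve "angle \<kappa>" "\<lambda>t. fst (\<phi> t)" "\<lambda>t. snd (\<phi> t)" 0
    unfolding \<phi>_def by (rule phi2_curve[OF \<kappa>])
  interpret par: parallel_curve "angle \<kappa>" "\<lambda>t. fst (\<phi>\<delta> t)" "\<lambda>t. snd (\<phi>\<delta> t)" \<delta>
    unfolding \<phi>\<delta>_def by (rule phi2_parallel_curve[OF \<kappa>])
  have \<theta>: "\<theta> i = fact i * tc (angle \<kappa>) i" for i by (simp add: \<theta>_def angle_coeff_tc)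
  \<comment> \<open>The Taylor coefficient is \<theta>_2 / 2!, hence the factor 2.\<close>
  have \<theta>2: "\<delta> * \<theta> 2 = 1 \<longleftrightarrow> 2 * \<delta> * tc (angle \<kappa>) 2 = 1" by (simp add: \<theta> algebra_simps)
  have \<theta>0: "\<theta> i = 0 \<longleftrightarrow> tc (angle \<kappa>) i = 0" for i by (simp add: \<theta>)
  note sing = \<phi>.A_sing_curve_iff[OF refl, simplified prod.collapse]
  have odd3: "odd i \<and> i < 3 \<longleftrightarrow> i = 1" for i :: nat by (auto simp: less_Suc_eq numeral_3_eq_3)
  have sing2: "A_sing 2 \<phi> \<longleftrightarrow> tc (angle \<kappa>) 1 \<noteq> 0" using sing[of 1] by (simp add: odd_pos)
  have sing4: "A_sing 4 \<phi> \<longleftrightarrow> tc (angle \<kappa>) 1 = 0 \<and> tc (angle \<kappa>) 3 \<noteq> 0"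
    using sing[of 2] odd3 by simp metis
  show ?thesis
  proof (intro conjI allI impI)
    show "A_sing 2 \<phi> \<longleftrightarrow> \<theta> 1 \<noteq> 0" using sing2 \<theta>0[of 1] by simp
    show "nonsingular \<phi>\<delta>" if "A_sing 2 \<phi>"
      using par.nonsingular_curve[OF \<delta>] that sing2 by simp
    show "A_sing 4 \<phi> \<longleftrightarrow> \<theta> 1 = 0 \<and> \<theta> 3 \<noteq> 0" using sing4 \<theta>0[of 1] \<theta>0[of 3] by simp
  next
    assume s: "A_sing 4 \<phi>" and d: "\<delta> * \<theta> 2 \<noteq> 1"
    have "tc (angle \<kappa>) i = 0" if "odd i" "i < 2 * 2 - 1" for i using s sing4 odd3[of i] that by simp
    from par.A_2k_equiv[OF order_refl this] show "A_sing 4 \<phi>\<delta>"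
      using s sing4 d \<theta>2 A_sing_iff[of 2 \<phi>\<delta>] by simp
  next
    assume "A_sing 4 \<phi>" "\<delta> * \<theta> 2 = 1"
    then show "E8_sing \<phi>\<delta>" using par.E8_equiv sing4 \<theta>2 by (simp add: E8_sing_def)
  next
    fix k :: nat assume k: "k \<ge> 3" and s: "A_sing (2 * k) \<phi>"
    have o: "\<And>i. odd i \<Longrightarrow> i < 2 * k - 1 \<Longrightarrow> tc (angle \<kappa>) i = 0" and ne: "tc (angle \<kappa>) (2 * k - 1) \<noteq> 0"
      using s sing[of k] k by simp_all
    show "A_sing (2 * k) \<phi>\<delta>" if "\<delta> * \<theta> 2 \<noteq> 1"
      using par.A_2k_equiv[OF _ o ne] that \<theta>2 k by (simp add: A_sing_iff)
    show "W1_sharp_sing (2 * k - 5) \<phi>\<delta>" if "\<delta> * \<theta> 2 = 1 \<and> \<theta> 4 \<noteq> 0"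
    proof -
      have "A_equiv \<phi>\<delta> (\<lambda>t. (t ^ 4, t ^ 6 + t ^ (2 * (k - 2) + 5)))"
        using par.W_equiv[OF k o ne] that \<theta>2 \<theta>0[of 4] by simp
      \<comment> \<open>The index of the type is q = k - 2.\<close>
      moreover have "k - 2 \<ge> 1" "2 * k - 5 = 2 * (k - 2) - 1" using k by arith+
      ultimately show ?thesis unfolding W1_sharp_sing_def by blast
    qed
    assume d: "\<delta> * \<theta> 2 = 1 \<and> \<theta> 4 = 0"
    then have "2 * \<delta> * tc (angle \<kappa>) 2 = 1" "tc (angle \<kappa>) 4 = 0" using \<theta>2 \<theta>0[of 4] by simp_all
    from par.degenerate_curve[OF k \<delta> o ne this]
    show "\<exists>m\<ge>5. has_multiplicity \<phi>\<delta> m" "\<not> A_simple \<phi>\<delta>" by simp_all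
  qed
qed

end
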